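(* Let $0<r<1/2$, $s=\frac{2r}{1-2r}$, and let $f_n=\sum_{j=1}^\infty\sum_{i=1}^{2^j}\theta_{nji}\phi_{ji}$ be a sequence of alternatives with $\|f_n\|_\infty\asymp n^{-r}$ satisfying assumption G. Then the sequence $f_n$ is $\alpha$-consistent for some $0<\alpha<1$ if and only if there are $P_0>0$ and a sequence of functions $f_{1n}\in\mathbb{B}^s_{\infty,\infty}(P_0)$ with $\|f_{1n}\|_\infty\asymp n^{-r}$ such that the functions $f_n$, $f_{1n}$ and $f_n-f_{1n}$ have the same orientation.
   Context: Notation: $a_n\asymp b_n$ means $0<c<a_n/b_n<C$ for all $n$; $[a]$ is the whole part of $a$; $k_n=[(1/2-r)\log_2n]$; $\|\cdot\|_\infty$ is the norm of $\mathbb{L}_\infty(0,1)$. Wavelets: $\phi$ is a mother periodic wavelet with smoothness more than $[s]+2$, bounded support $(a_1,a_2)$, and $\int_{a_1}^{a_2}x\phi(x+c)\,dx=0$ with $c=(a_1+a_2)/2$. $\phi_{kj}(x)=2^{k/2}\phi(2^kx-j)$, $x\in(0,1)$, $1\le k<\infty$, $1\le j\le2^k$, is the (periodic, orthonormal) wavelet basis. $\psi_{ji}(x)=\int_0^x\phi_{ji}(t)\,dt$. The Besov body is $$\mathbb{B}^s_{\infty,\infty}(P_0)=\Bigl\{f=\sum_{k=1}^\infty\sum_{j=1}^{2^k}\theta_{kj}\phi_{kj}:\ \sup_k2^{(s+1/2)k}\sup_{1\le j\le2^k}|\theta_{kj}|\le P_0\Bigr\}.$$ Two functions $f_1=\sum\theta_{1ji}\phi_{ji}$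 and $f_2=\sum\theta_{2ji}\phi_{ji}$ have the same orientation if $\theta_{1ji}\theta_{2ji}\ge0$ for all $1\le j<\infty$, $1\le i\le2^j$ (for several functions: pairwise). Testing problem: $X_1,\ldots,X_n$ are i.i.d. on $[0,1]$ with density $1+f$; the hypothesis is $f=0$, i.e. the c.d.f. is $F_0(x)=x$; the simple alternatives are $f=f_n$ (each $1+f_n$ is a density). $\hat F_n$ is the empirical c.d.f., $T(F)=\max_{x\in[0,1]}|F(x)-F_0(x)|$; a Kolmogorov test $K_n$ rejects when $T(\hat F_n)$ exceeds a critical value; $\alpha(K_n)$ and $\beta(K_n,f_n)$ are its type I and type II error probabilities. The sequence $f_n$ is $\alpha$-consistent, $0<\alpha<1$, if for $K_n$ with $\alpha(K_n)=\alpha+o(1)$ one has $\limsup_{n\to\infty}\beta(K_n,f_n)<1-\alpha$. Assumption G: for any $\varepsilon>0$ there is an integer $c_\varepsilon$ such that for all $n>n_0(\varepsilon,c_\varepsilon)$ and all $l<k_n-c_\varepsilon$ one has $n^{1/2}T(F_{nl})<\varepsilon$, where $F_{nl}(x)=x+\sum_{j=1}^l\sum_{i=1}^{2^j}\theta_{nji}\psi_{ji}(x)$, $x\in[0,1]$. *)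

theory Defs
  imports "HOL-Probability.Probability"
begin

abbreviation unit_lborel :: "real measure" where
  "unit_lborel \<equiv> restrict_space lborel {0..1}"

definition dyadic_wavelet :: "(real \<Rightarrow> real) \<Rightarrow> int \<Rightarrow> int \<Rightarrow> real \<Rightarrow> real" where
  "dyadic_wavelet \<phi> k j x = 2 powr (of_int k / 2) * \<phi> (2 powi k * x - of_int j)"

text \<open>A mother wavelet: its dyadic dilations and translations form an orthonormal basis of
  \<open>L\<^sup>2(\<real>)\<close> (an orthonormal family whose finite linear combinations are dense).\<close>

definition mother_wavelet :: "(real \<Rightarrow> real) \<Rightarrow> bool" where
  "mother_wavelet \<phi> \<longleftrightarrow>
     \<phi> \<in> borel_measurable lborel \<and> integrable lborel (\<lambda>x. (\<phi> x)\<^sup>2) \<and>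
     (\<forall>k j k' j'. (LINT x|lborel. dyadic_wavelet \<phi> k j x * dyadic_wavelet \<phi> k' j' x) =
        (if k = k' \<and> j = j' then 1 else 0)) \<and>
     (\<forall>g \<in> borel_measurable lborel. integrable lborel (\<lambda>x. (g x)\<^sup>2) \<longrightarrow>
        (\<forall>\<epsilon>>0. \<exists>K c. finite K \<and>
           (LINT x|lborel. (g x - (\<Sum>(k, j)\<in>K. c k j * dyadic_wavelet \<phi> k j x))\<^sup>2) < \<epsilon>))"

text \<open>Smoothness strictly larger than \<open>m\<close> in the Hoelder scale: \<open>m\<close> derivatives exist and the
  \<open>m\<close>-th one is Hoelder continuous of some positive order.\<close>

definition smoothness_more_than :: "nat \<Rightarrow> (real \<Rightarrow> real) \<Rightarrow> bool" where
  "smoothness_more_than m \<phi> \<longleftrightarrow>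
     (\<forall>i<m. \<forall>x. ((deriv ^^ i) \<phi>) differentiable (at x)) \<and>
     (\<exists>\<delta> L. 0 < \<delta> \<and> \<delta> \<le> 1 \<and>
        (\<forall>x y. \<bar>(deriv ^^ m) \<phi> x - (deriv ^^ m) \<phi> y\<bar> \<le> L * \<bar>x - y\<bar> powr \<delta>))"

text \<open>The element \<open>\<phi>\<^sub>k\<^sub>j\<close> of the periodic wavelet basis: the function
  \<open>2\<^bsup>k/2\<^esup> \<phi> (2\<^bsup>k\<^esup> x - j)\<close> wrapped around the circle \<open>\<real>/\<int>\<close>. For \<open>\<phi>\<close> of bounded support the sum
  has only finitely many nonzero terms.\<close>

definition per_wavelet :: "(real \<Rightarrow> real) \<Rightarrow> nat \<Rightarrow> nat \<Rightarrow> real \<Rightarrow> real" where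
  "per_wavelet \<phi> k j x = (\<Sum>\<^sub>\<infinity>m::int. dyadic_wavelet \<phi> (int k) (int j) (x + of_int m))"

definition per_wavelet_prim :: "(real \<Rightarrow> real) \<Rightarrow> nat \<Rightarrow> nat \<Rightarrow> real \<Rightarrow> real" where
  "per_wavelet_prim \<phi> k j x = (LBINT t:{0..x}. per_wavelet \<phi> k j t)"

text \<open>\<open>f = (\<Sum>k\<ge>1. \<Sum>j=1..2\<^bsup>k\<^esup>. \<theta> k j \<phi>\<^sub>k\<^sub>j)\<close>, the series converging in \<open>L\<^sup>2(0,1)\<close>.\<close>

definition has_wavelet_series ::
    "(real \<Rightarrow> real) \<Rightarrow> (real \<Rightarrow> real) \<Rightarrow> (nat \<Rightarrow> nat \<Rightarrow> real) \<Rightarrow> bool" where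
  "has_wavelet_series \<phi> f \<theta> \<longleftrightarrow>
     f \<in> borel_measurable unit_lborel \<and> integrable unit_lborel (\<lambda>x. (f x)\<^sup>2) \<and>
     (\<lambda>N. LINT x|unit_lborel.
        (f x - (\<Sum>k=1..N. \<Sum>j=1..2^k. \<theta> k j * per_wavelet \<phi> k j x))\<^sup>2) \<longlonglongrightarrow> 0"

definition besov_body :: "(real \<Rightarrow> real) \<Rightarrow> real \<Rightarrow> real \<Rightarrow> (real \<Rightarrow> real) set" where
  "besov_body \<phi> s P\<^sub>0 = {f. \<exists>\<theta>. has_wavelet_series \<phi> f \<theta> \<and>
     (\<forall>k\<ge>1. \<forall>j\<in>{1..2^k}. 2 powr ((s + 1/2) * real k) * \<bar>\<theta> k j\<bar> \<le> P\<^sub>0)}"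

definition same_orientation ::
    "(real \<Rightarrow> real) \<Rightarrow> (real \<Rightarrow> real) \<Rightarrow> (real \<Rightarrow> real) \<Rightarrow> bool" where
  "same_orientation \<phi> f\<^sub>1 f\<^sub>2 \<longleftrightarrow>
     (\<exists>\<theta>\<^sub>1 \<theta>\<^sub>2. has_wavelet_series \<phi> f\<^sub>1 \<theta>\<^sub>1 \<and> has_wavelet_series \<phi> f\<^sub>2 \<theta>\<^sub>2 \<and>
        (\<forall>j\<ge>1. \<forall>i\<in>{1..2^j}. \<theta>\<^sub>1 j i * \<theta>\<^sub>2 j i \<ge> 0))"

text \<open>\<open>esssup\<close> is \<open>\<infinity>\<close> on functions that are not measurable, and extended reals keep unbounded
  functions apart; a function of finite norm is therefore a member of \<open>L\<^sup>\<infinity>(0,1)\<close>.\<close>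

definition Linf_norm :: "(real \<Rightarrow> real) \<Rightarrow> ereal" where
  "Linf_norm f = esssup unit_lborel (\<lambda>x. ereal \<bar>f x\<bar>)"

definition asymp_order :: "(nat \<Rightarrow> ereal) \<Rightarrow> (nat \<Rightarrow> real) \<Rightarrow> bool" where
  "asymp_order a b \<longleftrightarrow>
     (\<exists>c C. 0 < c \<and> (\<forall>n\<ge>1. ereal c < a n / ereal (b n) \<and> a n / ereal (b n) < ereal C))"

definition kolmogorov_T :: "(real \<Rightarrow> real) \<Rightarrow> real" where
  "kolmogorov_T F = (SUP x\<in>{0..1}. \<bar>F x - x\<bar>)"

definition empirical_cdf :: "nat \<Rightarrow> (nat \<Rightarrow> real) \<Rightarrow> real \<Rightarrow> real" where
  "empirical_cdf n X x = real (card {i. i < n \<and> X i \<le> x}) / real n"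

definition is_density :: "(real \<Rightarrow> real) \<Rightarrow> bool" where
  "is_density p \<longleftrightarrow> p \<in> borel_measurable unit_lborel \<and> (AE x in unit_lborel. 0 \<le> p x) \<and>
     (LINT x|unit_lborel. p x) = 1"

definition sample_law :: "nat \<Rightarrow> (real \<Rightarrow> real) \<Rightarrow> (nat \<Rightarrow> real) measure" where
  "sample_law n f = PiM {..<n} (\<lambda>_. density unit_lborel (\<lambda>x. ennreal (1 + f x)))"

text \<open>A Kolmogorov test for sample size \<open>n\<close> is given by its critical value \<open>q\<close>.\<close>

definition type1_error :: "nat \<Rightarrow> real \<Rightarrow> real" where
  "type1_error n q = measure (sample_law n (\<lambda>_. 0))
     {X \<in> space (sample_law n (\<lambda>_. 0)). kolmogorov_T (empirical_cdf n X) > q}"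

definition type2_error :: "nat \<Rightarrow> real \<Rightarrow> (real \<Rightarrow> real) \<Rightarrow> real" where
  "type2_error n q f = measure (sample_law n f)
     {X \<in> space (sample_law n f). \<not> kolmogorov_T (empirical_cdf n X) > q}"

definition alpha_consistent :: "real \<Rightarrow> (nat \<Rightarrow> real \<Rightarrow> real) \<Rightarrow> bool" where
  "alpha_consistent \<alpha> f \<longleftrightarrow>
     (\<forall>q. (\<lambda>n. type1_error n (q n)) \<longlonglongrightarrow> \<alpha> \<longrightarrow>
        limsup (\<lambda>n. ereal (type2_error n (q n) (f n))) < ereal (1 - \<alpha>))"

definition k_index :: "real \<Rightarrow> nat \<Rightarrow> int" where
  "k_index r n = \<lfloor>(1/2 - r) * log 2 (real n)\<rfloor>"

definition partial_cdf :: "(real \<Rightarrow> real) \<Rightarrow> (nat \<Rightarrow> nat \<Rightarrow> real) \<Rightarrow> nat \<Rightarrow> real \<Rightarrow> real" where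
  "partial_cdf \<phi> \<theta> l x = x + (\<Sum>j=1..l. \<Sum>i=1..2^j. \<theta> j i * per_wavelet_prim \<phi> j i x)"

definition assumption_G :: "real \<Rightarrow> (real \<Rightarrow> real) \<Rightarrow> (nat \<Rightarrow> nat \<Rightarrow> nat \<Rightarrow> real) \<Rightarrow> bool" where
  "assumption_G r \<phi> \<theta> \<longleftrightarrow>
     (\<forall>\<epsilon>>0. \<exists>c::int. \<exists>n\<^sub>0. \<forall>n>n\<^sub>0. \<forall>l. int l < k_index r n - c \<longrightarrow>
        sqrt (real n) * kolmogorov_T (partial_cdf \<phi> (\<theta> n) l) < \<epsilon>)"

end

theory Submission
  imports Defs
begin

text \<open>Three objects carry the proof: the drift \<open>g(x) = \<surd>n (F(x) - x)\<close> of an alternative with distribution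
function \<open>F\<close>, the empirical process \<open>W(u) = \<surd>n (F\<^sub>n(u) - u)\<close> of a uniform sample, and the wavelet
coefficients \<open>\<theta>\<close> of \<open>f\<close>. A sample from the alternative is the image of a uniform sample under the
quantile function of \<open>F\<close>, and this turns its normalised deviation from the uniform distribution into
\<open>W(F(x)) + g(x)\<close> (\<open>emp_process_couple\<close>). Both sides of the equivalence say that \<open>sup \<bar>g\<bar>\<close>
stays above a positive constant for all large \<open>n\<close>.

\<^bold>\<open>Consistency and the drift.\<close> If \<open>g\<close> is uniformly small along a subsequence, the statistic under the
alternative is a small perturbation of the statistic under the hypothesis. As the law of \<open>\<surd>n T\<close> puts
little mass on short intervals (\<open>T_anticoncentration\<close>), the two error probabilities add up to almost
one, and the test is not consistent for any \<open>\<alpha>\<close> (\<open>not_consistent_if_drift_vanishes\<close>).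
Suppose conversely that \<open>\<bar>g(x\<^sub>0)\<bar> \<ge> c\<close> for some point \<open>x\<^sub>0\<close> (depending on \<open>n\<close>). Since \<open>\<surd>n T\<close> is below
\<open>c/8\<close> with a probability bounded below (\<open>T_small_ball\<close>), some \<open>\<alpha>\<close> close to one has critical values below
\<open>c/8\<close>, and acceptance means that the path \<open>W \<circ> F + g\<close> is flat up to \<open>c/8\<close>. With high probability
\<open>W\<close> oscillates little on short intervals (\<open>emp_process_equicontinuous\<close>). Averages of \<open>g\<close> over windows
of a fixed width hardly depend on the position of the window: assumption G removes the low frequencies,
and the primitives of wavelets of high frequency have mean zero on the line, so they average out
(\<open>drift_oscillation_le\<close>). Next to the endpoint \<open>0\<close>, where \<open>W\<close> vanishes, the average of \<open>g\<close> must
therefore be small on a flat path, hence also next to \<open>x\<^sub>0\<close>, where \<open>W \<circ> F\<close>, and with it \<open>g(x\<^sub>0)\<close>, is then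
small as well; this is a contradiction (\<open>regular_sample_not_flat\<close>, \<open>consistent_if_drift_oscillates\<close>).

All facts about \<open>W\<close> come from two tools. Equicontinuity is an exponential bound for increments, summed
along dyadic points. Anticoncentration and the small ball bound are changes of measure: a density
\<open>1 + h\<close> with \<open>n \<integral> h\<^sup>2\<close> bounded has a bounded second moment of the likelihood ratio, so tilted and
untilted probabilities control each other (\<open>sample_law_diff_le\<close>, \<open>sample_law_square_le\<close>), while the
coupling shows that a tilt just adds a prescribed function to the path.

\<^bold>\<open>The drift and the coefficients.\<close> Since \<open>\<parallel>f\<parallel>\<close> is of order \<open>n\<^bsup>-r\<^esup>\<close>, coefficients of level \<open>k\<close> are at most
of order \<open>n\<^bsup>-r\<^esup> 2\<^bsup>-k/2\<^esup>\<close>. Call one of them significant if it attains this order on a level with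
\<open>2\<^bsup>k\<^esup> = O(n\<^bsup>1/2-r\<^esup>)\<close>. The drift is large if and only if there is a significant coefficient: low levels
are negligible by assumption G, high levels because primitives of wavelets are small
(\<open>significant_if_drift_large\<close>), and a coefficient is at most a multiple of \<open>2\<^bsup>k/2\<^esup>\<close> times the
supremum of the primitive of \<open>f\<close>, by integration by parts (\<open>drift_large_if_significant\<close>).
A single significant term \<open>\<theta>\<^sub>k\<^sub>j \<phi>\<^sub>k\<^sub>j\<close> is already a function \<open>f\<^sub>1\<close> as required: it has norm of order
\<open>n\<^bsup>-r\<^esup>\<close>, the right orientation, and lies in a fixed Besov body because \<open>2\<^bsup>sk\<^esup> = O(n\<^bsup>r\<^esup>)\<close> by the choice of
\<open>s\<close> (\<open>besov_part_if_significant\<close>). Conversely, equal orientation makes the coefficients of \<open>f\<^sub>1\<close> smaller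
in modulus than those of \<open>f\<close>; assumption G bounds the low levels of \<open>f\<^sub>1\<close> and the Besov condition
its high levels, so a norm of order \<open>n\<^bsup>-r\<^esup>\<close> can only come from a significant coefficient of \<open>f\<close> in the
bounded number of levels between (\<open>significant_if_besov_part\<close>).\<close>

section \<open>Uniform samples and the Kolmogorov statistic\<close>

abbreviation unif_law :: "nat \<Rightarrow> (nat \<Rightarrow> real) measure" where
  "unif_law n \<equiv> PiM {..<n} (\<lambda>_. unit_lborel)"

lemma space_unit [simp]: "space unit_lborel = {0..1}"
  by (simp add: space_restrict_space)

lemma prob_unit: "prob_space unit_lborel"
  by (rule prob_spaceI) (simp add: emeasure_restrict_space)

interpretation unit_prob: prob_space unit_lborel
  by (rule prob_unit)

lemma prob_unif: "prob_space (unif_law n)"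
  by (rule prob_space_PiM) (rule prob_unit)

interpretation unif_prob: prob_space "unif_law n" for n
  by (rule prob_unif)

lemma sample_law_zero: "sample_law n (\<lambda>_. 0) = unif_law n"
  by (simp add: sample_law_def density_1)

lemma sets_sample_law [simp]: "sets (sample_law n f) = sets (unif_law n)"
  by (auto simp: sample_law_def intro!: sets_PiM_cong)

lemma space_sample_law [simp]: "space (sample_law n f) = space (unif_law n)"
  by (rule sets_eq_imp_space_eq) simp

lemma space_unif: "space (unif_law n) = (\<Pi>\<^sub>E i\<in>{..<n}. {0..1})"
  by (simp add: space_PiM)

lemma empirical_cdf_sum:
  "empirical_cdf n X x = (\<Sum>i<n. indicator {..x} (X i)) / real n"
proof -
  have "(\<Sum>i<n. indicator {..x} (X i)) = (\<Sum>i\<in>{i. i < n \<and> X i \<le> x}. (1::real))"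
    by (rule sum.mono_neutral_cong_right) (auto split: split_indicator)
  then show ?thesis
    by (simp add: empirical_cdf_def)
qed

lemma unit_borel_measurable: "g \<in> borel_measurable borel \<Longrightarrow> g \<in> borel_measurable unit_lborel"
  by (rule measurable_restrict_space1) simp

lemma empirical_cdf_measurable [measurable]:
  "(\<lambda>X. empirical_cdf n X x) \<in> borel_measurable (unif_law n)"
proof -
  have "(\<lambda>X. indicator {..x} (X i) :: real) \<in> borel_measurable (unif_law n)" if "i < n" for i
    using measurable_compose[OF measurable_component_singleton[of i "{..<n}" "\<lambda>_. unit_lborel"]
        unit_borel_measurable[of "indicator {..x}"]] that by auto
  then show ?thesis
    unfolding empirical_cdf_sum by (intro borel_measurable_divide borel_measurable_sum) auto
qed

lemma empirical_cdf_bounds: "0 \<le> empirical_cdf n X x" "empirical_cdf n X x \<le> 1"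
proof -
  have "card {i. i < n \<and> X i \<le> x} \<le> card {..<n}"
    by (intro card_mono) auto
  then show "empirical_cdf n X x \<le> 1"
    by (simp add: empirical_cdf_def divide_le_eq)
qed (simp add: empirical_cdf_def)

lemma empirical_cdf_mono: "x \<le> y \<Longrightarrow> empirical_cdf n X x \<le> empirical_cdf n X y"
  unfolding empirical_cdf_def by (intro divide_right_mono) (auto intro!: card_mono)

text \<open>Right continuity in its strongest form: step functions are locally constant to the right. It allows
suprema over the unit interval to be replaced by suprema over rational points, which is what makes the
Kolmogorov statistic measurable.\<close>

lemma empirical_cdf_right:
  "\<forall>\<^sub>F y in at_right x. empirical_cdf n X y = empirical_cdf n X x"
proof -
  have "\<forall>\<^sub>F y in at_right x. (X i \<le> y) = (X i \<le> x)" for i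
  proof (cases "X i \<le> x")
    case True
    then show ?thesis
      by (intro eventually_at_right_less[THEN eventually_mono]) auto
  next
    case False
    then have "\<forall>\<^sub>F y in at_right x. y < X i"
      by (intro eventually_at_rightI[of x "X i"]) auto
    then show ?thesis
      by (rule eventually_mono) (use False in auto)
  qed
  then have "\<forall>\<^sub>F y in at_right x. \<forall>i\<in>{..<n}. (X i \<le> y) = (X i \<le> x)"
    by (intro eventually_ball_finite) auto
  then show ?thesis
  proof (rule eventually_mono)
    fix y assume "\<forall>i\<in>{..<n}. (X i \<le> y) = (X i \<le> x)"
    then have "{i. i < n \<and> X i \<le> y} = {i. i < n \<and> X i \<le> x}"
      by auto
    then show "empirical_cdf n X y = empirical_cdf n X x"
      by (simp add: empirical_cdf_def)
  qed
qed

lemma deviation_rational: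
  assumes "x \<in> {0..1}" and "a < \<sigma> * (empirical_cdf n X x - x)"
  shows "\<exists>y\<in>\<rat> \<inter> {0..1}. a < \<sigma> * (empirical_cdf n X y - y)"
proof (cases "x = 1")
  \<comment> \<open>The point \<open>1\<close> has no room to its right, but it is rational itself.\<close>
  case True
  then show ?thesis using assms by (intro bexI[of _ 1]) auto
next
  case False
  have "((\<lambda>y. \<sigma> * (empirical_cdf n X x - y)) \<longlongrightarrow> \<sigma> * (empirical_cdf n X x - x)) (at_right x)"
    by (intro tendsto_intros)
  then have "\<forall>\<^sub>F y in at_right x. a < \<sigma> * (empirical_cdf n X x - y)"
    using assms(2) by (rule order_tendstoD(1))
  moreover have "\<forall>\<^sub>F y in at_right x. y < 1"
    using False assms by (intro eventually_at_rightI[of x 1]) auto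
  ultimately have "\<forall>\<^sub>F y in at_right x. a < \<sigma> * (empirical_cdf n X y - y) \<and> y < 1"
    using empirical_cdf_right[of n X x] by eventually_elim auto
  then obtain b where b: "b > x" "\<And>y. x < y \<Longrightarrow> y < b \<Longrightarrow> a < \<sigma> * (empirical_cdf n X y - y) \<and> y < 1"
    by (auto simp: eventually_at_right_field)
  obtain y where "y \<in> \<rat>" "x < y" "y < b"
    using Rats_dense_in_real[OF b(1)] by auto
  then show ?thesis
    using b(2)[of y] assms(1) by (intro bexI[of _ y]) auto
qed

lemma deviation_set_measurable:
  "{X \<in> space (unif_law n). \<exists>x\<in>{0..1}. a < \<sigma> * (empirical_cdf n X x - x)} \<in> sets (unif_law n)"
proof -
  have "{X \<in> space (unif_law n). \<exists>x\<in>{0..1}. a < \<sigma> * (empirical_cdf n X x - x)} =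
      (\<Union>y\<in>\<rat> \<inter> {0..1}. {X \<in> space (unif_law n). a < \<sigma> * (empirical_cdf n X y - y)})"
    using deviation_rational by fastforce
  also have "\<dots> \<in> sets (unif_law n)"
    by (intro sets.countable_UN'' countable_Int1 countable_rat) measurable
  finally show ?thesis .
qed

lemma kolmogorov_T_gt_iff:
  assumes "\<And>x. x \<in> {0..1} \<Longrightarrow> \<bar>F x - x\<bar> \<le> B"
  shows "q < kolmogorov_T F \<longleftrightarrow> (\<exists>x\<in>{0..1}. q < \<bar>F x - x\<bar>)"
proof -
  have "bdd_above ((\<lambda>x. \<bar>F x - x\<bar>) ` {0..1})"
    using assms by (intro bdd_aboveI2[where M = B]) auto
  then show ?thesis
    unfolding kolmogorov_T_def by (intro less_cSUP_iff) auto
qed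

lemma kolmogorov_T_le_iff:
  assumes "\<And>x. x \<in> {0..1} \<Longrightarrow> \<bar>F x - x\<bar> \<le> B"
  shows "kolmogorov_T F \<le> q \<longleftrightarrow> (\<forall>x\<in>{0..1}. \<bar>F x - x\<bar> \<le> q)"
  using kolmogorov_T_gt_iff[of F B q] assms by (auto simp: not_less[symmetric])

lemma empirical_dev_bound: "x \<in> {0..1} \<Longrightarrow> \<bar>empirical_cdf n X x - x\<bar> \<le> 1"
  using empirical_cdf_bounds[of n X x] by auto

lemma empirical_T_gt_iff:
    "q < kolmogorov_T (empirical_cdf n X) \<longleftrightarrow> (\<exists>x\<in>{0..1}. q < \<bar>empirical_cdf n X x - x\<bar>)"
  and empirical_T_le_iff:
    "kolmogorov_T (empirical_cdf n X) \<le> q \<longleftrightarrow> (\<forall>x\<in>{0..1}. \<bar>empirical_cdf n X x - x\<bar> \<le> q)"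
  by (rule kolmogorov_T_gt_iff kolmogorov_T_le_iff, erule empirical_dev_bound)+

lemma empirical_T_measurable [measurable]:
  "(\<lambda>X. kolmogorov_T (empirical_cdf n X)) \<in> borel_measurable (unif_law n)"
proof (rule borel_measurableI_greater)
  fix q
  have "{X \<in> space (unif_law n). q < kolmogorov_T (empirical_cdf n X)} =
     {X \<in> space (unif_law n). \<exists>x\<in>{0..1}. q < 1 * (empirical_cdf n X x - x)} \<union>
     {X \<in> space (unif_law n). \<exists>x\<in>{0..1}. q < -1 * (empirical_cdf n X x - x)}"
    by (auto simp: empirical_T_gt_iff abs_real_def split: if_splits) force+
  then show "{X \<in> space (unif_law n). q < kolmogorov_T (empirical_cdf n X)} \<in> sets (unif_law n)"
    by (simp only: deviation_set_measurable sets.Un)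
qed

section \<open>Coupling by quantiles\<close>

text \<open>The primitive of \<open>f\<close> plus the uniform distribution function, that is, the distribution function of the
density \<open>1 + f\<close>.\<close>

definition drift_cdf :: "(real \<Rightarrow> real) \<Rightarrow> real \<Rightarrow> real" where
  "drift_cdf f x = x + (LBINT t:{0..x}. f t)"

definition quantile :: "(real \<Rightarrow> real) \<Rightarrow> real \<Rightarrow> real" where
  "quantile F u = Inf {x\<in>{0..1}. u \<le> F x}"

text \<open>The infimum in the definition of the quantile is attained because a continuous function has closed
superlevel sets; this gives the Galois connection between a distribution function and its quantile.\<close>

lemma quantile_le_iff:
  assumes "continuous_on {0..1} F" "mono_on {0..1} F" "F 0 = 0" "F 1 = 1"
    and u: "u \<in> {0..1::real}" and x: "x \<in> {0..1}"
  shows "quantile F u \<le> x \<longleftrightarrow> u \<le> F x" and "quantile F u \<in> {0..1}"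
proof -
  define S where "S = {x\<in>{0..1}. u \<le> F x}"
  have "S = {0..1} \<inter> F -` {u..}" by (auto simp: S_def)
  then have "closed S"
    using continuous_closed_preimage[OF assms(1)] by simp
  moreover have ne: "1 \<in> S" using assms u by (auto simp: S_def)
  moreover have bd: "bdd_below S" by (auto simp: S_def intro!: bdd_belowI[of _ 0])
  ultimately have inS: "Inf S \<in> S"
    using closed_contains_Inf by blast
  then show "quantile F u \<in> {0..1}" by (auto simp: quantile_def S_def)
  show "quantile F u \<le> x \<longleftrightarrow> u \<le> F x"
  proof
    assume "quantile F u \<le> x"
    then have "F (Inf S) \<le> F x" using inS x
      by (intro mono_onD[OF assms(2)]) (auto simp: quantile_def S_def)
    then show "u \<le> F x" using inS by (auto simp: S_def)
  next
    assume "u \<le> F x"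
    then have "x \<in> S" using x by (auto simp: S_def)
    then show "quantile F u \<le> x"
      using cInf_lower[OF _ bd] by (simp add: quantile_def S_def)
  qed
qed

lemma density_integrable:
  assumes "is_density (\<lambda>x. 1 + f x)"
  shows "integrable unit_lborel f" and "(LINT x|unit_lborel. f x) = 0"
proof -
  have "integrable unit_lborel (\<lambda>x. 1 + f x)"
    using assms not_integrable_integral_eq by (fastforce simp: is_density_def)
  then have "integrable unit_lborel (\<lambda>x. (1 + f x) - 1)"
    by (intro Bochner_Integration.integrable_diff unit_prob.integrable_const)
  then show *: "integrable unit_lborel f" by simp
  have "(LINT x|unit_lborel. 1 + f x) = 1 + (LINT x|unit_lborel. f x)"
    using * by (subst Bochner_Integration.integral_add) (auto simp: unit_prob.prob_space[simplified])
  then show "(LINT x|unit_lborel. f x) = 0"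
    using assms by (simp add: is_density_def)
qed

lemma set_integrable_unit_iff:
  fixes f :: "real \<Rightarrow> real"
  shows "set_integrable lborel {0..1} f \<longleftrightarrow> integrable unit_lborel f"
  unfolding set_integrable_def by (subst integrable_restrict_space) auto

lemma set_integral_unit:
  fixes f :: "real \<Rightarrow> real"
  shows "(LBINT x:{0..1}. f x) = (LINT x|unit_lborel. f x)"
  by (simp add: set_lebesgue_integral_def integral_restrict_space)

lemma set_integral_sub_unit:
  fixes f :: "real \<Rightarrow> real"
  assumes "x \<in> {0..1}"
  shows "(LBINT t:{0..x}. f t) = (LINT t|unit_lborel. indicator {0..x} t * f t)"
proof -
  have "(\<lambda>t. indicator {0..1} t * (indicator {0..x} t * f t)) = (\<lambda>t. indicator {0..x} t * f t)"
    using assms by (auto simp: fun_eq_iff split: split_indicator)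
  then show ?thesis
    by (simp add: set_lebesgue_integral_def integral_restrict_space)
qed

lemma integral_unit_indicator: 
  assumes "x \<in> {0..1}"
  shows "(LINT t|unit_lborel. indicator {0..x} t) = x"
  using set_integral_sub_unit[OF assms, of "\<lambda>_. 1"] assms
  by (simp add: set_lebesgue_integral_def)

lemma drift_cdf_eq:
  assumes "integrable unit_lborel f" "x \<in> {0..1}"
  shows "drift_cdf f x = (LINT t|unit_lborel. indicator {0..x} t * (1 + f t))"
proof -
  have set: "{0..x} \<in> sets unit_lborel"
    using assms by (auto simp: sets_restrict_space_iff)
  have "integrable unit_lborel (\<lambda>t. indicator {0..x} t * f t)"
    using integrable_mult_indicator[OF set assms(1)] by simp
  moreover have "integrable unit_lborel (indicator {0..x} :: real \<Rightarrow> real)"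
    by (rule unit_prob.integrable_const_bound[of _ 1]) 
      (auto intro!: unit_borel_measurable split: split_indicator)
  ultimately show ?thesis
    unfolding drift_cdf_def set_integral_sub_unit[OF assms(2)] distrib_left
    by (subst Bochner_Integration.integral_add)
      (simp_all add: integral_unit_indicator[OF assms(2)] del: Bochner_Integration.integral_indicator)
qed

lemma continuous_on_integral_unit:
  fixes f :: "real \<Rightarrow> real"
  assumes "integrable unit_lborel f"
  shows "continuous_on {0..1} (\<lambda>x. LBINT t:{0..x}. f t)"
proof -
  have f: "set_integrable lborel {0..1} f"
    using assms by (simp add: set_integrable_unit_iff)
  have "continuous_on {0..1} (\<lambda>x. integral {0..x} f)"
    by (rule indefinite_integral_continuous_1[OF set_borel_integral_eq_integral(1)[OF f]])
  also have "?this \<longleftrightarrow> continuous_on {0..1} (\<lambda>x. LBINT t:{0..x}. f t)"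
    by (intro continuous_on_cong refl set_borel_integral_eq_integral(2)[symmetric]
        set_integrable_subset[OF f]) auto
  finally show ?thesis .
qed

context
  fixes f :: "real \<Rightarrow> real"
  assumes dens: "is_density (\<lambda>x. 1 + f x)"
begin

private abbreviation "D \<equiv> density unit_lborel (\<lambda>x. ennreal (1 + f x))"

private lemma meas [measurable]: "(\<lambda>x. 1 + f x) \<in> borel_measurable unit_lborel"
  using dens by (simp add: is_density_def)

private lemma integrable_1p: "integrable unit_lborel (\<lambda>x. 1 + f x)"
  using density_integrable(1)[OF dens] by auto

private lemma emeasure_D:
  assumes "x \<in> {0..1}"
  shows "emeasure D {0..x} = ennreal (drift_cdf f x)"
proof -
  have set: "{0..x} \<in> sets unit_lborel"
    using assms by (auto simp: sets_restrict_space_iff)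
  have "emeasure D {0..x} = (\<integral>\<^sup>+t. ennreal (1 + f t) * indicator {0..x} t \<partial>unit_lborel)"
    using set by (intro emeasure_density) auto
  also have "\<dots> = (\<integral>\<^sup>+t. ennreal (indicator {0..x} t * (1 + f t)) \<partial>unit_lborel)"
    by (intro nn_integral_cong) (auto split: split_indicator)
  also have "\<dots> = ennreal (LINT t|unit_lborel. indicator {0..x} t * (1 + f t))"
  proof (rule nn_integral_eq_integral)
    show "integrable unit_lborel (\<lambda>t. indicator {0..x} t * (1 + f t))"
      using integrable_mult_indicator[OF set integrable_1p] by simp
    show "AE t in unit_lborel. 0 \<le> indicator {0..x} t * (1 + f t)"
      using dens unfolding is_density_def by (auto split: split_indicator)
  qed
  also have "\<dots> = ennreal (drift_cdf f x)"
    using drift_cdf_eq[OF density_integrable(1)[OF dens] assms] by simp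
  finally show ?thesis .
qed

lemma drift_cdf_nonneg: "x \<in> {0..1} \<Longrightarrow> 0 \<le> drift_cdf f x"
  using drift_cdf_eq[OF density_integrable(1)[OF dens], of x] dens
  by (auto simp: is_density_def intro!: integral_nonneg_AE split: split_indicator)

lemma drift_cdf_mono: "mono_on {0..1} (drift_cdf f)"
proof (rule mono_onI)
  fix x y :: real assume *: "x \<in> {0..1}" "y \<in> {0..1}" "x \<le> y"
  have "ennreal (drift_cdf f x) \<le> ennreal (drift_cdf f y)"
    unfolding emeasure_D[OF *(1), symmetric] emeasure_D[OF *(2), symmetric]
    using * by (intro emeasure_mono) (auto simp: sets_restrict_space_iff)
  then show "drift_cdf f x \<le> drift_cdf f y"
    using drift_cdf_nonneg[OF *(2)] by simp
qed

lemma drift_cdf_ends: "drift_cdf f 0 = 0" "drift_cdf f 1 = 1"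
proof -
  show "drift_cdf f 1 = 1"
    by (simp add: drift_cdf_def set_integral_unit density_integrable(2)[OF dens])
  have "(LBINT t:{0..0}. f t) = 0"
    unfolding set_lebesgue_integral_def
    by (rule integral_eq_zero_AE, rule eventually_mono[OF AE_lborel_singleton[of "0::real"]]) simp
  then show "drift_cdf f 0 = 0" by (simp add: drift_cdf_def)
qed

lemma drift_cdf_continuous: "continuous_on {0..1} (drift_cdf f)"
  unfolding drift_cdf_def
  by (intro continuous_intros continuous_on_integral_unit density_integrable(1)[OF dens])

lemma drift_cdf_range: "x \<in> {0..1} \<Longrightarrow> drift_cdf f x \<in> {0..1}"
  using mono_onD[OF drift_cdf_mono, of x 1] drift_cdf_nonneg[of x] drift_cdf_ends by auto

private abbreviation "Q \<equiv> quantile (drift_cdf f)"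

private lemmas Q_iff = quantile_le_iff[OF drift_cdf_continuous drift_cdf_mono drift_cdf_ends]

lemma prob_density_unit: "prob_space D"
proof (rule prob_spaceI)
  have "emeasure D {0..1} = ennreal (drift_cdf f 1)"
    by (rule emeasure_D) auto
  then show "emeasure D (space D) = 1" by (simp add: drift_cdf_ends)
qed

private lemma Q_range: "u \<in> {0..1} \<Longrightarrow> Q u \<in> {0..1}"
  using Q_iff(2)[of u 0] by simp

private lemma sublevel_Q:
  "{u \<in> space unit_lborel. Q u \<le> x} = (if x < 0 then {} else {0..drift_cdf f (min x 1)})"
proof (cases "x < 0")
  case True
  then show ?thesis using Q_range by fastforce
next
  case False
  define y where "y = min x 1"
  have y: "y \<in> {0..1}" using False by (auto simp: y_def)
  have "Q u \<le> x \<longleftrightarrow> u \<le> drift_cdf f y" if "u \<in> {0..1}" for u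
  proof -
    have "Q u \<le> x \<longleftrightarrow> Q u \<le> y" using Q_range[OF that] by (auto simp: y_def)
    then show ?thesis using Q_iff(1)[OF that y] by simp
  qed
  then have "{u \<in> space unit_lborel. Q u \<le> x} = {0..drift_cdf f y}"
    using drift_cdf_range[OF y] by auto
  then show ?thesis using False by (simp add: y_def)
qed

private lemma Q_measurable_borel: "Q \<in> borel_measurable unit_lborel"
proof (rule borel_measurableI_le)
  fix x
  show "{u \<in> space unit_lborel. Q u \<le> x} \<in> sets unit_lborel"
    unfolding sublevel_Q using drift_cdf_range[of "min x 1"] by (auto simp: sets_restrict_space_iff)
qed

private lemma Q_measurable: "Q \<in> measurable unit_lborel unit_lborel"
  using Q_range Q_measurable_borel by (intro measurable_restrict_space2) auto

text \<open>Both measures have distribution function \<open>drift_cdf f\<close>, by the Galois connection on one side and by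
integration on the other.\<close>

private lemma distr_Q: "distr unit_lborel unit_lborel Q = D"
proof -
  define N1 where "N1 = distr unit_lborel borel Q"
  define N2 where "N2 = distr D borel (\<lambda>x. x)"
  have idm: "(\<lambda>x. x) \<in> measurable D borel"
    using unit_borel_measurable[of "\<lambda>x. x"] by simp
  have 1: "real_distribution N1"
    unfolding N1_def by (intro unit_prob.real_distribution_distr Q_measurable_borel)
  have 2: "real_distribution N2"
    unfolding N2_def by (intro prob_space.real_distribution_distr prob_density_unit idm)
  have "cdf N1 x = cdf N2 x" for x
  proof -
    have "cdf N1 x = measure unit_lborel (Q -` {..x} \<inter> space unit_lborel)"
      unfolding N1_def cdf_def2 by (rule measure_distr[OF Q_measurable_borel]) simp
    also have "Q -` {..x} \<inter> space unit_lborel = {u \<in> space unit_lborel. Q u \<le> x}"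
      by auto
    finally have "cdf N1 x = measure unit_lborel {u \<in> space unit_lborel. Q u \<le> x}" .
    moreover have "cdf N2 x = measure D ({..x} \<inter> {0..1})"
      unfolding N2_def cdf_def2 using measure_distr[OF idm, of "{..x}"] by simp
    moreover have "measure unit_lborel {u \<in> space unit_lborel. Q u \<le> x} = measure D ({..x} \<inter> {0..1})"
    proof (cases "x < 0")
      case True
      then have "{..x} \<inter> {0..1} = {}" by auto
      then show ?thesis using True by (simp only: sublevel_Q if_True measure_empty)
    next
      case False
      define y where "y = min x 1"
      have y: "y \<in> {0..1}" using False by (auto simp: y_def)
      have "{..x} \<inter> {0..1} = {0..y}"
        using False by (auto simp: y_def)
      moreover have "measure unit_lborel {0..drift_cdf f y} = drift_cdf f y"
        using drift_cdf_range[OF y] by (subst measure_restrict_space) auto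
      moreover have "measure D {0..y} = drift_cdf f y"
        using emeasure_D[OF y] drift_cdf_nonneg[OF y] by (simp add: measure_def)
      ultimately show ?thesis
        using False unfolding sublevel_Q by (simp only: y_def if_False)
    qed
    ultimately show ?thesis by simp
  qed
  then have eq: "N1 = N2"
    by (intro cdf_unique 1 2 ext)
  show ?thesis
  proof (rule measure_eqI)
    fix A assume "A \<in> sets (distr unit_lborel unit_lborel Q)"
    then have A: "A \<in> sets unit_lborel" "A \<in> sets borel" "A \<subseteq> {0..1}"
      by (simp_all add: sets_restrict_space_iff)
    have "emeasure (distr unit_lborel unit_lborel Q) A = emeasure N1 A"
      using A Q_measurable Q_measurable_borel by (simp add: emeasure_distr N1_def)
    also have "\<dots> = emeasure D A"
      using A idm by (simp add: eq N2_def emeasure_distr Int_absorb2)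
    finally show "emeasure (distr unit_lborel unit_lborel Q) A = emeasure D A" .
  qed simp
qed

text \<open>The coupling identity: the Galois connection turns \<open>Q(U\<^sub>i) \<le> x\<close> into \<open>U\<^sub>i \<le> F(x)\<close>, for every
sample point at once.\<close>

lemma empirical_cdf_quantile:
  assumes "U \<in> space (unif_law n)" "x \<in> {0..1}"
  shows "empirical_cdf n (compose {..<n} (quantile (drift_cdf f)) U) x = empirical_cdf n U (drift_cdf f x)"
proof -
  have "U i \<in> {0..1}" if "i < n" for i
    using assms that by (auto simp: space_unif PiE_def)
  then have "{i. i < n \<and> compose {..<n} Q U i \<le> x} = {i. i < n \<and> U i \<le> drift_cdf f x}"
    using Q_iff(1)[OF _ assms(2)] by (auto simp: compose_def)
  then show ?thesis by (simp add: empirical_cdf_def)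
qed

lemma compose_quantile_measurable:
  "compose {..<n} (quantile (drift_cdf f)) \<in> measurable (unif_law n) (unif_law n)"
  unfolding compose_def
proof (rule measurable_restrict)
  fix i assume "i \<in> {..<n}"
  then have "(\<lambda>U. U i) \<in> measurable (unif_law n) unit_lborel"
    by (rule measurable_component_singleton)
  then show "(\<lambda>U. Q (U i)) \<in> measurable (unif_law n) unit_lborel"
    by (rule measurable_compose[OF _ Q_measurable])
qed

lemma measure_sample_law:
  assumes "A \<in> sets (unif_law n)"
  shows "measure (sample_law n f) A =
    measure (unif_law n) {U \<in> space (unif_law n). compose {..<n} (quantile (drift_cdf f)) U \<in> A}"
proof -
  have "sample_law n f = distr (unif_law n) (unif_law n) (compose {..<n} Q)"
    unfolding sample_law_def distr_Q[symmetric]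
    by (rule distr_PiM_finite_prob_space'[symmetric]) (auto intro: prob_unit Q_measurable)
  then have "measure (sample_law n f) A = measure (unif_law n) (compose {..<n} Q -` A \<inter> space (unif_law n))"
    using assms compose_quantile_measurable by (simp add: measure_distr)
  also have "compose {..<n} Q -` A \<inter> space (unif_law n) = {U \<in> space (unif_law n). compose {..<n} Q U \<in> A}"
    by auto
  finally show ?thesis .
qed

end

section \<open>Change of measure\<close>

text \<open>The discriminant argument: the integral of \<open>(t f + g)\<^sup>2\<close> is a nonnegative quadratic polynomial in \<open>t\<close>.\<close>

lemma Cauchy_Schwarz_integral:
  fixes f g :: "'a \<Rightarrow> real"
  assumes [measurable]: "f \<in> borel_measurable M" "g \<in> borel_measurable M"
    and f2: "integrable M (\<lambda>x. (f x)\<^sup>2)" and g2: "integrable M (\<lambda>x. (g x)\<^sup>2)"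
  shows "integrable M (\<lambda>x. f x * g x)"
    and "(LINT x|M. f x * g x)\<^sup>2 \<le> (LINT x|M. (f x)\<^sup>2) * (LINT x|M. (g x)\<^sup>2)"
proof -
  show fg: "integrable M (\<lambda>x. f x * g x)"
  proof (rule Bochner_Integration.integrable_bound)
    show "integrable M (\<lambda>x. (f x)\<^sup>2 + (g x)\<^sup>2)" using f2 g2 by auto
    show "AE x in M. norm (f x * g x) \<le> norm ((f x)\<^sup>2 + (g x)\<^sup>2)"
    proof (rule AE_I2)
      fix x 
      have "2 * \<bar>f x * g x\<bar> \<le> (f x)\<^sup>2 + (g x)\<^sup>2"
        using sum_squares_bound[of "\<bar>f x\<bar>" "\<bar>g x\<bar>"] by (simp add: abs_mult)
      then show "norm (f x * g x) \<le> norm ((f x)\<^sup>2 + (g x)\<^sup>2)" by simp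
    qed
  qed simp
  define a b c where "a = (LINT x|M. (f x)\<^sup>2)" and "b = (LINT x|M. f x * g x)" and "c = (LINT x|M. (g x)\<^sup>2)"
  have quad: "0 \<le> a * t\<^sup>2 + 2 * b * t + c" for t
  proof -
    have "0 \<le> (LINT x|M. (t * f x + g x)\<^sup>2)" by (rule Bochner_Integration.integral_nonneg) auto
    also have "\<dots> = (LINT x|M. (t\<^sup>2 * (f x)\<^sup>2 + 2 * t * (f x * g x)) + (g x)\<^sup>2)"
      by (intro Bochner_Integration.integral_cong) (auto simp: power2_eq_square algebra_simps)
    also have "\<dots> = a * t\<^sup>2 + 2 * b * t + c"
      using f2 g2 fg by (simp add: a_def b_def c_def)
    finally show ?thesis .
  qed
  have "0 \<le> a" "0 \<le> c" by (auto simp: a_def c_def)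
  show "b\<^sup>2 \<le> a * c"
  proof (cases "a = 0")
    case True
    have "b = 0"
    proof (rule ccontr)
      assume "b \<noteq> 0"
      then show False
        \<comment> \<open>An argument at which the linear polynomial \<open>2 b t + c\<close> equals \<open>-1\<close>.\<close>
        using quad[of "- (c + 1) / (2 * b)"] True \<open>0 \<le> c\<close> by (simp add: field_simps)
    qed
    then show ?thesis using True by simp
  next
    case False
    then have "0 < a" using \<open>0 \<le> a\<close> by simp
    have "0 \<le> a * (a * (- b / a)\<^sup>2 + 2 * b * (- b / a) + c)"
      using quad[of "- b / a"] \<open>0 < a\<close> by simp
    also have "\<dots> = a * c - b\<^sup>2"
      using \<open>0 < a\<close> by (simp add: field_simps power2_eq_square)
    finally show ?thesis by simp
  qed
qed

interpretation unif_product: product_sigma_finite "\<lambda>_::nat. unit_lborel"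
  by standard (rule unit_prob.sigma_finite_countable)

lemma integrable_unit_bounded:
  fixes g :: "real \<Rightarrow> real"
  assumes "g \<in> borel_measurable unit_lborel" "\<And>x. x \<in> {0..1} \<Longrightarrow> \<bar>g x\<bar> \<le> B"
  shows "integrable unit_lborel g"
proof (rule unit_prob.integrable_const_bound)
  show "AE x in unit_lborel. norm (g x) \<le> B"
    using assms(2) by (intro AE_I2) simp
qed (rule assms(1))

lemma integrable_indicator_unif:
  "A \<in> sets (unif_law n) \<Longrightarrow> integrable (unif_law n) (indicator A :: _ \<Rightarrow> real)"
  by (rule unif_prob.integrable_const_bound[of _ 1]) (auto intro!: AE_I2 split: split_indicator)

definition likelihood :: "nat \<Rightarrow> (real \<Rightarrow> real) \<Rightarrow> (nat \<Rightarrow> real) \<Rightarrow> real" where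
  "likelihood n f X = (\<Prod>i<n. 1 + f (X i))"

context
  fixes f :: "real \<Rightarrow> real"
  assumes f_meas: "f \<in> borel_measurable unit_lborel"
    and f_bound: "\<And>x. x \<in> {0..1} \<Longrightarrow> \<bar>f x\<bar> \<le> 1"
    and f_mean: "(LINT x|unit_lborel. f x) = 0"
begin

private lemma f_int: "integrable unit_lborel f" "integrable unit_lborel (\<lambda>x. (f x)\<^sup>2)"
    "integrable unit_lborel (\<lambda>x. 1 + f x)" "integrable unit_lborel (\<lambda>x. (1 + f x)\<^sup>2)"
proof -
  show *: "integrable unit_lborel f" 
    by (rule integrable_unit_bounded[OF f_meas f_bound])
  have b: "(f x)\<^sup>2 \<le> 1" if "x \<in> {0..1}" for x
    using f_bound[OF that] by (simp add: abs_square_le_1)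
  show **: "integrable unit_lborel (\<lambda>x. (f x)\<^sup>2)"
    using f_meas b by (intro integrable_unit_bounded[of _ 1]) auto
  show "integrable unit_lborel (\<lambda>x. 1 + f x)" "integrable unit_lborel (\<lambda>x. (1 + f x)\<^sup>2)"
    using * ** by (auto simp: power2_sum)
qed

lemma is_density_perturbation: "is_density (\<lambda>x. 1 + f x)"
proof -
  have "AE x in unit_lborel. 0 \<le> 1 + f x"
    using f_bound by (intro AE_I2) force
  moreover have "(LINT x|unit_lborel. 1 + f x) = 1"
    using f_int f_mean by (simp add: unit_prob.prob_space[simplified])
  ultimately show ?thesis
    using f_meas by (auto simp: is_density_def)
qed

private lemma likelihood_meas [measurable]: "likelihood n f \<in> borel_measurable (unif_law n)"
  unfolding likelihood_def
proof (intro borel_measurable_prod)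
  fix i assume "i \<in> {..<n}"
  then show "(\<lambda>X. 1 + f (X i)) \<in> borel_measurable (unif_law n)"
    using measurable_compose[OF measurable_component_singleton[of i "{..<n}" "\<lambda>_. unit_lborel"] f_meas]
    by auto
qed

text \<open>The two measures agree on boxes, where the integral of the likelihood factorises.\<close>

lemma sample_law_likelihood:
  "sample_law n f = density (unif_law n) (\<lambda>X. ennreal (likelihood n f X))"
proof -
  let ?D = "density unit_lborel (\<lambda>x. ennreal (1 + f x))"
  have "product_sigma_finite (\<lambda>_::nat. ?D)"
    using prob_density_unit[OF is_density_perturbation]
    by (simp add: product_sigma_finite_def prob_space_imp_sigma_finite)
  then interpret D: product_sigma_finite "\<lambda>_::nat. ?D" .
  show ?thesis
    unfolding sample_law_def
  proof (rule D.PiM_eqI[symmetric])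
    show "sets (density (unif_law n) (\<lambda>X. ennreal (likelihood n f X))) = sets (\<Pi>\<^sub>M i\<in>{..<n}. ?D)"
      by (auto intro!: sets_PiM_cong)
    fix A :: "nat \<Rightarrow> real set" assume A: "\<And>i. i \<in> {..<n} \<Longrightarrow> A i \<in> sets ?D"
    then have A': "\<And>i. i \<in> {..<n} \<Longrightarrow> A i \<in> sets unit_lborel" by simp
    have "emeasure (density (unif_law n) (\<lambda>X. ennreal (likelihood n f X))) (Pi\<^sub>E {..<n} A) =
      (\<integral>\<^sup>+X. ennreal (likelihood n f X) * indicator (Pi\<^sub>E {..<n} A) X \<partial>unif_law n)"
      using A' by (intro emeasure_density sets_PiM_I_finite) auto
    also have "\<dots> = (\<integral>\<^sup>+X. (\<Prod>i<n. ennreal (1 + f (X i)) * indicator (A i) (X i)) \<partial>unif_law n)"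
    proof (rule nn_integral_cong)
      fix X assume X: "X \<in> space (unif_law n)"
      then have "\<bar>f (X i)\<bar> \<le> 1" if "i < n" for i
        using that by (intro f_bound) (auto simp: space_unif PiE_def)
      then have "0 \<le> 1 + f (X i)" if "i < n" for i
        using that by fastforce
      then have "ennreal (likelihood n f X) = (\<Prod>i<n. ennreal (1 + f (X i)))"
        unfolding likelihood_def by (intro prod_ennreal[symmetric]) auto
      moreover have "indicator (Pi\<^sub>E {..<n} A) X = (\<Prod>i<n. indicator (A i) (X i) :: ennreal)"
      proof (cases "X \<in> Pi\<^sub>E {..<n} A")
        case True
        then show ?thesis by (auto simp: PiE_def Pi_def)
      next
        case False
        then obtain i where "i < n" "X i \<notin> A i"
          using X by (auto simp: space_unif PiE_def Pi_def)
        then show ?thesis using False by (auto simp: prod_zero_iff intro!: bexI[of _ i])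
      qed
      ultimately show "ennreal (likelihood n f X) * indicator (Pi\<^sub>E {..<n} A) X =
          (\<Prod>i<n. ennreal (1 + f (X i)) * indicator (A i) (X i))"
        by (simp add: prod.distrib)
    qed
    also have "\<dots> = (\<Prod>i<n. \<integral>\<^sup>+x. ennreal (1 + f x) * indicator (A i) x \<partial>unit_lborel)"
      using f_meas A' by (intro unif_product.product_nn_integral_prod) auto
    also have "\<dots> = (\<Prod>i<n. emeasure ?D (A i))"
      using f_meas A' by (intro prod.cong refl emeasure_density[symmetric]) auto
    finally show "emeasure (density (unif_law n) (\<lambda>X. ennreal (likelihood n f X))) (Pi\<^sub>E {..<n} A) =
      (\<Prod>i<n. emeasure ?D (A i))" .
  qed simp
qed

private lemma likelihood_int: "integrable (unif_law n) (likelihood n f)" "(LINT X|unif_law n. likelihood n f X) = 1"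
proof -
  show "integrable (unif_law n) (likelihood n f)"
    unfolding likelihood_def using f_int by (intro unif_product.product_integrable_prod) auto
  have "(LINT X|unif_law n. likelihood n f X) = (\<Prod>i<n. LINT x|unit_lborel. 1 + f x)"
    unfolding likelihood_def using f_int by (intro unif_product.product_integral_prod) auto
  also have "(LINT x|unit_lborel. 1 + f x) = 1"
    using is_density_perturbation unfolding is_density_def by blast
  also have "(\<Prod>i<n. 1::real) = 1" by (rule prod.neutral_const)
  finally show "(LINT X|unif_law n. likelihood n f X) = 1" .
qed

text \<open>By independence the second moment is \<open>(1 + \<integral> f\<^sup>2)\<^sup>n\<close>; the linear terms vanish because \<open>f\<close> has mean zero.\<close>

private lemma likelihood_square:
  "integrable (unif_law n) (\<lambda>X. (likelihood n f X)\<^sup>2)"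
  "(LINT X|unif_law n. (likelihood n f X)\<^sup>2) \<le> exp (real n * (LINT x|unit_lborel. (f x)\<^sup>2))"
proof -
  have eq: "(likelihood n f X)\<^sup>2 = (\<Prod>i<n. (1 + f (X i))\<^sup>2)" for X
    by (simp add: likelihood_def prod_power_distrib)
  show "integrable (unif_law n) (\<lambda>X. (likelihood n f X)\<^sup>2)"
    unfolding eq using f_int by (intro unif_product.product_integrable_prod) auto
  have "(LINT X|unif_law n. (likelihood n f X)\<^sup>2) = (\<Prod>i<n. LINT x|unit_lborel. (1 + f x)\<^sup>2)"
    unfolding eq using f_int by (intro unif_product.product_integral_prod) auto
  also have "(LINT x|unit_lborel. (1 + f x)\<^sup>2) = 1 + (LINT x|unit_lborel. (f x)\<^sup>2)"
    using f_int f_mean by (simp add: power2_sum unit_prob.prob_space[simplified])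
  also have "(\<Prod>i<n. 1 + (LINT x|unit_lborel. (f x)\<^sup>2)) \<le> (\<Prod>i<n. exp (LINT x|unit_lborel. (f x)\<^sup>2))"
    by (intro prod_mono) (auto intro!: add_nonneg_nonneg)
  also have "\<dots> = exp (real n * (LINT x|unit_lborel. (f x)\<^sup>2))"
    by (simp add: exp_of_nat_mult)
  finally show "(LINT X|unif_law n. (likelihood n f X)\<^sup>2) \<le> exp (real n * (LINT x|unit_lborel. (f x)\<^sup>2))" .
qed

private lemma measure_likelihood:
  assumes "A \<in> sets (unif_law n)"
  shows "measure (sample_law n f) A = (LINT X|unif_law n. likelihood n f X * indicator A X)"
proof -
  have nn: "AE X in unif_law n. 0 \<le> likelihood n f X"
  proof (rule AE_I2)
    fix X assume "X \<in> space (unif_law n)"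
    then have "\<bar>f (X i)\<bar> \<le> 1" if "i < n" for i
      using that by (intro f_bound) (auto simp: space_unif PiE_def)
    then have "0 \<le> 1 + f (X i)" if "i < n" for i
      using that by fastforce
    then show "0 \<le> likelihood n f X"
      unfolding likelihood_def by (intro prod_nonneg) auto
  qed
  have "measure (sample_law n f) A = (LINT X|sample_law n f. indicator A X)"
    using assms by (subst Bochner_Integration.integral_indicator)
      (auto dest!: sets.sets_into_space intro!: arg_cong2[where f=measure])
  also have "\<dots> = (LINT X|unif_law n. likelihood n f X *\<^sub>R indicator A X)"
    unfolding sample_law_likelihood using assms nn by (intro integral_density) auto
  finally show ?thesis by simp
qed

text \<open>Cauchy and Schwarz applied to the likelihood ratio and an indicator. An event that is not rare under the
tilted law is not rare under the uniform law.\<close>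

lemma sample_law_square_le:
  assumes "A \<in> sets (unif_law n)"
  shows "(measure (sample_law n f) A)\<^sup>2 \<le>
     exp (real n * (LINT x|unit_lborel. (f x)\<^sup>2)) * measure (unif_law n) A"
proof -
  have 1: "(\<lambda>X. (indicator A X :: real)\<^sup>2) = indicator A" by (auto simp: fun_eq_iff split: split_indicator)
  have "(measure (sample_law n f) A)\<^sup>2 \<le>
      (LINT X|unif_law n. (likelihood n f X)\<^sup>2) * (LINT X|unif_law n. (indicator A X)\<^sup>2)"
    unfolding measure_likelihood[OF assms]
    using assms likelihood_square(1)
    by (intro Cauchy_Schwarz_integral(2)) (auto simp: 1 integrable_indicator_unif)
  also have "\<dots> \<le> exp (real n * (LINT x|unit_lborel. (f x)\<^sup>2)) * measure (unif_law n) A"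
    using assms by (intro mult_mono likelihood_square(2)) (auto simp: 1 sets.sets_into_space Int_absorb2)
  finally show ?thesis .
qed

text \<open>The same estimate with the likelihood ratio centred at one. It is useful for tilts that are small on the
scale \<open>n\<^bsup>-1/2\<^esup>\<close>, where it bounds the distance of the two laws.\<close>

lemma sample_law_diff_le:
  assumes "A \<in> sets (unif_law n)"
  shows "\<bar>measure (sample_law n f) A - measure (unif_law n) A\<bar> \<le>
     sqrt (exp (real n * (LINT x|unit_lborel. (f x)\<^sup>2)) - 1)"
proof -
  let ?L = "\<lambda>X. likelihood n f X - 1"
  have sq: "(\<lambda>X. (?L X)\<^sup>2) = (\<lambda>X. (likelihood n f X)\<^sup>2 + 1 - 2 * likelihood n f X)"
    by (auto simp: power2_diff)
  have i2: "integrable (unif_law n) (\<lambda>X. (?L X)\<^sup>2)"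
    unfolding sq using likelihood_square(1) likelihood_int by auto
  have 1: "(\<lambda>X. (indicator A X :: real)\<^sup>2) = indicator A" by (auto simp: fun_eq_iff split: split_indicator)
  have "measure (sample_law n f) A - measure (unif_law n) A = (LINT X|unif_law n. ?L X * indicator A X)"
  proof -
    have "integrable (unif_law n) (\<lambda>X. likelihood n f X * indicator A X)"
      using integrable_mult_indicator[OF assms likelihood_int(1)] by (simp add: mult.commute)
    then have "(LINT X|unif_law n. ?L X * indicator A X) =
      (LINT X|unif_law n. likelihood n f X * indicator A X) - (LINT X|unif_law n. indicator A X)"
      using assms unfolding left_diff_distrib by (subst Bochner_Integration.integral_diff) (auto simp: integrable_indicator_unif)
    then show ?thesis
      using assms by (simp add: measure_likelihood sets.sets_into_space Int_absorb2)
  qed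
  then have "(measure (sample_law n f) A - measure (unif_law n) A)\<^sup>2 \<le>
      (LINT X|unif_law n. (?L X)\<^sup>2) * (LINT X|unif_law n. (indicator A X)\<^sup>2)"
    using assms i2 by (simp only:) (intro Cauchy_Schwarz_integral(2), auto simp: 1 integrable_indicator_unif)
  also have "\<dots> \<le> (exp (real n * (LINT x|unit_lborel. (f x)\<^sup>2)) - 1) * 1"
  proof (rule mult_mono)
    show "(LINT X|unif_law n. (?L X)\<^sup>2) \<le> exp (real n * (LINT x|unit_lborel. (f x)\<^sup>2)) - 1"
      unfolding sq using likelihood_square[of n] likelihood_int
      by (simp add: unif_prob.prob_space[simplified])
    show "(LINT X|unif_law n. (indicator A X)\<^sup>2) \<le> (1::real)"
      using assms by (simp add: 1)
  qed (auto simp: 1)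
  finally show ?thesis
    by (intro real_le_rsqrt) simp
qed

end

section \<open>Equicontinuity of the empirical process\<close>

text \<open>The uniform empirical process, called \<open>W\<close> in comments.\<close>

definition emp_process :: "nat \<Rightarrow> (nat \<Rightarrow> real) \<Rightarrow> real \<Rightarrow> real" where
  "emp_process n X u = sqrt (real n) * (empirical_cdf n X u - u)"

lemma emp_process_measurable [measurable]:
  "(\<lambda>X. emp_process n X u) \<in> borel_measurable (unif_law n)"
  unfolding emp_process_def by measurable

lemma emp_process_zero_one:
  assumes "X \<in> space (unif_law n)" "n > 0"
  shows "emp_process n X 1 = 0"
proof -
  have "{i. i < n \<and> X i \<le> 1} = {..<n}"
    using assms by (auto simp: space_unif PiE_def)
  then show ?thesis using assms by (simp add: emp_process_def empirical_cdf_def)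
qed

lemma emp_process_increment:
  assumes "a \<le> b" "n > 0"
  shows "emp_process n X b - emp_process n X a =
    (\<Sum>i<n. indicator {a<..b} (X i) - (b - a)) / sqrt (real n)"
proof -
  have "indicator {..b} (X i) - indicator {..a} (X i) = (indicator {a<..b} (X i) :: real)" for i
    using assms by (auto split: split_indicator)
  then have "(\<Sum>i<n. indicator {a<..b} (X i)) = real n * empirical_cdf n X b - real n * empirical_cdf n X a"
    using assms unfolding empirical_cdf_sum by (simp flip: sum_subtractf)
  then have sum: "(\<Sum>i<n. indicator {a<..b} (X i) - (b - a)) =
      real n * ((empirical_cdf n X b - empirical_cdf n X a) - (b - a))"
    by (simp only: sum_subtractf sum_constant card_lessThan right_diff_distrib)
  have nD: "real n * D / sqrt (real n) = sqrt (real n) * D" for D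
    using real_div_sqrt[of "real n"] by (simp flip: times_divide_eq_left)
  show ?thesis
    unfolding sum nD emp_process_def by (simp add: algebra_simps)
qed

lemma exp_le_quadratic:
  fixes x :: real
  assumes "\<bar>x\<bar> \<le> 1"
  shows "exp x \<le> 1 + x + x\<^sup>2"
proof (cases "0 \<le> x")
  case True
  then show ?thesis using assms exp_bound[of x] by simp
next
  case False
  define y where "y = - x"
  have y: "0 < y" "y \<le> 1" using False assms by (auto simp: y_def)
  have "exp x = 1 / exp y" by (simp add: y_def exp_minus field_simps)
  also have "\<dots> \<le> 1 / (1 + y)"
    using y exp_ge_add_one_self[of y] by (intro divide_left_mono) auto
  also have "\<dots> \<le> 1 - y + y\<^sup>2"
  proof -
    have "(1 - y + y\<^sup>2) * (1 + y) = 1 + y ^ 3" by (simp add: algebra_simps power2_eq_square power3_eq_cube)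
    then have "1 \<le> (1 - y + y\<^sup>2) * (1 + y)" using y by simp
    then show ?thesis using y by (subst pos_divide_le_eq) auto
  qed
  finally show ?thesis by (simp add: y_def)
qed

text \<open>The moment generating function of a centred Bernoulli variable with success probability \<open>p = b - a\<close>, bounded by
\<open>exp (p l\<^sup>2)\<close>: the factor \<open>p\<close> makes the increments below small on short intervals.\<close>

lemma integral_exp_indicator:
  assumes ab: "0 \<le> a" "a \<le> b" "b \<le> 1" and l: "\<bar>l\<bar> \<le> 1"
  shows "integrable unit_lborel (\<lambda>x. exp (l * (indicator {a<..b} x - (b - a))))"
    and "(LINT x|unit_lborel. exp (l * (indicator {a<..b} x - (b - a)))) \<le> exp ((b - a) * l\<^sup>2)"
proof -
  let ?p = "b - a"
  have set: "{a<..b} \<in> sets unit_lborel" using ab by (auto simp: sets_restrict_space_iff)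
  have eq: "exp (l * (indicator {a<..b} x - ?p)) = exp (- l * ?p) * (1 + (exp l - 1) * indicator {a<..b} x)" for x
    by (auto split: split_indicator simp: algebra_simps simp flip: exp_add)
  have i: "integrable unit_lborel (indicator {a<..b} :: real \<Rightarrow> real)"
    using set by (intro integrable_unit_bounded[of _ 1]) (auto split: split_indicator)
  show "integrable unit_lborel (\<lambda>x. exp (l * (indicator {a<..b} x - ?p)))"
    unfolding eq using i by auto
  have m: "(LINT x|unit_lborel. indicator {a<..b} x) = ?p"
  proof -
    have "(LINT x|unit_lborel. indicator {a<..b} x) = measure unit_lborel {a<..b}"
      using ab by (subst Bochner_Integration.integral_indicator)
        (auto intro!: arg_cong2[where f=measure])
    also have "\<dots> = ?p" using ab by (subst measure_restrict_space) auto
    finally show ?thesis .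
  qed
  have "(LINT x|unit_lborel. exp (l * (indicator {a<..b} x - ?p))) = exp (- l * ?p) * (1 + (exp l - 1) * ?p)"
  proof -
    have "(LINT x|unit_lborel. 1 + (exp l - 1) * indicator {a<..b} x) = 1 + (exp l - 1) * ?p"
      using i by (subst Bochner_Integration.integral_add)
        (simp_all add: m unit_prob.prob_space[simplified] del: Bochner_Integration.integral_indicator)
    then show ?thesis unfolding eq by simp
  qed
  also have "\<dots> \<le> exp (- l * ?p) * exp ((exp l - 1) * ?p)"
    by (intro mult_left_mono) auto
  also have "\<dots> = exp (?p * (exp l - 1 - l))"
    by (simp add: algebra_simps flip: exp_add)
  also have "\<dots> \<le> exp (?p * l\<^sup>2)"
    using exp_le_quadratic[OF l] ab by (auto intro!: mult_left_mono)
  finally show "(LINT x|unit_lborel. exp (l * (indicator {a<..b} x - ?p))) \<le> exp (?p * l\<^sup>2)" .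
qed

text \<open>Chernoff's bound with the parameter \<open>l = 1 / \<surd>(n p)\<close>, for which the exponential moment is at most
\<open>e\<close>. The tail is only exponential, not Gaussian, but it scales with the standard deviation \<open>\<surd>p\<close> of the
increment and this is enough for the union bounds over dyadic points. The condition \<open>n p \<ge> 1\<close> keeps \<open>l\<close> in the range
where the exponential function is dominated by a quadratic polynomial.\<close>

lemma emp_process_increment_tail_one_sided:
  assumes ab: "0 \<le> a" "a < b" "b \<le> 1" and np: "1 \<le> real n * (b - a)" and \<sigma>: "\<sigma>\<^sup>2 = (1::real)"
  shows "measure (unif_law n) {X \<in> space (unif_law n). t \<le> \<sigma> * (emp_process n X b - emp_process n X a)}
    \<le> 3 * exp (- t / sqrt (b - a))"
proof -
  define l where "l = \<sigma> / sqrt (real n * (b - a))"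
  have n: "n > 0" using np by (cases n) auto
  have l2: "l\<^sup>2 = 1 / (real n * (b - a))" using \<sigma> np by (simp add: l_def power_divide)
  have "l\<^sup>2 \<le> 1" using np by (simp add: l2)
  then have l1: "\<bar>l\<bar> \<le> 1" by (simp add: abs_square_le_1)
  let ?e = "\<lambda>x. exp (l * (indicator {a<..b} x - (b - a)))"
  let ?E = "\<lambda>X. \<Prod>i<n. ?e (X i)"
  have int: "integrable unit_lborel ?e" "(LINT x|unit_lborel. ?e x) \<le> exp ((b - a) * l\<^sup>2)"
    using integral_exp_indicator[of a b l] ab l1 by auto
  have iE: "integrable (unif_law n) ?E"
    using int(1) by (intro unif_product.product_integrable_prod) auto
  have "(LINT X|unif_law n. ?E X) = (LINT x|unit_lborel. ?e x) ^ n"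
    using int(1) by (subst unif_product.product_integral_prod) auto
  also have "\<dots> \<le> exp ((b - a) * l\<^sup>2) ^ n"
    using int by (intro power_mono Bochner_Integration.integral_nonneg) auto
  also have "\<dots> = exp (real n * ((b - a) * l\<^sup>2))" by (simp add: exp_of_nat_mult)
  also have "\<dots> = exp 1" using n ab by (simp add: l2 field_simps)
  also have "\<dots> \<le> 3" by (rule exp_le)
  finally have E3: "(LINT X|unif_law n. ?E X) \<le> 3" .
  have E: "?E X = exp (\<sigma> * (emp_process n X b - emp_process n X a) / sqrt (b - a))" for X
  proof -
    have "?E X = exp (l * (\<Sum>i<n. indicator {a<..b} (X i) - (b - a)))"
      by (simp add: exp_sum sum_distrib_left)
    also have "(\<Sum>i<n. indicator {a<..b} (X i) - (b - a)) = sqrt (real n) * (emp_process n X b - emp_process n X a)"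
      using ab n by (subst emp_process_increment) auto
    finally have "?E X = exp (l * (sqrt (real n) * (emp_process n X b - emp_process n X a)))" .
    also have "l * (sqrt (real n) * D) = \<sigma> * D / sqrt (b - a)" for D
      using n unfolding l_def real_sqrt_mult by simp
    finally show ?thesis .
  qed
  have set: "{X \<in> space (unif_law n). t \<le> \<sigma> * (emp_process n X b - emp_process n X a)} =
     {X \<in> space (unif_law n). exp (t / sqrt (b - a)) \<le> ?E X}"
    unfolding E using ab by (simp add: divide_le_cancel)
  have "measure (unif_law n) {X \<in> space (unif_law n). exp (t / sqrt (b - a)) \<le> ?E X}
      \<le> (LINT X|unif_law n. ?E X) / exp (t / sqrt (b - a))"
  proof (rule integral_Markov_inequality_measure[OF iE sets.top])
    show "AE X in unif_law n. 0 \<le> ?E X" by (intro AE_I2 prod_nonneg) simp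
  qed simp
  also have "\<dots> \<le> 3 / exp (t / sqrt (b - a))"
    by (rule divide_right_mono[OF E3]) simp
  also have "\<dots> = 3 * exp (- t / sqrt (b - a))" by (simp add: exp_minus field_simps)
  finally show ?thesis unfolding set .
qed

lemma emp_process_increment_tail:
  assumes "0 \<le> a" "a < b" "b \<le> 1" and "1 \<le> real n * (b - a)"
  shows "measure (unif_law n) {X \<in> space (unif_law n). t < \<bar>emp_process n X b - emp_process n X a\<bar>}
    \<le> 6 * exp (- t / sqrt (b - a))"
proof -
  let ?A = "\<lambda>\<sigma>. {X \<in> space (unif_law n). t \<le> \<sigma> * (emp_process n X b - emp_process n X a)}"
  have "measure (unif_law n) {X \<in> space (unif_law n). t < \<bar>emp_process n X b - emp_process n X a\<bar>}
      \<le> measure (unif_law n) (?A 1 \<union> ?A (-1))"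
    by (intro unif_prob.finite_measure_mono) (auto simp: abs_real_def split: if_splits)
  also have "\<dots> \<le> measure (unif_law n) (?A 1) + measure (unif_law n) (?A (-1))"
    by (intro measure_Un_le) auto
  also have "\<dots> \<le> 3 * exp (- t / sqrt (b - a)) + 3 * exp (- t / sqrt (b - a))"
    using assms by (intro add_mono emp_process_increment_tail_one_sided) auto
  finally show ?thesis by simp
qed

text \<open>Passing from level \<open>l\<close> to level \<open>l + 1\<close>, the dyadic approximation from below of \<open>u\<close> either stays or moves to the
next grid point; hence at most one increment per level is used.\<close>

lemma dyadic_chaining:
  fixes W :: "real \<Rightarrow> real" and u :: real
  assumes inc: "\<And>l k. m \<le> l \<Longrightarrow> l \<le> L \<Longrightarrow> k < (2::nat) ^ l \<Longrightarrow>
      \<bar>W (real (Suc k) / 2 ^ l) - W (real k / 2 ^ l)\<bar> \<le> e l"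
    and u: "0 \<le> u" "u \<le> 1" and mL: "m \<le> L"
  shows "\<bar>W (real (nat \<lfloor>2 ^ L * u\<rfloor>) / 2 ^ L) - W (real (nat \<lfloor>2 ^ m * u\<rfloor>) / 2 ^ m)\<bar> \<le> (\<Sum>l=Suc m..L. e l)"
  using mL inc
proof (induction L rule: dec_induct)
  case base
  then show ?case by simp
next
  case (step L)
  define k where "k = nat \<lfloor>2 ^ L * u\<rfloor>"
  define k' where "k' = nat \<lfloor>2 ^ Suc L * u\<rfloor>"
  have k: "real k \<le> 2 ^ L * u" "2 ^ L * u < real k + 1"
    using u by (auto simp: k_def of_nat_nat)
  have k': "real k' \<le> 2 ^ Suc L * u" "2 ^ Suc L * u < real k' + 1"
    using u by (auto simp: k'_def of_nat_nat)
  have "2 * real k < real k' + 1" "real k' < 2 * real k + 2"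
    using k k' by (auto simp: field_simps)
  \<comment> \<open>The two floors differ by the next binary digit of \<open>u\<close>.\<close>
  then have cases: "k' = 2 * k \<or> k' = Suc (2 * k)" by linarith
  have eq: "real (2 * k) / 2 ^ Suc L = real k / 2 ^ L" by simp
  have "e (Suc L) \<ge> 0"
    using step.prems[of "Suc L" 0] step.hyps by force
  have "\<bar>W (real k' / 2 ^ Suc L) - W (real k / 2 ^ L)\<bar> \<le> e (Suc L)"
  proof (cases "k' = 2 * k")
    case True
    show ?thesis unfolding True eq using \<open>e (Suc L) \<ge> 0\<close> by simp
  next
    case False
    then have F: "k' = Suc (2 * k)" using cases by simp
    have "2 ^ Suc L * u \<le> 2 ^ Suc L" using u by (simp add: mult_left_le)
    then have "real k' \<le> 2 ^ Suc L" using k'(1) by (rule order.trans[rotated])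
    then have "real k' \<le> real (2 ^ Suc L)" by simp
    then have "2 * k < 2 ^ Suc L" using F by linarith
    then show ?thesis
      using step.prems[of "Suc L" "2 * k"] step.hyps by (simp only: F eq)
  qed
  moreover have "\<bar>W (real k / 2 ^ L) - W (real (nat \<lfloor>2 ^ m * u\<rfloor>) / 2 ^ m)\<bar> \<le> (\<Sum>l=Suc m..L. e l)"
    unfolding k_def using step.prems by (intro step.IH) auto
  moreover have "(\<Sum>l=Suc m..Suc L. e l) = (\<Sum>l=Suc m..L. e l) + e (Suc L)"
    using step.hyps by simp
  ultimately show ?case unfolding k'_def k_def by linarith
qed

text \<open>From the finest grid to \<open>u\<close> itself no more randomness is spent: the empirical distribution function
is monotone, so its value at \<open>u\<close> is enclosed by the values at the two neighbouring grid points, at the price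
of the deterministic term \<open>\<surd>n 2\<^bsup>-L\<^esup>\<close>.\<close>

lemma emp_process_near_grid:
  assumes inc: "\<And>l k. m \<le> l \<Longrightarrow> l \<le> L \<Longrightarrow> k < (2::nat) ^ l \<Longrightarrow>
      \<bar>emp_process n X (real (Suc k) / 2 ^ l) - emp_process n X (real k / 2 ^ l)\<bar> \<le> e l"
    and u: "0 \<le> u" "u \<le> 1" and mL: "m \<le> L"
  shows "\<bar>emp_process n X u - emp_process n X (real (nat \<lfloor>2 ^ m * u\<rfloor>) / 2 ^ m)\<bar>
     \<le> (\<Sum>l=Suc m..L. e l) + e L + sqrt (real n) / 2 ^ L"
proof -
  define k where "k = nat \<lfloor>2 ^ L * u\<rfloor>"
  have k: "real k \<le> 2 ^ L * u" "2 ^ L * u < real k + 1"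
    using u by (auto simp: k_def of_nat_nat)
  have e0: "e L \<ge> 0" using inc[of L 0] mL by force
  have "\<bar>emp_process n X u - emp_process n X (real k / 2 ^ L)\<bar> \<le> e L + sqrt (real n) / 2 ^ L"
  proof (cases "u = real k / 2 ^ L")
    case True
    then show ?thesis using e0 by simp
  next
    case False
    let ?a = "real k / 2 ^ L" and ?b = "real (Suc k) / 2 ^ L"
    have au: "?a < u" and ub: "u < ?b" using k False by (auto simp: field_simps)
    have "real k < real (2 ^ L)"
    proof -
      have "real k < 2 ^ L * u" using au by (simp add: field_simps)
      also have "\<dots> \<le> 2 ^ L" using u by (simp add: mult_left_le)
      finally show ?thesis by simp
    qed
    then have "k < 2 ^ L" by linarith
    then have i: "\<bar>emp_process n X ?b - emp_process n X ?a\<bar> \<le> e L" using inc[of L k] mL by simp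
    have ba: "?b - ?a = 1 / 2 ^ L" by (simp add: field_simps)
    have "empirical_cdf n X ?a \<le> empirical_cdf n X u" "empirical_cdf n X u \<le> empirical_cdf n X ?b"
      using au ub by (auto intro!: empirical_cdf_mono)
    then have m: "sqrt (real n) * empirical_cdf n X ?a \<le> sqrt (real n) * empirical_cdf n X u"
         "sqrt (real n) * empirical_cdf n X u \<le> sqrt (real n) * empirical_cdf n X ?b"
      by (auto intro!: mult_left_mono)
    have s: "sqrt (real n) * (u - ?a) \<le> sqrt (real n) * (1 / 2 ^ L)" "sqrt (real n) * (?b - u) \<le> sqrt (real n) * (1 / 2 ^ L)"
      by (intro mult_left_mono, use au ub ba in linarith, simp)+
    have "0 \<le> sqrt (real n) * (u - ?a)" "0 \<le> sqrt (real n) * (?b - u)" using au ub by auto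
    with m s i e0 show ?thesis
      unfolding emp_process_def by (simp add: right_diff_distrib abs_le_iff)
  qed
  moreover have "\<bar>emp_process n X (real k / 2 ^ L) - emp_process n X (real (nat \<lfloor>2 ^ m * u\<rfloor>) / 2 ^ m)\<bar>
     \<le> (\<Sum>l=Suc m..L. e l)"
    unfolding k_def by (rule dyadic_chaining[OF inc u mL])
  ultimately show ?thesis by linarith
qed

text \<open>The rate \<open>(9/10)\<^sup>l\<close> for the increments of level \<open>l\<close> is summable, with tail \<open>9 (9/10)\<^sup>m\<close> beyond level
\<open>m\<close>. Each of the two points costs at most \<open>10 (9/10)\<^sup>m\<close> (the tail plus the last level), and their
approximations on level \<open>m\<close> are equal or neighbours. The finest level \<open>L\<close> is the one with \<open>2\<^sup>L\<close> of order \<open>n\<close>.\<close>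

lemma emp_process_oscillation:
  assumes inc: "\<And>l k. m \<le> l \<Longrightarrow> l \<le> L \<Longrightarrow> k < (2::nat) ^ l \<Longrightarrow>
      \<bar>emp_process n X (real (Suc k) / 2 ^ l) - emp_process n X (real k / 2 ^ l)\<bar> \<le> (9/10) ^ l"
    and uv: "u \<in> {0..1}" "v \<in> {0..1}" "\<bar>u - v\<bar> \<le> 1 / 2 ^ m" and mL: "m \<le> L" 
    and n: "real n < 2 ^ Suc L" "n > 0"
  shows "\<bar>emp_process n X u - emp_process n X v\<bar> \<le> 21 * (9/10) ^ m + 4 / sqrt (real n)"
proof -
  let ?e = "\<lambda>l::nat. (9/10::real) ^ l"
  let ?d = "\<lambda>u. real (nat \<lfloor>2 ^ m * u\<rfloor>) / 2 ^ m"
  have sum: "(\<Sum>l=Suc m..L. ?e l) + 9 * ?e L \<le> 9 * ?e m"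
    using mL by (induction L rule: dec_induct) auto
  have "sqrt (real n) * sqrt (real n) \<le> 2 * 2 ^ L" using n by simp
  then have sq: "sqrt (real n) / 2 ^ L \<le> 2 / sqrt (real n)"
    using n by (simp add: divide_le_eq pos_le_divide_eq mult.commute)
  have near: "\<bar>emp_process n X u - emp_process n X (?d u)\<bar> \<le> 10 * ?e m + 2 / sqrt (real n)"
    if "u \<in> {0..1}" for u
  proof -
    have "?e L \<le> ?e m" using mL by (intro power_decreasing) auto
    moreover have "\<bar>emp_process n X u - emp_process n X (?d u)\<bar>
        \<le> (\<Sum>l=Suc m..L. ?e l) + ?e L + sqrt (real n) / 2 ^ L"
      using that mL by (intro emp_process_near_grid[where e = ?e] inc) auto
    moreover have "0 \<le> ?e L" by simp
    ultimately show ?thesis using sum sq by linarith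
  qed
  have mid: "\<bar>emp_process n X (?d u) - emp_process n X (?d v)\<bar> \<le> ?e m"
    if uv: "u \<in> {0..1}" "v \<in> {0..1}" "v \<le> u" "u - v \<le> 1 / 2 ^ m" for u v :: real
  proof -
    define a b where "a = nat \<lfloor>2 ^ m * v\<rfloor>" and "b = nat \<lfloor>2 ^ m * u\<rfloor>"
    have a: "real a \<le> 2 ^ m * v" "2 ^ m * v < real a + 1" and b: "real b \<le> 2 ^ m * u" "2 ^ m * u < real b + 1"
      using uv by (auto simp: a_def b_def of_nat_nat)
    have "2 ^ m * u \<le> 2 ^ m * v + 1" using uv by (simp add: field_simps)
    moreover have "2 ^ m * v \<le> 2 ^ m * u" using uv by simp
    ultimately have "b = a \<or> b = Suc a" using a b by linarith
    then show ?thesis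
    proof
      assume "b = Suc a"
      have "2 ^ m * u \<le> 2 ^ m" using uv by (simp add: mult_left_le)
      then have "real b \<le> 2 ^ m" using b(1) by (rule order.trans[rotated])
      then have "real b \<le> real (2 ^ m)" by simp
      then have "a < 2 ^ m" using \<open>b = Suc a\<close> by linarith
      then show ?thesis using inc[of m a] mL \<open>b = Suc a\<close> by (simp add: a_def b_def)
    qed (simp add: a_def b_def)
  qed
  have "\<bar>emp_process n X (?d u) - emp_process n X (?d v)\<bar> \<le> ?e m"
    using mid[of u v] mid[of v u] uv by (cases "v \<le> u") (auto simp: abs_minus_commute)
  with near[OF uv(1)] near[OF uv(2)] show ?thesis by linarith
qed

text \<open>Increments of level \<open>l\<close> have standard deviation about \<open>2\<^bsup>-l/2\<^esup>\<close>. They exceed \<open>(9/10)\<^sup>l\<close> with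
probability at most \<open>6 exp (- (5/4)\<^sup>l)\<close>, because \<open>(9/10) \<surd>2 \<ge> 5/4\<close>, and this beats the number \<open>2\<^sup>l\<close> of increments
of that level.\<close>

theorem emp_process_equicontinuous:
  assumes "0 < \<epsilon>" "0 < \<eta>"
  shows "\<exists>\<delta>>0. \<exists>n\<^sub>0. \<forall>n\<ge>n\<^sub>0. \<exists>G\<in>sets (unif_law n). 1 - \<eta> \<le> measure (unif_law n) G \<and>
    (\<forall>X\<in>G. \<forall>u\<in>{0..1}. \<forall>v\<in>{0..1}. \<bar>u - v\<bar> \<le> \<delta> \<longrightarrow> \<bar>emp_process n X u - emp_process n X v\<bar> \<le> \<epsilon>)"
proof -
  define g where "g l = 2 ^ l * (6 * exp (- ((5/4::real) ^ l)))" for l :: nat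
  have "summable g"
  proof (rule summable_comparison_test')
    \<comment> \<open>With \<open>y = (5/4)\<^sup>l\<close> one has \<open>2\<^sup>l \<le> y\<^sup>7\<close>, as \<open>(5/4)\<^sup>7 > 2\<close>, and \<open>exp y \<ge> (y/8)\<^sup>8\<close>, so the terms are at most a multiple of \<open>1/y\<close>.\<close>
    show "summable (\<lambda>l. 6 * 8 ^ 8 * (4/5::real) ^ l)"
      by (intro summable_mult summable_geometric) simp
    fix l :: nat
    define y where "y = (5/4::real) ^ l"
    have y: "0 < y" by (simp add: y_def)
    have "(2::real) ^ l \<le> ((5/4) ^ 7) ^ l" by (intro power_mono) (auto simp: eval_nat_numeral)
    then have 2: "2 ^ l \<le> y ^ 7" by (simp add: y_def mult.commute flip: power_mult)
    have "(y / 8) ^ 8 \<le> (1 + y / 8) ^ 8" using y by (intro power_mono) auto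
    also have "\<dots> \<le> exp y"
      using exp_ge_one_plus_x_over_n_power_n[of 8 y] y by simp
    finally have "y ^ 8 \<le> 8 ^ 8 * exp y" by (simp add: power_divide)
    then have "exp (- y) \<le> 8 ^ 8 / y ^ 8" using y by (simp add: exp_minus field_simps)
    then have "2 ^ l * exp (- y) \<le> y ^ 7 * (8 ^ 8 / y ^ 8)" using 2 y by (intro mult_mono) auto
    also have "\<dots> = 8 ^ 8 * (4/5) ^ l" using y by (simp add: y_def power_divide eval_nat_numeral field_simps)
    finally show "norm (g l) \<le> 6 * 8 ^ 8 * (4/5) ^ l" by (simp add: g_def y_def)
  qed
  have g0: "0 \<le> g l" for l by (simp add: g_def)
  obtain m1 where m1: "\<And>L m. m1 \<le> m \<Longrightarrow> (\<Sum>l=m..L. g l) < \<eta>"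
  proof -
    obtain N where N: "\<And>a b. N \<le> a \<Longrightarrow> norm (sum g {a..<b}) < \<eta>"
      using \<open>summable g\<close> \<open>0 < \<eta>\<close> unfolding summable_Cauchy by blast
    show ?thesis
    proof (rule that[of N])
      fix L m assume "N \<le> m"
      then have "norm (sum g {m..<Suc L}) < \<eta>" by (rule N)
      then show "(\<Sum>l=m..L. g l) < \<eta>" by (simp add: atLeastLessThanSuc_atLeastAtMost)
    qed
  qed
  have "(\<lambda>m. 21 * (9/10::real) ^ m) \<longlonglongrightarrow> 21 * 0"
    by (intro tendsto_mult tendsto_const LIMSEQ_realpow_zero) auto
  moreover have "21 * 0 < \<epsilon> / 2" using \<open>0 < \<epsilon>\<close> by simp
  ultimately have "\<forall>\<^sub>F m in sequentially. 21 * (9/10::real) ^ m < \<epsilon> / 2"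
    by (rule order_tendstoD(2))
  then obtain m2 where m2: "\<And>m. m2 \<le> m \<Longrightarrow> 21 * (9/10::real) ^ m < \<epsilon> / 2"
    by (auto simp: eventually_sequentially)
  define m where "m = max m1 m2"
  \<comment> \<open>The first bound makes level \<open>m\<close> coarser than the finest level \<open>L\<close>, the second makes \<open>4 / \<surd>n\<close> at most \<open>\<epsilon>/2\<close>.\<close>
  define n0 where "n0 = max (2 ^ m) (nat \<lceil>64 / \<epsilon>\<^sup>2\<rceil>)"
  show ?thesis
  proof (intro exI[of _ "1 / 2 ^ m"] conjI exI[of _ n0] allI impI)
    show "0 < 1 / (2::real) ^ m" by simp
    fix n assume "n0 \<le> n"
    then have n: "2 ^ m \<le> n" "64 / \<epsilon>\<^sup>2 \<le> real n"
      by (auto simp: n0_def nat_le_iff ceiling_le_iff)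
    have "n > 0" using n(1) by (metis gr0I not_numeral_le_zero power_eq_0_iff le_zero_eq zero_neq_numeral)
    have "4 / sqrt (real n) \<le> \<epsilon> / 2"
    proof -
      have "(8 / \<epsilon>)\<^sup>2 \<le> real n" using n(2) by (simp add: power_divide)
      then have "8 / \<epsilon> \<le> sqrt (real n)" by (rule real_le_rsqrt)
      then show ?thesis using \<open>n > 0\<close> \<open>0 < \<epsilon>\<close> by (simp add: field_simps)
    qed
    obtain L where L: "2 ^ L \<le> n" "n < 2 ^ Suc L"
      using ex_power_ivl1[of 2 n] \<open>n > 0\<close> by auto
    have mL: "m \<le> L"
    proof -
      have "(2::nat) ^ m < 2 ^ Suc L" using n(1) L(2) by simp
      then have "m < Suc L" by (rule power_less_imp_less_exp[rotated]) simp
      then show ?thesis by simp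
    qed
    let ?B = "\<lambda>l k. {X \<in> space (unif_law n). (9/10) ^ l <
        \<bar>emp_process n X (real (Suc k) / 2 ^ l) - emp_process n X (real k / 2 ^ l)\<bar>}"
    \<comment> \<open>The bad event: some dyadic increment of the levels from \<open>m\<close> to \<open>L\<close> is too large.\<close>
    define B where "B = (\<Union>l\<in>{m..L}. \<Union>k\<in>{..<2 ^ l}. ?B l k)"
    have Bset: "B \<in> sets (unif_law n)" unfolding B_def by measurable
    have tail: "measure (unif_law n) (?B l k) \<le> 6 * exp (- ((5/4) ^ l))" if "l \<in> {m..L}" "k < 2 ^ l" for l k
    proof -
      have kl: "real (Suc k) \<le> 2 ^ l" using that(2) by (metis Suc_leI of_nat_le_iff of_nat_numeral of_nat_power)
      have "(2::nat) ^ l \<le> 2 ^ L" using that(1) by (intro power_increasing) auto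
      also note L(1)
      finally have "(2::nat) ^ l \<le> n" .
      then have nl: "(2::real) ^ l \<le> real n" by (metis of_nat_le_iff of_nat_numeral of_nat_power)
      have d: "real (Suc k) / 2 ^ l - real k / 2 ^ l = 1 / 2 ^ l" by (simp add: field_simps)
      have sq: "(9/10) ^ l / sqrt (real (Suc k) / 2 ^ l - real k / 2 ^ l) = ((9/10) * sqrt 2) ^ l"
        unfolding d power_mult_distrib by (simp add: real_sqrt_divide real_sqrt_power)
      have "measure (unif_law n) (?B l k) \<le> 6 * exp (- ((9/10) ^ l) / sqrt (real (Suc k) / 2 ^ l - real k / 2 ^ l))"
        by (rule emp_process_increment_tail) (use kl nl in \<open>auto simp: d divide_right_mono field_simps\<close>)
      also have "\<dots> = 6 * exp (- (((9/10) * sqrt 2) ^ l))"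
        by (simp only: sq minus_divide_left[symmetric])
      also have "\<dots> \<le> 6 * exp (- ((5/4) ^ l))"
      proof -
        have "25/18 \<le> sqrt 2" by (rule real_le_rsqrt) (simp add: power_divide)
        then have "(5/4::real) ^ l \<le> ((9/10) * sqrt 2) ^ l" by (intro power_mono) auto
        then show ?thesis by simp
      qed
      finally show ?thesis .
    qed
    have "measure (unif_law n) B \<le> (\<Sum>l\<in>{m..L}. measure (unif_law n) (\<Union>k\<in>{..<2 ^ l}. ?B l k))"
      unfolding B_def by (rule unif_prob.finite_measure_subadditive_finite) auto
    also have "\<dots> \<le> (\<Sum>l\<in>{m..L}. g l)"
    proof (rule sum_mono)
      fix l assume l: "l \<in> {m..L}"
      have "measure (unif_law n) (\<Union>k\<in>{..<2 ^ l}. ?B l k) \<le> (\<Sum>k\<in>{..<2 ^ l}. measure (unif_law n) (?B l k))"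
        by (rule unif_prob.finite_measure_subadditive_finite) auto
      also have "\<dots> \<le> (\<Sum>k\<in>{..<(2::nat) ^ l}. 6 * exp (- ((5/4) ^ l)))"
        using l by (intro sum_mono tail) auto
      also have "\<dots> = g l" by (simp add: g_def)
      finally show "measure (unif_law n) (\<Union>k\<in>{..<2 ^ l}. ?B l k) \<le> g l" .
    qed
    also have "\<dots> < \<eta>" by (rule m1) (simp add: m_def)
    finally have B: "measure (unif_law n) B < \<eta>" .
    show "\<exists>G\<in>sets (unif_law n). 1 - \<eta> \<le> measure (unif_law n) G \<and>
      (\<forall>X\<in>G. \<forall>u\<in>{0..1}. \<forall>v\<in>{0..1}. \<bar>u - v\<bar> \<le> 1 / 2 ^ m \<longrightarrow> \<bar>emp_process n X u - emp_process n X v\<bar> \<le> \<epsilon>)"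
    proof (intro bexI[of _ "space (unif_law n) - B"] conjI ballI impI)
      show "1 - \<eta> \<le> measure (unif_law n) (space (unif_law n) - B)"
        using B Bset by (simp add: unif_prob.prob_compl)
      show "space (unif_law n) - B \<in> sets (unif_law n)" using Bset by auto
      fix X u v assume X: "X \<in> space (unif_law n) - B" and uv: "u \<in> {0..1}" "v \<in> {0..1::real}" "\<bar>u - v\<bar> \<le> 1 / 2 ^ m"
      have "\<bar>emp_process n X (real (Suc k) / 2 ^ l) - emp_process n X (real k / 2 ^ l)\<bar> \<le> (9/10) ^ l"
        if "m \<le> l" "l \<le> L" "k < (2::nat) ^ l" for l k
        using X that by (auto simp: B_def not_less)
      then have "\<bar>emp_process n X u - emp_process n X v\<bar> \<le> 21 * (9/10) ^ m + 4 / sqrt (real n)"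
        using uv mL L(2) \<open>n > 0\<close> 
        by (intro emp_process_oscillation[of m L]) (auto, metis of_nat_less_iff of_nat_numeral of_nat_power power_Suc)
      also have "\<dots> \<le> \<epsilon>" using m2[of m] \<open>4 / sqrt (real n) \<le> \<epsilon> / 2\<close> by (simp add: m_def)
      finally show "\<bar>emp_process n X u - emp_process n X v\<bar> \<le> \<epsilon>" .
    qed
  qed
qed

section \<open>Regular samples and tilted samples\<close>

lemma sqrt_T_le_iff:
  assumes "n > 0"
  shows "sqrt (real n) * kolmogorov_T (empirical_cdf n X) \<le> t \<longleftrightarrow>
    (\<forall>x\<in>{0..1}. \<bar>emp_process n X x\<bar> \<le> t)"
proof -
  have "sqrt (real n) * kolmogorov_T (empirical_cdf n X) \<le> t \<longleftrightarrow>
      kolmogorov_T (empirical_cdf n X) \<le> t / sqrt (real n)"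
    using assms by (simp add: field_simps)
  also have "\<dots> \<longleftrightarrow> (\<forall>x\<in>{0..1}. \<bar>empirical_cdf n X x - x\<bar> \<le> t / sqrt (real n))"
    by (rule empirical_T_le_iff)
  also have "\<dots> \<longleftrightarrow> (\<forall>x\<in>{0..1}. \<bar>emp_process n X x\<bar> \<le> t)"
  proof -
    have "\<bar>emp_process n X x\<bar> = \<bar>empirical_cdf n X x - x\<bar> * sqrt (real n)" for x
      by (simp add: emp_process_def abs_mult mult.commute)
    then show ?thesis using assms by (simp add: pos_le_divide_eq)
  qed
  finally show ?thesis .
qed

lemma emp_process_zero_AE: "AE X in unif_law n. emp_process n X 0 = 0"
proof -
  have "AE X in unif_law n. X i \<noteq> 0" if "i < n" for i
  proof (rule AE_PiM_component)
    show "AE x in unit_lborel. x \<noteq> 0"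
      using AE_lborel_singleton[of "0::real"] by (auto simp: AE_restrict_space_iff)
  qed (use that prob_unit in auto)
  then have "AE X in unif_law n. \<forall>i\<in>{..<n}. X i \<noteq> 0"
    by (intro AE_finite_allI) auto
  then show ?thesis
  proof (rule AE_mp, intro AE_I2 impI)
    fix X assume "X \<in> space (unif_law n)" "\<forall>i\<in>{..<n}. X i \<noteq> 0"
    then have "{i. i < n \<and> X i \<le> 0} = {}"
      by (force simp: space_unif PiE_def Pi_def)
    then show "emp_process n X 0 = 0"
      by (simp add: emp_process_def empirical_cdf_def)
  qed
qed

text \<open>Regular samples are the ones on which pathwise arguments work: small oscillation on the scale \<open>\<delta>\<close>, and
no point at the left end, which excludes a null event on which \<open>W(0) \<noteq> 0\<close>.\<close>

definition regular_sample :: "nat \<Rightarrow> real \<Rightarrow> real \<Rightarrow> (nat \<Rightarrow> real) \<Rightarrow> bool" where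
  "regular_sample n \<epsilon> \<delta> X \<longleftrightarrow> X \<in> space (unif_law n) \<and> emp_process n X 0 = 0 \<and>
    (\<forall>u\<in>{0..1}. \<forall>v\<in>{0..1}. \<bar>u - v\<bar> \<le> \<delta> \<longrightarrow> \<bar>emp_process n X u - emp_process n X v\<bar> \<le> \<epsilon>)"

lemma regular_sampleD:
  assumes "regular_sample n \<epsilon> \<delta> X"
  shows "X \<in> space (unif_law n)" "emp_process n X 0 = 0"
    "u \<in> {0..1} \<Longrightarrow> v \<in> {0..1} \<Longrightarrow> \<bar>u - v\<bar> \<le> \<delta> \<Longrightarrow> \<bar>emp_process n X u - emp_process n X v\<bar> \<le> \<epsilon>"
  using assms by (auto simp: regular_sample_def)

lemma regular_samples:
  assumes "0 < \<epsilon>" "0 < \<eta>"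
  shows "\<exists>\<delta>>0. \<exists>n\<^sub>0. \<forall>n\<ge>n\<^sub>0. \<exists>G\<in>sets (unif_law n). 1 - \<eta> \<le> measure (unif_law n) G \<and>
    (\<forall>X\<in>G. regular_sample n \<epsilon> \<delta> X)"
proof -
  obtain \<delta> n\<^sub>0 where \<delta>: "0 < \<delta>" and *: "\<And>n. n\<^sub>0 \<le> n \<Longrightarrow> \<exists>G\<in>sets (unif_law n). 1 - \<eta> \<le> measure (unif_law n) G \<and>
    (\<forall>X\<in>G. \<forall>u\<in>{0..1}. \<forall>v\<in>{0..1}. \<bar>u - v\<bar> \<le> \<delta> \<longrightarrow> \<bar>emp_process n X u - emp_process n X v\<bar> \<le> \<epsilon>)"
    using emp_process_equicontinuous[OF assms] by blast
  have "\<exists>G\<in>sets (unif_law n). 1 - \<eta> \<le> measure (unif_law n) G \<and> (\<forall>X\<in>G. regular_sample n \<epsilon> \<delta> X)"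
    if n: "n\<^sub>0 \<le> n" for n
  proof -
    obtain G where G: "G \<in> sets (unif_law n)" "1 - \<eta> \<le> measure (unif_law n) G"
      "\<And>X u v. X \<in> G \<Longrightarrow> u \<in> {0..1} \<Longrightarrow> v \<in> {0..1} \<Longrightarrow> \<bar>u - v\<bar> \<le> \<delta> \<Longrightarrow>
         \<bar>emp_process n X u - emp_process n X v\<bar> \<le> \<epsilon>"
      using *[OF n] by blast
    let ?Z = "{X \<in> space (unif_law n). emp_process n X 0 = 0}"
    have Z: "?Z \<in> sets (unif_law n)" by measurable
    have "measure (unif_law n) (G \<inter> ?Z) = measure (unif_law n) G"
      using emp_process_zero_AE[of n] G(1) Z
      by (intro unif_prob.finite_measure_eq_AE) (auto elim: eventually_mono)
    then show ?thesis
      using G Z sets.sets_into_space[OF G(1)]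
      by (intro bexI[of _ "G \<inter> ?Z"]) (auto simp: regular_sample_def)
  qed
  then show ?thesis using \<delta> by blast
qed

text \<open>The derivative of \<open>c\<close> times the tent \<open>min x (1 - x)\<close>. Sampling from \<open>1 + tent_tilt c\<close> lifts the whole path of
the empirical process, except for its fixed ends, by \<open>\<surd>n c\<close> times the tent, up to a small shift of its
argument.\<close>

definition tent_tilt :: "real \<Rightarrow> real \<Rightarrow> real" where
  "tent_tilt c x = (if x \<le> 1/2 then c else - c)"

lemma tent_tilt_measurable: "tent_tilt c \<in> borel_measurable unit_lborel"
  by (rule unit_borel_measurable) (simp add: tent_tilt_def[abs_def])

lemma tent_tilt_square: "(LINT x|unit_lborel. (tent_tilt c x)\<^sup>2) = c\<^sup>2"
proof -
  have "(\<lambda>x. (tent_tilt c x)\<^sup>2) = (\<lambda>_. c\<^sup>2)" by (auto simp: tent_tilt_def)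
  then show ?thesis by (simp add: unit_prob.prob_space[simplified])
qed

lemma tent_tilt_integral:
  assumes "x \<in> {0..1}"
  shows "(LBINT t:{0..x}. tent_tilt c t) = c * min x (1 - x)"
proof -
  have eq: "indicator {0..x} t *\<^sub>R tent_tilt c t = 
      2 * c * indicator {0..min x (1/2)} t - c * indicator {0..x} t" for t
    by (auto simp: tent_tilt_def split: split_indicator)
  have "(LBINT t:{0..x}. tent_tilt c t) = 2 * c * min x (1/2) - c * x"
    unfolding set_lebesgue_integral_def eq using assms
    by (subst Bochner_Integration.integral_diff) auto
  then show ?thesis by (auto simp: min_def algebra_simps split: if_splits)
qed

lemma drift_cdf_tent_tilt:
  assumes "x \<in> {0..1}"
  shows "drift_cdf (tent_tilt c) x = x + c * min x (1 - x)"
  using tent_tilt_integral[OF assms] by (simp add: drift_cdf_def)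

lemma tent_tilt_mean: "(LINT x|unit_lborel. tent_tilt c x) = 0"
  using tent_tilt_integral[of 1 c] by (simp add: set_integral_unit)

lemma tent_tilt_bound: "\<bar>tent_tilt c x\<bar> = \<bar>c\<bar>"
  by (simp add: tent_tilt_def)

definition couple :: "nat \<Rightarrow> (real \<Rightarrow> real) \<Rightarrow> (nat \<Rightarrow> real) \<Rightarrow> (nat \<Rightarrow> real)" where
  "couple n f = compose {..<n} (quantile (drift_cdf f))"

text \<open>The central identity: the process of the coupled sample is \<open>W \<circ> F\<close> plus the drift.\<close>

lemma emp_process_couple:
  assumes "is_density (\<lambda>x. 1 + f x)" "U \<in> space (unif_law n)" "x \<in> {0..1}"
  shows "emp_process n (couple n f U) x =
    emp_process n U (drift_cdf f x) + sqrt (real n) * (drift_cdf f x - x)"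
  unfolding couple_def emp_process_def using empirical_cdf_quantile[OF assms] by (simp add: algebra_simps)

lemma measure_sample_law_couple:
  assumes "is_density (\<lambda>x. 1 + f x)" "A \<in> sets (unif_law n)"
  shows "measure (sample_law n f) A = measure (unif_law n) {U \<in> space (unif_law n). couple n f U \<in> A}"
    and "{U \<in> space (unif_law n). couple n f U \<in> A} \<in> sets (unif_law n)"
proof -
  show "measure (sample_law n f) A = measure (unif_law n) {U \<in> space (unif_law n). couple n f U \<in> A}"
    unfolding couple_def by (rule measure_sample_law[OF assms])
  have "couple n f \<in> measurable (unif_law n) (unif_law n)"
    unfolding couple_def by (rule compose_quantile_measurable[OF assms(1)])
  from measurable_sets[OF this assms(2)]
  show "{U \<in> space (unif_law n). couple n f U \<in> A} \<in> sets (unif_law n)"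
    by (simp add: vimage_def Int_def conj_commute)
qed

section \<open>Anticoncentration of the Kolmogorov statistic\<close>

text \<open>Why tilting yields anticoncentration. The tilts of sizes \<open>i h / \<surd>n\<close>, \<open>i < K\<close>, change the probability
of \<open>A\<close> by at most \<open>\<surd>(exp ((K h)\<^sup>2) - 1)\<close>, which is small when \<open>K h\<close> is. If no regular sample enters \<open>A\<close>
under two different tilts, the \<open>K\<close> preimages of \<open>A\<close> are disjoint up to an event of small probability,
so \<open>K\<close> times the probability of \<open>A\<close> is essentially at most one.\<close>

lemma measure_le_of_disjoint_tilts:
  assumes K: "0 < K" and n: "0 < n" and h: "0 \<le> h" "real K * h \<le> sqrt (real n)" and \<sigma>: "\<bar>\<sigma>\<bar> = 1"
    and A: "A \<in> sets (unif_law n)" and G: "G \<in> sets (unif_law n)"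
    and disj: "\<And>i j U. i < j \<Longrightarrow> j < K \<Longrightarrow> U \<in> G \<Longrightarrow>
      couple n (tent_tilt (\<sigma> * real i * h / sqrt (real n))) U \<in> A \<Longrightarrow>
      couple n (tent_tilt (\<sigma> * real j * h / sqrt (real n))) U \<notin> A"
  shows "measure (unif_law n) A \<le>
    1 / real K + sqrt (exp ((real K * h)\<^sup>2) - 1) + (1 - measure (unif_law n) G)"
proof -
  define c where "c i = \<sigma> * real i * h / sqrt (real n)" for i :: nat
  define B where "B i = {U \<in> space (unif_law n). couple n (tent_tilt (c i)) U \<in> A}" for i
  define r where "r = sqrt (exp ((real K * h)\<^sup>2) - 1)"
  have c1: "\<bar>c i\<bar> \<le> 1" and c2: "real n * (c i)\<^sup>2 \<le> (real K * h)\<^sup>2" if "i < K" for i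
  proof -
    have "real i * h \<le> real K * h" using that h by (intro mult_right_mono) auto
    then have ih: "0 \<le> real i * h" "real i * h \<le> real K * h" using h by auto
    then show "\<bar>c i\<bar> \<le> 1" using h n \<sigma> by (simp add: c_def abs_mult divide_le_eq)
    have "\<sigma>\<^sup>2 = 1" using \<sigma> by (metis one_power2 power2_abs)
    then have "real n * (c i)\<^sup>2 = (real i * h)\<^sup>2"
      using n by (simp add: c_def power_divide power_mult_distrib)
    then show "real n * (c i)\<^sup>2 \<le> (real K * h)\<^sup>2" using ih by (simp add: power_mono)
  qed
  have dens: "is_density (\<lambda>x. 1 + tent_tilt (c i) x)" if "i < K" for i
    using c1[OF that] by (intro is_density_perturbation) (auto simp: tent_tilt_measurable tent_tilt_mean tent_tilt_bound)
  have B: "B i \<in> sets (unif_law n)" "measure (unif_law n) (B i) \<ge> measure (unif_law n) A - r" if "i < K" for i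
  proof -
    show "B i \<in> sets (unif_law n)"
      unfolding B_def by (rule measure_sample_law_couple(2)[OF dens[OF that] A])
    have "measure (sample_law n (tent_tilt (c i))) A = measure (unif_law n) (B i)"
      unfolding B_def by (rule measure_sample_law_couple(1)[OF dens[OF that] A])
    moreover have "\<bar>measure (sample_law n (tent_tilt (c i))) A - measure (unif_law n) A\<bar> \<le>
       sqrt (exp (real n * (LINT x|unit_lborel. (tent_tilt (c i) x)\<^sup>2)) - 1)"
      using c1[OF that] A
      by (intro sample_law_diff_le) (auto simp: tent_tilt_measurable tent_tilt_mean tent_tilt_bound)
    moreover have "sqrt (exp (real n * (LINT x|unit_lborel. (tent_tilt (c i) x)\<^sup>2)) - 1) \<le> r"
      using c2[OF that] by (simp add: tent_tilt_square r_def)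
    ultimately show "measure (unif_law n) (B i) \<ge> measure (unif_law n) A - r" by linarith
  qed
  have BG: "measure (unif_law n) A - r - (1 - measure (unif_law n) G) \<le> measure (unif_law n) (B i \<inter> G)"
    if "i < K" for i
  proof -
    have "measure (unif_law n) (B i) \<le> measure (unif_law n) ((B i \<inter> G) \<union> (space (unif_law n) - G))"
      using B[OF that] G by (intro unif_prob.finite_measure_mono) (auto simp: B_def)
    also have "\<dots> \<le> measure (unif_law n) (B i \<inter> G) + measure (unif_law n) (space (unif_law n) - G)"
      using B[OF that] G by (intro measure_Un_le) auto
    finally show ?thesis using B(2)[OF that] G by (simp add: unif_prob.prob_compl)
  qed
  have "real K * (measure (unif_law n) A - r - (1 - measure (unif_law n) G)) =
      (\<Sum>i<K. measure (unif_law n) A - r - (1 - measure (unif_law n) G))"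
    by simp
  also have "\<dots> \<le> (\<Sum>i<K. measure (unif_law n) (B i \<inter> G))"
    using BG by (intro sum_mono) auto
  also have "\<dots> = measure (unif_law n) (\<Union>i<K. B i \<inter> G)"
  proof (rule unif_prob.finite_measure_finite_Union[symmetric])
    show "disjoint_family_on (\<lambda>i. B i \<inter> G) {..<K}"
      unfolding disjoint_family_on_def
    proof (intro ballI impI)
      fix i j assume ij: "i \<in> {..<K}" "j \<in> {..<K}" "i \<noteq> j"
      have "\<not> (U \<in> B i \<and> U \<in> B j)" if "U \<in> G" for U
        using disj[of i j U] disj[of j i U] ij that by (cases "i < j") (auto simp: B_def c_def)
      then show "B i \<inter> G \<inter> (B j \<inter> G) = {}" by auto
    qed
  qed (use B(1) G in auto)
  also have "\<dots> \<le> 1" by (rule unif_prob.prob_le_1)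
  finally have "real K * (measure (unif_law n) A - r - (1 - measure (unif_law n) G)) \<le> 1" .
  then have "measure (unif_law n) A - r - (1 - measure (unif_law n) G) \<le> 1 / real K"
    using K by (simp add: pos_le_divide_eq mult.commute)
  then show ?thesis by (simp add: r_def)
qed

lemma ex_inverse_le: "0 < (\<eta>::real) \<Longrightarrow> \<exists>K>0. 1 / real K \<le> \<eta>"
  using reals_Archimedean[of \<eta>]
  by (metis inverse_eq_divide less_imp_le zero_less_Suc)

lemma small_tilt:
  assumes "0 < \<eta>"
  shows "\<exists>h>0. \<forall>x. 0 \<le> x \<longrightarrow> x \<le> h \<longrightarrow> sqrt (exp (x\<^sup>2) - 1) \<le> (\<eta>::real)"
proof -
  define h where "h = sqrt (ln (1 + \<eta>\<^sup>2))"
  have p: "0 < ln (1 + \<eta>\<^sup>2)" using assms by (simp add: ln_gt_zero)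
  have "sqrt (exp (x\<^sup>2) - 1) \<le> \<eta>" if "0 \<le> x" "x \<le> h" for x
  proof -
    have "x\<^sup>2 \<le> h\<^sup>2" using that by (intro power_mono) auto
    then have "x\<^sup>2 \<le> ln (1 + \<eta>\<^sup>2)" using p by (simp add: h_def)
    then have "exp (x\<^sup>2) \<le> 1 + \<eta>\<^sup>2" using assms by (metis add_pos_nonneg exp_le_cancel_iff exp_ln zero_le_power2 zero_less_one)
    then show ?thesis using assms by (intro real_le_lsqrt) auto
  qed
  then show ?thesis using p by (intro exI[of _ h]) (auto simp: h_def)
qed

lemma eventually_sqrt_large: "\<exists>n\<^sub>0>0. \<forall>n\<ge>n\<^sub>0. c \<le> sqrt (real n)"
proof (intro exI[of _ "Suc (nat \<lceil>c\<^sup>2\<rceil>)"] conjI allI impI)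
  fix n assume "Suc (nat \<lceil>c\<^sup>2\<rceil>) \<le> n"
  then have "c\<^sup>2 \<le> real n" by linarith
  then show "c \<le> sqrt (real n)" by (rule real_le_rsqrt)
qed simp

lemma emp_process_tent_couple:
  assumes "U \<in> space (unif_law n)" "x \<in> {0..1}" "0 < n" "\<bar>b\<bar> \<le> sqrt (real n)"
  shows "emp_process n (couple n (tent_tilt (b / sqrt (real n))) U) x =
      emp_process n U (x + b / sqrt (real n) * min x (1 - x)) + b * min x (1 - x)"
    and "x + b / sqrt (real n) * min x (1 - x) \<in> {0..1}"
proof -
  have c: "\<bar>b / sqrt (real n)\<bar> \<le> 1" using assms by (simp add: divide_le_eq)
  have dens: "is_density (\<lambda>x. 1 + tent_tilt (b / sqrt (real n)) x)"
    using c by (intro is_density_perturbation) (auto simp: tent_tilt_measurable tent_tilt_mean tent_tilt_bound)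
  show "emp_process n (couple n (tent_tilt (b / sqrt (real n))) U) x =
      emp_process n U (x + b / sqrt (real n) * min x (1 - x)) + b * min x (1 - x)"
    using emp_process_couple[OF dens assms(1,2)] drift_cdf_tent_tilt[OF assms(2)] assms(3) by simp
  show "x + b / sqrt (real n) * min x (1 - x) \<in> {0..1}"
    using drift_cdf_range[OF dens assms(2)] drift_cdf_tent_tilt[OF assms(2)] by simp
qed

lemma tent_shift_le:
  fixes x :: real
  assumes "x \<in> {0..1}" "\<bar>b\<bar> / s \<le> \<delta>" "0 < s"
  shows "\<bar>x + b / s * min x (1 - x) - x\<bar> \<le> \<delta>"
proof -
  have "0 \<le> min x (1 - x)" "min x (1 - x) \<le> 1" using assms by auto
  then have "\<bar>b\<bar> / s * min x (1 - x) \<le> \<bar>b\<bar> / s * 1" using assms by (intro mult_left_mono) auto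
  then show ?thesis using assms \<open>0 \<le> min x (1 - x)\<close> by (simp add: abs_mult)
qed

text \<open>The value at the midpoint alone already spreads out: two of the tilts move it by at least
\<open>h / 2\<close> relative to each other, more than the interval of values allows.\<close>

lemma T_small_unlikely:
  assumes "0 < \<eta>"
  shows "\<exists>\<kappa>>0. \<exists>n\<^sub>0. \<forall>n\<ge>n\<^sub>0. measure (unif_law n)
    {X \<in> space (unif_law n). sqrt (real n) * kolmogorov_T (empirical_cdf n X) \<le> \<kappa>} \<le> \<eta>"
proof -
  obtain K where K: "0 < K" "1 / real K \<le> \<eta> / 4"
    using ex_inverse_le[of "\<eta> / 4"] assms by auto
  obtain h\<^sub>0 where h0: "0 < h\<^sub>0" "\<And>x. 0 \<le> x \<Longrightarrow> x \<le> h\<^sub>0 \<Longrightarrow> sqrt (exp (x\<^sup>2) - 1) \<le> \<eta> / 4"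
    using small_tilt[of "\<eta> / 4"] assms by auto
  define h where "h = h\<^sub>0 / real K"
  \<comment> \<open>Two tilts separate the midpoint values by \<open>h / 2\<close>, and both being small confines them to a distance of
\<open>4 \<kappa>\<close>: hence \<open>4 \<kappa> < h / 2\<close> is required.\<close>
  define \<kappa> where "\<kappa> = h / 9"
  have pos: "0 < h" "0 < \<kappa>" using h0 K by (auto simp: h_def \<kappa>_def)
  obtain \<delta> n1 where \<delta>: "0 < \<delta>" and G: "\<And>n. n1 \<le> n \<Longrightarrow> \<exists>G\<in>sets (unif_law n). 1 - \<eta>/4 \<le> measure (unif_law n) G \<and>
    (\<forall>X\<in>G. regular_sample n \<kappa> \<delta> X)"
    using regular_samples[of \<kappa> "\<eta>/4"] pos assms by fastforce
  obtain n2 where n2: "0 < n2" "\<And>n. n2 \<le> n \<Longrightarrow> real K * h / min \<delta> 1 \<le> sqrt (real n)"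
    using eventually_sqrt_large by blast
  have "measure (unif_law n) {X \<in> space (unif_law n). sqrt (real n) * kolmogorov_T (empirical_cdf n X) \<le> \<kappa>} \<le> \<eta>"
    if n: "max n1 n2 \<le> n" for n
  proof -
    have n0: "0 < n" using n n2(1) by auto
    have "real K * h / min \<delta> 1 \<le> sqrt (real n)" using n n2 by auto
    then have Kh: "real K * h \<le> sqrt (real n) * min \<delta> 1" using \<delta> by (simp add: divide_le_eq)
    have sq: "0 < sqrt (real n)" using n0 by simp
    have "sqrt (real n) * min \<delta> 1 \<le> sqrt (real n) * \<delta>" "sqrt (real n) * min \<delta> 1 \<le> sqrt (real n) * 1"
      using sq by (intro mult_left_mono; simp)+
    with Kh have "real K * h \<le> sqrt (real n) * \<delta>" "real K * h \<le> sqrt (real n) * 1" by linarith+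
    then have Kh1: "real K * h \<le> sqrt (real n)" and Kh2: "real K * h / sqrt (real n) \<le> \<delta>"
      using sq by (simp_all add: pos_divide_le_eq mult.commute)
    let ?A = "{X \<in> space (unif_law n). \<bar>emp_process n X (1/2)\<bar> \<le> \<kappa>}"
    obtain G where G: "G \<in> sets (unif_law n)" "1 - \<eta>/4 \<le> measure (unif_law n) G"
        "\<And>X. X \<in> G \<Longrightarrow> regular_sample n \<kappa> \<delta> X"
      using G[of n] n by auto
    have shift: "\<bar>emp_process n U (1/2) + real i * h / 2\<bar> \<le> 2 * \<kappa>"
      if "U \<in> G" "i < K" and *: "couple n (tent_tilt (1 * real i * h / sqrt (real n))) U \<in> ?A" for U i
    proof -
      have ih: "0 \<le> real i * h" "real i * h \<le> real K * h" using that pos by (auto intro!: mult_right_mono)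
      have U: "U \<in> space (unif_law n)" using G(3)[OF that(1)] by (rule regular_sampleD)
      have b: "\<bar>real i * h\<bar> \<le> sqrt (real n)" using ih Kh1 by linarith
      define y where "y = 1/2 + real i * h / sqrt (real n) * min (1/2) (1 - 1/2)"
      have y: "y \<in> {0..1}" "emp_process n (couple n (tent_tilt (real i * h / sqrt (real n))) U) (1/2)
          = emp_process n U y + real i * h / 2"
        unfolding y_def using emp_process_tent_couple[OF U _ n0 b, of "1/2"] by auto
      have "real i * h / sqrt (real n) \<le> real K * h / sqrt (real n)" using ih sq by (intro divide_right_mono) auto
      then have "\<bar>y - 1/2\<bar> \<le> \<delta>" unfolding y_def using ih Kh2 by (intro tent_shift_le sq) auto
      then have "\<bar>emp_process n U y - emp_process n U (1/2)\<bar> \<le> \<kappa>"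
        using regular_sampleD(3)[OF G(3)[OF that(1)] y(1), of "1/2"] by simp
      moreover have "\<bar>emp_process n U y + real i * h / 2\<bar> \<le> \<kappa>" using * y(2) by simp
      ultimately show ?thesis by linarith
    qed
    have "measure (unif_law n) ?A \<le> 1 / real K + sqrt (exp ((real K * h)\<^sup>2) - 1) + (1 - measure (unif_law n) G)"
    proof (rule measure_le_of_disjoint_tilts[OF K(1) n0 _ Kh1])
      fix i j U assume ij: "i < j" "j < K" "U \<in> G"
        and i: "couple n (tent_tilt (1 * real i * h / sqrt (real n))) U \<in> ?A"
      show "couple n (tent_tilt (1 * real j * h / sqrt (real n))) U \<notin> ?A"
      proof
        assume j: "couple n (tent_tilt (1 * real j * h / sqrt (real n))) U \<in> ?A"
        have "\<bar>emp_process n U (1/2) + real i * h / 2\<bar> \<le> 2 * \<kappa>"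
          by (rule shift[OF ij(3) _ i]) (use ij in simp)
        moreover have "\<bar>emp_process n U (1/2) + real j * h / 2\<bar> \<le> 2 * \<kappa>"
          by (rule shift[OF ij(3) ij(2) j])
        moreover have "real i * h + h \<le> real j * h"
        proof -
          have "(real i + 1) * h \<le> real j * h" using ij pos by (intro mult_right_mono) auto
          then show ?thesis by (simp add: algebra_simps)
        qed
        ultimately show False using pos unfolding \<kappa>_def by linarith
      qed
    qed (use pos G in auto)
    moreover have "sqrt (exp ((real K * h)\<^sup>2) - 1) \<le> \<eta> / 4"
      using h0 K by (intro h0) (auto simp: h_def)
    moreover have "measure (unif_law n) {X \<in> space (unif_law n). sqrt (real n) * kolmogorov_T (empirical_cdf n X) \<le> \<kappa>}
        \<le> measure (unif_law n) ?A"
      unfolding sqrt_T_le_iff[OF n0] by (intro unif_prob.finite_measure_mono) auto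
    ultimately show ?thesis using K(2) G(2) assms by linarith
  qed
  then show ?thesis using pos by blast
qed

text \<open>Suppose the path exceeds \<open>t\<close> at a point \<open>x\<close> while its maximum is at most \<open>t + \<epsilon>\<close>. Any larger tilt
lifts the path at \<open>x\<close> by at least \<open>h min x (1 - x)\<close>, above \<open>t + \<epsilon>\<close>. This needs \<open>x\<close> to keep a distance from the
ends, which holds because \<open>t\<close> is bounded below while regular paths are small near \<open>0\<close> and \<open>1\<close>. The sign \<open>\<sigma>\<close>
treats exceedances of both signs.\<close>

lemma T_band_unlikely_large:
  assumes "0 < \<eta>" "0 < \<kappa>"
  shows "\<exists>\<epsilon>>0. \<exists>n\<^sub>0. \<forall>n\<ge>n\<^sub>0. \<forall>t\<ge>\<kappa>. \<forall>\<sigma>. \<bar>\<sigma>\<bar> = 1 \<longrightarrow> measure (unif_law n)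
    {X \<in> space (unif_law n). (\<exists>x\<in>{0..1}. t < \<sigma> * emp_process n X x) \<and>
       sqrt (real n) * kolmogorov_T (empirical_cdf n X) \<le> t + \<epsilon>} \<le> \<eta>"
proof -
  obtain K where K: "0 < K" "1 / real K \<le> \<eta> / 4"
    using ex_inverse_le[of "\<eta> / 4"] assms by auto
  obtain h\<^sub>0 where h0: "0 < h\<^sub>0" "\<And>x. 0 \<le> x \<Longrightarrow> x \<le> h\<^sub>0 \<Longrightarrow> sqrt (exp (x\<^sup>2) - 1) \<le> \<eta> / 4"
    using small_tilt[of "\<eta> / 4"] assms by auto
  \<comment> \<open>Besides \<open>K h \<le> h\<^sub>0\<close>, which keeps the laws close, \<open>K h \<le> \<kappa> / 2\<close> keeps all lifts below half of the level \<open>t\<close>.\<close>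
  define h where "h = min h\<^sub>0 (\<kappa> / 2) / real K"
  have h: "0 < h" "real K * h \<le> h\<^sub>0" "real K * h \<le> \<kappa> / 2" using h0 K assms by (auto simp: h_def)
  obtain d n1 where d: "0 < d" and G1: "\<And>n. n1 \<le> n \<Longrightarrow> \<exists>G\<in>sets (unif_law n). 1 - \<eta>/8 \<le> measure (unif_law n) G \<and>
    (\<forall>X\<in>G. regular_sample n (\<kappa>/8) d X)"
    using regular_samples[of "\<kappa>/8" "\<eta>/8"] assms by fastforce
  \<comment> \<open>Paths oscillate by at most \<open>\<kappa> / 8\<close> on the scale \<open>d\<close>, so an exceedance of \<open>t \<ge> \<kappa>\<close> occurs at a distance of at least \<open>d'\<close>
from the ends. There the lift from one tilt to the next is at least \<open>d' h\<close>, which has to exceed the three errors \<open>\<epsilon>\<close>.\<close>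
  define d' where "d' = min d 1"
  define \<epsilon> where "\<epsilon> = min (\<kappa> / 8) (d' * h / 4)"
  have d': "0 < d'" "d' \<le> d" using d by (auto simp: d'_def)
  have \<epsilon>: "0 < \<epsilon>" "\<epsilon> \<le> \<kappa> / 8" "4 * \<epsilon> \<le> d' * h" using assms d' h by (auto simp: \<epsilon>_def min_def)
  obtain \<delta> n2 where \<delta>: "0 < \<delta>" and G2: "\<And>n. n2 \<le> n \<Longrightarrow> \<exists>G\<in>sets (unif_law n). 1 - \<eta>/8 \<le> measure (unif_law n) G \<and>
    (\<forall>X\<in>G. regular_sample n \<epsilon> \<delta> X)"
    using regular_samples[of \<epsilon> "\<eta>/8"] assms \<epsilon> by fastforce
  obtain n3 where n3: "0 < n3" "\<And>n. n3 \<le> n \<Longrightarrow> real K * h / min \<delta> 1 \<le> sqrt (real n)"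
    using eventually_sqrt_large by blast
  have "measure (unif_law n) {X \<in> space (unif_law n). (\<exists>x\<in>{0..1}. t < \<sigma> * emp_process n X x) \<and>
       sqrt (real n) * kolmogorov_T (empirical_cdf n X) \<le> t + \<epsilon>} \<le> \<eta>" (is "measure _ ?A \<le> \<eta>")
    if n: "max n1 (max n2 n3) \<le> n" and t: "\<kappa> \<le> t" and \<sigma>: "\<bar>\<sigma>\<bar> = 1" for n t \<sigma>
  proof -
    have n0: "0 < n" using n n3(1) by auto
    have "real K * h / min \<delta> 1 \<le> sqrt (real n)" using n n3 by auto
    then have Kh: "real K * h \<le> sqrt (real n) * min \<delta> 1" using \<delta> by (simp add: divide_le_eq)
    have sq: "0 < sqrt (real n)" using n0 by simp
    have "sqrt (real n) * min \<delta> 1 \<le> sqrt (real n) * \<delta>" "sqrt (real n) * min \<delta> 1 \<le> sqrt (real n) * 1"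
      using sq by (intro mult_left_mono; simp)+
    with Kh have "real K * h \<le> sqrt (real n) * \<delta>" "real K * h \<le> sqrt (real n) * 1" by linarith+
    then have Kh1: "real K * h \<le> sqrt (real n)" and Kh2: "real K * h / sqrt (real n) \<le> \<delta>"
      using sq by (simp_all add: pos_divide_le_eq mult.commute)
    have \<sigma>2: "\<sigma> * \<sigma> = 1" using \<sigma> by (metis abs_mult_self_eq mult_1)
    obtain G\<^sub>1 where G\<^sub>1: "G\<^sub>1 \<in> sets (unif_law n)" "1 - \<eta>/8 \<le> measure (unif_law n) G\<^sub>1"
        "\<And>X. X \<in> G\<^sub>1 \<Longrightarrow> regular_sample n (\<kappa>/8) d X"
      using G1[of n] n by auto
    obtain G\<^sub>2 where G\<^sub>2: "G\<^sub>2 \<in> sets (unif_law n)" "1 - \<eta>/8 \<le> measure (unif_law n) G\<^sub>2"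
        "\<And>X. X \<in> G\<^sub>2 \<Longrightarrow> regular_sample n \<epsilon> \<delta> X"
      using G2[of n] n by auto
    have G: "1 - \<eta>/4 \<le> measure (unif_law n) (G\<^sub>1 \<inter> G\<^sub>2)"
    proof -
      have "measure (unif_law n) (space (unif_law n) - (G\<^sub>1 \<inter> G\<^sub>2)) \<le>
        measure (unif_law n) ((space (unif_law n) - G\<^sub>1) \<union> (space (unif_law n) - G\<^sub>2))"
        using G\<^sub>1 G\<^sub>2 by (intro unif_prob.finite_measure_mono) auto
      also have "\<dots> \<le> measure (unif_law n) (space (unif_law n) - G\<^sub>1) + measure (unif_law n) (space (unif_law n) - G\<^sub>2)"
        using G\<^sub>1 G\<^sub>2 by (intro measure_Un_le) auto
      finally show ?thesis using G\<^sub>1 G\<^sub>2 by (simp add: unif_prob.prob_compl)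
    qed
    have A: "?A \<in> sets (unif_law n)"
    proof -
      have "(\<exists>x\<in>{0..1}. t < \<sigma> * emp_process n X x) \<longleftrightarrow>
         (\<exists>x\<in>{0..1}. t < (\<sigma> * sqrt (real n)) * (empirical_cdf n X x - x))" for X
        by (simp add: emp_process_def mult.assoc)
      then have "?A = {X \<in> space (unif_law n). \<exists>x\<in>{0..1}. t < (\<sigma> * sqrt (real n)) * (empirical_cdf n X x - x)} \<inter>
        {X \<in> space (unif_law n). sqrt (real n) * kolmogorov_T (empirical_cdf n X) \<le> t + \<epsilon>}"
        by auto
      moreover have "{X \<in> space (unif_law n). sqrt (real n) * kolmogorov_T (empirical_cdf n X) \<le> t + \<epsilon>} \<in> sets (unif_law n)"
        by measurable
      ultimately show ?thesis using deviation_set_measurable by auto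
    qed
    have "measure (unif_law n) ?A \<le> 1 / real K + sqrt (exp ((real K * h)\<^sup>2) - 1) + (1 - measure (unif_law n) (G\<^sub>1 \<inter> G\<^sub>2))"
    proof (rule measure_le_of_disjoint_tilts[OF K(1) n0 _ Kh1 \<sigma> A])
      fix i j U assume ij: "i < j" "j < K" "U \<in> G\<^sub>1 \<inter> G\<^sub>2"
        and i: "couple n (tent_tilt (\<sigma> * real i * h / sqrt (real n))) U \<in> ?A"
      let ?W = "emp_process n U"
      have U: "regular_sample n (\<kappa>/8) d U" "regular_sample n \<epsilon> \<delta> U" "U \<in> space (unif_law n)"
        using G\<^sub>1(3) G\<^sub>2(3) ij(3) by (auto dest: regular_sampleD)
      have lh: "0 \<le> real l * h" "real l * h \<le> real K * h" if "l < K" for l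
        using that h by (auto intro!: mult_right_mono)
      have ijh: "real i * h + h \<le> real j * h"
      proof -
        have "(real i + 1) * h \<le> real j * h" using ij h by (intro mult_right_mono) auto
        then show ?thesis by (simp add: algebra_simps)
      qed
      \<comment> \<open>A tilted path is the original path plus the lift, up to the oscillation of \<open>W\<close> over the shift of its argument.\<close>
      have repr: "\<bar>\<sigma> * emp_process n (couple n (tent_tilt (\<sigma> * real l * h / sqrt (real n))) U) x
          - (\<sigma> * ?W x + real l * h * min x (1 - x))\<bar> \<le> \<epsilon>" if "l < K" "x \<in> {0..1}" for l x
      proof -
        define y where "y = x + (\<sigma> * (real l * h)) / sqrt (real n) * min x (1 - x)"
        have b: "\<bar>\<sigma> * (real l * h)\<bar> = real l * h" using \<sigma> h(1) by (simp add: abs_mult)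
        then have b': "\<bar>\<sigma> * (real l * h)\<bar> \<le> sqrt (real n)" using lh[OF that(1)] Kh1 by linarith
        have y: "y \<in> {0..1}" "emp_process n (couple n (tent_tilt (\<sigma> * real l * h / sqrt (real n))) U) x
          = ?W y + \<sigma> * (real l * h) * min x (1 - x)"
          unfolding y_def using emp_process_tent_couple[OF U(3) that(2) n0 b'] by (auto simp: mult.assoc)
        have "real l * h / sqrt (real n) \<le> real K * h / sqrt (real n)"
          using lh[OF that(1)] sq by (intro divide_right_mono) auto
        then have "\<bar>y - x\<bar> \<le> \<delta>" unfolding y_def using b Kh2 by (intro tent_shift_le[OF that(2) _ sq]) auto
        then have "\<bar>?W y - ?W x\<bar> \<le> \<epsilon>"
          using regular_sampleD(3)[OF U(2) y(1) that(2)] by simp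
        moreover have "\<sigma> * (?W y + \<sigma> * (real l * h) * min x (1 - x)) - (\<sigma> * ?W x + real l * h * min x (1 - x))
            = \<sigma> * (?W y - ?W x) + (\<sigma> * \<sigma> - 1) * (real l * h * min x (1 - x))"
          by (simp add: algebra_simps)
        ultimately show ?thesis using y(2) \<sigma> \<sigma>2 by (simp add: abs_mult)
      qed
      obtain x where x: "x \<in> {0..1}" "t < \<sigma> * emp_process n (couple n (tent_tilt (\<sigma> * real i * h / sqrt (real n))) U) x"
        using i by auto
      have lower: "t - \<epsilon> < \<sigma> * ?W x + real i * h * min x (1 - x)"
        using x(2) repr[of i x] ij x(1) by fastforce
      have central: "d' \<le> min x (1 - x)"
      proof (rule ccontr)
        assume "\<not> d' \<le> min x (1 - x)"
        then consider "\<bar>x - 0\<bar> \<le> d" | "\<bar>x - 1\<bar> \<le> d" using x(1) d' by (fastforce simp: min_def split: if_splits)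
        then have "\<bar>?W x\<bar> \<le> \<kappa> / 8"
        proof cases
          case 1
          then show ?thesis using regular_sampleD(3)[OF U(1) x(1), of 0] regular_sampleD(2)[OF U(1)] by simp
        next
          case 2
          then show ?thesis
            using regular_sampleD(3)[OF U(1) x(1), of 1] emp_process_zero_one[OF U(3) n0] by simp
        qed
        then have "\<sigma> * ?W x \<le> \<kappa> / 8" using \<sigma> by (metis abs_le_D1 abs_mult mult_1)
        moreover have "real i * h * min x (1 - x) \<le> real i * h * 1"
          using lh[of i] ij x(1) by (intro mult_left_mono) auto
        ultimately show False using lower t \<epsilon> lh[of i] ij h assms by linarith
      qed
      show "couple n (tent_tilt (\<sigma> * real j * h / sqrt (real n))) U \<notin> ?A"
      proof
        assume "couple n (tent_tilt (\<sigma> * real j * h / sqrt (real n))) U \<in> ?A"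
        then have "\<bar>emp_process n (couple n (tent_tilt (\<sigma> * real j * h / sqrt (real n))) U) x\<bar> \<le> t + \<epsilon>"
          unfolding sqrt_T_le_iff[OF n0] using x(1) by blast
        then have "\<sigma> * emp_process n (couple n (tent_tilt (\<sigma> * real j * h / sqrt (real n))) U) x \<le> t + \<epsilon>"
          using \<sigma> by (metis abs_le_D1 abs_mult mult_1)
        then have "\<sigma> * ?W x + real j * h * min x (1 - x) \<le> t + 2 * \<epsilon>"
          using repr[of j x] ij x(1) by fastforce
        moreover have "real i * h * min x (1 - x) + h * d' \<le> real j * h * min x (1 - x)"
        proof -
          have "h * d' \<le> h * min x (1 - x)" using central h by (intro mult_left_mono) auto
          moreover have "(real i * h + h) * min x (1 - x) \<le> real j * h * min x (1 - x)"
            using ijh x(1) by (intro mult_right_mono) auto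
          ultimately show ?thesis by (simp add: algebra_simps)
        qed
        ultimately show False using lower \<epsilon> by (simp add: mult.commute)
      qed
    qed (use h G\<^sub>1 G\<^sub>2 in auto)
    moreover have "sqrt (exp ((real K * h)\<^sup>2) - 1) \<le> \<eta> / 4"
      using h by (intro h0) auto
    ultimately show ?thesis using K(2) G assms by linarith
  qed
  then show ?thesis using \<epsilon>(1) by blast
qed

text \<open>Low bands are covered by \<open>T_small_unlikely\<close>, all other bands by \<open>T_band_unlikely_large\<close>, once for each sign
of the deviation.\<close>

theorem T_anticoncentration:
  assumes "0 < \<eta>"
  shows "\<exists>\<epsilon>>0. \<exists>n\<^sub>0>0. \<forall>n\<ge>n\<^sub>0. \<forall>t. measure (unif_law n)
    {X \<in> space (unif_law n). t < sqrt (real n) * kolmogorov_T (empirical_cdf n X) \<and>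
       sqrt (real n) * kolmogorov_T (empirical_cdf n X) \<le> t + \<epsilon>} \<le> \<eta>"
proof -
  obtain \<kappa> n1 where \<kappa>: "0 < \<kappa>" and small: "\<And>n. n1 \<le> n \<Longrightarrow> measure (unif_law n)
    {X \<in> space (unif_law n). sqrt (real n) * kolmogorov_T (empirical_cdf n X) \<le> \<kappa>} \<le> \<eta>"
    using T_small_unlikely[OF assms] by blast
  obtain \<epsilon> n2 where \<epsilon>: "0 < \<epsilon>" and large: "\<And>n t \<sigma>. n2 \<le> n \<Longrightarrow> \<kappa> / 2 \<le> t \<Longrightarrow> \<bar>\<sigma>\<bar> = 1 \<Longrightarrow> measure (unif_law n)
    {X \<in> space (unif_law n). (\<exists>x\<in>{0..1}. t < \<sigma> * emp_process n X x) \<and>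
       sqrt (real n) * kolmogorov_T (empirical_cdf n X) \<le> t + \<epsilon>} \<le> \<eta> / 2"
    using T_band_unlikely_large[of "\<eta> / 2" "\<kappa> / 2"] assms \<kappa> by fastforce
  \<comment> \<open>Bands starting below \<open>\<kappa> / 2\<close> then end below \<open>\<kappa>\<close>.\<close>
  define e where "e = min \<epsilon> (\<kappa> / 2)"
  have "measure (unif_law n) {X \<in> space (unif_law n). t < sqrt (real n) * kolmogorov_T (empirical_cdf n X) \<and>
       sqrt (real n) * kolmogorov_T (empirical_cdf n X) \<le> t + e} \<le> \<eta>" (is "measure _ ?B \<le> _")
    if n: "Suc (max n1 n2) \<le> n" for n t
  proof (cases "\<kappa> / 2 \<le> t")
    case False
    have "measure (unif_law n) ?B \<le> measure (unif_law n)
      {X \<in> space (unif_law n). sqrt (real n) * kolmogorov_T (empirical_cdf n X) \<le> \<kappa>}"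
      using False \<kappa> by (intro unif_prob.finite_measure_mono) (auto simp: e_def)
    then show ?thesis using small[of n] n by linarith
  next
    case True
    have n0: "0 < n" using n by simp
    let ?A = "\<lambda>\<sigma>. {X \<in> space (unif_law n). (\<exists>x\<in>{0..1}. t < \<sigma> * emp_process n X x) \<and>
       sqrt (real n) * kolmogorov_T (empirical_cdf n X) \<le> t + \<epsilon>}"
    have A: "?A \<sigma> \<in> sets (unif_law n)" for \<sigma>
    proof -
      have "(\<exists>x\<in>{0..1}. t < \<sigma> * emp_process n X x) \<longleftrightarrow>
         (\<exists>x\<in>{0..1}. t < (\<sigma> * sqrt (real n)) * (empirical_cdf n X x - x))" for X
        by (simp add: emp_process_def mult.assoc)
      then have "?A \<sigma> = {X \<in> space (unif_law n). \<exists>x\<in>{0..1}. t < (\<sigma> * sqrt (real n)) * (empirical_cdf n X x - x)} \<inter>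
        {X \<in> space (unif_law n). sqrt (real n) * kolmogorov_T (empirical_cdf n X) \<le> t + \<epsilon>}"
        by auto
      moreover have "{X \<in> space (unif_law n). sqrt (real n) * kolmogorov_T (empirical_cdf n X) \<le> t + \<epsilon>} \<in> sets (unif_law n)"
        by measurable
      ultimately show ?thesis using deviation_set_measurable by auto
    qed
    have "?B \<subseteq> ?A 1 \<union> ?A (-1)"
    proof
      fix X assume X: "X \<in> ?B"
      then have "\<not> sqrt (real n) * kolmogorov_T (empirical_cdf n X) \<le> t" by simp
      then obtain x where "x \<in> {0..1}" "t < \<bar>emp_process n X x\<bar>"
        unfolding sqrt_T_le_iff[OF n0] by (auto simp: not_le)
      then have "(\<exists>x\<in>{0..1}. t < 1 * emp_process n X x) \<or> (\<exists>x\<in>{0..1}. t < -1 * emp_process n X x)"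
        by (cases "0 \<le> emp_process n X x") auto
      then show "X \<in> ?A 1 \<union> ?A (-1)" using X by (auto simp: e_def)
    qed
    then have "measure (unif_law n) ?B \<le> measure (unif_law n) (?A 1 \<union> ?A (-1))"
      by (rule unif_prob.finite_measure_mono[OF _ sets.Un[OF A A]])
    also have "\<dots> \<le> measure (unif_law n) (?A 1) + measure (unif_law n) (?A (-1))"
      by (rule measure_Un_le[OF A A])
    also have "\<dots> \<le> \<eta> / 2 + \<eta> / 2"
      using n True by (intro add_mono large) auto
    finally show ?thesis by simp
  qed
  moreover have "0 < e" using \<epsilon> \<kappa> by (simp add: e_def)
  ultimately show ?thesis by (intro exI[of _ e] conjI exI[of _ "Suc (max n1 n2)"]) auto
qed

section \<open>Small balls\<close>

text \<open>Truncation to the unit interval: \<open>clamp (M x - k)\<close> is the part of the \<open>k\<close>-th cell of a grid with mesh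
\<open>1/M\<close> that lies to the left of \<open>x\<close>, in units of the mesh.\<close>

definition clamp :: "real \<Rightarrow> real" where
  "clamp t = max 0 (min 1 t)"

text \<open>The step function whose primitive is piecewise linear on the grid of mesh \<open>1/M\<close> and increases by \<open>d k\<close>
over the \<open>k\<close>-th cell.\<close>

definition step_tilt :: "nat \<Rightarrow> (nat \<Rightarrow> real) \<Rightarrow> real \<Rightarrow> real" where
  "step_tilt M d x = real M * (\<Sum>k<M. d k * indicator {real k / real M..<real (Suc k) / real M} x)"

lemma step_tilt_measurable: "step_tilt M d \<in> borel_measurable unit_lborel"
  unfolding step_tilt_def[abs_def] by (rule unit_borel_measurable) measurable

lemma step_tilt_bound:
  assumes "\<And>k. k < M \<Longrightarrow> \<bar>d k\<bar> \<le> B" "0 \<le> B"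
  shows "\<bar>step_tilt M d x\<bar> \<le> real M * B"
proof -
  let ?I = "\<lambda>k. {real k / real M..<real (Suc k) / real M}"
  define g where "g k = d k * indicator (?I k) x" for k
  have "\<bar>sum g {..<M}\<bar> \<le> B"
  proof (cases "\<exists>k<M. x \<in> ?I k")
    case True
    then obtain j where j: "j < M" "x \<in> ?I j" by blast
    have "g k = 0" if "k < M" "k \<noteq> j" for k
    proof -
      have "x \<notin> ?I k"
      proof
        assume k: "x \<in> ?I k"
        have "real k < real (Suc j)" "real j < real (Suc k)"
          using k j by (auto simp: field_simps)
        then show False using that by simp
      qed
      then show ?thesis by (simp add: g_def)
    qed
    then have "sum g {..<M} = sum g {j}"
      using j by (intro sum.mono_neutral_right) auto
    moreover have "g j = d j" using j(2) by (simp add: g_def)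
    ultimately show ?thesis using j assms by simp
  next
    case False
    then have "sum g {..<M} = 0"
      by (intro sum.neutral) (auto simp: g_def split: split_indicator)
    then show ?thesis using assms by simp
  qed
  then have "real M * \<bar>sum g {..<M}\<bar> \<le> real M * B" by (rule mult_left_mono) simp
  then show ?thesis unfolding step_tilt_def g_def[symmetric] by (simp add: abs_mult)
qed

lemma step_tilt_integral:
  assumes x: "x \<in> {0..1}"
  shows "(LBINT t:{0..x}. step_tilt M d t) = (\<Sum>k<M. d k * clamp (real M * x - real k))"
proof -
  have one: "(LBINT t. indicator {0..x} t * indicator {real k / real M..<real (Suc k) / real M} t)
      = clamp (real M * x - real k) / real M" if "k < M" for k
  proof -
    define a b where "a = real k / real M" and "b = real (Suc k) / real M"
    have ab: "0 \<le> a" "a < b" using that by (auto simp: a_def b_def divide_strict_right_mono)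
    have "(LBINT t. indicator {0..x} t * indicator {a..<b} t :: real) = measure lborel ({0..x} \<inter> {a..<b})"
      by (subst indicator_inter_arith[symmetric]) simp
    also have "\<dots> = max 0 (min x b - a)"
    proof (cases "x < b")
      case True
      then have "{0..x} \<inter> {a..<b} = {a..x}" using ab by auto
      then show ?thesis using True by simp
    next
      case False
      then have "{0..x} \<inter> {a..<b} = {a..<b}" using ab by auto
      then show ?thesis using False ab by (simp add: less_imp_le)
    qed
    also have "\<dots> = clamp (real M * x - real k) / real M"
      using that by (auto simp: clamp_def min_def max_def a_def b_def field_simps)
    finally show ?thesis unfolding a_def b_def .
  qed
  have "(LBINT t:{0..x}. step_tilt M d t) = (LBINT t. \<Sum>k<M. real M * d k *
     (indicator {0..x} t * indicator {real k / real M..<real (Suc k) / real M} t))"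
    unfolding set_lebesgue_integral_def step_tilt_def
    by (intro Bochner_Integration.integral_cong refl) (simp only: sum_distrib_left mult_ac real_scaleR_def)
  also have "\<dots> = (\<Sum>k<M. real M * d k * (LBINT t. (indicator {0..x} t * indicator {real k / real M..<real (Suc k) / real M} t)))"
  proof (subst Bochner_Integration.integral_sum)
    fix k assume "k \<in> {..<M}"
    have "integrable lborel (\<lambda>t. indicator ({0..x} \<inter> {real k / real M..<real (Suc k) / real M}) t :: real)"
      using emeasure_mono[of "{0..x} \<inter> {real k / real M..<real (Suc k) / real M}" "{0..x}" lborel] x
      by (intro integrable_real_indicator) (auto intro: le_less_trans)
    then show "integrable lborel (\<lambda>t. real M * d k * (indicator {0..x} t * indicator {real k / real M..<real (Suc k) / real M} t))"
      unfolding indicator_inter_arith by (rule integrable_mult_right)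
  qed simp
  also have "\<dots> = (\<Sum>k<M. d k * clamp (real M * x - real k))"
    by (intro sum.cong refl) (simp add: one del: of_nat_Suc)
  finally show ?thesis .
qed

text \<open>The sum is the piecewise linear interpolation of \<open>z\<close> on the grid, normalised to vanish at \<open>0\<close>.\<close>

lemma sum_clamp_telescope:
  assumes x: "x \<in> {0..1}" and M: "0 < M" and j: "j = nat \<lfloor>real M * x\<rfloor>"
  shows "(\<Sum>k<M. (z (Suc k) - z k) * clamp (real M * x - real k)) =
    z j - z 0 + (if j < M then (z (Suc j) - z j) * (real M * x - real j) else 0)" and "j \<le> M"
proof -
  have jr: "real j \<le> real M * x" "real M * x < real j + 1" using x by (auto simp: j of_nat_nat)
  have "real M * x \<le> real M" using x by (simp add: mult_left_le)
  then have "real j \<le> real M" using jr by linarith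
  then show jM: "j \<le> M" by simp
  let ?f = "\<lambda>k. (z (Suc k) - z k) * clamp (real M * x - real k)"
  have low: "sum ?f {..<j} = z j - z 0"
  proof -
    have "sum ?f {..<j} = (\<Sum>k<j. z (Suc k) - z k)"
    proof (intro sum.cong refl)
      fix k assume "k \<in> {..<j}"
      then have "real k + 1 \<le> real j" by auto
      then show "?f k = z (Suc k) - z k" using jr by (simp add: clamp_def)
    qed
    then show ?thesis by (simp add: sum_lessThan_telescope)
  qed
  show "(\<Sum>k<M. ?f k) = z j - z 0 + (if j < M then (z (Suc j) - z j) * (real M * x - real j) else 0)"
  proof (cases "j < M")
    case True
    have "sum ?f {..<M} = sum ?f {..<Suc j}"
    proof (rule sum.mono_neutral_right)
      show "\<forall>k\<in>{..<M} - {..<Suc j}. ?f k = 0"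
      proof
        fix k assume "k \<in> {..<M} - {..<Suc j}"
        then have "real j + 1 \<le> real k" by auto
        then show "?f k = 0" using jr by (simp add: clamp_def)
      qed
    qed (use True in auto)
    also have "\<dots> = z j - z 0 + (z (Suc j) - z j) * (real M * x - real j)"
      using low jr by (simp add: clamp_def)
    finally show ?thesis using True by simp
  next
    case False
    then show ?thesis using low jM by simp
  qed
qed

lemma measure_pigeonhole:
  assumes "finite_measure N" "finite Z" and G: "G \<in> sets N" and E: "\<And>z. z \<in> Z \<Longrightarrow> E z \<in> sets N"
    and cover: "G \<subseteq> (\<Union>z\<in>Z. E z)" and p: "p \<le> measure N G" "0 < p"
  shows "\<exists>z\<in>Z. p / real (card Z) \<le> measure N (G \<inter> E z)"
proof (rule ccontr)
  interpret finite_measure N by fact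
  assume "\<not> ?thesis"
  then have less: "\<And>z. z \<in> Z \<Longrightarrow> measure N (G \<inter> E z) < p / real (card Z)" by auto
  have "Z \<noteq> {}"
  proof
    assume "Z = {}"
    then show False using cover p by auto
  qed
  have "measure N G = measure N (\<Union>z\<in>Z. G \<inter> E z)"
    using cover by (intro arg_cong[where f = "measure N"]) auto
  also have "\<dots> \<le> (\<Sum>z\<in>Z. measure N (G \<inter> E z))"
    using assms E by (intro finite_measure_subadditive_finite) auto
  also have "\<dots> < (\<Sum>z\<in>Z. p / real (card Z))"
    using less \<open>Z \<noteq> {}\<close> \<open>finite Z\<close> by (intro sum_strict_mono) auto
  also have "\<dots> = p" using \<open>Z \<noteq> {}\<close> \<open>finite Z\<close> by simp
  finally show False using p by simp
qed

text \<open>Discretised regular paths take finitely many shapes \<open>z\<close>, and regular paths have probability at least one half, so one shape has probability at least \<open>1 / (2 N)\<close>,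
where \<open>N\<close> is the number of shapes and does not depend on \<open>n\<close>. Tilting by the derivative of minus the
interpolated shape subtracts this shape from the path and leaves a path close to zero. The tilt has
size \<open>O(n\<^bsup>-1/2\<^esup>)\<close>, hence the tilted probability controls the original one from below.\<close>

theorem T_small_ball:
  assumes "0 < q"
  shows "\<exists>p>0. \<exists>n\<^sub>0. \<forall>n\<ge>n\<^sub>0. p \<le> measure (unif_law n)
    {X \<in> space (unif_law n). sqrt (real n) * kolmogorov_T (empirical_cdf n X) \<le> q}"
proof -
  \<comment> \<open>There will be four errors of size \<open>e\<close>: the oscillation of \<open>W\<close> over the shift of its argument and over one cell, the
discretisation of the values of \<open>W\<close>, and the interpolation of the shape.\<close>
  define e where "e = q / 4"
  have e: "0 < e" using assms by (simp add: e_def)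
  obtain \<delta> n1 where \<delta>: "0 < \<delta>" and good: "\<And>n. n1 \<le> n \<Longrightarrow> \<exists>G\<in>sets (unif_law n). 1 - 1/2 \<le> measure (unif_law n) G \<and>
    (\<forall>X\<in>G. regular_sample n e \<delta> X)"
    using regular_samples[OF e, of "1/2"] by fastforce
  obtain M where M: "0 < M" "1 / real M \<le> \<delta>" using ex_inverse_le[OF \<delta>] by auto
  \<comment> \<open>The candidates for the shape: integer multiples of \<open>e\<close> at the grid points, bounded by \<open>M e\<close> because every one of the \<open>M\<close>
cells contributes at most \<open>e\<close>.\<close>
  define Z where "Z = {..M} \<rightarrow>\<^sub>E {- int M..int M}"
  have Z: "finite Z" by (simp add: Z_def finite_PiE)
  obtain n2 where n2: "0 < n2" "\<And>n. n2 \<le> n \<Longrightarrow> e * (real M + 1) / min \<delta> 1 \<le> sqrt (real n)"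
    using eventually_sqrt_large by blast
  \<comment> \<open>The squared probability of the most frequent shape over the bound for the second moment of the likelihood.\<close>
  define p where "p = ((1/2) / real (card Z))\<^sup>2 / exp ((e * real M)\<^sup>2)"
  have "(\<lambda>k\<in>{..M}. 0) \<in> Z" by (auto simp: Z_def)
  then have cZ: "0 < card Z" using Z card_gt_0_iff by blast
  have "p \<le> measure (unif_law n) {X \<in> space (unif_law n). sqrt (real n) * kolmogorov_T (empirical_cdf n X) \<le> q}"
    (is "_ \<le> measure _ ?A") if n: "max n1 n2 \<le> n" for n
  proof -
    have n0: "0 < n" using n n2(1) by auto
    have sq: "0 < sqrt (real n)" using n0 by simp
    have "e * (real M + 1) / min \<delta> 1 \<le> sqrt (real n)" using n n2 by auto
    then have Kh: "e * (real M + 1) \<le> sqrt (real n) * min \<delta> 1" using \<delta> by (simp add: divide_le_eq)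
    have "sqrt (real n) * min \<delta> 1 \<le> sqrt (real n) * \<delta>" "sqrt (real n) * min \<delta> 1 \<le> sqrt (real n) * 1"
      using sq by (intro mult_left_mono; simp)+
    with Kh have Kh: "e * (real M + 1) \<le> sqrt (real n) * \<delta>" "e * (real M + 1) \<le> sqrt (real n) * 1" by linarith+
    obtain G where G: "G \<in> sets (unif_law n)" "1/2 \<le> measure (unif_law n) G"
        "\<And>X. X \<in> G \<Longrightarrow> regular_sample n e \<delta> X"
      using good[of n] n by auto
    define E where "E z = {X \<in> space (unif_law n). \<forall>k\<in>{..M}. \<lfloor>emp_process n X (real k / real M) / e\<rfloor> = z k}"
      for z :: "nat \<Rightarrow> int"
    have E: "E z \<in> sets (unif_law n)" for z unfolding E_def by measurable
    have grid: "real k / real M \<in> {0..1}" if "k \<le> M" for k using that M by auto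
    have step: "\<bar>emp_process n X (real (Suc k) / real M) - emp_process n X (real k / real M)\<bar> \<le> e"
      if "X \<in> G" "Suc k \<le> M" for X k
    proof (rule regular_sampleD(3)[OF G(3)[OF that(1)]])
      show "\<bar>real (Suc k) / real M - real k / real M\<bar> \<le> \<delta>"
        using M by (simp flip: diff_divide_distrib)
    qed (use grid[OF that(2)] grid[of k] that(2) in auto)
    have size: "\<bar>emp_process n X (real k / real M)\<bar> \<le> real k * e" if "X \<in> G" "k \<le> M" for X k
      using that(2)
    proof (induction k)
      case 0
      then show ?case using regular_sampleD(2)[OF G(3)[OF that(1)]] by simp
    next
      case (Suc k)
      then show ?case using step[OF that(1) Suc.prems] by (simp add: algebra_simps)
    qed
    have cover: "G \<subseteq> (\<Union>z\<in>Z. E z)"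
    proof
      fix X assume X: "X \<in> G"
      let ?z = "\<lambda>k\<in>{..M}. \<lfloor>emp_process n X (real k / real M) / e\<rfloor>"
      have "\<lfloor>emp_process n X (real k / real M) / e\<rfloor> \<in> {- int M..int M}" if "k \<le> M" for k
      proof -
        have "\<bar>emp_process n X (real k / real M)\<bar> \<le> real M * e"
          using size[OF X that] that e by (auto intro: order.trans mult_right_mono)
        then have "emp_process n X (real k / real M) / e \<le> real M" "- real M \<le> emp_process n X (real k / real M) / e"
          using e by (auto simp: pos_divide_le_eq pos_le_divide_eq)
        then show ?thesis by (auto simp: floor_le_iff le_floor_iff)
      qed
      then have "?z \<in> Z" by (auto simp: Z_def)
      moreover have "X \<in> E ?z" using regular_sampleD(1)[OF G(3)[OF X]] by (auto simp: E_def)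
      ultimately show "X \<in> (\<Union>z\<in>Z. E z)" by blast
    qed
    obtain z where z: "z \<in> Z" "(1/2) / real (card Z) \<le> measure (unif_law n) (G \<inter> E z)"
      using measure_pigeonhole[OF unif_prob.finite_measure_axioms Z G(1) E cover G(2)] by auto
    moreover have "0 < (1/2) / real (card Z)" using cZ by simp
    ultimately have "0 < measure (unif_law n) (G \<inter> E z)" by linarith
    then have "G \<inter> E z \<noteq> {}" by force
    then obtain X\<^sub>0 where X0: "X\<^sub>0 \<in> G" "X\<^sub>0 \<in> E z" by blast
    have zeq: "z k = \<lfloor>emp_process n X\<^sub>0 (real k / real M) / e\<rfloor>" if "k \<le> M" for k
      using X0(2) that by (auto simp: E_def)
    \<comment> \<open>A shape that occurs inherits the boundary values and the small increments of a path; the former give the tilt mean zero, the latter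
make it \<open>O(n\<^bsup>-1/2\<^esup>)\<close>.\<close>
    have z0: "z 0 = 0" using zeq[of 0] regular_sampleD(2)[OF G(3)[OF X0(1)]] by simp
    have zM: "z M = 0"
      using zeq[of M] emp_process_zero_one[OF regular_sampleD(1)[OF G(3)[OF X0(1)]] n0] M by simp
    define D where "D k = real_of_int (z (Suc k)) - real_of_int (z k)" for k
    have D: "\<bar>D k\<bar> \<le> 1" if "k < M" for k
    proof -
      have "\<bar>emp_process n X\<^sub>0 (real (Suc k) / real M) / e - emp_process n X\<^sub>0 (real k / real M) / e\<bar> \<le> 1"
        using step[OF X0(1), of k] that e by (simp add: abs_le_iff pos_divide_le_eq flip: diff_divide_distrib)
      then have "\<bar>z (Suc k) - z k\<bar> \<le> 1"
        using that zeq[of k] zeq[of "Suc k"] by linarith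
      then show ?thesis unfolding D_def by linarith
    qed
    define f where "f = step_tilt M (\<lambda>k. - (e / sqrt (real n)) * D k)"
    define g where "g x = (\<Sum>k<M. D k * clamp (real M * x - real k))" for x
    have f_int: "(LBINT t:{0..x}. f t) = - (e / sqrt (real n)) * g x" if "x \<in> {0..1}" for x
      unfolding f_def step_tilt_integral[OF that] g_def sum_distrib_left by (simp add: mult.assoc)
    have g_near: "\<bar>g x - real_of_int (z (nat \<lfloor>real M * x\<rfloor>))\<bar> \<le> 1" "nat \<lfloor>real M * x\<rfloor> \<le> M" if x: "x \<in> {0..1}" for x
    proof -
      define j where "j = nat \<lfloor>real M * x\<rfloor>"
      note tel = sum_clamp_telescope(1)[OF x M(1) j_def, of "\<lambda>k. real_of_int (z k)"]
          sum_clamp_telescope(2)[OF x M(1) j_def]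
      have jr: "real j \<le> real M * x" "real M * x < real j + 1" using x by (auto simp: j_def of_nat_nat)
      have "\<bar>D j * (real M * x - real j)\<bar> \<le> 1" if "j < M"
        using D[OF that] jr by (simp add: abs_mult mult_le_one)
      then show "\<bar>g x - real_of_int (z (nat \<lfloor>real M * x\<rfloor>))\<bar> \<le> 1"
        using tel(1) z0 unfolding g_def D_def j_def[symmetric] by auto
      show "nat \<lfloor>real M * x\<rfloor> \<le> M" using tel(2) by (simp add: j_def)
    qed
    have g1: "g 1 = 0"
      using sum_clamp_telescope(1)[of 1 M M "\<lambda>k. real_of_int (z k)"] M(1) z0 zM by (simp add: g_def D_def)
    have g_bound: "\<bar>g x\<bar> \<le> real M + 1" if x: "x \<in> {0..1}" for x
    proof -
      have "z (nat \<lfloor>real M * x\<rfloor>) \<in> {- int M..int M}"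
        using z(1) g_near(2)[OF x] by (auto simp: Z_def)
      then have "\<bar>real_of_int (z (nat \<lfloor>real M * x\<rfloor>))\<bar> \<le> real M" by (auto simp: abs_le_iff)
      then show ?thesis using g_near(1)[OF x] by linarith
    qed
    have fb: "\<bar>f x\<bar> \<le> real M * (e / sqrt (real n))" for x
      unfolding f_def using D e sq
      by (intro step_tilt_bound) (auto simp: abs_mult mult_left_le divide_right_mono)
    have fb1: "\<bar>f x\<bar> \<le> 1" for x
    proof -
      have "real M * e \<le> e * (real M + 1)" using e by (simp add: algebra_simps)
      then have "real M * e \<le> sqrt (real n)" using Kh by linarith
      then have "real M * (e / sqrt (real n)) \<le> 1" using sq by (simp add: divide_le_eq)
      then show ?thesis using fb[of x] by linarith
    qed
    have f_meas: "f \<in> borel_measurable unit_lborel" unfolding f_def by (rule step_tilt_measurable)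
    have f_mean: "(LINT x|unit_lborel. f x) = 0"
      using f_int[of 1] g1 by (simp add: set_integral_unit)
    have f2: "real n * (LINT x|unit_lborel. (f x)\<^sup>2) \<le> (e * real M)\<^sup>2"
    proof -
      have b: "(f x)\<^sup>2 \<le> (real M * (e / sqrt (real n)))\<^sup>2" for x
        using fb[of x] by (rule abs_le_square_iff[THEN iffD1, OF order.trans[OF _ abs_ge_self]])
      have "(LINT x|unit_lborel. (f x)\<^sup>2) \<le> (LINT x|unit_lborel. (real M * (e / sqrt (real n)))\<^sup>2)"
      proof (rule Bochner_Integration.integral_mono)
        show "integrable unit_lborel (\<lambda>x. (f x)\<^sup>2)"
          using b f_meas by (intro integrable_unit_bounded[where B = "(real M * (e / sqrt (real n)))\<^sup>2"]) auto
      qed (use b in auto)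
      also have "\<dots> = (real M * (e / sqrt (real n)))\<^sup>2" by (simp add: unit_prob.prob_space[simplified])
      finally show ?thesis using n0 by (simp add: power_mult_distrib power_divide field_simps)
    qed
    have dens: "is_density (\<lambda>x. 1 + f x)"
      by (rule is_density_perturbation[OF f_meas fb1 f_mean])
    have A: "?A \<in> sets (unif_law n)" by measurable
    have sub: "G \<inter> E z \<subseteq> {U \<in> space (unif_law n). couple n f U \<in> ?A}"
    proof
      fix U assume U: "U \<in> G \<inter> E z"
      then have reg: "regular_sample n e \<delta> U" using G(3) by auto
      note Us = regular_sampleD(1)[OF reg]
      have "\<bar>emp_process n (couple n f U) x\<bar> \<le> q" if x: "x \<in> {0..1}" for x
      proof -
        define y where "y = drift_cdf f x"
        define j where "j = nat \<lfloor>real M * x\<rfloor>"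
        have y: "y \<in> {0..1}" unfolding y_def by (rule drift_cdf_range[OF dens x])
        have yx: "y - x = - (e / sqrt (real n)) * g x" using f_int[OF x] by (simp add: y_def drift_cdf_def)
        have eq: "emp_process n (couple n f U) x = emp_process n U y - e * g x"
          using emp_process_couple[OF dens Us x] yx sq by (simp add: y_def[symmetric])
        have "\<bar>y - x\<bar> = e / sqrt (real n) * \<bar>g x\<bar>" using yx e sq by (simp add: abs_mult)
        also have "\<dots> \<le> e / sqrt (real n) * (real M + 1)" using g_bound[OF x] e sq by (intro mult_left_mono) auto
        also have "\<dots> \<le> \<delta>" using Kh(1) sq by (simp add: field_simps)
        finally have 1: "\<bar>emp_process n U y - emp_process n U x\<bar> \<le> e"
          by (rule regular_sampleD(3)[OF reg y x])
        have jr: "real j \<le> real M * x" "real M * x < real j + 1" using x by (auto simp: j_def of_nat_nat)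
        have jM: "j \<le> M" using g_near(2)[OF x] by (simp add: j_def)
        have "real j / real M \<le> x" using jr M by (simp add: divide_le_eq mult.commute)
        moreover have "x < (real j + 1) / real M" using jr M by (simp add: less_divide_eq mult.commute)
        ultimately have "\<bar>x - real j / real M\<bar> \<le> 1 / real M" by (simp add: add_divide_distrib)
        then have 2: "\<bar>emp_process n U x - emp_process n U (real j / real M)\<bar> \<le> e"
          using M by (intro regular_sampleD(3)[OF reg x grid[OF jM]]) linarith
        have "\<lfloor>emp_process n U (real j / real M) / e\<rfloor> = z j" using U jM by (auto simp: E_def)
        then have "real_of_int (z j) \<le> emp_process n U (real j / real M) / e"
           "emp_process n U (real j / real M) / e < real_of_int (z j) + 1" by linarith+
        then have "\<bar>emp_process n U (real j / real M) / e - real_of_int (z j)\<bar> \<le> 1" by linarith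
        then have "e * \<bar>emp_process n U (real j / real M) / e - real_of_int (z j)\<bar> \<le> e * 1"
          using e by (intro mult_left_mono) auto
        moreover have "e * \<bar>emp_process n U (real j / real M) / e - real_of_int (z j)\<bar> =
            \<bar>emp_process n U (real j / real M) - e * real_of_int (z j)\<bar>"
        proof -
          have "emp_process n U (real j / real M) - e * real_of_int (z j) =
             e * (emp_process n U (real j / real M) / e - real_of_int (z j))"
            using e by (simp add: algebra_simps)
          then show ?thesis using e by (simp only: abs_mult abs_of_pos)
        qed
        ultimately have 3: "\<bar>emp_process n U (real j / real M) - e * real_of_int (z j)\<bar> \<le> e" by simp
        have "e * \<bar>g x - real_of_int (z j)\<bar> \<le> e * 1"
          using g_near(1)[OF x] e unfolding j_def by (intro mult_left_mono) auto
        moreover have "\<bar>e * real_of_int (z j) - e * g x\<bar> = e * \<bar>g x - real_of_int (z j)\<bar>"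
        proof -
          have "e * real_of_int (z j) - e * g x = e * - (g x - real_of_int (z j))" by (simp add: algebra_simps)
          then show ?thesis using e by (simp only: abs_mult abs_minus_cancel abs_of_pos)
        qed
        ultimately have 4: "\<bar>e * real_of_int (z j) - e * g x\<bar> \<le> e" by simp
        show ?thesis using 1 2 3 4 unfolding eq e_def by linarith
      qed
      moreover have "couple n f U \<in> space (unif_law n)"
        using measurable_space[OF compose_quantile_measurable[OF dens] Us] by (simp add: couple_def)
      ultimately show "U \<in> {U \<in> space (unif_law n). couple n f U \<in> ?A}"
        using Us unfolding sqrt_T_le_iff[OF n0] by auto
    qed
    have "(1/2) / real (card Z) \<le> measure (sample_law n f) ?A"
    proof -
      have "measure (unif_law n) (G \<inter> E z) \<le> measure (unif_law n) {U \<in> space (unif_law n). couple n f U \<in> ?A}"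
        by (rule unif_prob.finite_measure_mono[OF sub measure_sample_law_couple(2)[OF dens A]])
      then show ?thesis using z(2) measure_sample_law_couple(1)[OF dens A] by linarith
    qed
    then have "((1/2) / real (card Z))\<^sup>2 \<le> (measure (sample_law n f) ?A)\<^sup>2"
      by (intro power_mono) auto
    also have "\<dots> \<le> exp (real n * (LINT x|unit_lborel. (f x)\<^sup>2)) * measure (unif_law n) ?A"
      by (rule sample_law_square_le[OF f_meas fb1 f_mean A])
    also have "\<dots> \<le> exp ((e * real M)\<^sup>2) * measure (unif_law n) ?A"
      using f2 by (intro mult_right_mono) auto
    finally show ?thesis by (simp add: p_def divide_le_eq mult.commute)
  qed
  moreover have "0 < p" using cZ by (simp add: p_def)
  ultimately show ?thesis by blast
qed

section \<open>Error probabilities and the drift\<close>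

lemma type1_error_eq:
  "type1_error n q = measure (unif_law n) {X \<in> space (unif_law n). q < kolmogorov_T (empirical_cdf n X)}"
  by (simp add: type1_error_def sample_law_zero)

lemma type1_error_antimono: "p \<le> q \<Longrightarrow> type1_error n q \<le> type1_error n p"
  unfolding type1_error_eq by (intro unif_prob.finite_measure_mono) auto

lemma type1_error_compl:
  "measure (unif_law n) {X \<in> space (unif_law n). kolmogorov_T (empirical_cdf n X) \<le> q} = 1 - type1_error n q"
proof -
  have "{X \<in> space (unif_law n). kolmogorov_T (empirical_cdf n X) \<le> q} =
     space (unif_law n) - {X \<in> space (unif_law n). q < kolmogorov_T (empirical_cdf n X)}" by auto
  then show ?thesis unfolding type1_error_eq by (simp add: unif_prob.prob_compl)
qed

lemma type1_error_diff:
  assumes "p \<le> q"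
  shows "type1_error n p - type1_error n q = measure (unif_law n)
    {X \<in> space (unif_law n). p < kolmogorov_T (empirical_cdf n X) \<and> kolmogorov_T (empirical_cdf n X) \<le> q}"
proof -
  have "{X \<in> space (unif_law n). p < kolmogorov_T (empirical_cdf n X) \<and> kolmogorov_T (empirical_cdf n X) \<le> q} =
    {X \<in> space (unif_law n). p < kolmogorov_T (empirical_cdf n X)} -
    {X \<in> space (unif_law n). q < kolmogorov_T (empirical_cdf n X)}" by auto
  then show ?thesis unfolding type1_error_eq using assms
    by (simp add: unif_prob.finite_measure_Diff subset_eq)
qed

lemma type1_error_neg: "q < 0 \<Longrightarrow> type1_error n q = 1"
proof -
  assume "q < 0"
  then have "{X \<in> space (unif_law n). q < kolmogorov_T (empirical_cdf n X)} = space (unif_law n)"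
    by (auto simp: empirical_T_gt_iff intro: bexI[of _ 0] less_le_trans)
  then show ?thesis unfolding type1_error_eq by (simp add: unif_prob.prob_space)
qed

lemma type1_error_one: "type1_error n 1 = 0"
proof -
  have "kolmogorov_T (empirical_cdf n X) \<le> 1" for X
    unfolding empirical_T_le_iff using empirical_dev_bound by blast
  then have "{X \<in> space (unif_law n). 1 < kolmogorov_T (empirical_cdf n X)} = {}"
    by (auto dest: leD)
  then show ?thesis unfolding type1_error_eq by (simp only: measure_empty)
qed

text \<open>Anticoncentration in terms of errors: moving the critical value by \<open>\<epsilon> / \<surd>n\<close> changes the type I error by
at most \<open>\<eta>\<close>, uniformly in the critical value.\<close>

lemma type1_error_increment:
  assumes "0 < \<eta>"
  shows "\<exists>\<epsilon>>0. \<exists>n\<^sub>0>0. \<forall>n\<ge>n\<^sub>0. \<forall>q. \<forall>p\<ge>q - \<epsilon> / sqrt (real n). type1_error n p \<le> type1_error n q + \<eta>"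
proof -
  obtain \<epsilon> n\<^sub>0 where *: "0 < \<epsilon>" "0 < n\<^sub>0" "\<And>n t. n\<^sub>0 \<le> n \<Longrightarrow> measure (unif_law n)
    {X \<in> space (unif_law n). t < sqrt (real n) * kolmogorov_T (empirical_cdf n X) \<and>
       sqrt (real n) * kolmogorov_T (empirical_cdf n X) \<le> t + \<epsilon>} \<le> \<eta>"
    using T_anticoncentration[OF assms] by blast
  have "type1_error n p \<le> type1_error n q + \<eta>" if n: "n\<^sub>0 \<le> n" and p: "q - \<epsilon> / sqrt (real n) \<le> p" for n q p
  proof -
    have sq: "0 < sqrt (real n)" using n *(2) by simp
    let ?r = "q - \<epsilon> / sqrt (real n)"
    have "type1_error n ?r - type1_error n q = measure (unif_law n)
      {X \<in> space (unif_law n). ?r < kolmogorov_T (empirical_cdf n X) \<and> kolmogorov_T (empirical_cdf n X) \<le> q}"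
      using *(1) sq by (intro type1_error_diff) simp
    also have "\<dots> = measure (unif_law n)
      {X \<in> space (unif_law n). sqrt (real n) * ?r < sqrt (real n) * kolmogorov_T (empirical_cdf n X) \<and>
       sqrt (real n) * kolmogorov_T (empirical_cdf n X) \<le> sqrt (real n) * ?r + \<epsilon>}"
    proof -
      have "sqrt (real n) * ?r + \<epsilon> = sqrt (real n) * q" using sq by (simp add: algebra_simps)
      then show ?thesis using sq by simp
    qed
    also have "\<dots> \<le> \<eta>" by (rule *(3)[OF n])
    finally show ?thesis using type1_error_antimono[OF p, of n] by linarith
  qed
  then show ?thesis using * by blast
qed

definition critical_value :: "real \<Rightarrow> nat \<Rightarrow> real" where
  "critical_value \<alpha> n = Inf {q. type1_error n q \<le> \<alpha>}"

text \<open>The type I error may jump as a function of the critical value, so \<open>\<alpha>\<close> need not be attained; but the jumps vanish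
in the limit by \<open>type1_error_increment\<close>. This shows that tests of asymptotic level \<open>\<alpha>\<close> exist at all,
without which consistency would be vacuous.\<close>

lemma type1_error_critical_value:
  assumes \<alpha>: "0 < \<alpha>" "\<alpha> < 1"
  shows "(\<lambda>n. type1_error n (critical_value \<alpha> n)) \<longlonglongrightarrow> \<alpha>"
proof (rule LIMSEQ_I)
  fix \<eta> :: real assume "0 < \<eta>"
  then obtain \<epsilon> n\<^sub>0 where *: "0 < \<epsilon>" "0 < n\<^sub>0" "\<And>n q p. n\<^sub>0 \<le> n \<Longrightarrow> q - \<epsilon> / sqrt (real n) \<le> p \<Longrightarrow>
      type1_error n p \<le> type1_error n q + \<eta> / 2"
    using type1_error_increment[of "\<eta> / 2"] by fastforce
  have "norm (type1_error n (critical_value \<alpha> n) - \<alpha>) < \<eta>" if n: "n\<^sub>0 \<le> n" for n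
  proof -
    define S where "S = {q. type1_error n q \<le> \<alpha>}"
    define c where "c = critical_value \<alpha> n"
    \<comment> \<open>The error is at most \<open>\<alpha>\<close> at \<open>c + d\<close> and above \<open>\<alpha>\<close> at \<open>c - d\<close>; both are within \<open>\<eta> / 2\<close> of the error at \<open>c\<close>.\<close>
    define d where "d = \<epsilon> / sqrt (real n) / 2"
    have d: "0 < d" using *(1,2) n by (simp add: d_def)
    have bdd: "bdd_below S"
    proof (rule bdd_belowI)
      fix q assume "q \<in> S"
      then show "0 \<le> q" using type1_error_neg[of q n] \<alpha> by (force simp: S_def)
    qed
    have "1 \<in> S" using \<alpha> by (simp add: S_def type1_error_one)
    have cS: "c = Inf S" by (simp add: c_def S_def critical_value_def)
    obtain q where q: "q \<in> S" "q < c + d"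
      using cInf_lessD[of S "c + d"] \<open>1 \<in> S\<close> d cS by auto
    then have "type1_error n (c + d) \<le> \<alpha>"
      using type1_error_antimono[of q "c + d" n] by (simp add: S_def)
    moreover have "type1_error n c \<le> type1_error n (c + d) + \<eta> / 2"
      using d by (intro *(3)[OF n]) (simp add: d_def)
    moreover have "\<alpha> < type1_error n (c - d)"
    proof (rule ccontr)
      assume "\<not> \<alpha> < type1_error n (c - d)"
      then have "c - d \<in> S" by (simp add: S_def)
      then have "c \<le> c - d" using cInf_lower[OF _ bdd] cS by simp
      then show False using d by simp
    qed
    moreover have "type1_error n (c - d) \<le> type1_error n c + \<eta> / 2"
      using d by (intro *(3)[OF n]) (simp add: d_def)
    ultimately show ?thesis using \<open>0 < \<eta>\<close> by (simp add: c_def[symmetric])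
  qed
  then show "\<exists>no. \<forall>n\<ge>no. norm (type1_error n (critical_value \<alpha> n) - \<alpha>) < \<eta>" by blast
qed

lemma type2_error_eq:
  assumes "is_density (\<lambda>x. 1 + f x)"
  shows "type2_error n q f =
     measure (unif_law n) {U \<in> space (unif_law n). kolmogorov_T (empirical_cdf n (couple n f U)) \<le> q}"
    and "{U \<in> space (unif_law n). kolmogorov_T (empirical_cdf n (couple n f U)) \<le> q} \<in> sets (unif_law n)"
proof -
  let ?A = "{X \<in> space (unif_law n). kolmogorov_T (empirical_cdf n X) \<le> q}"
  have A: "?A \<in> sets (unif_law n)" by measurable
  have "couple n f U \<in> space (unif_law n)" if "U \<in> space (unif_law n)" for U
    using measurable_space[OF compose_quantile_measurable[OF assms] that] by (simp add: couple_def)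
  then have eq: "{U \<in> space (unif_law n). couple n f U \<in> ?A} =
     {U \<in> space (unif_law n). kolmogorov_T (empirical_cdf n (couple n f U)) \<le> q}" by auto
  have "type2_error n q f = measure (sample_law n f) ?A" by (simp add: type2_error_def not_less)
  then show "type2_error n q f =
     measure (unif_law n) {U \<in> space (unif_law n). kolmogorov_T (empirical_cdf n (couple n f U)) \<le> q}"
    using measure_sample_law_couple(1)[OF assms A] eq by simp
  show "{U \<in> space (unif_law n). kolmogorov_T (empirical_cdf n (couple n f U)) \<le> q} \<in> sets (unif_law n)"
    using measure_sample_law_couple(2)[OF assms A] eq by simp
qed

text \<open>The coupled process exceeds \<open>sup \<bar>W\<bar>\<close> by at most the drift, so acceptance by the test with a lowered critical
value under the hypothesis implies acceptance under the alternative.\<close>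

lemma type2_error_lower:
  assumes dens: "is_density (\<lambda>x. 1 + f x)" and n: "0 < n"
    and small: "\<And>x. x \<in> {0..1} \<Longrightarrow> sqrt (real n) * \<bar>drift_cdf f x - x\<bar> \<le> c"
  shows "1 - type1_error n (q - c / sqrt (real n)) \<le> type2_error n q f"
proof -
  have sq: "0 < sqrt (real n)" using n by simp
  have "1 - type1_error n (q - c / sqrt (real n)) =
    measure (unif_law n) {X \<in> space (unif_law n). kolmogorov_T (empirical_cdf n X) \<le> q - c / sqrt (real n)}"
    by (rule type1_error_compl[symmetric])
  also have "\<dots> \<le> measure (unif_law n) {U \<in> space (unif_law n). kolmogorov_T (empirical_cdf n (couple n f U)) \<le> q}"
  proof (rule unif_prob.finite_measure_mono[OF subsetI type2_error_eq(2)[OF dens]])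
    fix U assume U: "U \<in> {X \<in> space (unif_law n). kolmogorov_T (empirical_cdf n X) \<le> q - c / sqrt (real n)}"
    then have "sqrt (real n) * kolmogorov_T (empirical_cdf n U) \<le> sqrt (real n) * (q - c / sqrt (real n))"
      using sq by (intro mult_left_mono) auto
    then have "sqrt (real n) * kolmogorov_T (empirical_cdf n U) \<le> sqrt (real n) * q - c"
      using sq by (simp add: algebra_simps)
    then have W: "\<bar>emp_process n U x\<bar> \<le> sqrt (real n) * q - c" if "x \<in> {0..1}" for x
      using that unfolding sqrt_T_le_iff[OF n] by blast
    have "\<bar>emp_process n (couple n f U) x\<bar> \<le> sqrt (real n) * q" if x: "x \<in> {0..1}" for x
    proof -
      have "\<bar>sqrt (real n) * (drift_cdf f x - x)\<bar> \<le> c" using small[OF x] by (simp add: abs_mult)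
      moreover have "emp_process n (couple n f U) x = emp_process n U (drift_cdf f x) + sqrt (real n) * (drift_cdf f x - x)"
        using U x by (intro emp_process_couple[OF dens]) auto
      ultimately show ?thesis using W[OF drift_cdf_range[OF dens x]] by linarith
    qed
    then have "sqrt (real n) * kolmogorov_T (empirical_cdf n (couple n f U)) \<le> sqrt (real n) * q"
      unfolding sqrt_T_le_iff[OF n] by blast
    then show "U \<in> {U \<in> space (unif_law n). kolmogorov_T (empirical_cdf n (couple n f U)) \<le> q}"
      using U sq by simp
  qed
  also have "\<dots> = type2_error n q f" by (rule type2_error_eq(1)[OF dens, symmetric])
  finally show ?thesis .
qed

text \<open>Along the subsequence with small drift the type II error is at least \<open>1 - \<alpha>\<close> up to an arbitrarily small
term.\<close>

theorem not_consistent_if_drift_vanishes: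
  assumes dens: "\<And>n. n \<ge> 1 \<Longrightarrow> is_density (\<lambda>x. 1 + f n x)"
    and small: "\<And>c N. 0 < c \<Longrightarrow> \<exists>n\<ge>N. \<forall>x\<in>{0..1}. sqrt (real n) * \<bar>drift_cdf (f n) x - x\<bar> \<le> c"
    and \<alpha>: "0 < \<alpha>" "\<alpha> < 1"
  shows "\<not> alpha_consistent \<alpha> f"
proof
  assume "alpha_consistent \<alpha> f"
  define q where "q = critical_value \<alpha>"
  have lim: "(\<lambda>n. type1_error n (q n)) \<longlonglongrightarrow> \<alpha>"
    unfolding q_def by (rule type1_error_critical_value[OF \<alpha>])
  with \<open>alpha_consistent \<alpha> f\<close> have "limsup (\<lambda>n. ereal (type2_error n (q n) (f n))) < ereal (1 - \<alpha>)"
    unfolding alpha_consistent_def by blast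
  then obtain y where y: "limsup (\<lambda>n. ereal (type2_error n (q n) (f n))) < y" "y < ereal (1 - \<alpha>)"
    using dense by blast
  then have ev: "\<forall>\<^sub>F n in sequentially. ereal (type2_error n (q n) (f n)) < y"
    using Limsup_le_iff[of sequentially "\<lambda>n. ereal (type2_error n (q n) (f n))"] by blast
  then obtain n where "ereal (type2_error n (q n) (f n)) < y" by (auto simp: eventually_sequentially)
  then obtain y' where y': "y = ereal y'" using y(2) by (cases y) auto
  \<comment> \<open>A third of the gap: one part for the convergence of the type I error, one for its increment, and one to spare.\<close>
  define \<eta> where "\<eta> = (1 - \<alpha> - y') / 3"
  have \<eta>: "0 < \<eta>" using y y' by (simp add: \<eta>_def)
  obtain N1 where N1: "\<And>n. N1 \<le> n \<Longrightarrow> type2_error n (q n) (f n) < y'"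
    using ev y' by (auto simp: eventually_sequentially)
  obtain N2 where N2: "\<And>n. N2 \<le> n \<Longrightarrow> \<bar>type1_error n (q n) - \<alpha>\<bar> < \<eta>"
    using LIMSEQ_D[OF lim \<eta>] by auto
  obtain \<epsilon> N3 where \<epsilon>: "0 < \<epsilon>" and N3: "\<And>n q p. N3 \<le> n \<Longrightarrow> q - \<epsilon> / sqrt (real n) \<le> p \<Longrightarrow>
      type1_error n p \<le> type1_error n q + \<eta>"
    using type1_error_increment[OF \<eta>] by blast
  obtain n where n: "Suc (max N1 (max N2 N3)) \<le> n"
     and sm: "\<And>x. x \<in> {0..1} \<Longrightarrow> sqrt (real n) * \<bar>drift_cdf (f n) x - x\<bar> \<le> \<epsilon>"
    using small[OF \<epsilon>] by blast
  have "1 - type1_error n (q n - \<epsilon> / sqrt (real n)) \<le> type2_error n (q n) (f n)"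
    using n by (intro type2_error_lower dens sm) auto
  moreover have "type1_error n (q n - \<epsilon> / sqrt (real n)) \<le> type1_error n (q n) + \<eta>"
    using n by (intro N3) auto
  moreover have "type2_error n (q n) (f n) < y'" using n by (intro N1) auto
  moreover have "\<bar>type1_error n (q n) - \<alpha>\<bar> < \<eta>" using n by (intro N2) auto
  ultimately show False using \<eta> unfolding \<eta>_def by (simp add: field_simps abs_less_iff)
qed

section \<open>Consistency for a drift with equal local averages\<close>

text \<open>A tent of half-width \<open>\<delta>\<close> around \<open>b\<close>, normalised to integral one: a Lipschitz weight for local averages.\<close>

definition tent :: "real \<Rightarrow> real \<Rightarrow> real \<Rightarrow> real" where
  "tent \<delta> b x = max 0 (\<delta> - \<bar>x - b\<bar>) / \<delta>\<^sup>2"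

lemma tent_nonneg: "0 \<le> tent \<delta> b x"
  by (simp add: tent_def)

lemma tent_outside: "\<delta> \<le> \<bar>x - b\<bar> \<Longrightarrow> tent \<delta> b x = 0"
  by (simp add: tent_def)

lemma tent_continuous: "continuous_on S (tent \<delta> b)"
  unfolding tent_def[abs_def] by (cases "\<delta> = 0") (auto intro!: continuous_intros)

lemma tent_lipschitz:
  assumes "0 < \<delta>"
  shows "\<bar>tent \<delta> b x - tent \<delta> b y\<bar> \<le> 1 / \<delta>\<^sup>2 * \<bar>x - y\<bar>"
proof -
  have "\<bar>max 0 (\<delta> - \<bar>x - b\<bar>) - max 0 (\<delta> - \<bar>y - b\<bar>)\<bar> \<le> \<bar>x - y\<bar>" by (auto simp: max_def abs_real_def)
  then show ?thesis using assms
    by (simp add: tent_def divide_right_mono flip: diff_divide_distrib)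
qed

lemma tent_bounded:
  assumes "0 < \<delta>"
  shows "\<bar>tent \<delta> b x\<bar> \<le> 1 / \<delta>"
proof -
  have "max 0 (\<delta> - \<bar>x - b\<bar>) \<le> \<delta>" using assms by simp
  then have "tent \<delta> b x \<le> \<delta> / \<delta>\<^sup>2" unfolding tent_def by (intro divide_right_mono) auto
  then show ?thesis using tent_nonneg[of \<delta> b x] assms by (simp add: power2_eq_square)
qed

lemma integral_tent:
  assumes "0 < \<delta>" "\<delta> \<le> b" "b \<le> 1 - \<delta>"
  shows "(LINT x|unit_lborel. tent \<delta> b x) = 1"
proof -
  define k where "k = 1 / \<delta>\<^sup>2"
  have "(LBINT x:{0..1}. tent \<delta> b x) = (LBINT x. indicator {b - \<delta>..b} x *\<^sub>R ((x - (b - \<delta>)) * k)) +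
     (LBINT x. indicator {b..b + \<delta>} x *\<^sub>R ((b + \<delta> - x) * k))"
  proof (subst Bochner_Integration.integral_add[symmetric])
    show "integrable lborel (\<lambda>x. indicator {b - \<delta>..b} x *\<^sub>R ((x - (b - \<delta>)) * k))"
      "integrable lborel (\<lambda>x. indicator {b..b + \<delta>} x *\<^sub>R ((b + \<delta> - x) * k))"
      using assms by (intro borel_integrable_compact; auto intro!: continuous_intros)+
    show "(LBINT x:{0..1}. tent \<delta> b x) = (LBINT x. indicator {b - \<delta>..b} x *\<^sub>R ((x - (b - \<delta>)) * k) +
       indicator {b..b + \<delta>} x *\<^sub>R ((b + \<delta> - x) * k))"
      unfolding set_lebesgue_integral_def
    proof (rule integral_cong_AE)
      show "AE x in lborel. indicator {0..1} x *\<^sub>R tent \<delta> b x = indicator {b - \<delta>..b} x *\<^sub>R ((x - (b - \<delta>)) * k) +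
       indicator {b..b + \<delta>} x *\<^sub>R ((b + \<delta> - x) * k)"
        using AE_lborel_singleton[of b]
      proof eventually_elim
        case (elim x)
        then show ?case using assms by (auto simp: tent_def k_def max_def abs_real_def split: split_indicator)
      qed
    qed (auto simp: tent_def[abs_def])
  qed
  also have "(LBINT x. indicator {b - \<delta>..b} x *\<^sub>R ((x - (b - \<delta>)) * k)) = (b - (b - \<delta>))\<^sup>2 / 2 * k - (b - \<delta> - (b - \<delta>))\<^sup>2 / 2 * k"
    using assms by (intro integral_FTC_Icc)
      (auto intro!: derivative_eq_intros continuous_intros simp: has_real_derivative_iff_has_vector_derivative[symmetric])
  also have "(LBINT x. indicator {b..b + \<delta>} x *\<^sub>R ((b + \<delta> - x) * k)) =
      - (b + \<delta> - (b + \<delta>))\<^sup>2 / 2 * k - (- (b + \<delta> - b)\<^sup>2 / 2 * k)"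
    using assms by (intro integral_FTC_Icc)
      (auto intro!: derivative_eq_intros continuous_intros simp: has_real_derivative_iff_has_vector_derivative[symmetric] field_simps)
  finally show ?thesis using assms by (simp add: set_integral_unit k_def)
qed

lemma tent_average:
  assumes b: "0 < \<delta>" "\<delta> \<le> b" "b \<le> 1 - \<delta>"
    and h: "h \<in> borel_measurable unit_lborel" "\<And>x. x \<in> {0..1} \<Longrightarrow> \<bar>h x\<bar> \<le> B"
  shows "integrable unit_lborel (\<lambda>x. h x * tent \<delta> b x)"
    and "(\<And>x. x \<in> {0..1} \<Longrightarrow> \<bar>x - b\<bar> \<le> \<delta> \<Longrightarrow> \<bar>h x - v\<bar> \<le> e) \<Longrightarrow> \<bar>(LINT x|unit_lborel. h x * tent \<delta> b x) - v\<bar> \<le> e"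
proof -
  have tm: "tent \<delta> b \<in> borel_measurable unit_lborel"
    by (intro unit_borel_measurable borel_measurable_continuous_onI tent_continuous)
  show i: "integrable unit_lborel (\<lambda>x. h x * tent \<delta> b x)"
  proof (rule integrable_unit_bounded)
    fix x :: real assume x: "x \<in> {0..1}"
    show "\<bar>h x * tent \<delta> b x\<bar> \<le> B * (1 / \<delta>)"
      unfolding abs_mult using h(2)[OF x] tent_bounded[OF b(1), of b x]
      by (intro mult_mono) (auto intro: order.trans[OF abs_ge_zero])
  qed (use h tm in auto)
  have it: "integrable unit_lborel (tent \<delta> b)"
    by (rule integrable_unit_bounded[OF tm tent_bounded[OF b(1)]])
  assume e: "\<And>x. x \<in> {0..1} \<Longrightarrow> \<bar>x - b\<bar> \<le> \<delta> \<Longrightarrow> \<bar>h x - v\<bar> \<le> e"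
  have iv: "integrable unit_lborel (\<lambda>x. v * tent \<delta> b x)" using it by (rule integrable_mult_right)
  have ie: "integrable unit_lborel (\<lambda>x. e * tent \<delta> b x)" using it by (rule integrable_mult_right)
  have "(LINT x|unit_lborel. h x * tent \<delta> b x) - v = (LINT x|unit_lborel. h x * tent \<delta> b x - v * tent \<delta> b x)"
    by (subst Bochner_Integration.integral_diff[OF i iv]) (simp add: integral_tent[OF b])
  also have "\<bar>\<dots>\<bar> \<le> (LINT x|unit_lborel. e * tent \<delta> b x)"
  proof (rule integral_abs_bound[THEN order.trans], rule integral_mono)
    show "integrable unit_lborel (\<lambda>x. \<bar>h x * tent \<delta> b x - v * tent \<delta> b x\<bar>)"
      by (rule integrable_abs[OF Bochner_Integration.integrable_diff[OF i iv]])
    show "integrable unit_lborel (\<lambda>x. e * tent \<delta> b x)" by (rule ie)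
    fix x assume "x \<in> space unit_lborel"
    then have x: "x \<in> {0..1}" by simp
    show "\<bar>h x * tent \<delta> b x - v * tent \<delta> b x\<bar> \<le> e * tent \<delta> b x"
    proof (cases "\<bar>x - b\<bar> \<le> \<delta>")
      case True
      have "\<bar>h x * tent \<delta> b x - v * tent \<delta> b x\<bar> = \<bar>h x - v\<bar> * tent \<delta> b x"
        using tent_nonneg[of \<delta> b x] by (simp add: abs_mult flip: left_diff_distrib)
      then show ?thesis using e[OF x True] tent_nonneg[of \<delta> b x] by (simp add: mult_right_mono)
    next
      case False
      then show ?thesis by (simp add: tent_outside)
    qed
  qed
  also have "\<dots> = e" by (simp add: integral_tent[OF b])
  finally show "\<bar>(LINT x|unit_lborel. h x * tent \<delta> b x) - v\<bar> \<le> e" .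
qed

lemma emp_process_drift_measurable:
  assumes "is_density (\<lambda>x. 1 + f x)"
  shows "(\<lambda>x. emp_process n U (drift_cdf f x)) \<in> borel_measurable unit_lborel"
    and "drift_cdf f \<in> borel_measurable unit_lborel"
proof -
  show F: "drift_cdf f \<in> borel_measurable unit_lborel"
    using borel_measurable_continuous_on_restrict[OF drift_cdf_continuous[OF assms]]
    by (simp add: measurable_cong_sets[OF sets_restrict_space_cong[OF sets_lborel] refl])
  have "indicator {..u} (U i) = (indicator {U i..} u :: real)" for u i
    by (auto split: split_indicator)
  then have "emp_process n U = (\<lambda>u. sqrt (real n) * ((\<Sum>i<n. indicator {U i..} u) / real n - u))"
    by (simp add: fun_eq_iff emp_process_def empirical_cdf_sum)
  moreover have "(\<lambda>u. sqrt (real n) * ((\<Sum>i<n. indicator {U i..} u) / real n - u)) \<in> borel_measurable borel"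
    by measurable
  ultimately have "emp_process n U \<in> borel_measurable borel" by simp
  then show "(\<lambda>x. emp_process n U (drift_cdf f x)) \<in> borel_measurable unit_lborel"
    by (rule measurable_compose[OF F])
qed

text \<open>Compare averages over the windows at the left end and next to \<open>x\<^sub>0\<close>. If the path were flat, \<open>W \<circ> F\<close>
and \<open>- g\<close> would have nearly equal averages on each window. Those of \<open>g\<close> nearly agree by hypothesis, and at the left
end \<open>W \<circ> F\<close> is close to \<open>W(0) = 0\<close>. So \<open>W(F(x\<^sub>0))\<close> is small, hence \<open>g(x\<^sub>0)\<close> is. In units of \<open>c/16\<close> the
errors are \<open>2 + 2\<close> (flatness on the two windows), \<open>1\<close> (the averages of \<open>g\<close>) and \<open>1 + 1\<close> (oscillation of
\<open>W\<close>), then \<open>2\<close> more for flatness at \<open>x\<^sub>0\<close>: this is \<open>9 < 16\<close>.\<close>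

lemma regular_sample_not_flat:
  assumes dens: "is_density (\<lambda>x. 1 + f x)" and reg: "regular_sample n (c / 16) (4 * \<delta>) U"
    and \<delta>: "0 < \<delta>" "\<delta> \<le> 1/2" and c: "0 < c"
    and lip: "\<And>x y. x \<in> {0..1} \<Longrightarrow> y \<in> {0..1} \<Longrightarrow> \<bar>drift_cdf f x - drift_cdf f y\<bar> \<le> 2 * \<bar>x - y\<bar>"
    and x0: "x\<^sub>0 \<in> {0..1}" "c \<le> sqrt (real n) * \<bar>drift_cdf f x\<^sub>0 - x\<^sub>0\<bar>"
    and osc: "\<And>b. \<delta> \<le> b \<Longrightarrow> b \<le> 1 - \<delta> \<Longrightarrow>
      \<bar>LINT x|unit_lborel. sqrt (real n) * (drift_cdf f x - x) * (tent \<delta> b x - tent \<delta> \<delta> x)\<bar> \<le> c / 16"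
  shows "\<exists>x\<in>{0..1}. c / 8 < \<bar>emp_process n (couple n f U) x\<bar>"
proof (rule ccontr)
  assume "\<not> ?thesis"
  then have flat: "\<And>x. x \<in> {0..1} \<Longrightarrow> \<bar>emp_process n (couple n f U) x\<bar> \<le> c / 8" by (auto simp: not_less)
  note U = regular_sampleD(1)[OF reg]
  let ?F = "drift_cdf f"
  let ?W = "\<lambda>x. emp_process n U (?F x)"
  let ?g = "\<lambda>x. sqrt (real n) * (?F x - x)"
  have w: "\<bar>?W x + ?g x\<bar> \<le> c / 8" if "x \<in> {0..1}" for x
    using flat[OF that] emp_process_couple[OF dens U that] by simp
  note Fr = drift_cdf_range[OF dens]
  have g_bound: "\<bar>?g x\<bar> \<le> sqrt (real n) * 2" if "x \<in> {0..1}" for x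
    using Fr[OF that] that by (auto simp: abs_mult intro!: mult_left_mono)
  have W_bound: "\<bar>?W x\<bar> \<le> sqrt (real n) * 2 + c / 8" if "x \<in> {0..1}" for x
    using g_bound[OF that] w[OF that] by linarith
  have Wm: "?W \<in> borel_measurable unit_lborel" and Fm: "?F \<in> borel_measurable unit_lborel"
    using emp_process_drift_measurable[OF dens] by auto
  have gm: "?g \<in> borel_measurable unit_lborel"
    by (intro borel_measurable_times borel_measurable_diff borel_measurable_const Fm unit_borel_measurable)
      (rule measurable_ident_sets[OF refl])
  \<comment> \<open>The centre closest to \<open>x\<^sub>0\<close> whose window lies inside the unit interval.\<close>
  define b where "b = max \<delta> (min (1 - \<delta>) x\<^sub>0)"
  have b: "\<delta> \<le> b" "b \<le> 1 - \<delta>" "\<bar>b - x\<^sub>0\<bar> \<le> \<delta>"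
  proof -
    show "\<delta> \<le> b" "b \<le> 1 - \<delta>" using \<delta> by (simp_all add: b_def)
    consider "x\<^sub>0 \<le> \<delta>" "b = \<delta>" | "1 - \<delta> \<le> x\<^sub>0" "b = 1 - \<delta>" | "b = x\<^sub>0"
      using \<delta> unfolding b_def by linarith
    then show "\<bar>b - x\<^sub>0\<bar> \<le> \<delta>"
      using \<delta> x0(1) by cases auto
  qed
  have avg: "\<bar>(LINT x|unit_lborel. ?W x * tent \<delta> b' x) + (LINT x|unit_lborel. ?g x * tent \<delta> b' x)\<bar> \<le> c / 8"
    and ints: "integrable unit_lborel (\<lambda>x. ?W x * tent \<delta> b' x)" "integrable unit_lborel (\<lambda>x. ?g x * tent \<delta> b' x)"
    if b': "\<delta> \<le> b'" "b' \<le> 1 - \<delta>" for b'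
  proof -
    show ints: "integrable unit_lborel (\<lambda>x. ?W x * tent \<delta> b' x)" "integrable unit_lborel (\<lambda>x. ?g x * tent \<delta> b' x)"
      by (rule tent_average(1)[OF \<delta>(1) b' Wm W_bound], simp, rule tent_average(1)[OF \<delta>(1) b' gm g_bound], simp)
    have "\<bar>(LINT x|unit_lborel. (?W x + ?g x) * tent \<delta> b' x) - 0\<bar> \<le> c / 8"
      by (rule tent_average(2)[OF \<delta>(1) b', where B = "c / 8"]) (use w Wm gm in auto)
    then show "\<bar>(LINT x|unit_lborel. ?W x * tent \<delta> b' x) + (LINT x|unit_lborel. ?g x * tent \<delta> b' x)\<bar> \<le> c / 8"
      unfolding distrib_right by (simp only: Bochner_Integration.integral_add[OF ints] diff_0_right)
  qed
  have \<delta>b: "\<delta> \<le> 1 - \<delta>" using \<delta> by simp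
  \<comment> \<open>Since \<open>F\<close> is Lipschitz with constant two, the window \<open>[0, 2 \<delta>]\<close> is mapped into \<open>[0, 4 \<delta>]\<close>.\<close>
  have edge: "\<bar>(LINT x|unit_lborel. ?W x * tent \<delta> \<delta> x) - 0\<bar> \<le> c / 16"
  proof (rule tent_average(2)[OF \<delta>(1) order_refl \<delta>b Wm W_bound])
    fix x :: real assume x: "x \<in> {0..1}" "\<bar>x - \<delta>\<bar> \<le> \<delta>"
    have "\<bar>?F x - ?F 0\<bar> \<le> 2 * \<bar>x - 0\<bar>" using x by (intro lip) auto
    then have "\<bar>?F x - 0\<bar> \<le> 4 * \<delta>" using x drift_cdf_ends(1)[OF dens] by simp
    then show "\<bar>?W x - 0\<bar> \<le> c / 16"
      using regular_sampleD(3)[OF reg Fr[OF x(1)], of 0] regular_sampleD(2)[OF reg] by simp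
  qed
  have near: "\<bar>(LINT x|unit_lborel. ?W x * tent \<delta> b x) - ?W x\<^sub>0\<bar> \<le> c / 16"
  proof (rule tent_average(2)[OF \<delta>(1) b(1,2) Wm W_bound])
    fix x :: real assume x: "x \<in> {0..1}" "\<bar>x - b\<bar> \<le> \<delta>"
    have "\<bar>?F x - ?F x\<^sub>0\<bar> \<le> 2 * \<bar>x - x\<^sub>0\<bar>" using x x0 by (intro lip) auto
    also have "\<dots> \<le> 4 * \<delta>"
    proof -
      have "\<bar>x - x\<^sub>0\<bar> \<le> \<bar>x - b\<bar> + \<bar>b - x\<^sub>0\<bar>" by simp
      also have "\<dots> \<le> \<delta> + \<delta>" by (rule add_mono[OF x(2) b(3)])
      finally show ?thesis by simp
    qed
    finally show "\<bar>?W x - ?W x\<^sub>0\<bar> \<le> c / 16"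
      by (rule regular_sampleD(3)[OF reg Fr[OF x(1)] Fr[OF x0(1)]])
  qed
  have "\<bar>(LINT x|unit_lborel. ?g x * tent \<delta> b x) - (LINT x|unit_lborel. ?g x * tent \<delta> \<delta> x)\<bar> \<le> c / 16"
    using osc[OF b(1,2)] unfolding right_diff_distrib[of "_ * _" "tent \<delta> b _"]
    by (simp only: Bochner_Integration.integral_diff[OF ints(2)[OF b(1,2)] ints(2)[OF order_refl \<delta>b]])
  then have "\<bar>?W x\<^sub>0\<bar> \<le> 7 * c / 16"
    using avg[OF b(1,2)] avg[OF order_refl \<delta>b] edge near by linarith
  then have "\<bar>?g x\<^sub>0\<bar> \<le> 9 * c / 16" using w[OF x0(1)] by linarith
  then show False using x0(2) c by (simp add: abs_mult)
qed

text \<open>A level \<open>\<alpha>\<close> close to one forces critical values so small that acceptance contradicts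
\<open>regular_sample_not_flat\<close>, except on irregular samples. The small ball probability \<open>p\<close> of radius \<open>c/8\<close> tells how
close to one is enough; irregular samples are then given probability less than \<open>1 - \<alpha>\<close>.\<close>

theorem consistent_if_drift_oscillates:
  assumes dens: "\<And>n. n \<ge> 1 \<Longrightarrow> is_density (\<lambda>x. 1 + f n x)" and c: "0 < c"
    and lip: "\<And>n x y. n \<ge> N \<Longrightarrow> x \<in> {0..1} \<Longrightarrow> y \<in> {0..1} \<Longrightarrow>
      \<bar>drift_cdf (f n) x - drift_cdf (f n) y\<bar> \<le> 2 * \<bar>x - y\<bar>"
    and large: "\<And>n. n \<ge> N \<Longrightarrow> \<exists>x\<in>{0..1}. c \<le> sqrt (real n) * \<bar>drift_cdf (f n) x - x\<bar>"
    and osc: "\<And>\<delta> e. 0 < \<delta> \<Longrightarrow> 0 < e \<Longrightarrow> \<exists>n\<^sub>0. \<forall>n\<ge>n\<^sub>0. \<forall>b. \<delta> \<le> b \<longrightarrow> b \<le> 1 - \<delta> \<longrightarrow>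
      \<bar>LINT x|unit_lborel. sqrt (real n) * (drift_cdf (f n) x - x) * (tent \<delta> b x - tent \<delta> \<delta> x)\<bar> \<le> e"
  shows "\<exists>\<alpha>. 0 < \<alpha> \<and> \<alpha> < 1 \<and> alpha_consistent \<alpha> f"
proof -
  obtain p n\<^sub>0 where p: "0 < p" and ball: "\<And>n. n\<^sub>0 \<le> n \<Longrightarrow> p \<le> measure (unif_law n)
    {X \<in> space (unif_law n). sqrt (real n) * kolmogorov_T (empirical_cdf n X) \<le> c / 8}"
    using T_small_ball[of "c / 8"] c by auto
  have "p \<le> 1" using ball[of n\<^sub>0] unif_prob.prob_le_1[of n\<^sub>0] by (meson order.refl order.trans)
  \<comment> \<open>Strictly between \<open>1 - p\<close>, above which critical values are below \<open>c / 8\<close>, and one.\<close>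
  define \<alpha> where "\<alpha> = 1 - p / 2"
  have \<alpha>: "0 < \<alpha>" "\<alpha> < 1" using p \<open>p \<le> 1\<close> by (auto simp: \<alpha>_def)
  have "alpha_consistent \<alpha> f"
    unfolding alpha_consistent_def
  proof (intro allI impI)
    fix q assume lim: "(\<lambda>n. type1_error n (q n)) \<longlonglongrightarrow> \<alpha>"
    have "\<forall>\<^sub>F n in sequentially. 1 - p < type1_error n (q n)"
      using p by (intro order_tendstoD(1)[OF lim]) (simp add: \<alpha>_def)
    then obtain n1 where n1: "\<And>n. n1 \<le> n \<Longrightarrow> 1 - p < type1_error n (q n)"
      by (auto simp: eventually_sequentially)
    have crit: "sqrt (real n) * q n \<le> c / 8" if n: "Suc (max n\<^sub>0 n1) \<le> n" for n
    proof (rule ccontr)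
      assume "\<not> sqrt (real n) * q n \<le> c / 8"
      then have less: "c / 8 < sqrt (real n) * q n" by simp
      have sq: "0 < sqrt (real n)" using n by simp
      have "p \<le> measure (unif_law n) {X \<in> space (unif_law n). sqrt (real n) * kolmogorov_T (empirical_cdf n X) \<le> c / 8}"
        using n by (intro ball) simp
      also have "\<dots> \<le> measure (unif_law n) {X \<in> space (unif_law n). kolmogorov_T (empirical_cdf n X) \<le> q n}"
      proof (rule unif_prob.finite_measure_mono)
        show "{X \<in> space (unif_law n). sqrt (real n) * kolmogorov_T (empirical_cdf n X) \<le> c / 8} \<subseteq>
          {X \<in> space (unif_law n). kolmogorov_T (empirical_cdf n X) \<le> q n}"
        proof safe
          fix X assume "sqrt (real n) * kolmogorov_T (empirical_cdf n X) \<le> c / 8"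
          then have "sqrt (real n) * kolmogorov_T (empirical_cdf n X) \<le> sqrt (real n) * q n" using less by linarith
          then show "kolmogorov_T (empirical_cdf n X) \<le> q n" using sq by simp
        qed
      qed measurable
      also have "\<dots> = 1 - type1_error n (q n)" by (rule type1_error_compl)
      finally have "p \<le> 1 - type1_error n (q n)" .
      moreover have "n1 \<le> n" using n by simp
      ultimately show False using n1[of n] by simp
    qed
    \<comment> \<open>Irregular samples get probability \<open>p / 4\<close>, half of \<open>1 - \<alpha>\<close>.\<close>
    have "0 < c / 16" "0 < p / 4" using c p by auto
    from regular_samples[OF this] obtain d n2 where d: "0 < d" and
      G: "\<And>n. n2 \<le> n \<Longrightarrow> \<exists>G\<in>sets (unif_law n). 1 - p / 4 \<le> measure (unif_law n) G \<and> (\<forall>X\<in>G. regular_sample n (c / 16) d X)"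
      by blast
    define \<delta> where "\<delta> = min (d / 4) (1/2)"
    have \<delta>: "0 < \<delta>" "\<delta> \<le> 1/2" "4 * \<delta> \<le> d" using d by (auto simp: \<delta>_def min_def)
    obtain n3 where n3: "\<And>n b. n3 \<le> n \<Longrightarrow> \<delta> \<le> b \<Longrightarrow> b \<le> 1 - \<delta> \<Longrightarrow>
      \<bar>LINT x|unit_lborel. sqrt (real n) * (drift_cdf (f n) x - x) * (tent \<delta> b x - tent \<delta> \<delta> x)\<bar> \<le> c / 16"
      using osc[OF \<delta>(1), of "c / 16"] c by auto
    have small: "type2_error n (q n) (f n) \<le> p / 4"
      if n: "Suc (max N (max n\<^sub>0 (max n1 (max n2 n3)))) \<le> n" for n
    proof -
      have n0: "0 < n" and nn: "N \<le> n" "n2 \<le> n" "n3 \<le> n" using n by linarith+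
      have dn: "is_density (\<lambda>x. 1 + f n x)" using n by (intro dens) simp
      obtain G where G: "G \<in> sets (unif_law n)" "1 - p / 4 \<le> measure (unif_law n) G"
          "\<And>X. X \<in> G \<Longrightarrow> regular_sample n (c / 16) d X"
        using G[OF nn(2)] by blast
      obtain x\<^sub>0 where x0: "x\<^sub>0 \<in> {0..1}" "c \<le> sqrt (real n) * \<bar>drift_cdf (f n) x\<^sub>0 - x\<^sub>0\<bar>"
        using large[OF nn(1)] by blast
      let ?A = "{U \<in> space (unif_law n). kolmogorov_T (empirical_cdf n (couple n (f n) U)) \<le> q n}"
      have "?A \<subseteq> space (unif_law n) - G"
      proof
        fix U assume U: "U \<in> ?A"
        have "U \<notin> G"
        proof
          assume "U \<in> G"
          then have reg: "regular_sample n (c / 16) (4 * \<delta>) U"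
            using G(3)[of U] \<delta>(3) by (auto simp: regular_sample_def)
          have "\<exists>x\<in>{0..1}. c / 8 < \<bar>emp_process n (couple n (f n) U) x\<bar>"
            by (rule regular_sample_not_flat[OF dn reg \<delta>(1,2) c lip[OF nn(1)] x0 n3[OF nn(3)]])
          then have "\<not> sqrt (real n) * kolmogorov_T (empirical_cdf n (couple n (f n) U)) \<le> c / 8"
            unfolding sqrt_T_le_iff[OF n0] by (meson not_le)
          moreover have "sqrt (real n) * kolmogorov_T (empirical_cdf n (couple n (f n) U)) \<le> sqrt (real n) * q n"
            using U by (intro mult_left_mono) auto
          moreover have "sqrt (real n) * q n \<le> c / 8" using n by (intro crit) simp
          ultimately show False by linarith
        qed
        then show "U \<in> space (unif_law n) - G" using U by auto
      qed
      then have "measure (unif_law n) ?A \<le> measure (unif_law n) (space (unif_law n) - G)"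
        using G(1) by (intro unif_prob.finite_measure_mono) auto
      then show ?thesis
        using G by (simp add: type2_error_eq(1)[OF dn] unif_prob.prob_compl)
    qed
    have "limsup (\<lambda>n. ereal (type2_error n (q n) (f n))) \<le> ereal (p / 4)"
    proof (rule Limsup_bounded)
      show "\<forall>\<^sub>F n in sequentially. ereal (type2_error n (q n) (f n)) \<le> ereal (p / 4)"
        using small by (auto simp: eventually_sequentially intro!: exI)
    qed
    also have "\<dots> < ereal (1 - \<alpha>)" using p by (simp add: \<alpha>_def)
    finally show "limsup (\<lambda>n. ereal (type2_error n (q n) (f n))) < ereal (1 - \<alpha>)" .
  qed
  then show ?thesis using \<alpha> by blast
qed

section \<open>Vanishing moments of a compactly supported wavelet\<close>

lemma compact_support_integrable:
  fixes h :: "real \<Rightarrow> real"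
  assumes "continuous_on UNIV h" "\<And>x. x \<notin> {a..b} \<Longrightarrow> h x = 0"
  shows "integrable lborel h"
proof -
  have "integrable lborel (\<lambda>x. indicator {a..b} x *\<^sub>R h x)"
    by (rule borel_integrable_compact[OF compact_Icc continuous_on_subset[OF assms(1)]]) simp
  also have "(\<lambda>x. indicator {a..b} x *\<^sub>R h x) = h"
    using assms(2) by (auto simp: fun_eq_iff split: split_indicator)
  finally show ?thesis .
qed

lemma compact_support_integral:
  fixes h H :: "real \<Rightarrow> real"
  assumes "continuous_on UNIV h" "\<And>x. x \<notin> {a..b} \<Longrightarrow> h x = 0" "a \<le> b"
    and "\<And>x. (H has_real_derivative h x) (at x)"
  shows "(LBINT x. h x) = H b - H a"
proof -
  have "(LBINT x. indicator {a..b} x *\<^sub>R h x) = H b - H a"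
    using assms
    by (intro integral_FTC_Icc) (auto intro: has_field_derivative_at_within continuous_on_subset
        simp: has_real_derivative_iff_has_vector_derivative[symmetric])
  also have "(\<lambda>x. indicator {a..b} x *\<^sub>R h x) = h"
    using assms(2) by (auto simp: fun_eq_iff split: split_indicator)
  finally show ?thesis .
qed

text \<open>The substitution \<open>y = 2\<^sup>k (x + m) - j\<close>.\<close>

lemma integral_affine_dyadic:
  fixes h g :: "real \<Rightarrow> real"
  shows "(LBINT x. h (2 ^ k * (x + m) - j) * g x) = (LBINT y. h y * g ((y + j) / 2 ^ k - m)) / 2 ^ k"
proof -
  have "(LBINT x. h (2 ^ k * (x + m) - j) * g x) = \<bar>1 / 2 ^ k\<bar> *\<^sub>R
     (LBINT y. h (2 ^ k * ((j / 2 ^ k - m + 1 / 2 ^ k * y) + m) - j) * g (j / 2 ^ k - m + 1 / 2 ^ k * y))"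
    by (rule lborel_integral_real_affine) simp
  also have "(\<lambda>y. h (2 ^ k * ((j / 2 ^ k - m + 1 / 2 ^ k * y) + m) - j) * g (j / 2 ^ k - m + 1 / 2 ^ k * y))
     = (\<lambda>y. h y * g ((y + j) / 2 ^ k - m))"
  proof
    fix y :: real
    have "2 ^ k * ((j / 2 ^ k - m + 1 / 2 ^ k * y) + m) - j = y" by (simp add: field_simps)
    moreover have "j / 2 ^ k - m + 1 / 2 ^ k * y = (y + j) / 2 ^ k - m" by (simp add: field_simps)
    ultimately show "h (2 ^ k * ((j / 2 ^ k - m + 1 / 2 ^ k * y) + m) - j) * g (j / 2 ^ k - m + 1 / 2 ^ k * y)
     = h y * g ((y + j) / 2 ^ k - m)" by (simp only:)
  qed
  finally show ?thesis by simp
qed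

text \<open>Integrating a periodisation over the circle is integrating over the line: the cells \<open>[m, m + 1]\<close> tile
the support.\<close>

lemma unfold_circle:
  fixes h :: "real \<Rightarrow> real" and M :: nat
  assumes h: "continuous_on UNIV h" "\<And>x. real M \<le> \<bar>x\<bar> \<Longrightarrow> h x = 0"
  shows "(\<Sum>m\<in>{- int M..int M}. LBINT x:{0..1}. h (x + of_int m)) = (LBINT x. h x)"
proof -
  \<comment> \<open>With an antiderivative of \<open>h\<close> the sum over the cells telescopes.\<close>
  obtain g where g: "\<And>x. x \<in> {- real M..real M + 1} \<Longrightarrow> (g has_vector_derivative h x) (at x within {- real M..real M + 1})"
    using antiderivative_continuous[of "- real M" "real M + 1" h] continuous_on_subset[OF h(1)] by blast
  have cell: "(LBINT x:{0..1}. h (x + of_int m)) = g (of_int (m + 1)) - g (of_int m)" if m: "m \<in> {- int M..int M}" for m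
  proof -
    have "(LBINT x:{0..1}. h (x + of_int m)) = (\<lambda>x. g (x + of_int m)) 1 - (\<lambda>x. g (x + of_int m)) 0"
      unfolding set_lebesgue_integral_def
    proof (rule integral_FTC_Icc)
      fix x :: real assume x: "0 \<le> x" "x \<le> 1"
      have "(\<lambda>x. x + real_of_int m) ` {0..1} \<subseteq> {- real M..real M + 1}" using m by auto
      moreover have "((\<lambda>x. x + real_of_int m) has_vector_derivative 1) (at x within {0..1})"
        by (auto intro!: derivative_eq_intros)
      moreover have "(g has_vector_derivative h (x + real_of_int m)) (at (x + real_of_int m) within (\<lambda>x. x + real_of_int m) ` {0..1})"
        using m x by (intro has_vector_derivative_within_subset[OF g]) auto
      ultimately have "((g \<circ> (\<lambda>x. x + real_of_int m)) has_vector_derivative (1 *\<^sub>R h (x + of_int m))) (at x within {0..1})"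
        by (intro vector_diff_chain_within)
      then show "((\<lambda>x. g (x + of_int m)) has_vector_derivative h (x + of_int m)) (at x within {0..1})"
        by (simp add: o_def)
    next
      show "continuous_on {0..1} (\<lambda>x. h (x + of_int m))"
        by (intro continuous_on_compose2[OF h(1)] continuous_intros) auto
    qed simp
    then show ?thesis by (simp add: add.commute)
  qed
  have tel: "(\<Sum>m\<in>{- int N..int N}. g (of_int (m + 1)) - g (of_int m)) = g (real N + 1) - g (- real N)" for N
  proof (induction N)
    case (Suc N)
    have "{- int (Suc N)..int (Suc N)} = insert (- int (Suc N)) (insert (int (Suc N)) {- int N..int N})" by auto
    then show ?case using Suc by (simp add: algebra_simps)
  qed (simp add: add.commute)
  have "(LBINT x. h x) = (LBINT x. indicator {- real M..real M + 1} x *\<^sub>R h x)"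
    using h(2) by (intro Bochner_Integration.integral_cong) (auto split: split_indicator)
  also have "\<dots> = g (real M + 1) - g (- real M)"
    using g by (intro integral_FTC_Icc) (auto intro: continuous_on_subset[OF h(1)])
  finally show ?thesis using tel[of M] cell by simp
qed

text \<open>Integer translates of a compact support overlap a bounded number of times.\<close>

lemma sum_translates_le:
  fixes h :: "real \<Rightarrow> real"
  assumes h: "\<And>x. \<bar>h x\<bar> \<le> B" "\<And>x. x \<notin> {a..b} \<Longrightarrow> h x = 0" and ab: "a \<le> b" and J: "finite J"
  shows "(\<Sum>j\<in>J. \<bar>h (y - real j)\<bar>) \<le> B * (b - a + 1)"
proof -
  define S where "S = {j\<in>J. a \<le> y - real j \<and> y - real j \<le> b}"
  have B: "0 \<le> B" using h(1)[of 0] by linarith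
  have "int ` S \<subseteq> {\<lceil>y - b\<rceil>..\<lfloor>y - a\<rfloor>}" by (auto simp: S_def ceiling_le_iff le_floor_iff)
  then have "card (int ` S) \<le> card {\<lceil>y - b\<rceil>..\<lfloor>y - a\<rfloor>}" by (intro card_mono) auto
  then have "card S \<le> nat (\<lfloor>y - a\<rfloor> - \<lceil>y - b\<rceil> + 1)" by (simp add: card_image)
  then have "real (card S) \<le> real (nat (\<lfloor>y - a\<rfloor> - \<lceil>y - b\<rceil> + 1))" by linarith
  also have "\<dots> \<le> b - a + 1"
  proof -
    have "real_of_int (\<lfloor>y - a\<rfloor> - \<lceil>y - b\<rceil> + 1) \<le> b - a + 1" by linarith
    then show ?thesis using ab by (cases "0 \<le> \<lfloor>y - a\<rfloor> - \<lceil>y - b\<rceil> + 1") (auto simp: of_nat_nat)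
  qed
  finally have c: "real (card S) \<le> b - a + 1" .
  have "(\<Sum>j\<in>J. \<bar>h (y - real j)\<bar>) = (\<Sum>j\<in>S. \<bar>h (y - real j)\<bar>)"
    using J h(2) by (intro sum.mono_neutral_right) (auto simp: S_def)
  also have "\<dots> \<le> (\<Sum>j\<in>S. B)" by (intro sum_mono h)
  also have "\<dots> \<le> B * (b - a + 1)" using c B by (simp add: mult.commute mult_left_mono)
  finally show ?thesis .
qed

lemma dyadic_floor_tendsto: "(\<lambda>k. (y + of_int \<lfloor>2 ^ k * p\<rfloor>) / 2 ^ k) \<longlonglongrightarrow> (p::real)"
proof (rule tendsto_sandwich)
  have z: "(\<lambda>k. c / 2 ^ k) \<longlonglongrightarrow> 0" for c :: real
  proof -
    have "(\<lambda>k. c * (1/2) ^ k) \<longlonglongrightarrow> c * 0" by (intro tendsto_mult tendsto_const LIMSEQ_realpow_zero) auto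
    then show ?thesis by (simp add: power_divide)
  qed
  have "(y + of_int \<lfloor>2 ^ k * p\<rfloor>) / 2 ^ k \<le> (y + 2 ^ k * p) / 2 ^ k" for k
    by (intro divide_right_mono) auto
  then show "\<forall>\<^sub>F k in sequentially. (y + of_int \<lfloor>2 ^ k * p\<rfloor>) / 2 ^ k \<le> p + y / 2 ^ k"
    by (auto simp: add_divide_distrib add.commute)
  have "(y + (2 ^ k * p - 1)) / 2 ^ k \<le> (y + of_int \<lfloor>2 ^ k * p\<rfloor>) / 2 ^ k" for k
    by (intro divide_right_mono) (linarith, simp)
  then show "\<forall>\<^sub>F k in sequentially. p + (y - 1) / 2 ^ k \<le> (y + of_int \<lfloor>2 ^ k * p\<rfloor>) / 2 ^ k"
    by (auto simp: add_divide_distrib diff_divide_distrib algebra_simps)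
  show "(\<lambda>k. p + y / 2 ^ k) \<longlonglongrightarrow> p" "(\<lambda>k. p + (y - 1) / 2 ^ k) \<longlonglongrightarrow> p"
    using tendsto_add[OF tendsto_const z] by fastforce+
qed

text \<open>Orthogonality of \<open>h\<close> to all dyadic rescalings of \<open>g\<close> forces \<open>h\<close> to have mean zero unless \<open>g\<close> vanishes: choose the translations
so that the rescaled functions zoom in at the point \<open>p\<close>, where they converge to the constant \<open>g p\<close>.\<close>

lemma integral_zoom_limit:
  fixes g h :: "real \<Rightarrow> real"
  assumes g: "continuous_on UNIV g" "\<And>x. \<bar>g x\<bar> \<le> B" and h: "integrable lborel h"
    and zero: "\<And>k j. 1 \<le> k \<Longrightarrow> (LBINT y. g ((y + of_int j) / 2 ^ k) * h y) = 0"
  shows "g p * (LBINT y. h y) = 0"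
proof -
  have "(\<lambda>k. LBINT y. g ((y + of_int \<lfloor>2 ^ k * p\<rfloor>) / 2 ^ k) * h y) \<longlonglongrightarrow> (LBINT y. g p * h y)"
  proof (rule integral_dominated_convergence[where w = "\<lambda>y. B * \<bar>h y\<bar>"])
    have [measurable]: "g \<in> borel_measurable borel" "h \<in> borel_measurable lborel"
      using g(1) h by (auto intro: borel_measurable_continuous_onI)
    show "(\<lambda>y. g p * h y) \<in> borel_measurable lborel"
      "\<And>k. (\<lambda>y. g ((y + of_int \<lfloor>2 ^ k * p\<rfloor>) / 2 ^ k) * h y) \<in> borel_measurable lborel" by measurable
    show "integrable lborel (\<lambda>y. B * \<bar>h y\<bar>)" using h by auto
    show "AE y in lborel. (\<lambda>k. g ((y + of_int \<lfloor>2 ^ k * p\<rfloor>) / 2 ^ k) * h y) \<longlonglongrightarrow> g p * h y"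
    proof (intro AE_I2 tendsto_mult tendsto_const)
      fix y
      have "isCont g p" using g(1) by (simp add: continuous_on_eq_continuous_at)
      then show "(\<lambda>k. g ((y + of_int \<lfloor>2 ^ k * p\<rfloor>) / 2 ^ k)) \<longlonglongrightarrow> g p"
        by (rule isCont_tendsto_compose[OF _ dyadic_floor_tendsto])
    qed
    fix k
    show "AE y in lborel. norm (g ((y + of_int \<lfloor>2 ^ k * p\<rfloor>) / 2 ^ k) * h y) \<le> B * \<bar>h y\<bar>"
      using g(2) by (intro AE_I2) (auto simp: abs_mult intro: mult_right_mono)
  qed
  moreover have "(\<lambda>k. LBINT y. g ((y + of_int \<lfloor>2 ^ k * p\<rfloor>) / 2 ^ k) * h y) \<longlonglongrightarrow> 0"
    by (rule tendsto_eventually) (use zero in \<open>auto simp: eventually_sequentially intro!: exI[of _ 1]\<close>)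
  ultimately have "(LBINT y. g p * h y) = 0" by (rule LIMSEQ_unique)
  then show ?thesis using h by simp
qed

text \<open>What remains of a mother wavelet: an orthonormal dyadic system generated by a continuously differentiable
function of compact support.\<close>

locale compact_wavelet =
  fixes \<phi> :: "real \<Rightarrow> real" and a\<^sub>1 a\<^sub>2 :: real
  assumes orthonormal: "\<And>k j k' j'. (LINT x|lborel. dyadic_wavelet \<phi> k j x * dyadic_wavelet \<phi> k' j' x) =
        (if k = k' \<and> j = j' then 1 else 0)"
    and deriv_\<phi>: "\<And>x. (\<phi> has_real_derivative deriv \<phi> x) (at x)"
    and cont_deriv: "continuous_on UNIV (deriv \<phi>)"
    and outside: "\<And>x. x \<notin> {a\<^sub>1..a\<^sub>2} \<Longrightarrow> \<phi> x = 0"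
    and a_less: "a\<^sub>1 < a\<^sub>2"
begin

lemma continuous_\<phi>: "continuous_on UNIV \<phi>"
  by (intro continuous_at_imp_continuous_on ballI DERIV_isCont[OF deriv_\<phi>])

lemma deriv_outside:
  assumes "x \<notin> {a\<^sub>1..a\<^sub>2}" shows "deriv \<phi> x = 0"
proof -
  have "((\<lambda>_. 0) has_real_derivative deriv \<phi> x) (at x)"
    by (rule has_field_derivative_transform_within_open[OF deriv_\<phi>, of "- {a\<^sub>1..a\<^sub>2}"]) (use assms outside in auto)
  then show ?thesis using DERIV_const DERIV_unique by blast
qed

lemma compact_support_bounded:
  assumes "continuous_on UNIV h" "\<And>x. x \<notin> {a\<^sub>1..a\<^sub>2} \<Longrightarrow> h x = (0::real)"
  shows "\<exists>B>0. \<forall>x. \<bar>h x\<bar> \<le> B"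
proof -
  have "compact (h ` {a\<^sub>1..a\<^sub>2})"
    using assms(1) by (intro compact_continuous_image) (auto intro: continuous_on_subset)
  then have "bounded (h ` {a\<^sub>1..a\<^sub>2})" by (rule compact_imp_bounded)
  then obtain B where B: "B > 0" "\<And>x. x \<in> {a\<^sub>1..a\<^sub>2} \<Longrightarrow> \<bar>h x\<bar> \<le> B"
    by (auto simp: bounded_pos)
  have "\<bar>h x\<bar> \<le> B" for x
    using B assms(2)[of x] by (cases "x \<in> {a\<^sub>1..a\<^sub>2}") auto
  then show ?thesis using B by blast
qed

text \<open>The primitive of \<open>\<phi>\<close>; its lower limit lies outside the support so that the primitive is differentiable
everywhere, including the left end of the support.\<close>

definition prim :: "real \<Rightarrow> real" where
  "prim y = integral {a\<^sub>1 - 1..y} \<phi>"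

lemma prim_left: "y \<le> a\<^sub>1 \<Longrightarrow> prim y = 0"
proof -
  assume y: "y \<le> a\<^sub>1"
  have "integral {a\<^sub>1 - 1..y} \<phi> = integral {a\<^sub>1 - 1..y} (\<lambda>_. 0)"
  proof (rule integral_spike[of "{a\<^sub>1}"])
    show "\<And>x. x \<in> {a\<^sub>1 - 1..y} - {a\<^sub>1} \<Longrightarrow> 0 = \<phi> x" using y outside by auto
  qed simp
  then show ?thesis by (simp add: prim_def)
qed

lemma prim_deriv: "(prim has_real_derivative \<phi> x) (at x)"
proof (cases "x < a\<^sub>1")
  case True
  have "((\<lambda>_. 0) has_real_derivative 0) (at x)" by simp
  then have "(prim has_real_derivative 0) (at x)"
    by (rule has_field_derivative_transform_within_open[of _ _ _ "{..<a\<^sub>1}"]) (use True prim_left in auto)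
  then show ?thesis using outside[of x] True by simp
next
  case False
  have "((\<lambda>y. integral {a\<^sub>1 - 1..y} \<phi>) has_real_derivative \<phi> x) (at x within {a\<^sub>1 - 1..x + 1})"
    using False by (intro integral_has_real_derivative continuous_on_subset[OF continuous_\<phi>]) auto
  moreover have "at x within {a\<^sub>1 - 1..x + 1} = at x"
    using False by (intro at_within_interior) (auto simp: interior_atLeastAtMost_real)
  ultimately show ?thesis by (simp add: prim_def[abs_def])
qed

lemma continuous_prim: "continuous_on UNIV prim"
  by (intro continuous_at_imp_continuous_on ballI DERIV_isCont[OF prim_deriv])

lemma integrable_\<phi>: "integrable lborel \<phi>"
  by (rule compact_support_integrable[OF continuous_\<phi> outside])

lemma \<phi>_nonzero: "\<exists>p. \<phi> p \<noteq> 0"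
proof (rule ccontr)
  assume "\<not> ?thesis"
  then have "dyadic_wavelet \<phi> 0 0 = (\<lambda>_. 0)" by (auto simp: dyadic_wavelet_def fun_eq_iff)
  then have "(LINT x|lborel. dyadic_wavelet \<phi> 0 0 x * dyadic_wavelet \<phi> 0 0 x) = 0" by simp
  then show False unfolding orthonormal by simp
qed

lemma dyadic_wavelet_nat:
  "dyadic_wavelet \<phi> (int k) j x = 2 powr (real k / 2) * \<phi> (2 ^ k * x - of_int j)"
  by (simp add: dyadic_wavelet_def)

text \<open>Orthogonality of the wavelets of level \<open>k\<close> to the mother wavelet, after rescaling.\<close>

lemma zoom_orthogonal:
  assumes "1 \<le> k"
  shows "(LBINT y. \<phi> ((y + of_int j) / 2 ^ k) * \<phi> y) = 0"
proof -
  have "(LINT x|lborel. dyadic_wavelet \<phi> (int k) j x * dyadic_wavelet \<phi> 0 0 x) = 0"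
    using orthonormal[of "int k" j 0 0] assms by simp
  also have "(\<lambda>x. dyadic_wavelet \<phi> (int k) j x * dyadic_wavelet \<phi> 0 0 x) =
     (\<lambda>x. 2 powr (real k / 2) * (\<phi> (2 ^ k * (x + 0) - of_int j) * \<phi> x))"
    unfolding dyadic_wavelet_nat by (auto simp: dyadic_wavelet_def fun_eq_iff)
  finally have "(LBINT x. \<phi> (2 ^ k * (x + 0) - of_int j) * \<phi> x) = 0" by simp
  then show ?thesis unfolding integral_affine_dyadic by (simp add: mult.commute)
qed

text \<open>The wavelet has mean zero, because it is orthogonal to rescalings of itself which look locally constant.\<close>

lemma integral_\<phi>: "(LBINT y. \<phi> y) = 0"
proof -
  obtain p where "\<phi> p \<noteq> 0" using \<phi>_nonzero by blast
  moreover obtain B where "\<And>x. \<bar>\<phi> x\<bar> \<le> B" using compact_support_bounded[OF continuous_\<phi> outside] by blast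
  then have "\<phi> p * (LBINT y. \<phi> y) = 0"
    by (intro integral_zoom_limit[OF continuous_\<phi> _ integrable_\<phi> zoom_orthogonal])
  ultimately show ?thesis by simp
qed

text \<open>As the wavelet has mean zero, its primitive again has compact support.\<close>

lemma prim_outside:
  assumes "y \<notin> {a\<^sub>1..a\<^sub>2}" shows "prim y = 0"
proof (cases "y < a\<^sub>1")
  case False
  then have y: "a\<^sub>2 < y" using assms by auto
  have "(LBINT x. \<phi> x) = prim y - prim a\<^sub>1"
    using y a_less outside by (intro compact_support_integral continuous_\<phi> prim_deriv) auto
  then show ?thesis using integral_\<phi> prim_left[of a\<^sub>1] by simp
qed (use prim_left in simp)

lemma integrable_prim: "integrable lborel prim"
  by (rule compact_support_integrable[OF continuous_prim prim_outside])

text \<open>Integration by parts moves one derivative from the second factor of \<open>zoom_orthogonal\<close> to the first.\<close>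

lemma zoom_orthogonal_prim:
  assumes "1 \<le> k"
  shows "(LBINT y. deriv \<phi> ((y + of_int j) / 2 ^ k) * prim y) = 0"
proof -
  let ?x = "\<lambda>y::real. (y + of_int j) / 2 ^ k"
  have cx: "continuous_on UNIV ?x" by (auto intro!: continuous_intros)
  have c1: "continuous_on UNIV (\<lambda>y. \<phi> (?x y) * \<phi> y)"
    by (intro continuous_on_mult continuous_on_compose2[OF continuous_\<phi> cx] continuous_\<phi>) auto
  have c2: "continuous_on UNIV (\<lambda>y. deriv \<phi> (?x y) * prim y)"
    by (intro continuous_on_mult continuous_on_compose2[OF cont_deriv cx] continuous_prim) auto
  have i1: "integrable lborel (\<lambda>y. \<phi> (?x y) * \<phi> y)"
    by (rule compact_support_integrable[OF c1, of a\<^sub>1 a\<^sub>2]) (simp add: outside)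
  have i2: "integrable lborel (\<lambda>y. deriv \<phi> (?x y) * prim y)"
    by (rule compact_support_integrable[OF c2, of a\<^sub>1 a\<^sub>2]) (simp add: prim_outside)
  have "(LBINT y. \<phi> (?x y) * \<phi> y + 1 / 2 ^ k * (deriv \<phi> (?x y) * prim y)) =
     \<phi> (?x (a\<^sub>2 + 1)) * prim (a\<^sub>2 + 1) - \<phi> (?x (a\<^sub>1 - 1)) * prim (a\<^sub>1 - 1)"
  proof (rule compact_support_integral[where H = "\<lambda>y. \<phi> (?x y) * prim y"])
    show "continuous_on UNIV (\<lambda>y. \<phi> (?x y) * \<phi> y + 1 / 2 ^ k * (deriv \<phi> (?x y) * prim y))"
      by (intro continuous_on_add c1 continuous_on_mult_left c2)
    fix y :: real
    show "((\<lambda>y. \<phi> (?x y) * prim y) has_real_derivative \<phi> (?x y) * \<phi> y + 1 / 2 ^ k * (deriv \<phi> (?x y) * prim y)) (at y)"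
      by (auto intro!: derivative_eq_intros prim_deriv DERIV_chain2[OF deriv_\<phi>])
    assume "y \<notin> {a\<^sub>1 - 1..a\<^sub>2 + 1}"
    then have "y \<notin> {a\<^sub>1..a\<^sub>2}" by auto
    then show "\<phi> (?x y) * \<phi> y + 1 / 2 ^ k * (deriv \<phi> (?x y) * prim y) = 0"
      by (simp add: outside prim_outside)
  qed (use a_less in simp)
  also have "\<dots> = 0" using prim_outside[of "a\<^sub>2 + 1"] prim_outside[of "a\<^sub>1 - 1"] by simp
  finally have "(LBINT y. \<phi> (?x y) * \<phi> y) + 1 / 2 ^ k * (LBINT y. deriv \<phi> (?x y) * prim y) = 0"
    using i1 i2 by simp
  then show ?thesis using zoom_orthogonal[OF assms, of j] by simp
qed

text \<open>The second vanishing moment, by the argument for the first, applied to \<open>deriv \<phi>\<close> in place of \<open>\<phi>\<close>. It makes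
averages of primitives of wavelets of high frequency negligible.\<close>

lemma integral_prim: "(LBINT y. prim y) = 0"
proof -
  have "\<exists>p. deriv \<phi> p \<noteq> 0"
  proof (rule ccontr)
    assume "\<not> ?thesis"
    then have "(\<phi> has_real_derivative 0) (at x)" for x using deriv_\<phi>[of x] by simp
    then have "\<phi> x = \<phi> (a\<^sub>1 - 1)" for x by (intro DERIV_isconst_all) auto
    then show False using \<phi>_nonzero outside[of "a\<^sub>1 - 1"] by auto
  qed
  then obtain p where "deriv \<phi> p \<noteq> 0" by blast
  moreover obtain B where "\<And>x. \<bar>deriv \<phi> x\<bar> \<le> B" using compact_support_bounded[OF cont_deriv deriv_outside] by blast
  then have "deriv \<phi> p * (LBINT y. prim y) = 0"
    by (intro integral_zoom_limit[OF cont_deriv _ integrable_prim zoom_orthogonal_prim])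
  ultimately show ?thesis by simp
qed

end

section \<open>Estimates for periodised wavelets\<close>

lemma two_powr_half: "2 powr (real k / 2) = sqrt 2 ^ k"
proof -
  have "sqrt 2 ^ k = (2 powr (1/2)) powr real k" by (simp add: powr_half_sqrt powr_realpow)
  then show ?thesis by (simp add: powr_powr)
qed

lemma sqrt2_power_mult: "sqrt 2 ^ k * sqrt 2 ^ k = 2 ^ k"
  by (simp flip: power_mult_distrib)

lemma sum_cong_translates:
  fixes v :: "real \<Rightarrow> real" and M :: nat
  assumes v: "\<And>x. real M \<le> \<bar>x\<bar> \<Longrightarrow> v x = 0" and x: "x \<in> {0..1}" and m: "m \<in> {- int M..int M}"
  shows "(\<Sum>m'\<in>{- int M..int M}. v (x + of_int m')) = (\<Sum>d\<in>{- int (2 * M)..int (2 * M)}. v (x + of_int m + of_int d))"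
proof -
  have "(\<Sum>d\<in>{- int (2 * M)..int (2 * M)}. v (x + of_int m + of_int d)) =
      (\<Sum>m'\<in>(\<lambda>d. m + d) ` {- int (2 * M)..int (2 * M)}. v (x + of_int m'))"
    by (subst sum.reindex) (auto simp: inj_on_def add.assoc)
  also have "\<dots> = (\<Sum>m'\<in>{- int M..int M}. v (x + of_int m'))"
  proof (rule sum.mono_neutral_right)
    show "{- int M..int M} \<subseteq> (\<lambda>d. m + d) ` {- int (2 * M)..int (2 * M)}"
    proof
      fix m' assume "m' \<in> {- int M..int M}"
      then show "m' \<in> (\<lambda>d. m + d) ` {- int (2 * M)..int (2 * M)}"
        using m by (intro image_eqI[of _ _ "m' - m"]) auto
    qed
    show "\<forall>m'\<in>(\<lambda>d. m + d) ` {- int (2 * M)..int (2 * M)} - {- int M..int M}. v (x + of_int m') = 0"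
    proof
      fix m' assume "m' \<in> (\<lambda>d. m + d) ` {- int (2 * M)..int (2 * M)} - {- int M..int M}"
      then have "m' \<ge> int M + 1 \<or> m' \<le> - int M - 1" by auto
      then have "real_of_int m' \<ge> real M + 1 \<or> real_of_int m' \<le> - real M - 1" by linarith
      then show "v (x + of_int m') = 0" using x by (intro v) auto
    qed
  qed simp
  finally show ?thesis by simp
qed

text \<open>Inner products on the circle are sums of inner products on the line over all relative shifts.\<close>

lemma unfold_circle_product:
  fixes u v :: "real \<Rightarrow> real" and M :: nat
  assumes u: "continuous_on UNIV u" "\<And>x. real M \<le> \<bar>x\<bar> \<Longrightarrow> u x = 0"
    and v: "continuous_on UNIV v" "\<And>x. real M \<le> \<bar>x\<bar> \<Longrightarrow> v x = 0"
  shows "(LBINT x:{0..1}. (\<Sum>m\<in>{- int M..int M}. u (x + of_int m)) * (\<Sum>m\<in>{- int M..int M}. v (x + of_int m)))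
    = (\<Sum>d\<in>{- int (2 * M)..int (2 * M)}. LBINT x. u x * v (x + of_int d))"
proof -
  let ?I = "{- int M..int M}" and ?D = "{- int (2 * M)..int (2 * M)}"
  have cont: "continuous_on UNIV (\<lambda>x. u x * v (x + of_int d))" for d
    by (intro continuous_on_mult u continuous_on_compose2[OF v(1)] continuous_intros) auto
  have int: "set_integrable lborel {0..1} (\<lambda>x. u (x + of_int m) * v (x + of_int m + of_int d))" for m d
    unfolding set_integrable_def
    by (intro borel_integrable_compact continuous_on_mult continuous_on_compose2[OF u(1)] continuous_on_compose2[OF v(1)])
      (auto intro!: continuous_intros)
  have "(LBINT x:{0..1}. (\<Sum>m\<in>?I. u (x + of_int m)) * (\<Sum>m\<in>?I. v (x + of_int m))) =
      (LBINT x:{0..1}. \<Sum>d\<in>?D. \<Sum>m\<in>?I. u (x + of_int m) * v (x + of_int m + of_int d))"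
  proof (rule set_lebesgue_integral_cong)
    show "\<forall>x. x \<in> {0..1} \<longrightarrow> (\<Sum>m\<in>?I. u (x + of_int m)) * (\<Sum>m\<in>?I. v (x + of_int m)) =
       (\<Sum>d\<in>?D. \<Sum>m\<in>?I. u (x + of_int m) * v (x + of_int m + of_int d))"
    proof (intro allI impI)
      fix x :: real assume x: "x \<in> {0..1}"
      have "(\<Sum>m\<in>?I. u (x + of_int m)) * (\<Sum>m\<in>?I. v (x + of_int m)) =
          (\<Sum>m\<in>?I. u (x + of_int m) * (\<Sum>d\<in>?D. v (x + of_int m + of_int d)))"
        unfolding sum_distrib_right
        by (intro sum.cong refl arg_cong2[where f = "(*)"] sum_cong_translates[of M v, OF v(2) x])
      also have "\<dots> = (\<Sum>m\<in>?I. \<Sum>d\<in>?D. u (x + of_int m) * v (x + of_int m + of_int d))"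
        by (simp only: sum_distrib_left)
      also have "\<dots> = (\<Sum>d\<in>?D. \<Sum>m\<in>?I. u (x + of_int m) * v (x + of_int m + of_int d))"
        by (rule sum.swap)
      finally show "(\<Sum>m\<in>?I. u (x + of_int m)) * (\<Sum>m\<in>?I. v (x + of_int m)) =
       (\<Sum>d\<in>?D. \<Sum>m\<in>?I. u (x + of_int m) * v (x + of_int m + of_int d))" .
    qed
  qed simp
  also have "\<dots> = (\<Sum>d\<in>?D. \<Sum>m\<in>?I. LBINT x:{0..1}. u (x + of_int m) * v (x + of_int m + of_int d))"
    using int unfolding set_lebesgue_integral_def scaleR_sum_right set_integrable_def
    by (simp only: Bochner_Integration.integral_sum Bochner_Integration.integrable_sum)
  also have "\<dots> = (\<Sum>d\<in>?D. LBINT x. u x * v (x + of_int d))"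
  proof (rule sum.cong[OF refl])
    fix d
    show "(\<Sum>m\<in>?I. LBINT x:{0..1}. u (x + of_int m) * v (x + of_int m + of_int d)) = (LBINT x. u x * v (x + of_int d))"
      using unfold_circle[OF cont[of d], of M] u(2) by simp
  qed
  finally show ?thesis .
qed

context compact_wavelet
begin

text \<open>So large that all wavelets with \<open>1 \<le> j \<le> 2\<^sup>k\<close> are supported in \<open>[-window, window]\<close>, whatever the level; hence the
periodisation is a sum over one fixed finite set of translates.\<close>

definition window :: nat where
  "window = Suc (Suc (nat \<lceil>\<bar>a\<^sub>1\<bar> + \<bar>a\<^sub>2\<bar>\<rceil>))"

lemma window: "\<bar>a\<^sub>1\<bar> + \<bar>a\<^sub>2\<bar> + 1 < real window"
  unfolding window_def by linarith

definition translates :: "int set" where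
  "translates = {- int window..int window}"

lemma finite_translates [simp]: "finite translates"
  by (simp add: translates_def)

text \<open>One summand of a periodisation, without its normalising factor and for an arbitrary generator \<open>h\<close>: it is
used with \<open>\<phi>\<close>, its derivative and its primitive.\<close>

definition piece :: "(real \<Rightarrow> real) \<Rightarrow> nat \<Rightarrow> nat \<Rightarrow> int \<Rightarrow> real \<Rightarrow> real" where
  "piece h k j m x = h (2 ^ k * (x + of_int m) - real j)"

lemma scaled_outside:
  assumes j: "j \<in> {1..2 ^ k}" and h: "\<And>x. x \<notin> {a\<^sub>1..a\<^sub>2} \<Longrightarrow> h x = 0" and x: "real window \<le> \<bar>x\<bar>"
  shows "h (2 ^ k * x - real j) = 0"
proof (rule h)
  have "real j \<le> real (2 ^ k)" using j by (simp only: of_nat_le_iff) simp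
  then have jk: "1 \<le> real j" "real j \<le> 2 ^ k" using j by auto
  have k1: "1 \<le> (2::real) ^ k" by simp
  show "2 ^ k * x - real j \<notin> {a\<^sub>1..a\<^sub>2}"
  proof (cases "0 \<le> x")
    case True
    then have "\<bar>a\<^sub>1\<bar> + \<bar>a\<^sub>2\<bar> < x - 1" using x window by simp
    also have "\<dots> \<le> 2 ^ k * (x - 1)"
      using mult_right_mono[OF k1, of "x - 1"] True x window by simp
    also have "\<dots> = 2 ^ k * x - 2 ^ k" by (simp add: algebra_simps)
    finally have "\<bar>a\<^sub>1\<bar> + \<bar>a\<^sub>2\<bar> < 2 ^ k * x - real j" using jk by linarith
    then show ?thesis by auto
  next
    case False
    then have "\<bar>a\<^sub>1\<bar> + \<bar>a\<^sub>2\<bar> < - x" using x window by simp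
    moreover have "2 ^ k * x \<le> 1 * x" using False k1 by (intro mult_right_mono_neg) auto
    ultimately have "2 ^ k * x - real j < - (\<bar>a\<^sub>1\<bar> + \<bar>a\<^sub>2\<bar>)" using jk by linarith
    then show ?thesis by auto
  qed
qed

lemma piece_outside:
  assumes "j \<in> {1..2 ^ k}" "\<And>x. x \<notin> {a\<^sub>1..a\<^sub>2} \<Longrightarrow> h x = 0" "x \<in> {0..1}" "m \<notin> translates"
  shows "piece h k j m x = 0"
  unfolding piece_def
proof (rule scaled_outside[OF assms(1,2)])
  have "m \<ge> int window + 1 \<or> m \<le> - int window - 1" using assms(4) by (auto simp: translates_def)
  then have "real_of_int m \<ge> real window + 1 \<or> real_of_int m \<le> - real window - 1" by linarith
  then show "real window \<le> \<bar>x + of_int m\<bar>" using assms(3) by auto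
qed auto

lemma per_wavelet_sum:
  assumes j: "j \<in> {1..2 ^ k}" and x: "x \<in> {0..1}"
  shows "per_wavelet \<phi> k j x = sqrt 2 ^ k * (\<Sum>m\<in>translates. piece \<phi> k j m x)"
proof -
  have d: "dyadic_wavelet \<phi> (int k) (int j) (x + of_int m) = sqrt 2 ^ k * piece \<phi> k j m x" for m
    unfolding dyadic_wavelet_nat two_powr_half piece_def by simp
  have "per_wavelet \<phi> k j x = (\<Sum>\<^sub>\<infinity>m\<in>translates. sqrt 2 ^ k * piece \<phi> k j m x)"
    unfolding per_wavelet_def d
    by (rule infsum_cong_neutral) (use piece_outside[OF j outside x] in auto)
  then show ?thesis by (simp add: sum_distrib_left)
qed

lemma piece_continuous:
  assumes "continuous_on UNIV h"
  shows "continuous_on S (piece h k j m)"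
  unfolding piece_def[abs_def]
  by (intro continuous_on_compose2[OF assms] continuous_intros) auto

lemma per_wavelet_continuous:
  assumes "j \<in> {1..2 ^ k}"
  shows "continuous_on {0..1} (per_wavelet \<phi> k j)"
proof -
  have "continuous_on {0..1} (\<lambda>x. sqrt 2 ^ k * (\<Sum>m\<in>translates. piece \<phi> k j m x))"
    by (intro continuous_intros piece_continuous continuous_\<phi>)
  moreover have "continuous_on {0..1} (per_wavelet \<phi> k j) \<longleftrightarrow>
      continuous_on {0..1} (\<lambda>x. sqrt 2 ^ k * (\<Sum>m\<in>translates. piece \<phi> k j m x))"
    by (rule continuous_on_cong[OF refl per_wavelet_sum[OF assms]])
  ultimately show ?thesis by (simp only:)
qed

lemma sum_pieces_le:
  assumes h: "\<And>x. \<bar>h x\<bar> \<le> B" "\<And>x. x \<notin> {a\<^sub>1..a\<^sub>2} \<Longrightarrow> h x = 0"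
  shows "(\<Sum>j\<in>{1..2 ^ k}. \<bar>\<Sum>m\<in>translates. piece h k j m x\<bar>) \<le> real (card translates) * (B * (a\<^sub>2 - a\<^sub>1 + 1))"
proof -
  have "(\<Sum>j\<in>{1..2 ^ k}. \<bar>\<Sum>m\<in>translates. piece h k j m x\<bar>) \<le> (\<Sum>j\<in>{1..2 ^ k}. \<Sum>m\<in>translates. \<bar>piece h k j m x\<bar>)"
    by (intro sum_mono sum_abs)
  also have "\<dots> = (\<Sum>m\<in>translates. \<Sum>j\<in>{1..2 ^ k}. \<bar>piece h k j m x\<bar>)" by (rule sum.swap)
  also have "\<dots> \<le> (\<Sum>m\<in>translates. B * (a\<^sub>2 - a\<^sub>1 + 1))"
    unfolding piece_def by (intro sum_mono sum_translates_le h) (use a_less in auto)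
  finally show ?thesis by simp
qed

text \<open>Primitives of periodised wavelets are periodised primitives, smaller by a factor of \<open>2\<^sup>k\<close>, up to the constant that makes
them vanish at \<open>0\<close>.\<close>

lemma per_wavelet_prim_eq:
  assumes j: "j \<in> {1..2 ^ k}" and x: "x \<in> {0..1}"
  shows "per_wavelet_prim \<phi> k j x =
    ((\<Sum>m\<in>translates. piece prim k j m x) - (\<Sum>m\<in>translates. piece prim k j m 0)) / sqrt 2 ^ k"
proof -
  let ?P = "\<lambda>x. (\<Sum>m\<in>translates. piece prim k j m x) / sqrt 2 ^ k"
  have "per_wavelet_prim \<phi> k j x = (LBINT t:{0..x}. sqrt 2 ^ k * (\<Sum>m\<in>translates. piece \<phi> k j m t))"
    unfolding per_wavelet_prim_def by (rule set_lebesgue_integral_cong) (use per_wavelet_sum[OF j] x in auto)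
  also have "\<dots> = ?P x - ?P 0"
    unfolding set_lebesgue_integral_def
  proof (rule integral_FTC_Icc)
    show "continuous_on {0..x} (\<lambda>t. sqrt 2 ^ k * (\<Sum>m\<in>translates. piece \<phi> k j m t))"
      by (intro continuous_intros piece_continuous continuous_\<phi>)
    fix t
    have "(?P has_real_derivative (\<Sum>m\<in>translates. piece \<phi> k j m t * 2 ^ k) / sqrt 2 ^ k) (at t within {0..x})"
      unfolding piece_def[abs_def]
      by (intro DERIV_cdivide DERIV_sum)
        (auto intro!: derivative_eq_intros DERIV_chain2[OF prim_deriv])
    moreover have "(\<Sum>m\<in>translates. piece \<phi> k j m t * 2 ^ k) / sqrt 2 ^ k = sqrt 2 ^ k * (\<Sum>m\<in>translates. piece \<phi> k j m t)"
    proof -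
      have "(\<Sum>m\<in>translates. piece \<phi> k j m t * 2 ^ k) =
          (\<Sum>m\<in>translates. piece \<phi> k j m t) * (sqrt 2 ^ k * sqrt 2 ^ k)"
        by (simp only: sqrt2_power_mult sum_distrib_right)
      then show ?thesis by simp
    qed
    ultimately show "(?P has_vector_derivative sqrt 2 ^ k * (\<Sum>m\<in>translates. piece \<phi> k j m t)) (at t within {0..x})"
      by (simp add: has_real_derivative_iff_has_vector_derivative)
  qed (use x in auto)
  finally show ?thesis by (simp add: diff_divide_distrib)
qed

text \<open>A relative shift by \<open>d\<close> on the line turns the index \<open>j'\<close> into \<open>j' - 2\<^sup>k d\<close>; as the indices range over
a full set of residues modulo \<open>2\<^sup>k\<close>, only \<open>d = 0\<close> contributes.\<close>

lemma per_wavelet_orthonormal: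
  assumes j: "j \<in> {1..2 ^ k}" and j': "j' \<in> {1..2 ^ k'}"
  shows "(LINT x|unit_lborel. per_wavelet \<phi> k j x * per_wavelet \<phi> k' j' x) = (if k = k' \<and> j = j' then 1 else 0)"
proof -
  let ?u = "\<lambda>x. sqrt 2 ^ k * \<phi> (2 ^ k * x - real j)" and ?v = "\<lambda>x. sqrt 2 ^ k' * \<phi> (2 ^ k' * x - real j')"
  have u: "continuous_on UNIV ?u" "continuous_on UNIV ?v"
    by (intro continuous_on_mult continuous_on_const continuous_on_compose2[OF continuous_\<phi>] continuous_intros; simp)+
  have u0: "real window \<le> \<bar>x\<bar> \<Longrightarrow> ?u x = 0" "real window \<le> \<bar>x\<bar> \<Longrightarrow> ?v x = 0" for x
    using scaled_outside[OF j outside] scaled_outside[OF j' outside] by auto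
  have "(LINT x|unit_lborel. per_wavelet \<phi> k j x * per_wavelet \<phi> k' j' x) =
     (LBINT x:{0..1}. (\<Sum>m\<in>translates. ?u (x + of_int m)) * (\<Sum>m\<in>translates. ?v (x + of_int m)))"
    unfolding set_integral_unit[symmetric]
    by (rule set_lebesgue_integral_cong)
      (auto simp: per_wavelet_sum[OF j] per_wavelet_sum[OF j'] piece_def sum_distrib_left)
  also have "\<dots> = (\<Sum>d\<in>{- int (2 * window)..int (2 * window)}. LBINT x. ?u x * ?v (x + of_int d))"
    unfolding translates_def by (rule unfold_circle_product[OF u(1) u0(1) u(2) u0(2)])
  also have "\<dots> = (\<Sum>d\<in>{- int (2 * window)..int (2 * window)}. if d = 0 \<and> k = k' \<and> j = j' then 1 else 0)"
  proof (rule sum.cong[OF refl])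
    fix d :: int
    have "(LBINT x. ?u x * ?v (x + of_int d)) =
       (LBINT x. dyadic_wavelet \<phi> (int k) (int j) x * dyadic_wavelet \<phi> (int k') (int j' - 2 ^ k' * d) x)"
      unfolding dyadic_wavelet_nat two_powr_half by (simp add: algebra_simps)
    also have "\<dots> = (if k = k' \<and> int j = int j' - 2 ^ k' * d then 1 else 0)"
      unfolding orthonormal by simp
    also have "(k = k' \<and> int j = int j' - 2 ^ k' * d) \<longleftrightarrow> (d = 0 \<and> k = k' \<and> j = j')"
    proof safe
      assume k: "k = k'" and eq: "int j = int j' - 2 ^ k' * d"
      have "int j \<le> int (2 ^ k)" "int j' \<le> int (2 ^ k')" using j j' by (simp_all only: of_nat_le_iff) simp_all
      then have "1 \<le> int j" "1 \<le> int j'" "int j \<le> 2 ^ k'" "int j' \<le> 2 ^ k'" using j j' k by auto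
      then have "\<bar>2 ^ k' * d\<bar> < 2 ^ k'" using eq by linarith
      then have "2 ^ k' * \<bar>d\<bar> < 2 ^ k' * (1::int)" by (simp add: abs_mult)
      then have "\<bar>d\<bar> < 1" by (subst (asm) mult_less_cancel_left_pos) auto
      then show "d = 0" by simp
      then show "j = j'" using eq by simp
    qed auto
    finally show "(LBINT x. ?u x * ?v (x + of_int d)) = (if d = 0 \<and> k = k' \<and> j = j' then 1 else 0)" .
  qed
  also have "\<dots> = (if k = k' \<and> j = j' then 1 else 0)"
    by (cases "k = k' \<and> j = j'") (auto simp: sum.delta)
  finally show ?thesis .
qed

lemma per_wavelet_mean:
  assumes j: "j \<in> {1..2 ^ k}"
  shows "(LINT x|unit_lborel. per_wavelet \<phi> k j x) = 0"
proof -
  let ?u = "\<lambda>x. \<phi> (2 ^ k * x - real j)"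
  have cu: "continuous_on UNIV ?u"
    by (intro continuous_on_compose2[OF continuous_\<phi>] continuous_intros) auto
  have i: "set_integrable lborel {0..1} (piece \<phi> k j m)" for m
    unfolding set_integrable_def by (intro borel_integrable_compact piece_continuous continuous_\<phi>) auto
  have "(LINT x|unit_lborel. per_wavelet \<phi> k j x) =
      (LINT x|unit_lborel. sqrt 2 ^ k * (\<Sum>m\<in>translates. piece \<phi> k j m x))"
    by (intro Bochner_Integration.integral_cong refl) (simp add: per_wavelet_sum[OF j])
  also have "\<dots> = sqrt 2 ^ k * (\<Sum>m\<in>translates. (LINT x|unit_lborel. piece \<phi> k j m x))"
    using i unfolding set_integrable_unit_iff by (simp add: Bochner_Integration.integral_sum)
  also have "(\<Sum>m\<in>translates. (LINT x|unit_lborel. piece \<phi> k j m x)) = (LBINT x. ?u x)"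
    unfolding set_integral_unit[symmetric] piece_def translates_def
    by (rule unfold_circle[OF cu]) (rule scaled_outside[OF j outside])
  also have "\<dots> = 0"
    using integral_affine_dyadic[of \<phi> k 0 "real j" "\<lambda>_. 1"] by (simp add: integral_\<phi>)
  finally show ?thesis by simp
qed

lemma piece_mass:
  assumes h: "continuous_on UNIV h" "\<And>x. x \<notin> {a\<^sub>1..a\<^sub>2} \<Longrightarrow> h x = 0"
  shows "integrable unit_lborel (\<lambda>x. \<bar>\<Sum>m\<in>translates. piece h k j m x\<bar>)"
    and "(LINT x|unit_lborel. \<bar>\<Sum>m\<in>translates. piece h k j m x\<bar>) \<le> real (card translates) * (LBINT y. \<bar>h y\<bar>) / 2 ^ k"
proof -
  have c: "continuous_on UNIV (\<lambda>x. \<bar>h x\<bar>)" by (intro continuous_intros h)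
  have ip: "integrable unit_lborel (\<lambda>x. \<bar>piece h k j m x\<bar>)" for m
  proof -
    have "set_integrable lborel {0..1} (\<lambda>x. \<bar>piece h k j m x\<bar>)"
      unfolding set_integrable_def by (intro borel_integrable_compact continuous_intros piece_continuous h) auto
    then show ?thesis by (simp add: set_integrable_unit_iff)
  qed
  have ip': "integrable unit_lborel (\<lambda>x. piece h k j m x)" for m
  proof -
    have "set_integrable lborel {0..1} (piece h k j m)"
      unfolding set_integrable_def by (intro borel_integrable_compact piece_continuous h) auto
    then show ?thesis by (simp add: set_integrable_unit_iff)
  qed
  show i: "integrable unit_lborel (\<lambda>x. \<bar>\<Sum>m\<in>translates. piece h k j m x\<bar>)"
    by (intro integrable_abs Bochner_Integration.integrable_sum ip')
  have le: "(LINT x|unit_lborel. \<bar>piece h k j m x\<bar>) \<le> (LBINT y. \<bar>h y\<bar>) / 2 ^ k" for m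
  proof -
    have cp: "continuous_on UNIV (\<lambda>x. \<bar>piece h k j m x\<bar>)" by (intro continuous_intros piece_continuous h)
    have int: "integrable lborel (\<lambda>x. \<bar>piece h k j m x\<bar>)"
    proof (rule compact_support_integrable[OF cp])
      fix x assume x: "x \<notin> {(a\<^sub>1 + real j) / 2 ^ k - of_int m..(a\<^sub>2 + real j) / 2 ^ k - of_int m}"
      have "2 ^ k * (x + of_int m) - real j \<notin> {a\<^sub>1..a\<^sub>2}"
        using x by (auto simp: field_simps)
      then show "\<bar>piece h k j m x\<bar> = 0" using h(2) by (simp add: piece_def)
    qed
    have "(LINT x|unit_lborel. \<bar>piece h k j m x\<bar>) = (LBINT x. indicator {0..1} x *\<^sub>R \<bar>piece h k j m x\<bar>)"
      unfolding set_integral_unit[symmetric] set_lebesgue_integral_def ..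
    also have "\<dots> \<le> (LBINT x. \<bar>piece h k j m x\<bar>)"
      using integrable_mult_indicator[of "{0..1}", OF _ int]
      by (intro integral_mono int) (auto split: split_indicator)
    also have "\<dots> = (LBINT y. \<bar>h y\<bar>) / 2 ^ k"
      using integral_affine_dyadic[of "\<lambda>y. \<bar>h y\<bar>" k "of_int m" "real j" "\<lambda>_. 1"] by (simp add: piece_def)
    finally show ?thesis .
  qed
  have "(LINT x|unit_lborel. \<bar>\<Sum>m\<in>translates. piece h k j m x\<bar>) \<le> (LINT x|unit_lborel. (\<Sum>m\<in>translates. \<bar>piece h k j m x\<bar>))"
    by (intro integral_mono i Bochner_Integration.integrable_sum ip sum_abs)
  also have "\<dots> = (\<Sum>m\<in>translates. (LINT x|unit_lborel. \<bar>piece h k j m x\<bar>))"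
    by (intro Bochner_Integration.integral_sum ip)
  also have "\<dots> \<le> (\<Sum>m\<in>translates. (LBINT y. \<bar>h y\<bar>) / 2 ^ k)" by (intro sum_mono le)
  finally show "(LINT x|unit_lborel. \<bar>\<Sum>m\<in>translates. piece h k j m x\<bar>) \<le> real (card translates) * (LBINT y. \<bar>h y\<bar>) / 2 ^ k" by simp
qed

text \<open>Integration by parts; the boundary terms vanish because \<open>g\<close> has mean zero. The derivative of a wavelet of level \<open>k\<close>
has mass of order \<open>2\<^bsup>k/2\<^esup>\<close>. This bounds a wavelet coefficient by the supremum of the primitive.\<close>

lemma per_wavelet_pairing:
  assumes j: "j \<in> {1..2 ^ k}" and g: "continuous_on {0..1} g"
    and mean: "(LINT x|unit_lborel. g x) = 0" and t: "\<And>x. x \<in> {0..1} \<Longrightarrow> \<bar>LBINT u:{0..x}. g u\<bar> \<le> t"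
  shows "\<bar>LINT x|unit_lborel. g x * per_wavelet \<phi> k j x\<bar> \<le> t * (real (card translates) * (LBINT y. \<bar>deriv \<phi> y\<bar>)) * sqrt 2 ^ k"
proof -
  define G where "G x = integral {0..x} g" for x
  have int: "set_integrable lborel {0..x} g" if "x \<in> {0..1}" for x
    unfolding set_integrable_def using that by (intro borel_integrable_compact continuous_on_subset[OF g]) auto
  have G: "G x = (LBINT u:{0..x}. g u)" if "x \<in> {0..1}" for x
    unfolding G_def using int[OF that] by (rule set_borel_integral_eq_integral(2)[symmetric])
  have G0: "G 0 = 0" by (simp add: G_def)
  have G1: "G 1 = 0" using mean G[of 1] by (simp add: set_integral_unit)
  \<comment> \<open>The wavelet and its derivative as sums over translates.\<close>
  define p p' where "p x = sqrt 2 ^ k * (\<Sum>m\<in>translates. piece \<phi> k j m x)"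
    and "p' x = sqrt 2 ^ k * (\<Sum>m\<in>translates. piece (deriv \<phi>) k j m x) * 2 ^ k" for x
  have cp: "continuous_on {0..1} p" "continuous_on {0..1} p'"
    unfolding p_def p'_def by (intro continuous_intros piece_continuous continuous_\<phi> cont_deriv)+
  have dp: "(p has_real_derivative p' x) (at x within S)" for x S
  proof -
    have "(p has_real_derivative sqrt 2 ^ k * (\<Sum>m\<in>translates. piece (deriv \<phi>) k j m x * 2 ^ k)) (at x within S)"
      unfolding p_def piece_def
      by (intro DERIV_cmult DERIV_sum) (auto intro!: derivative_eq_intros DERIV_chain2[OF deriv_\<phi>])
    then show ?thesis by (simp add: p'_def sum_distrib_right mult.assoc)
  qed
  have dG: "(G has_real_derivative g x) (at x within {0..1})" if "x \<in> {0..1}" for x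
    unfolding G_def by (rule integral_has_real_derivative[OF g that])
  have cG: "continuous_on {0..1} G"
    using dG by (meson has_field_derivative_imp_has_derivative has_derivative_continuous continuous_on_eq_continuous_within)
  have "(LBINT x. indicator {0..1} x *\<^sub>R (g x * p x + G x * p' x)) = G 1 * p 1 - G 0 * p 0"
  proof (rule integral_FTC_Icc)
    fix x :: real assume "0 \<le> x" "x \<le> 1"
    then show "((\<lambda>x. G x * p x) has_vector_derivative g x * p x + G x * p' x) (at x within {0..1})"
      using DERIV_mult[OF dG dp, of x] by (simp add: has_real_derivative_iff_has_vector_derivative mult.commute add.commute)
  qed (auto intro!: continuous_intros g cp cG)
  then have z: "(LINT x|unit_lborel. g x * p x + G x * p' x) = 0"
    using G0 G1 by (simp add: set_integral_unit[symmetric] set_lebesgue_integral_def)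
  have i1: "integrable unit_lborel (\<lambda>x. g x * p x)" and i2: "integrable unit_lborel (\<lambda>x. G x * p' x)"
  proof -
    have "set_integrable lborel {0..1} (\<lambda>x. g x * p x)" "set_integrable lborel {0..1} (\<lambda>x. G x * p' x)"
      unfolding set_integrable_def by (intro borel_integrable_compact continuous_intros g cp cG; simp)+
    then show "integrable unit_lborel (\<lambda>x. g x * p x)" "integrable unit_lborel (\<lambda>x. G x * p' x)"
      by (simp_all add: set_integrable_unit_iff)
  qed
  let ?T = "\<lambda>x. \<bar>\<Sum>m\<in>translates. piece (deriv \<phi>) k j m x\<bar>"
  note pm = piece_mass[OF cont_deriv deriv_outside, of k j]
  have t0: "0 \<le> t" using t[of 0] by (auto intro: order.trans[OF abs_ge_zero])
  have "(LINT x|unit_lborel. g x * per_wavelet \<phi> k j x) = (LINT x|unit_lborel. g x * p x)"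
    by (intro Bochner_Integration.integral_cong refl) (simp add: per_wavelet_sum[OF j] p_def)
  also have "\<dots> = - (LINT x|unit_lborel. G x * p' x)"
    using z Bochner_Integration.integral_add[OF i1 i2] by linarith
  finally have "\<bar>LINT x|unit_lborel. g x * per_wavelet \<phi> k j x\<bar> = \<bar>LINT x|unit_lborel. G x * p' x\<bar>" by simp
  also have "\<dots> \<le> (LINT x|unit_lborel. \<bar>G x * p' x\<bar>)" by (rule integral_abs_bound)
  also have "\<dots> \<le> (LINT x|unit_lborel. (t * sqrt 2 ^ k * 2 ^ k) * ?T x)"
  proof (rule integral_mono[OF integrable_abs[OF i2] integrable_mult_right[OF pm(1)]])
    fix x assume "x \<in> space unit_lborel"
    then have x: "x \<in> {0..1}" by simp
    have "\<bar>G x\<bar> * \<bar>p' x\<bar> \<le> t * \<bar>p' x\<bar>" using t[OF x] G[OF x] by (intro mult_right_mono) auto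
    then show "\<bar>G x * p' x\<bar> \<le> (t * sqrt 2 ^ k * 2 ^ k) * ?T x"
      by (simp add: abs_mult p'_def mult_ac)
  qed
  also have "\<dots> = (t * sqrt 2 ^ k * 2 ^ k) * (LINT x|unit_lborel. ?T x)" by simp
  also have "\<dots> \<le> (t * sqrt 2 ^ k * 2 ^ k) * (real (card translates) * (LBINT y. \<bar>deriv \<phi> y\<bar>) / 2 ^ k)"
    using t0 by (intro mult_left_mono pm(2)) auto
  also have "\<dots> = t * (real (card translates) * (LBINT y. \<bar>deriv \<phi> y\<bar>)) * sqrt 2 ^ k"
    by simp
  finally show ?thesis .
qed

text \<open>The primitive of a wavelet has mean zero on the line, so subtracting from \<open>w\<close> its value at one fixed point near the support
changes nothing; what remains of \<open>w\<close> is of order \<open>L 2\<^bsup>-k\<^esup>\<close> on the support. The constant by which a periodised primitive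
differs from \<open>per_wavelet_prim\<close> is harmless because \<open>w\<close> has mean zero.\<close>

lemma per_wavelet_prim_pairing:
  assumes j: "j \<in> {1..2 ^ k}" and lip: "\<And>x y. \<bar>w x - w y\<bar> \<le> L * \<bar>x - y\<bar>"
    and w: "\<And>x. x \<notin> {0..1} \<Longrightarrow> w x = 0" "(LINT x|unit_lborel. w x) = 0"
  shows "\<bar>LINT x|unit_lborel. per_wavelet_prim \<phi> k j x * w x\<bar> \<le>
    L * (real (card translates) * (LBINT y. \<bar>prim y\<bar> * \<bar>y\<bar>)) / (sqrt 2 ^ k * 2 ^ k * 2 ^ k)"
proof -
  have L: "0 \<le> L" using lip[of 0 1] by (auto intro: order.trans[OF abs_ge_zero])
  have cw: "continuous_on UNIV w"
  proof (rule continuous_at_imp_continuous_on, intro ballI)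
    fix x
    have "(\<lambda>y. L * \<bar>y - x\<bar>) \<midarrow>x\<rightarrow> L * \<bar>x - x\<bar>" by (intro tendsto_intros)
    then have "(\<lambda>y. L * \<bar>y - x\<bar>) \<midarrow>x\<rightarrow> 0" by simp
    then have "(\<lambda>y. w y - w x) \<midarrow>x\<rightarrow> 0"
      by (rule Lim_null_comparison[rotated]) (use lip in \<open>auto intro!: always_eventually\<close>)
    then show "isCont w x" by (simp add: isCont_def LIM_zero_iff)
  qed
  have ci: "integrable unit_lborel h" if "continuous_on {0..1} h" for h :: "real \<Rightarrow> real"
  proof -
    have "set_integrable lborel {0..1} h"
      unfolding set_integrable_def using that by (intro borel_integrable_compact) auto
    then show ?thesis by (simp add: set_integrable_unit_iff)
  qed
  have pw: "integrable unit_lborel (\<lambda>x. piece prim k j m x * w x)" for m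
    by (intro ci continuous_intros piece_continuous continuous_prim continuous_on_subset[OF cw]) auto
  have wi: "integrable unit_lborel w" by (intro ci continuous_on_subset[OF cw]) auto
  have pairing: "\<bar>LINT x|unit_lborel. piece prim k j m x * w x\<bar> \<le> L * (LBINT y. \<bar>prim y\<bar> * \<bar>y\<bar>) / (2 ^ k * 2 ^ k)" for m
  proof -
    have "(LINT x|unit_lborel. piece prim k j m x * w x) = (LBINT x. piece prim k j m x * w x)"
      unfolding set_integral_unit[symmetric] set_lebesgue_integral_def
      using w(1) by (intro Bochner_Integration.integral_cong) (auto split: split_indicator)
    also have "\<dots> = (LBINT y. prim y * w ((y + real j) / 2 ^ k - of_int m)) / 2 ^ k"
      unfolding piece_def by (rule integral_affine_dyadic)
    finally have 1: "(LINT x|unit_lborel. piece prim k j m x * w x) =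
      (LBINT y. prim y * w ((y + real j) / 2 ^ k - of_int m)) / 2 ^ k" .
    define z where "z y = (y + real j) / 2 ^ k - of_int m" for y
    have cz: "continuous_on UNIV (\<lambda>y. w (z y))"
      unfolding z_def by (intro continuous_on_compose2[OF cw] continuous_intros) auto
    have i1: "integrable lborel (\<lambda>y. prim y * w (z y))"
    proof (rule compact_support_integrable)
      show "continuous_on UNIV (\<lambda>y. prim y * w (z y))" by (intro continuous_intros continuous_prim cz)
      show "\<And>y. y \<notin> {a\<^sub>1..a\<^sub>2} \<Longrightarrow> prim y * w (z y) = 0" by (simp add: prim_outside)
    qed
    have i2: "integrable lborel (\<lambda>y. prim y * w (z 0))" using integrable_prim by simp
    have "(LBINT y. prim y * w (z y)) = (LBINT y. prim y * w (z y)) - (LBINT y. prim y * w (z 0))"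
      using integral_prim by simp
    also have "\<dots> = (LBINT y. prim y * (w (z y) - w (z 0)))"
      unfolding right_diff_distrib by (rule Bochner_Integration.integral_diff[OF i1 i2, symmetric])
    finally have "\<bar>LBINT y. prim y * w (z y)\<bar> = \<bar>LBINT y. prim y * (w (z y) - w (z 0))\<bar>" by simp
    also have "\<dots> \<le> (LBINT y. \<bar>prim y * (w (z y) - w (z 0))\<bar>)" by (rule integral_abs_bound)
    also have "\<dots> \<le> (LBINT y. L / 2 ^ k * (\<bar>prim y\<bar> * \<bar>y\<bar>))"
    proof (rule integral_mono)
      show "integrable lborel (\<lambda>y. \<bar>prim y * (w (z y) - w (z 0))\<bar>)"
        unfolding right_diff_distrib by (intro integrable_abs Bochner_Integration.integrable_diff i1 i2)
      have "integrable lborel (\<lambda>y. \<bar>prim y\<bar> * \<bar>y\<bar>)"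
      proof (rule compact_support_integrable)
        show "continuous_on UNIV (\<lambda>y. \<bar>prim y\<bar> * \<bar>y\<bar>)" by (intro continuous_intros continuous_prim)
        show "\<And>y. y \<notin> {a\<^sub>1..a\<^sub>2} \<Longrightarrow> \<bar>prim y\<bar> * \<bar>y\<bar> = 0" by (simp add: prim_outside)
      qed
      then show "integrable lborel (\<lambda>y. L / 2 ^ k * (\<bar>prim y\<bar> * \<bar>y\<bar>))" by (rule integrable_mult_right)
      fix y
      have "\<bar>w (z y) - w (z 0)\<bar> \<le> L * \<bar>z y - z 0\<bar>" by (rule lip)
      also have "z y - z 0 = y / 2 ^ k" by (simp add: z_def add_divide_distrib)
      finally have "\<bar>prim y\<bar> * \<bar>w (z y) - w (z 0)\<bar> \<le> \<bar>prim y\<bar> * (L * \<bar>y / 2 ^ k\<bar>)" by (rule mult_left_mono) simp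
      then show "\<bar>prim y * (w (z y) - w (z 0))\<bar> \<le> L / 2 ^ k * (\<bar>prim y\<bar> * \<bar>y\<bar>)"
        by (simp add: abs_mult mult_ac)
    qed
    finally have "\<bar>LBINT y. prim y * w (z y)\<bar> \<le> L / 2 ^ k * (LBINT y. \<bar>prim y\<bar> * \<bar>y\<bar>)" by simp
    then show ?thesis unfolding 1 z_def by (simp add: divide_le_eq field_simps)
  qed
  have "(LINT x|unit_lborel. per_wavelet_prim \<phi> k j x * w x) =
     (LINT x|unit_lborel. (\<Sum>m\<in>translates. piece prim k j m x * w x) / sqrt 2 ^ k -
        (\<Sum>m\<in>translates. piece prim k j m 0) / sqrt 2 ^ k * w x)"
    by (intro Bochner_Integration.integral_cong refl)
      (simp add: per_wavelet_prim_eq[OF j] diff_divide_distrib left_diff_distrib sum_distrib_right)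
  also have "\<dots> = (LINT x|unit_lborel. (\<Sum>m\<in>translates. piece prim k j m x * w x) / sqrt 2 ^ k) -
        (LINT x|unit_lborel. (\<Sum>m\<in>translates. piece prim k j m 0) / sqrt 2 ^ k * w x)"
    by (intro Bochner_Integration.integral_diff integrable_divide Bochner_Integration.integrable_sum pw integrable_mult_right wi)
  also have "\<dots> = (\<Sum>m\<in>translates. (LINT x|unit_lborel. piece prim k j m x * w x)) / sqrt 2 ^ k"
    using pw w(2) by (simp add: Bochner_Integration.integral_sum)
  also have "\<bar>\<dots>\<bar> \<le> (\<Sum>m\<in>translates. L * (LBINT y. \<bar>prim y\<bar> * \<bar>y\<bar>) / (2 ^ k * 2 ^ k)) / sqrt 2 ^ k"
  proof -
    have "\<bar>\<Sum>m\<in>translates. (LINT x|unit_lborel. piece prim k j m x * w x)\<bar> \<le>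
       (\<Sum>m\<in>translates. \<bar>LINT x|unit_lborel. piece prim k j m x * w x\<bar>)" by (rule sum_abs)
    also have "\<dots> \<le> (\<Sum>m\<in>translates. L * (LBINT y. \<bar>prim y\<bar> * \<bar>y\<bar>) / (2 ^ k * 2 ^ k))"
      by (intro sum_mono pairing)
    finally have "\<bar>\<Sum>m\<in>translates. (LINT x|unit_lborel. piece prim k j m x * w x)\<bar> / sqrt 2 ^ k \<le>
       (\<Sum>m\<in>translates. L * (LBINT y. \<bar>prim y\<bar> * \<bar>y\<bar>) / (2 ^ k * 2 ^ k)) / sqrt 2 ^ k"
      by (rule divide_right_mono) simp
    moreover have "\<bar>sqrt 2 ^ k\<bar> = sqrt 2 ^ k" by simp
    ultimately show ?thesis by (simp only: abs_divide)
  qed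
  also have "\<dots> = L * (real (card translates) * (LBINT y. \<bar>prim y\<bar> * \<bar>y\<bar>)) / (sqrt 2 ^ k * 2 ^ k * 2 ^ k)"
    by (simp add: mult_ac)
  finally show ?thesis .
qed

text \<open>All size estimates with one constant, so that later arguments need not know the wavelet.\<close>

theorem per_wavelet_bounds:
  obtains C where "1 \<le> C"
    and "\<And>k x. x \<in> {0..1} \<Longrightarrow> (\<Sum>j\<in>{1..2 ^ k}. \<bar>per_wavelet \<phi> k j x\<bar>) \<le> C * sqrt 2 ^ k"
    and "\<And>k x. x \<in> {0..1} \<Longrightarrow> (\<Sum>j\<in>{1..2 ^ k}. \<bar>per_wavelet_prim \<phi> k j x\<bar>) \<le> C / sqrt 2 ^ k"
    and "\<And>k j. j \<in> {1..2 ^ k} \<Longrightarrow> (LINT x|unit_lborel. \<bar>per_wavelet \<phi> k j x\<bar>) \<le> C / sqrt 2 ^ k"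
    and "\<And>k j g t. j \<in> {1..2 ^ k} \<Longrightarrow> continuous_on {0..1} g \<Longrightarrow> (LINT x|unit_lborel. g x) = 0 \<Longrightarrow>
      (\<And>x. x \<in> {0..1} \<Longrightarrow> \<bar>LBINT u:{0..x}. g u\<bar> \<le> t) \<Longrightarrow>
      \<bar>LINT x|unit_lborel. g x * per_wavelet \<phi> k j x\<bar> \<le> t * C * sqrt 2 ^ k"
    and "\<And>k j w L. j \<in> {1..2 ^ k} \<Longrightarrow> (\<And>x y. \<bar>w x - w y\<bar> \<le> L * \<bar>x - y\<bar>) \<Longrightarrow>
      (\<And>x. x \<notin> {0..1} \<Longrightarrow> w x = 0) \<Longrightarrow> (LINT x|unit_lborel. w x) = 0 \<Longrightarrow>
      \<bar>LINT x|unit_lborel. per_wavelet_prim \<phi> k j x * w x\<bar> \<le> L * C / (sqrt 2 ^ k * 2 ^ k * 2 ^ k)"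
proof -
  obtain B where B: "0 < B" "\<And>x. \<bar>\<phi> x\<bar> \<le> B" using compact_support_bounded[OF continuous_\<phi> outside] by blast
  obtain B' where B': "0 < B'" "\<And>x. \<bar>prim x\<bar> \<le> B'" using compact_support_bounded[OF continuous_prim prim_outside] by blast
  let ?N = "real (card translates)"
  define C1 where "C1 = ?N * (B * (a\<^sub>2 - a\<^sub>1 + 1))"
  define C2 where "C2 = 2 * (?N * (B' * (a\<^sub>2 - a\<^sub>1 + 1)))"
  define C3 where "C3 = ?N * (LBINT y. \<bar>\<phi> y\<bar>)"
  define C4 where "C4 = ?N * (LBINT y. \<bar>deriv \<phi> y\<bar>)"
  define C5 where "C5 = ?N * (LBINT y. \<bar>prim y\<bar> * \<bar>y\<bar>)"
  define C where "C = 1 + C1 + C2 + C3 + C4 + C5"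
  have nn: "0 \<le> C1" "0 \<le> C2" "0 \<le> C3" "0 \<le> C4" "0 \<le> C5"
    using B B' a_less by (auto simp: C1_def C2_def C3_def C4_def C5_def)
  show ?thesis
  proof (rule that[of C])
    show "1 \<le> C" using nn by (simp add: C_def)
  next
    fix k :: nat and x :: real assume x: "x \<in> {0..1}"
    have "(\<Sum>j\<in>{1..2 ^ k}. \<bar>per_wavelet \<phi> k j x\<bar>) = sqrt 2 ^ k * (\<Sum>j\<in>{1..2 ^ k}. \<bar>\<Sum>m\<in>translates. piece \<phi> k j m x\<bar>)"
      unfolding sum_distrib_left by (intro sum.cong refl) (simp add: per_wavelet_sum[OF _ x] abs_mult)
    also have "\<dots> \<le> sqrt 2 ^ k * C1"
      unfolding C1_def by (intro mult_left_mono sum_pieces_le B outside) auto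
    also have "\<dots> \<le> sqrt 2 ^ k * C" using nn by (intro mult_left_mono) (auto simp: C_def)
    finally show "(\<Sum>j\<in>{1..2 ^ k}. \<bar>per_wavelet \<phi> k j x\<bar>) \<le> C * sqrt 2 ^ k" by (simp add: mult.commute)
    have "(\<Sum>j\<in>{1..2 ^ k}. \<bar>per_wavelet_prim \<phi> k j x\<bar>) \<le>
       (\<Sum>j\<in>{1..2 ^ k}. (\<bar>\<Sum>m\<in>translates. piece prim k j m x\<bar> + \<bar>\<Sum>m\<in>translates. piece prim k j m 0\<bar>) / sqrt 2 ^ k)"
      by (intro sum_mono) (simp add: per_wavelet_prim_eq[OF _ x] abs_divide divide_right_mono abs_triangle_ineq4)
    also have "\<dots> = ((\<Sum>j\<in>{1..2 ^ k}. \<bar>\<Sum>m\<in>translates. piece prim k j m x\<bar>) +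
       (\<Sum>j\<in>{1..2 ^ k}. \<bar>\<Sum>m\<in>translates. piece prim k j m 0\<bar>)) / sqrt 2 ^ k"
      by (simp add: sum_divide_distrib sum.distrib add_divide_distrib)
    also have "\<dots> \<le> C2 / sqrt 2 ^ k"
    proof (rule divide_right_mono)
      have "(\<Sum>j\<in>{1..2 ^ k}. \<bar>\<Sum>m\<in>translates. piece prim k j m y\<bar>) \<le> C2 / 2" for y
        using sum_pieces_le[of prim B' k y, OF B'(2) prim_outside] by (simp add: C2_def)
      from add_mono[OF this[of x] this[of 0]]
      show "(\<Sum>j\<in>{1..2 ^ k}. \<bar>\<Sum>m\<in>translates. piece prim k j m x\<bar>) +
       (\<Sum>j\<in>{1..2 ^ k}. \<bar>\<Sum>m\<in>translates. piece prim k j m 0\<bar>) \<le> C2" by simp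
    qed simp
    also have "\<dots> \<le> C / sqrt 2 ^ k" using nn by (intro divide_right_mono) (auto simp: C_def)
    finally show "(\<Sum>j\<in>{1..2 ^ k}. \<bar>per_wavelet_prim \<phi> k j x\<bar>) \<le> C / sqrt 2 ^ k" .
  next
    fix k j :: nat assume j: "j \<in> {1..2 ^ k}"
    have "(LINT x|unit_lborel. \<bar>per_wavelet \<phi> k j x\<bar>) = (LINT x|unit_lborel. sqrt 2 ^ k * \<bar>\<Sum>m\<in>translates. piece \<phi> k j m x\<bar>)"
      by (intro Bochner_Integration.integral_cong refl) (simp add: per_wavelet_sum[OF j] abs_mult)
    also have "\<dots> = sqrt 2 ^ k * (LINT x|unit_lborel. \<bar>\<Sum>m\<in>translates. piece \<phi> k j m x\<bar>)" by simp
    also have "\<dots> \<le> sqrt 2 ^ k * (C3 / 2 ^ k)"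
      unfolding C3_def by (intro mult_left_mono piece_mass(2)[OF continuous_\<phi> outside]) auto
    also have "\<dots> = C3 / sqrt 2 ^ k" by (simp flip: sqrt2_power_mult)
    also have "\<dots> \<le> C / sqrt 2 ^ k" using nn by (intro divide_right_mono) (auto simp: C_def)
    finally show "(LINT x|unit_lborel. \<bar>per_wavelet \<phi> k j x\<bar>) \<le> C / sqrt 2 ^ k" .
  next
    fix k j :: nat and g :: "real \<Rightarrow> real" and t
    assume a: "j \<in> {1..2 ^ k}" "continuous_on {0..1} g" "(LINT x|unit_lborel. g x) = 0"
      "\<And>x. x \<in> {0..1} \<Longrightarrow> \<bar>LBINT u:{0..x}. g u\<bar> \<le> t"
    have t0: "0 \<le> t" using a(4)[of 0] by (auto intro: order.trans[OF abs_ge_zero])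
    have "\<bar>LINT x|unit_lborel. g x * per_wavelet \<phi> k j x\<bar> \<le> t * C4 * sqrt 2 ^ k"
      unfolding C4_def by (rule per_wavelet_pairing[OF a])
    also have "\<dots> \<le> t * C * sqrt 2 ^ k"
      using nn t0 by (intro mult_right_mono mult_left_mono) (auto simp: C_def)
    finally show "\<bar>LINT x|unit_lborel. g x * per_wavelet \<phi> k j x\<bar> \<le> t * C * sqrt 2 ^ k" .
  next
    fix k j :: nat and w :: "real \<Rightarrow> real" and L
    assume a: "j \<in> {1..2 ^ k}" "\<And>x y. \<bar>w x - w y\<bar> \<le> L * \<bar>x - y\<bar>"
      "\<And>x. x \<notin> {0..1} \<Longrightarrow> w x = 0" "(LINT x|unit_lborel. w x) = 0"
    have L: "0 \<le> L" using a(2)[of 0 1] by (auto intro: order.trans[OF abs_ge_zero])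
    have "\<bar>LINT x|unit_lborel. per_wavelet_prim \<phi> k j x * w x\<bar> \<le> L * C5 / (sqrt 2 ^ k * 2 ^ k * 2 ^ k)"
      unfolding C5_def by (rule per_wavelet_prim_pairing[OF a])
    also have "\<dots> \<le> L * C / (sqrt 2 ^ k * 2 ^ k * 2 ^ k)"
      using nn L by (intro divide_right_mono mult_left_mono) (auto simp: C_def)
    finally show "\<bar>LINT x|unit_lborel. per_wavelet_prim \<phi> k j x * w x\<bar> \<le> L * C / (sqrt 2 ^ k * 2 ^ k * 2 ^ k)" .
  qed
qed

end

section \<open>Wavelet series, coefficients and primitives\<close>

definition wavelet_partial :: "(real \<Rightarrow> real) \<Rightarrow> (nat \<Rightarrow> nat \<Rightarrow> real) \<Rightarrow> nat \<Rightarrow> real \<Rightarrow> real" where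
  "wavelet_partial \<phi> \<theta> N x = (\<Sum>k=1..N. \<Sum>j=1..2^k. \<theta> k j * per_wavelet \<phi> k j x)"

definition tail_norm :: "(real \<Rightarrow> real) \<Rightarrow> (real \<Rightarrow> real) \<Rightarrow> (nat \<Rightarrow> nat \<Rightarrow> real) \<Rightarrow> nat \<Rightarrow> real" where
  "tail_norm \<phi> f \<theta> N = sqrt (LINT x|unit_lborel. (f x - wavelet_partial \<phi> \<theta> N x)\<^sup>2)"

lemma integrable_unit_continuous:
  fixes h :: "real \<Rightarrow> real"
  assumes "continuous_on {0..1} h" shows "integrable unit_lborel h"
proof -
  have "set_integrable lborel {0..1} h"
    unfolding set_integrable_def using assms by (intro borel_integrable_compact) auto
  then show ?thesis by (simp add: set_integrable_unit_iff)
qed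

lemma weighted_sum_le:
  fixes c y :: "'a \<Rightarrow> real"
  assumes "\<And>i. i \<in> I \<Longrightarrow> \<bar>c i\<bar> \<le> A" "(\<Sum>i\<in>I. \<bar>y i\<bar>) \<le> B" "0 \<le> A"
  shows "\<bar>\<Sum>i\<in>I. c i * y i\<bar> \<le> A * B"
proof -
  have "\<bar>\<Sum>i\<in>I. c i * y i\<bar> \<le> (\<Sum>i\<in>I. \<bar>c i * y i\<bar>)" by (rule sum_abs)
  also have "\<dots> \<le> (\<Sum>i\<in>I. A * \<bar>y i\<bar>)"
    using assms by (intro sum_mono) (auto simp: abs_mult intro: mult_right_mono)
  also have "\<dots> = A * (\<Sum>i\<in>I. \<bar>y i\<bar>)" by (simp add: sum_distrib_left)
  also have "\<dots> \<le> A * B" using assms by (intro mult_left_mono) auto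
  finally show ?thesis .
qed

lemma geometric_tail_le:
  fixes \<rho> :: real
  assumes "0 \<le> \<rho>" "\<rho> < 1"
  shows "(\<Sum>k=Suc m..N. \<rho> ^ k) \<le> \<rho> ^ Suc m / (1 - \<rho>)"
proof (cases "m \<le> N")
  case True
  have "(\<Sum>k=Suc m..N. \<rho> ^ k) + \<rho> ^ Suc N / (1 - \<rho>) = \<rho> ^ Suc m / (1 - \<rho>)"
    using True
  proof (induction N rule: dec_induct)
    case (step N)
    have "\<rho> ^ Suc N + \<rho> ^ Suc (Suc N) / (1 - \<rho>) = \<rho> ^ Suc N / (1 - \<rho>)"
      using assms by (simp add: field_simps)
    then show ?case using step by simp
  qed simp
  then show ?thesis using assms by (smt (verit) divide_nonneg_pos zero_le_power)
next
  case False
  then show ?thesis using assms by simp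
qed

lemma tail_norm_tendsto:
  assumes "has_wavelet_series \<phi> f \<theta>"
  shows "tail_norm \<phi> f \<theta> \<longlonglongrightarrow> 0"
proof -
  have "(\<lambda>N. LINT x|unit_lborel. (f x - wavelet_partial \<phi> \<theta> N x)\<^sup>2) \<longlonglongrightarrow> 0"
    using assms unfolding has_wavelet_series_def wavelet_partial_def by simp
  from tendsto_real_sqrt[OF this] show ?thesis unfolding tail_norm_def[abs_def] by simp
qed

text \<open>The estimates of \<open>per_wavelet_bounds\<close>, together with orthonormality and means, are all that is used of the wavelets
from here on.\<close>

locale bounded_wavelets =
  fixes \<phi> :: "real \<Rightarrow> real" and C :: real
  assumes C1: "1 \<le> C"
    and continuous_pw: "\<And>k j. j \<in> {1..2 ^ k} \<Longrightarrow> continuous_on {0..1} (per_wavelet \<phi> k j)"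
    and orthonormal_pw: "\<And>k j k' j'. j \<in> {1..2 ^ k} \<Longrightarrow> j' \<in> {1..2 ^ k'} \<Longrightarrow>
      (LINT x|unit_lborel. per_wavelet \<phi> k j x * per_wavelet \<phi> k' j' x) = (if k = k' \<and> j = j' then 1 else 0)"
    and mean_pw: "\<And>k j. j \<in> {1..2 ^ k} \<Longrightarrow> (LINT x|unit_lborel. per_wavelet \<phi> k j x) = 0"
    and sum_pw: "\<And>k x. x \<in> {0..1} \<Longrightarrow> (\<Sum>j\<in>{1..2 ^ k}. \<bar>per_wavelet \<phi> k j x\<bar>) \<le> C * sqrt 2 ^ k"
    and sum_prim: "\<And>k x. x \<in> {0..1} \<Longrightarrow> (\<Sum>j\<in>{1..2 ^ k}. \<bar>per_wavelet_prim \<phi> k j x\<bar>) \<le> C / sqrt 2 ^ k"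
    and mass_pw: "\<And>k j. j \<in> {1..2 ^ k} \<Longrightarrow> (LINT x|unit_lborel. \<bar>per_wavelet \<phi> k j x\<bar>) \<le> C / sqrt 2 ^ k"
    and pairing_pw: "\<And>k j g t. j \<in> {1..2 ^ k} \<Longrightarrow> continuous_on {0..1} g \<Longrightarrow> (LINT x|unit_lborel. g x) = 0 \<Longrightarrow>
      (\<And>x. x \<in> {0..1} \<Longrightarrow> \<bar>LBINT u:{0..x}. g u\<bar> \<le> t) \<Longrightarrow>
      \<bar>LINT x|unit_lborel. g x * per_wavelet \<phi> k j x\<bar> \<le> t * C * sqrt 2 ^ k"
    and pairing_prim: "\<And>k j w L. j \<in> {1..2 ^ k} \<Longrightarrow> (\<And>x y. \<bar>w x - w y\<bar> \<le> L * \<bar>x - y\<bar>) \<Longrightarrow>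
      (\<And>x. x \<notin> {0..1} \<Longrightarrow> w x = 0) \<Longrightarrow> (LINT x|unit_lborel. w x) = 0 \<Longrightarrow>
      \<bar>LINT x|unit_lborel. per_wavelet_prim \<phi> k j x * w x\<bar> \<le> L * C / (sqrt 2 ^ k * 2 ^ k * 2 ^ k)"
begin

abbreviation "S \<equiv> wavelet_partial \<phi>"

lemma continuous_partial: "continuous_on {0..1} (S \<theta> N)"
  unfolding wavelet_partial_def[abs_def] by (intro continuous_intros continuous_pw) auto

lemma series_error_integrable:
  assumes "has_wavelet_series \<phi> f \<theta>"
  shows "(\<lambda>x. f x - S \<theta> N x) \<in> borel_measurable unit_lborel"
    and "integrable unit_lborel (\<lambda>x. (f x - S \<theta> N x)\<^sup>2)"
    and "integrable unit_lborel f"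
proof -
  have f: "f \<in> borel_measurable unit_lborel" "integrable unit_lborel (\<lambda>x. (f x)\<^sup>2)"
    using assms by (auto simp: has_wavelet_series_def)
  have S: "S \<theta> N \<in> borel_measurable unit_lborel"
    using integrable_unit_continuous[OF continuous_partial] by (rule borel_measurable_integrable)
  have S2: "integrable unit_lborel (\<lambda>x. (S \<theta> N x)\<^sup>2)"
    by (intro integrable_unit_continuous continuous_intros continuous_partial)
  have fS: "integrable unit_lborel (\<lambda>x. f x * S \<theta> N x)"
    by (rule Cauchy_Schwarz_integral(1)[OF f(1) S f(2) S2])
  show "(\<lambda>x. f x - S \<theta> N x) \<in> borel_measurable unit_lborel" using f S by measurable
  have "integrable unit_lborel (\<lambda>x. (f x)\<^sup>2 + (S \<theta> N x)\<^sup>2 - 2 * (f x * S \<theta> N x))"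
    by (intro Bochner_Integration.integrable_diff Bochner_Integration.integrable_add f S2 integrable_mult_right fS)
  then show "integrable unit_lborel (\<lambda>x. (f x - S \<theta> N x)\<^sup>2)"
    by (simp add: power2_diff algebra_simps)
  have "integrable unit_lborel (\<lambda>x. f x * 1)"
    by (rule Cauchy_Schwarz_integral(1)[OF f(1) _ f(2)]) auto
  then show "integrable unit_lborel f" by simp
qed

text \<open>Convergence in \<open>L\<^sup>2\<close> passes to integrals against bounded functions: this yields the coefficients (against
wavelets) and the distribution function (against indicators).\<close>

lemma series_error_pairing:
  assumes f: "has_wavelet_series \<phi> f \<theta>" and X: "X \<in> borel_measurable unit_lborel" "\<And>x. x \<in> {0..1} \<Longrightarrow> \<bar>X x\<bar> \<le> B"
  shows "\<bar>(LINT x|unit_lborel. f x * X x) - (LINT x|unit_lborel. S \<theta> N x * X x)\<bar> \<le> tail_norm \<phi> f \<theta> N * B"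
    and "integrable unit_lborel (\<lambda>x. f x * X x)" "integrable unit_lborel (\<lambda>x. S \<theta> N x * X x)"
proof -
  have B: "0 \<le> B" using X(2)[of 0] by (auto intro: order.trans[OF abs_ge_zero])
  have X2b: "(X x)\<^sup>2 \<le> B\<^sup>2" if "x \<in> {0..1}" for x using power_mono[OF X(2)[OF that], of 2] by simp
  have X2: "integrable unit_lborel (\<lambda>x. (X x)\<^sup>2)"
    using X X2b by (intro integrable_unit_bounded[where B = "B\<^sup>2"]) auto
  have f': "f \<in> borel_measurable unit_lborel" "integrable unit_lborel (\<lambda>x. (f x)\<^sup>2)"
    using f by (auto simp: has_wavelet_series_def)
  show i1: "integrable unit_lborel (\<lambda>x. f x * X x)"
    by (rule Cauchy_Schwarz_integral(1)[OF f'(1) X(1) f'(2) X2])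
  show i2: "integrable unit_lborel (\<lambda>x. S \<theta> N x * X x)"
  proof (rule Cauchy_Schwarz_integral(1)[OF _ X(1) _ X2])
    show "S \<theta> N \<in> borel_measurable unit_lborel"
      using integrable_unit_continuous[OF continuous_partial] by (rule borel_measurable_integrable)
    show "integrable unit_lborel (\<lambda>x. (S \<theta> N x)\<^sup>2)"
      by (intro integrable_unit_continuous continuous_intros continuous_partial)
  qed
  have "(LINT x|unit_lborel. f x * X x) - (LINT x|unit_lborel. S \<theta> N x * X x) =
     (LINT x|unit_lborel. (f x - S \<theta> N x) * X x)"
    unfolding left_diff_distrib by (rule Bochner_Integration.integral_diff[OF i1 i2, symmetric])
  then have "((LINT x|unit_lborel. f x * X x) - (LINT x|unit_lborel. S \<theta> N x * X x))\<^sup>2 \<le>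
     (LINT x|unit_lborel. (f x - S \<theta> N x)\<^sup>2) * (LINT x|unit_lborel. (X x)\<^sup>2)"
    using Cauchy_Schwarz_integral(2)[OF series_error_integrable(1)[OF f] X(1) series_error_integrable(2)[OF f] X2] by simp
  also have "\<dots> \<le> (tail_norm \<phi> f \<theta> N)\<^sup>2 * B\<^sup>2"
  proof (rule mult_mono)
    have "0 \<le> (LINT x|unit_lborel. (f x - S \<theta> N x)\<^sup>2)" by (rule Bochner_Integration.integral_nonneg) simp
    then show "(LINT x|unit_lborel. (f x - S \<theta> N x)\<^sup>2) \<le> (tail_norm \<phi> f \<theta> N)\<^sup>2"
      unfolding tail_norm_def by (subst real_sqrt_pow2) auto
    have "(LINT x|unit_lborel. (X x)\<^sup>2) \<le> (LINT x|unit_lborel. B\<^sup>2)"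
      using X2b by (intro integral_mono X2) auto
    then show "(LINT x|unit_lborel. (X x)\<^sup>2) \<le> B\<^sup>2" by (simp add: unit_prob.prob_space[simplified])
  qed (auto intro: Bochner_Integration.integral_nonneg)
  also have "\<dots> = (tail_norm \<phi> f \<theta> N * B)\<^sup>2" by (simp add: power_mult_distrib)
  finally have "((LINT x|unit_lborel. f x * X x) - (LINT x|unit_lborel. S \<theta> N x * X x))\<^sup>2 \<le> (tail_norm \<phi> f \<theta> N * B)\<^sup>2" .
  moreover have "0 \<le> tail_norm \<phi> f \<theta> N * B" using B unfolding tail_norm_def
    by (intro mult_nonneg_nonneg real_sqrt_ge_zero Bochner_Integration.integral_nonneg) auto
  ultimately show "\<bar>(LINT x|unit_lborel. f x * X x) - (LINT x|unit_lborel. S \<theta> N x * X x)\<bar> \<le> tail_norm \<phi> f \<theta> N * B"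
    by (metis power2_abs power2_le_imp_le)
qed

lemma partial_pairing:
  assumes X: "X \<in> borel_measurable unit_lborel" "\<And>x. x \<in> {0..1} \<Longrightarrow> \<bar>X x\<bar> \<le> B"
  shows "(LINT x|unit_lborel. S \<theta> N x * X x) = (\<Sum>k=1..N. \<Sum>j=1..2^k. \<theta> k j * (LINT x|unit_lborel. per_wavelet \<phi> k j x * X x))"
proof -
  have i: "integrable unit_lborel (\<lambda>x. per_wavelet \<phi> k j x * X x)" if "j \<in> {1..2 ^ k}" for k j
  proof (rule Cauchy_Schwarz_integral(1)[OF _ X(1)])
    show "per_wavelet \<phi> k j \<in> borel_measurable unit_lborel"
      using integrable_unit_continuous[OF continuous_pw[OF that]] by (rule borel_measurable_integrable)
    show "integrable unit_lborel (\<lambda>x. (per_wavelet \<phi> k j x)\<^sup>2)"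
      by (intro integrable_unit_continuous continuous_intros continuous_pw that)
    have "(X x)\<^sup>2 \<le> B\<^sup>2" if "x \<in> {0..1}" for x using power_mono[OF X(2)[OF that], of 2] by simp
    then show "integrable unit_lborel (\<lambda>x. (X x)\<^sup>2)"
      using X by (intro integrable_unit_bounded[where B = "B\<^sup>2"]) auto
  qed
  have "(LINT x|unit_lborel. S \<theta> N x * X x) =
      (LINT x|unit_lborel. (\<Sum>k=1..N. \<Sum>j=1..2^k. \<theta> k j * (per_wavelet \<phi> k j x * X x)))"
    by (simp add: wavelet_partial_def sum_distrib_right mult.assoc)
  also have "\<dots> = (\<Sum>k=1..N. LINT x|unit_lborel. (\<Sum>j=1..2^k. \<theta> k j * (per_wavelet \<phi> k j x * X x)))"
    by (intro Bochner_Integration.integral_sum Bochner_Integration.integrable_sum integrable_mult_right i)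
  also have "\<dots> = (\<Sum>k=1..N. \<Sum>j=1..2^k. LINT x|unit_lborel. \<theta> k j * (per_wavelet \<phi> k j x * X x))"
    by (intro sum.cong refl Bochner_Integration.integral_sum integrable_mult_right i)
  finally show ?thesis by simp
qed

lemma pw_bounded:
  assumes j: "j \<in> {1..2 ^ k}"
  shows "per_wavelet \<phi> k j \<in> borel_measurable unit_lborel" "x \<in> {0..1} \<Longrightarrow> \<bar>per_wavelet \<phi> k j x\<bar> \<le> C * sqrt 2 ^ k"
proof -
  show "per_wavelet \<phi> k j \<in> borel_measurable unit_lborel"
    using integrable_unit_continuous[OF continuous_pw[OF j]] by (rule borel_measurable_integrable)
  assume "x \<in> {0..1}"
  have "\<bar>per_wavelet \<phi> k j x\<bar> \<le> (\<Sum>j\<in>{1..2 ^ k}. \<bar>per_wavelet \<phi> k j x\<bar>)"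
    using j by (intro member_le_sum) auto
  also have "\<dots> \<le> C * sqrt 2 ^ k" by (rule sum_pw) fact
  finally show "\<bar>per_wavelet \<phi> k j x\<bar> \<le> C * sqrt 2 ^ k" .
qed

lemma partial_coefficient:
  assumes j: "j \<in> {1..2 ^ k}" and k: "k \<in> {1..N}"
  shows "(LINT x|unit_lborel. S \<theta> N x * per_wavelet \<phi> k j x) = \<theta> k j"
proof -
  have "(LINT x|unit_lborel. S \<theta> N x * per_wavelet \<phi> k j x) =
     (\<Sum>k'=1..N. \<Sum>j'=1..2^k'. \<theta> k' j' * (if k' = k \<and> j' = j then 1 else 0))"
    using j by (subst partial_pairing[OF pw_bounded[OF j]]) (auto intro!: sum.cong simp: orthonormal_pw)
  also have "\<dots> = (\<Sum>k'=1..N. if k' = k then \<theta> k j else 0)"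
  proof (intro sum.cong refl)
    fix k'
    show "(\<Sum>j'=1..2^k'. \<theta> k' j' * (if k' = k \<and> j' = j then 1 else 0)) = (if k' = k then \<theta> k j else 0)"
    proof (cases "k' = k")
      case True
      have "(\<Sum>j'=1..2^k'. \<theta> k' j' * (if k' = k \<and> j' = j then 1 else 0)) = (\<Sum>j'=1..2^k. if j' = j then \<theta> k j' else 0)"
        using True by (intro sum.cong) auto
      also have "\<dots> = \<theta> k j" using j by (subst sum.delta) auto
      finally show ?thesis using True by simp
    qed simp
  qed
  also have "\<dots> = \<theta> k j" using k by (subst sum.delta) auto
  finally show ?thesis .
qed

text \<open>The coefficients are determined by the function; hence the coefficient families in the definitions of orientation and of the
Besov body, which are only claimed to exist, are the same.\<close>

lemma coefficient_eq:
  assumes f: "has_wavelet_series \<phi> f \<theta>" and k: "1 \<le> k" and j: "j \<in> {1..2 ^ k}"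
  shows "\<theta> k j = (LINT x|unit_lborel. f x * per_wavelet \<phi> k j x)"
proof -
  have "(\<lambda>N. \<bar>(LINT x|unit_lborel. f x * per_wavelet \<phi> k j x) - \<theta> k j\<bar>) \<longlonglongrightarrow> 0"
  proof (rule tendsto_sandwich[of "\<lambda>_. 0" _ _ "\<lambda>N. tail_norm \<phi> f \<theta> N * (C * sqrt 2 ^ k)"])
    show "\<forall>\<^sub>F N in sequentially. \<bar>(LINT x|unit_lborel. f x * per_wavelet \<phi> k j x) - \<theta> k j\<bar> \<le> tail_norm \<phi> f \<theta> N * (C * sqrt 2 ^ k)"
      using eventually_ge_at_top[of k]
    proof eventually_elim
      case (elim N)
      then show ?case
        using series_error_pairing(1)[OF f pw_bounded[OF j], of N] partial_coefficient[OF j, of N \<theta>] k by simp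
    qed
    show "(\<lambda>N. tail_norm \<phi> f \<theta> N * (C * sqrt 2 ^ k)) \<longlonglongrightarrow> 0"
      using tendsto_mult_right[OF tail_norm_tendsto[OF f], of "C * sqrt 2 ^ k"] by simp
  qed auto
  then have "\<bar>(LINT x|unit_lborel. f x * per_wavelet \<phi> k j x) - \<theta> k j\<bar> = 0"
    using LIMSEQ_const_iff by blast
  then show ?thesis by simp
qed

lemma coefficient_le:
  assumes f: "has_wavelet_series \<phi> f \<theta>" and k: "1 \<le> k" and j: "j \<in> {1..2 ^ k}"
    and b: "AE x in unit_lborel. \<bar>f x\<bar> \<le> c" "0 \<le> c"
  shows "\<bar>\<theta> k j\<bar> \<le> c * C / sqrt 2 ^ k"
proof -
  have ip: "integrable unit_lborel (\<lambda>x. \<bar>per_wavelet \<phi> k j x\<bar>)"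
    by (intro integrable_unit_continuous continuous_intros continuous_pw j)
  have "\<bar>\<theta> k j\<bar> = \<bar>LINT x|unit_lborel. f x * per_wavelet \<phi> k j x\<bar>" using coefficient_eq[OF f k j] by simp
  also have "\<dots> \<le> (LINT x|unit_lborel. \<bar>f x * per_wavelet \<phi> k j x\<bar>)" by (rule integral_abs_bound)
  also have "\<dots> \<le> (LINT x|unit_lborel. c * \<bar>per_wavelet \<phi> k j x\<bar>)"
  proof (rule integral_mono_AE)
    show "integrable unit_lborel (\<lambda>x. \<bar>f x * per_wavelet \<phi> k j x\<bar>)"
      by (rule integrable_abs[OF series_error_pairing(2)[OF f pw_bounded[OF j]]])
    show "integrable unit_lborel (\<lambda>x. c * \<bar>per_wavelet \<phi> k j x\<bar>)" using ip by (rule integrable_mult_right)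
    show "AE x in unit_lborel. \<bar>f x * per_wavelet \<phi> k j x\<bar> \<le> c * \<bar>per_wavelet \<phi> k j x\<bar>"
      using b(1) by eventually_elim (simp add: abs_mult mult_right_mono)
  qed
  also have "\<dots> = c * (LINT x|unit_lborel. \<bar>per_wavelet \<phi> k j x\<bar>)" by simp
  also have "\<dots> \<le> c * (C / sqrt 2 ^ k)" using b(2) by (intro mult_left_mono mass_pw j)
  finally show ?thesis by simp
qed

lemma indicator_unit:
  assumes "x \<in> {0..1}"
  shows "(indicator {0..x} :: real \<Rightarrow> real) \<in> borel_measurable unit_lborel" "\<bar>indicator {0..x} t :: real\<bar> \<le> 1"
  by (auto intro!: unit_borel_measurable split: split_indicator)

lemma partial_cdf_eq:
  assumes x: "x \<in> {0..1}"
  shows "partial_cdf \<phi> \<theta> N x = x + (LBINT t:{0..x}. S \<theta> N t)"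
proof -
  have "(LBINT t:{0..x}. S \<theta> N t) = (LINT t|unit_lborel. S \<theta> N t * indicator {0..x} t)"
    using set_integral_sub_unit[OF x] by (simp add: mult.commute)
  also have "\<dots> = (\<Sum>k=1..N. \<Sum>j=1..2^k. \<theta> k j * (LINT t|unit_lborel. per_wavelet \<phi> k j t * indicator {0..x} t))"
    by (rule partial_pairing[OF indicator_unit[OF x]])
  also have "\<dots> = (\<Sum>k=1..N. \<Sum>j=1..2^k. \<theta> k j * per_wavelet_prim \<phi> k j x)"
    using set_integral_sub_unit[OF x] by (simp add: per_wavelet_prim_def mult.commute)
  finally show ?thesis by (simp add: partial_cdf_def)
qed

lemma partial_cdf_error:
  assumes f: "has_wavelet_series \<phi> f \<theta>" and x: "x \<in> {0..1}"
  shows "\<bar>drift_cdf f x - partial_cdf \<phi> \<theta> N x\<bar> \<le> tail_norm \<phi> f \<theta> N"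
  using series_error_pairing(1)[OF f indicator_unit[OF x], of N]
  unfolding partial_cdf_eq[OF x] drift_cdf_def set_integral_sub_unit[OF x] by (simp add: mult.commute)

lemma partial_mean: "(LINT x|unit_lborel. S \<theta> N x) = 0"
proof -
  have "(LINT x|unit_lborel. S \<theta> N x * 1) = (\<Sum>k=1..N. \<Sum>j=1..2^k. \<theta> k j * (LINT x|unit_lborel. per_wavelet \<phi> k j x * 1))"
    by (rule partial_pairing[where B = 1]) auto
  also have "\<dots> = 0" by (simp add: mean_pw)
  finally show ?thesis by simp
qed

text \<open>Low-frequency coefficients are bounded by the supremum of the primitive of a partial sum, which is how assumption G
bounds individual coefficients.\<close>

lemma coefficient_le_partial_cdf:
  assumes k: "k \<in> {1..l}" and j: "j \<in> {1..2 ^ k}" and t: "\<And>x. x \<in> {0..1} \<Longrightarrow> \<bar>partial_cdf \<phi> \<theta> l x - x\<bar> \<le> t"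
  shows "\<bar>\<theta> k j\<bar> \<le> t * C * sqrt 2 ^ k"
  using pairing_pw[OF j continuous_partial partial_mean, of \<theta> l t] partial_coefficient[OF j k, of \<theta>]
    t partial_cdf_eq[of _ \<theta> l] by simp

text \<open>The preceding bound in the limit of all levels.\<close>

lemma coefficient_le_drift:
  assumes f: "has_wavelet_series \<phi> f \<theta>" and k: "1 \<le> k" and j: "j \<in> {1..2 ^ k}"
    and t: "\<And>x. x \<in> {0..1} \<Longrightarrow> \<bar>drift_cdf f x - x\<bar> \<le> t"
  shows "\<bar>\<theta> k j\<bar> \<le> t * C * sqrt 2 ^ k"
proof (rule tendsto_lowerbound)
  show "(\<lambda>N. (t + tail_norm \<phi> f \<theta> N) * C * sqrt 2 ^ k) \<longlonglongrightarrow> t * C * sqrt 2 ^ k"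
    using tendsto_add[OF tendsto_const tail_norm_tendsto[OF f], of t]
    by (intro tendsto_mult_right) simp
  show "\<forall>\<^sub>F N in sequentially. \<bar>\<theta> k j\<bar> \<le> (t + tail_norm \<phi> f \<theta> N) * C * sqrt 2 ^ k"
    using eventually_ge_at_top[of k]
  proof eventually_elim
    case (elim N)
    have "\<bar>partial_cdf \<phi> \<theta> N x - x\<bar> \<le> t + tail_norm \<phi> f \<theta> N" if "x \<in> {0..1}" for x
      using partial_cdf_error[OF f that, of N] t[OF that] by linarith
    then show ?case using elim k j by (intro coefficient_le_partial_cdf[of k N]) auto
  qed
qed simp

text \<open>Coefficients of order \<open>2\<^bsup>-k/2\<^esup>\<close> on level \<open>k\<close> contribute \<open>2\<^bsup>-k\<^esup>\<close> to the primitive.\<close>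

lemma level_prim_le:
  assumes "x \<in> {0..1}" "\<And>j. j \<in> {1..2 ^ k} \<Longrightarrow> \<bar>\<theta> k j\<bar> \<le> A / sqrt 2 ^ k" "0 \<le> A"
  shows "\<bar>\<Sum>j=1..2^k. \<theta> k j * per_wavelet_prim \<phi> k j x\<bar> \<le> A * C * (1/2) ^ k"
proof -
  have "\<bar>\<Sum>j=1..2^k. \<theta> k j * per_wavelet_prim \<phi> k j x\<bar> \<le> (A / sqrt 2 ^ k) * (C / sqrt 2 ^ k)"
    using assms by (intro weighted_sum_le sum_prim) auto
  also have "\<dots> = A * C * (1/2) ^ k" by (simp add: sqrt2_power_mult power_divide)
  finally show ?thesis .
qed

lemma partial_cdf_split:
  assumes "l \<le> N"
  shows "partial_cdf \<phi> \<theta> N x = partial_cdf \<phi> \<theta> l x + (\<Sum>k=Suc l..N. \<Sum>j=1..2^k. \<theta> k j * per_wavelet_prim \<phi> k j x)"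
proof -
  have "{1..N} = {1..l} \<union> {Suc l..N}" "{1..l} \<inter> {Suc l..N} = {}" using assms by auto
  then show ?thesis by (simp add: partial_cdf_def sum.union_disjoint)
qed

text \<open>Levels up to \<open>l\<close> are estimated together, the next \<open>H\<close> levels by the bound \<open>B\<close>, and the remaining ones by the general
bound \<open>A\<close>, which gains the factor \<open>2\<^bsup>-H\<^esup>\<close> over the level \<open>l\<close>.\<close>

lemma drift_le_coefficients:
  assumes f: "has_wavelet_series \<phi> f \<theta>" and x: "x \<in> {0..1}"
    and low: "\<bar>partial_cdf \<phi> \<theta> l x - x\<bar> \<le> t"
    and mid: "\<And>k j. l < k \<Longrightarrow> k \<le> l + H \<Longrightarrow> j \<in> {1..2 ^ k} \<Longrightarrow> \<bar>\<theta> k j\<bar> \<le> B / sqrt 2 ^ k" "0 \<le> B"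
    and high: "\<And>k j. 1 \<le> k \<Longrightarrow> j \<in> {1..2 ^ k} \<Longrightarrow> \<bar>\<theta> k j\<bar> \<le> A / sqrt 2 ^ k" "0 \<le> A"
  shows "\<bar>drift_cdf f x - x\<bar> \<le> t + B * C * (1/2) ^ l + A * C * (1/2) ^ (l + H)"
proof (rule tendsto_lowerbound)
  show "(\<lambda>N. t + B * C * (1/2) ^ l + A * C * (1/2) ^ (l + H) + tail_norm \<phi> f \<theta> N) \<longlonglongrightarrow>
     t + B * C * (1/2) ^ l + A * C * (1/2) ^ (l + H)"
    using tendsto_add[OF tendsto_const tail_norm_tendsto[OF f]] by fastforce
  show "\<forall>\<^sub>F N in sequentially. \<bar>drift_cdf f x - x\<bar> \<le> t + B * C * (1/2) ^ l + A * C * (1/2) ^ (l + H) + tail_norm \<phi> f \<theta> N"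
    \<comment> \<open>It suffices to treat partial sums, up to their distance from \<open>f\<close>.\<close>
    using eventually_ge_at_top[of "l + H"]
  proof eventually_elim
    case (elim N)
    let ?L = "\<lambda>k. \<Sum>j=1..2^k. \<theta> k j * per_wavelet_prim \<phi> k j x"
    have geo: "(\<Sum>k=Suc a..b. (1/2::real) ^ k) \<le> (1/2) ^ a" for a b
      using geometric_tail_le[of "1/2" a b] by simp
    have AC: "0 \<le> A * C" "0 \<le> B * C" using mid(2) high(2) C1 by auto
    have "\<bar>\<Sum>k=Suc l..l + H. ?L k\<bar> \<le> (\<Sum>k=Suc l..l + H. \<bar>?L k\<bar>)" by (rule sum_abs)
    also have "\<dots> \<le> (\<Sum>k=Suc l..l + H. B * C * (1/2) ^ k)"
      using mid by (intro sum_mono level_prim_le[OF x]) auto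
    also have "\<dots> \<le> B * C * (1/2) ^ l"
      unfolding sum_distrib_left[symmetric] using AC by (intro mult_left_mono geo)
    finally have 1: "\<bar>\<Sum>k=Suc l..l + H. ?L k\<bar> \<le> B * C * (1/2) ^ l" .
    have "\<bar>\<Sum>k=Suc (l + H)..N. ?L k\<bar> \<le> (\<Sum>k=Suc (l + H)..N. \<bar>?L k\<bar>)" by (rule sum_abs)
    also have "\<dots> \<le> (\<Sum>k=Suc (l + H)..N. A * C * (1/2) ^ k)"
      using high by (intro sum_mono level_prim_le[OF x]) auto
    also have "\<dots> \<le> A * C * (1/2) ^ (l + H)"
      unfolding sum_distrib_left[symmetric] using AC by (intro mult_left_mono geo)
    finally have 2: "\<bar>\<Sum>k=Suc (l + H)..N. ?L k\<bar> \<le> A * C * (1/2) ^ (l + H)" .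
    have "partial_cdf \<phi> \<theta> N x = partial_cdf \<phi> \<theta> l x + (\<Sum>k=Suc l..l + H. ?L k) + (\<Sum>k=Suc (l + H)..N. ?L k)"
      using partial_cdf_split[OF elim, of \<theta> x] partial_cdf_split[of l "l + H" \<theta> x] by simp
    then show ?case using 1 2 low partial_cdf_error[OF f x, of N] by linarith
  qed
qed simp

text \<open>The excess of \<open>\<bar>f\<bar>\<close> over \<open>b\<close> is at most the distance to any partial sum, whose \<open>L\<^sup>2\<close> norm tends to zero.\<close>

lemma AE_le_of_partial_sums:
  assumes f: "has_wavelet_series \<phi> f \<theta>" and b: "\<And>N x. x \<in> {0..1} \<Longrightarrow> \<bar>S \<theta> N x\<bar> \<le> b"
  shows "AE x in unit_lborel. \<bar>f x\<bar> \<le> b"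
proof -
  let ?h = "\<lambda>x. (max 0 (\<bar>f x\<bar> - b))\<^sup>2"
  have fm: "f \<in> borel_measurable unit_lborel" using f by (simp add: has_wavelet_series_def)
  \<comment> \<open>The function \<open>?h\<close> is the squared excess over \<open>b\<close>.\<close>
  have le: "?h x \<le> (f x - S \<theta> N x)\<^sup>2" if "x \<in> {0..1}" for x N
  proof -
    have "max 0 (\<bar>f x\<bar> - b) \<le> \<bar>f x - S \<theta> N x\<bar>" using b[OF that, of N] by linarith
    then have "?h x \<le> \<bar>f x - S \<theta> N x\<bar>\<^sup>2" by (intro power_mono) auto
    then show ?thesis by simp
  qed
  have i: "integrable unit_lborel ?h"
    by (rule Bochner_Integration.integrable_bound[OF series_error_integrable(2)[OF f, of 0]])
      (use fm le[of _ 0] in auto)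
  have "(LINT x|unit_lborel. ?h x) \<le> (LINT x|unit_lborel. (f x - S \<theta> N x)\<^sup>2)" for N
    using le by (intro integral_mono i series_error_integrable(2)[OF f]) auto
  moreover have "(\<lambda>N. LINT x|unit_lborel. (f x - S \<theta> N x)\<^sup>2) \<longlonglongrightarrow> 0"
    using f unfolding has_wavelet_series_def wavelet_partial_def by simp
  ultimately have "(LINT x|unit_lborel. ?h x) \<le> 0"
    by (intro tendsto_lowerbound[of _ 0 sequentially]) auto
  moreover have "0 \<le> (LINT x|unit_lborel. ?h x)" by (rule Bochner_Integration.integral_nonneg) simp
  ultimately have "(LINT x|unit_lborel. ?h x) = 0" by simp
  then have "AE x in unit_lborel. ?h x = 0"
    using integral_nonneg_eq_0_iff_AE[OF i] by simp
  then show ?thesis by eventually_elim (auto simp: max_def split: if_splits)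
qed

lemma level_le:
  assumes "x \<in> {0..1}" "\<And>j. j \<in> {1..2 ^ k} \<Longrightarrow> \<bar>\<theta> k j\<bar> \<le> A" "0 \<le> A"
  shows "\<bar>\<Sum>j=1..2^k. \<theta> k j * per_wavelet \<phi> k j x\<bar> \<le> A * (C * sqrt 2 ^ k)"
  using assms by (intro weighted_sum_le sum_pw) auto

text \<open>The three ranges of levels are dominated by geometric series: increasing on the low levels, constant on the \<open>H\<close>
intermediate ones and decreasing on the high ones.\<close>

lemma partial_sum_le:
  assumes x: "x \<in> {0..1}" and \<rho>: "0 < \<rho>" "\<rho> < 1"
    and low: "\<And>k j. 1 \<le> k \<Longrightarrow> k \<le> l \<Longrightarrow> j \<in> {1..2 ^ k} \<Longrightarrow> \<bar>\<theta> k j\<bar> \<le> D * sqrt 2 ^ k" "0 \<le> D"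
    and mid: "\<And>k j. l < k \<Longrightarrow> k \<le> l + H \<Longrightarrow> j \<in> {1..2 ^ k} \<Longrightarrow> \<bar>\<theta> k j\<bar> \<le> B / sqrt 2 ^ k" "0 \<le> B"
    and high: "\<And>k j. 1 \<le> k \<Longrightarrow> j \<in> {1..2 ^ k} \<Longrightarrow> \<bar>\<theta> k j\<bar> \<le> P * \<rho> ^ k / sqrt 2 ^ k" "0 \<le> P"
  shows "\<bar>S \<theta> N x\<bar> \<le> D * C * 2 ^ Suc l + B * C * real H + P * C * \<rho> ^ (l + H) / (1 - \<rho>)"
proof -
  define L where "L k = \<bar>\<Sum>j=1..2^k. \<theta> k j * per_wavelet \<phi> k j x\<bar>" for k
  have C0: "0 \<le> C" using C1 by simp
  have L0: "0 \<le> L k" for k by (simp add: L_def)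
  have sq: "sqrt 2 ^ k * (C * sqrt 2 ^ k) = C * 2 ^ k" "C * sqrt 2 ^ k / sqrt 2 ^ k = C" for k :: nat
    by (simp_all add: mult.left_commute sqrt2_power_mult)
  have l1: "L k \<le> D * C * 2 ^ k" if "1 \<le> k" "k \<le> l" for k
    using level_le[OF x, of k \<theta> "D * sqrt 2 ^ k"] low that sq(1)[of k] by (simp add: L_def mult.assoc)
  have l2: "L k \<le> B * C" if "l < k" "k \<le> l + H" for k
    using level_le[OF x, of k \<theta> "B / sqrt 2 ^ k"] mid that by (simp add: L_def)
  have l3: "L k \<le> P * C * \<rho> ^ k" if "1 \<le> k" for k
    using level_le[OF x, of k \<theta> "P * \<rho> ^ k / sqrt 2 ^ k"] high that \<rho> by (simp add: L_def mult_ac)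
  have "\<bar>S \<theta> N x\<bar> \<le> (\<Sum>k=1..N. L k)"
    unfolding wavelet_partial_def L_def by (rule sum_abs)
  also have "\<dots> \<le> (\<Sum>k\<in>{1..l} \<union> {Suc l..l + H} \<union> {Suc (l + H)..N}. L k)"
    using L0 by (intro sum_mono2) auto
  also have "\<dots> = (\<Sum>k=1..l. L k) + (\<Sum>k=Suc l..l + H. L k) + (\<Sum>k=Suc (l + H)..N. L k)"
    by (subst sum.union_disjoint; auto simp: sum.union_disjoint)
  also have "(\<Sum>k=1..l. L k) \<le> D * C * 2 ^ Suc l"
  proof -
    have "(\<Sum>k=1..l. L k) \<le> (\<Sum>k=1..l. D * C * 2 ^ k)" using l1 by (intro sum_mono) auto
    also have "\<dots> = D * C * (\<Sum>k=1..l. 2 ^ k)" by (simp add: sum_distrib_left)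
    also have "(\<Sum>k=1..l. (2::real) ^ k) \<le> 2 ^ Suc l" by (induction l) auto
    finally show ?thesis using low(2) C0 by (simp add: mult_left_mono)
  qed
  also have "(\<Sum>k=Suc l..l + H. L k) \<le> B * C * real H"
  proof -
    have "(\<Sum>k=Suc l..l + H. L k) \<le> (\<Sum>k=Suc l..l + H. B * C)" using l2 by (intro sum_mono) auto
    then show ?thesis by (simp add: mult_ac)
  qed
  also have "(\<Sum>k=Suc (l + H)..N. L k) \<le> P * C * \<rho> ^ (l + H) / (1 - \<rho>)"
  proof -
    have "(\<Sum>k=Suc (l + H)..N. L k) \<le> (\<Sum>k=Suc (l + H)..N. P * C * \<rho> ^ k)" using l3 by (intro sum_mono) auto
    also have "\<dots> = P * C * (\<Sum>k=Suc (l + H)..N. \<rho> ^ k)" by (simp add: sum_distrib_left)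
    also have "(\<Sum>k=Suc (l + H)..N. \<rho> ^ k) \<le> \<rho> ^ Suc (l + H) / (1 - \<rho>)"
      using \<rho> by (intro geometric_tail_le) auto
    also have "\<dots> \<le> \<rho> ^ (l + H) / (1 - \<rho>)"
      using \<rho> by (intro divide_right_mono power_decreasing) auto
    finally show ?thesis using high(2) C0 by (simp add: mult_left_mono)
  qed
  finally show ?thesis by simp
qed

lemma continuous_prim_pw:
  assumes "j \<in> {1..2 ^ k}"
  shows "continuous_on {0..1} (per_wavelet_prim \<phi> k j)"
  unfolding per_wavelet_prim_def[abs_def]
  by (intro continuous_on_integral_unit integrable_unit_continuous continuous_pw assms)

lemma continuous_partial_cdf: "continuous_on {0..1} (partial_cdf \<phi> \<theta> N)"
  unfolding partial_cdf_def[abs_def] by (intro continuous_intros continuous_prim_pw) auto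

text \<open>Against a Lipschitz weight of mean zero, level \<open>k\<close> of the primitive contributes only \<open>4\<^bsup>-k\<^esup>\<close>, by the vanishing moment
of the primitive, whereas its supremum may be of order \<open>2\<^bsup>-k\<^esup>\<close>. At \<open>2\<^sup>k\<close> of order \<open>n\<^bsup>1/2-r\<^esup>\<close> the supremum is of the critical order
\<open>n\<^bsup>-1/2\<^esup>\<close>, and the average is of smaller order.\<close>

lemma drift_oscillation_le:
  assumes f: "has_wavelet_series \<phi> f \<theta>" and F: "continuous_on {0..1} (drift_cdf f)"
    and low: "\<And>x. x \<in> {0..1} \<Longrightarrow> \<bar>partial_cdf \<phi> \<theta> l x - x\<bar> \<le> t"
    and high: "\<And>k j. 1 \<le> k \<Longrightarrow> j \<in> {1..2 ^ k} \<Longrightarrow> \<bar>\<theta> k j\<bar> \<le> A / sqrt 2 ^ k" "0 \<le> A"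
    and w: "\<And>x y. \<bar>w x - w y\<bar> \<le> L * \<bar>x - y\<bar>" "\<And>x. x \<notin> {0..1} \<Longrightarrow> w x = 0" "(LINT x|unit_lborel. w x) = 0"
      "continuous_on {0..1} w" "\<And>x. \<bar>w x\<bar> \<le> W"
  shows "\<bar>LINT x|unit_lborel. (drift_cdf f x - x) * w x\<bar> \<le> t * W + A * C * L * (1/4) ^ l"
proof (rule tendsto_lowerbound)
  show "(\<lambda>N. t * W + A * C * L * (1/4) ^ l + tail_norm \<phi> f \<theta> N * W) \<longlonglongrightarrow> t * W + A * C * L * (1/4) ^ l"
    using tendsto_add[OF tendsto_const tendsto_mult_right[OF tail_norm_tendsto[OF f], of W]] by fastforce
  have bound: "\<bar>LINT x|unit_lborel. h x * w x\<bar> \<le> b * W"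
    if "continuous_on {0..1} h" "\<And>x. x \<in> {0..1} \<Longrightarrow> \<bar>h x\<bar> \<le> b" for h b
  proof -
    have b: "0 \<le> b" using that(2)[of 0] by (auto intro: order.trans[OF abs_ge_zero])
    have i: "integrable unit_lborel (\<lambda>x. h x * w x)"
      by (intro integrable_unit_continuous continuous_intros that w)
    have "\<bar>LINT x|unit_lborel. h x * w x\<bar> \<le> (LINT x|unit_lborel. \<bar>h x * w x\<bar>)" by (rule integral_abs_bound)
    also have "\<dots> \<le> (LINT x|unit_lborel. b * W)"
      using that(2) w(5) b by (intro integral_mono integrable_abs i) (auto simp: abs_mult intro!: mult_mono)
    also have "\<dots> = b * W" by (simp add: unit_prob.prob_space[simplified])
    finally show ?thesis .
  qed
  have L: "0 \<le> L" using w(1)[of 0 1] by (auto intro: order.trans[OF abs_ge_zero])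
  show "\<forall>\<^sub>F N in sequentially. \<bar>LINT x|unit_lborel. (drift_cdf f x - x) * w x\<bar> \<le>
      t * W + A * C * L * (1/4) ^ l + tail_norm \<phi> f \<theta> N * W"
    using eventually_ge_at_top[of l]
  proof eventually_elim
    case (elim N)
    let ?e = "\<lambda>x. drift_cdf f x - partial_cdf \<phi> \<theta> N x" and ?p = "\<lambda>x. partial_cdf \<phi> \<theta> l x - x"
    let ?L = "\<lambda>k x. \<Sum>j=1..2^k. \<theta> k j * per_wavelet_prim \<phi> k j x"
    have ce: "continuous_on {0..1} ?e" "continuous_on {0..1} ?p"
      by (intro continuous_intros F continuous_partial_cdf)+
    have ip: "integrable unit_lborel (\<lambda>x. \<theta> k j * (per_wavelet_prim \<phi> k j x * w x))" if "j \<in> {1..2 ^ k}" for k j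
      by (intro integrable_unit_continuous continuous_intros continuous_prim_pw that w)
    have i1: "integrable unit_lborel (\<lambda>x. ?e x * w x)" and i2: "integrable unit_lborel (\<lambda>x. ?p x * w x)"
      by (intro integrable_unit_continuous continuous_on_mult ce w)+
    have i3: "integrable unit_lborel (\<lambda>x. \<Sum>k=Suc l..N. \<Sum>j=1..2^k. \<theta> k j * (per_wavelet_prim \<phi> k j x * w x))"
      by (intro Bochner_Integration.integrable_sum ip)
    have "(LINT x|unit_lborel. (drift_cdf f x - x) * w x) =
      (LINT x|unit_lborel. ?e x * w x + (?p x * w x + (\<Sum>k=Suc l..N. \<Sum>j=1..2^k. \<theta> k j * (per_wavelet_prim \<phi> k j x * w x))))"
    proof (rule Bochner_Integration.integral_cong[OF refl])
      fix x
      have "(\<Sum>k=Suc l..N. \<Sum>j=1..2^k. \<theta> k j * (per_wavelet_prim \<phi> k j x * w x)) = (\<Sum>k=Suc l..N. ?L k x) * w x"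
        by (simp add: sum_distrib_right mult.assoc)
      then show "(drift_cdf f x - x) * w x = ?e x * w x + (?p x * w x + (\<Sum>k=Suc l..N. \<Sum>j=1..2^k. \<theta> k j * (per_wavelet_prim \<phi> k j x * w x)))"
        using partial_cdf_split[OF elim, of \<theta> x] by (simp add: algebra_simps)
    qed
    also have "\<dots> = (LINT x|unit_lborel. ?e x * w x) + ((LINT x|unit_lborel. ?p x * w x) +
       (LINT x|unit_lborel. (\<Sum>k=Suc l..N. \<Sum>j=1..2^k. \<theta> k j * (per_wavelet_prim \<phi> k j x * w x))))"
      by (simp only: Bochner_Integration.integral_add[OF i1 Bochner_Integration.integrable_add[OF i2 i3]]
          Bochner_Integration.integral_add[OF i2 i3])
    also have "(LINT x|unit_lborel. (\<Sum>k=Suc l..N. \<Sum>j=1..2^k. \<theta> k j * (per_wavelet_prim \<phi> k j x * w x))) =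
       (\<Sum>k=Suc l..N. \<Sum>j=1..2^k. \<theta> k j * (LINT x|unit_lborel. per_wavelet_prim \<phi> k j x * w x))"
    proof -
      have "(LINT x|unit_lborel. (\<Sum>k=Suc l..N. \<Sum>j=1..2^k. \<theta> k j * (per_wavelet_prim \<phi> k j x * w x))) =
         (\<Sum>k=Suc l..N. LINT x|unit_lborel. (\<Sum>j=1..2^k. \<theta> k j * (per_wavelet_prim \<phi> k j x * w x)))"
        by (intro Bochner_Integration.integral_sum Bochner_Integration.integrable_sum ip)
      also have "\<dots> = (\<Sum>k=Suc l..N. \<Sum>j=1..2^k. LINT x|unit_lborel. \<theta> k j * (per_wavelet_prim \<phi> k j x * w x))"
        by (intro sum.cong refl Bochner_Integration.integral_sum ip)
      finally show ?thesis by simp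
    qed
    finally have eq: "(LINT x|unit_lborel. (drift_cdf f x - x) * w x) = (LINT x|unit_lborel. ?e x * w x) +
      ((LINT x|unit_lborel. ?p x * w x) + (\<Sum>k=Suc l..N. \<Sum>j=1..2^k. \<theta> k j * (LINT x|unit_lborel. per_wavelet_prim \<phi> k j x * w x)))" .
    have 1: "\<bar>LINT x|unit_lborel. ?e x * w x\<bar> \<le> tail_norm \<phi> f \<theta> N * W"
      by (rule bound[OF ce(1) partial_cdf_error[OF f]])
    have 2: "\<bar>LINT x|unit_lborel. ?p x * w x\<bar> \<le> t * W"
      by (rule bound[OF ce(2) low])
    have lev: "\<bar>\<Sum>j=1..2^k. \<theta> k j * (LINT x|unit_lborel. per_wavelet_prim \<phi> k j x * w x)\<bar> \<le> A * C * L * (1/4) ^ k"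
      if "1 \<le> k" for k
    proof -
      have "\<bar>\<Sum>j=1..2^k. \<theta> k j * (LINT x|unit_lborel. per_wavelet_prim \<phi> k j x * w x)\<bar> \<le>
        (A / sqrt 2 ^ k) * (2 ^ k * (L * C / (sqrt 2 ^ k * 2 ^ k * 2 ^ k)))"
      proof (rule weighted_sum_le)
        have "(\<Sum>j\<in>{1..2^k}. \<bar>LINT x|unit_lborel. per_wavelet_prim \<phi> k j x * w x\<bar>) \<le>
           (\<Sum>j\<in>{1..(2::nat)^k}. L * C / (sqrt 2 ^ k * 2 ^ k * 2 ^ k))"
          by (intro sum_mono pairing_prim w(1,2,3))
        then show "(\<Sum>j\<in>{1..2^k}. \<bar>LINT x|unit_lborel. per_wavelet_prim \<phi> k j x * w x\<bar>) \<le>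
           2 ^ k * (L * C / (sqrt 2 ^ k * 2 ^ k * 2 ^ k))" by simp
      qed (use high that in auto)
      also have "\<dots> = A * C * L / ((sqrt 2 ^ k * sqrt 2 ^ k) * 2 ^ k)" by (simp add: mult_ac)
      also have "\<dots> = A * C * L * (1/4) ^ k"
        unfolding sqrt2_power_mult by (simp add: power_divide flip: power_mult_distrib)
      finally show ?thesis .
    qed
    have "\<bar>\<Sum>k=Suc l..N. \<Sum>j=1..2^k. \<theta> k j * (LINT x|unit_lborel. per_wavelet_prim \<phi> k j x * w x)\<bar> \<le>
      (\<Sum>k=Suc l..N. \<bar>\<Sum>j=1..2^k. \<theta> k j * (LINT x|unit_lborel. per_wavelet_prim \<phi> k j x * w x)\<bar>)" by (rule sum_abs)
    also have "\<dots> \<le> (\<Sum>k=Suc l..N. A * C * L * (1/4) ^ k)" by (intro sum_mono lev) auto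
    also have "\<dots> = A * C * L * (\<Sum>k=Suc l..N. (1/4) ^ k)" by (simp add: sum_distrib_left)
    also have "\<dots> \<le> A * C * L * (1/4) ^ l"
    proof (rule mult_left_mono)
      have "(\<Sum>k=Suc l..N. (1/4::real) ^ k) \<le> (1/4) ^ Suc l / (1 - 1/4)" by (rule geometric_tail_le) auto
      then show "(\<Sum>k=Suc l..N. (1/4::real) ^ k) \<le> (1/4) ^ l" by (rule order.trans) simp
      show "0 \<le> A * C * L" using high(2) C1 L by simp
    qed
    finally show ?case using eq 1 2 by linarith
  qed
qed simp

end

section \<open>Critical levels and norms\<close>

lemma powr_eventually_large:
  fixes a M :: real
  assumes "0 < a"
  shows "\<exists>n\<^sub>0>0. \<forall>n\<ge>n\<^sub>0. M \<le> real n powr a"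
proof (intro exI[of _ "Suc (nat \<lceil>max M 1 powr (1 / a)\<rceil>)"] conjI allI impI)
  fix n assume "Suc (nat \<lceil>max M 1 powr (1 / a)\<rceil>) \<le> n"
  then have "max M 1 powr (1 / a) \<le> real n" by linarith
  then have "(max M 1 powr (1 / a)) powr a \<le> real n powr a" using assms by (intro powr_mono2) auto
  then have "max M 1 \<le> real n powr a" using assms by (simp add: powr_powr)
  then show "M \<le> real n powr a" by simp
qed simp

lemma two_powr_nat: "2 powr real k = 2 ^ k"
  by (simp add: powr_realpow)

text \<open>The largest level \<open>l\<close> below \<open>k_index r n - c\<close>: there \<open>2\<^sup>l\<close> is still of order \<open>n\<^bsup>1/2-r\<^esup>\<close>. The exponent \<open>c + 2\<close> accounts for
the strict inequality and for the rounding in \<open>k_index\<close>.\<close>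

lemma level_below_critical:
  assumes r: "r < 1/2"
  shows "\<exists>n\<^sub>0>0. \<forall>n\<ge>n\<^sub>0. \<exists>l. int l < k_index r n - int c \<and>
    real n powr (1/2 - r) \<le> 2 ^ (c + 2) * 2 ^ l"
proof -
  define a where "a = 1/2 - r"
  have a: "0 < a" using r by (simp add: a_def)
  obtain n0 where n0: "0 < n0" "\<And>n. n0 \<le> n \<Longrightarrow> 2 ^ (c + 1) \<le> real n powr a"
    using powr_eventually_large[OF a, of "2 ^ (c + 1)"] by blast
  have "\<exists>l. int l < k_index r n - int c \<and> real n powr a \<le> 2 ^ (c + 2) * 2 ^ l" if n: "n0 \<le> n" for n
  proof -
    have np: "0 < real n" using n n0(1) by simp
    define y where "y = a * log 2 (real n)"
    have ny: "real n powr a = 2 powr y"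
      using np by (simp add: y_def powr_powr[symmetric] mult.commute[of a])
    have "2 powr real (c + 1) \<le> 2 powr y" unfolding two_powr_nat using n0(2)[OF n] ny by simp
    then have y: "real (c + 1) \<le> y" by simp
    have k: "k_index r n = \<lfloor>y\<rfloor>" by (simp add: k_index_def y_def a_def)
    define l where "l = nat (\<lfloor>y\<rfloor> - int c - 1)"
    have l: "int l = \<lfloor>y\<rfloor> - int c - 1" using y unfolding l_def by linarith
    have "y \<le> real (c + 2 + l)" using l by linarith
    then have "2 powr y \<le> 2 powr real (c + 2 + l)" by simp
    also have "\<dots> = 2 ^ (c + 2) * 2 ^ l" by (simp only: two_powr_nat power_add)
    finally show ?thesis using l k ny by (intro exI[of _ l]) auto
  qed
  then show ?thesis using n0(1) unfolding a_def by blast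
qed

lemma Linf_norm_AE:
  assumes "Linf_norm f < ereal b"
  shows "AE x in unit_lborel. \<bar>f x\<bar> \<le> b"
  using esssup_AE[of "\<lambda>x. ereal \<bar>f x\<bar>" unit_lborel]
proof eventually_elim
  case (elim x)
  then have "ereal \<bar>f x\<bar> < ereal b" using assms unfolding Linf_norm_def by (rule le_less_trans)
  then show ?case by simp
qed

lemma Linf_norm_le:
  assumes "f \<in> borel_measurable unit_lborel" "AE x in unit_lborel. \<bar>f x\<bar> \<le> b"
  shows "Linf_norm f \<le> ereal b"
  unfolding Linf_norm_def using assms by (intro esssup_I) auto

text \<open>The form without division, in which \<open>\<infinity>\<close> causes no special cases.\<close>

lemma asymp_order_iff:
  assumes "\<And>n. 1 \<le> n \<Longrightarrow> 0 < b n"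
  shows "asymp_order a b \<longleftrightarrow>
    (\<exists>c C. 0 < c \<and> (\<forall>n\<ge>1. ereal (c * b n) < a n \<and> a n < ereal (C * b n)))"
proof -
  have "(ereal c < a n / ereal (b n) \<and> a n / ereal (b n) < ereal C) \<longleftrightarrow>
      (ereal (c * b n) < a n \<and> a n < ereal (C * b n))" if "1 \<le> n" for n c C
    using assms[OF that] by (simp add: ereal_less_divide_pos ereal_divide_less_pos mult.commute)
  then show ?thesis unfolding asymp_order_def by blast
qed

text \<open>For a bound of one on \<open>f\<close> the density \<open>1 + f\<close> is at most two.\<close>

lemma drift_cdf_lipschitz:
  assumes i: "integrable unit_lborel f" and b: "AE x in unit_lborel. \<bar>f x\<bar> \<le> 1"
    and xy: "x \<in> {0..1}" "y \<in> {0..1}"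
  shows "\<bar>drift_cdf f x - drift_cdf f y\<bar> \<le> 2 * \<bar>x - y\<bar>"
proof -
  have main: "\<bar>drift_cdf f x - drift_cdf f y\<bar> \<le> 2 * \<bar>x - y\<bar>" if xy: "x \<in> {0..1}" "y \<in> {0..1}" "y \<le> x" for x y
  proof -
    have set: "{0..z} \<in> sets unit_lborel" if "z \<in> {0..1}" for z
      using that by (auto simp: sets_restrict_space_iff)
    have ii: "integrable unit_lborel (\<lambda>t. indicator {0..z} t * f t)" if "z \<in> {0..1}" for z
      using integrable_mult_indicator[OF set[OF that] i] by simp
    have i1: "integrable unit_lborel (indicator {0..z} :: real \<Rightarrow> real)" if "z \<in> {0..1}" for z
      using set[OF that] by (intro integrable_unit_bounded[where B = 1]) (auto split: split_indicator)
    have "(LBINT t:{0..x}. f t) - (LBINT t:{0..y}. f t) =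
       (LINT t|unit_lborel. indicator {0..x} t * f t - indicator {0..y} t * f t)"
      unfolding set_integral_sub_unit[OF xy(1)] set_integral_sub_unit[OF xy(2)]
      by (rule Bochner_Integration.integral_diff[OF ii[OF xy(1)] ii[OF xy(2)], symmetric])
    also have "\<bar>\<dots>\<bar> \<le> (LINT t|unit_lborel. \<bar>indicator {0..x} t * f t - indicator {0..y} t * f t\<bar>)"
      by (rule integral_abs_bound)
    also have "\<dots> \<le> (LINT t|unit_lborel. indicator {0..x} t - indicator {0..y} t)"
    proof (rule integral_mono_AE)
      show "AE t in unit_lborel. \<bar>indicator {0..x} t * f t - indicator {0..y} t * f t\<bar> \<le> indicator {0..x} t - indicator {0..y} t"
        using b by eventually_elim (use xy in \<open>auto split: split_indicator\<close>)
    qed (intro integrable_abs Bochner_Integration.integrable_diff ii i1 xy)+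
    also have "\<dots> = x - y"
      by (simp only: Bochner_Integration.integral_diff[OF i1[OF xy(1)] i1[OF xy(2)]] integral_unit_indicator[OF xy(1)] integral_unit_indicator[OF xy(2)])
    finally have "\<bar>(LBINT t:{0..x}. f t) - (LBINT t:{0..y}. f t)\<bar> \<le> x - y" .
    then show ?thesis using xy(3) by (simp add: drift_cdf_def abs_le_iff)
  qed
  show ?thesis using main[OF xy] main[OF xy(2,1)] by (cases "y \<le> x") (auto simp: abs_minus_commute)
qed

lemma (in bounded_wavelets) single_wavelet_series:
  assumes k: "1 \<le> k" and j: "j \<in> {1..2 ^ k}"
  shows "has_wavelet_series \<phi> (\<lambda>x. a * per_wavelet \<phi> k j x) (\<lambda>k' j'. if k' = k \<and> j' = j then a else 0)"
proof -
  let ?\<eta> = "\<lambda>k' j'. if k' = k \<and> j' = j then a else 0"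
  have S: "S ?\<eta> N x = a * per_wavelet \<phi> k j x" if "k \<le> N" for N x
  proof -
    have "S ?\<eta> N x = (\<Sum>k'=1..N. if k' = k then a * per_wavelet \<phi> k j x else 0)"
      unfolding wavelet_partial_def
    proof (intro sum.cong refl)
      fix k'
      have "(\<Sum>j'=1..2^k'. ?\<eta> k' j' * per_wavelet \<phi> k' j' x) =
         (\<Sum>j'=1..2^k'. if j' = j then (if k' = k then a * per_wavelet \<phi> k j x else 0) else 0)"
        by (intro sum.cong) auto
      then show "(\<Sum>j'=1..2^k'. ?\<eta> k' j' * per_wavelet \<phi> k' j' x) = (if k' = k then a * per_wavelet \<phi> k j x else 0)"
        using j by (cases "k' = k") (simp_all add: sum.delta)
    qed
    then show ?thesis using that k by (simp add: sum.delta)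
  qed
  have "\<forall>\<^sub>F N in sequentially. (LINT x|unit_lborel. (a * per_wavelet \<phi> k j x - S ?\<eta> N x)\<^sup>2) = 0"
    using eventually_ge_at_top[of k] by eventually_elim (simp add: S)
  then have "(\<lambda>N. LINT x|unit_lborel. (a * per_wavelet \<phi> k j x - S ?\<eta> N x)\<^sup>2) \<longlonglongrightarrow> 0"
    by (rule tendsto_eventually)
  moreover have "(\<lambda>x. a * per_wavelet \<phi> k j x) \<in> borel_measurable unit_lborel"
    using pw_bounded(1)[OF j] by measurable
  moreover have "integrable unit_lborel (\<lambda>x. (a * per_wavelet \<phi> k j x)\<^sup>2)"
    by (intro integrable_unit_continuous continuous_intros continuous_pw j)
  ultimately show ?thesis unfolding has_wavelet_series_def wavelet_partial_def by simp
qed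

lemma (in bounded_wavelets) series_diff:
  assumes f: "has_wavelet_series \<phi> f \<theta>" and g: "has_wavelet_series \<phi> g \<eta>"
  shows "has_wavelet_series \<phi> (\<lambda>x. f x - g x) (\<lambda>k j. \<theta> k j - \<eta> k j)"
proof -
  have Sd: "S (\<lambda>k j. \<theta> k j - \<eta> k j) N x = S \<theta> N x - S \<eta> N x" for N x
    by (simp add: wavelet_partial_def left_diff_distrib sum_subtractf)
  have fm: "f \<in> borel_measurable unit_lborel" "integrable unit_lborel (\<lambda>x. (f x)\<^sup>2)"
    "g \<in> borel_measurable unit_lborel" "integrable unit_lborel (\<lambda>x. (g x)\<^sup>2)"
    using f g by (auto simp: has_wavelet_series_def)
  have sq: "(u - v)\<^sup>2 \<le> 2 * u\<^sup>2 + 2 * v\<^sup>2" for u v :: real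
    using zero_le_power2[of "u + v"] by (simp add: power2_sum power2_diff)
  have m: "(\<lambda>x. f x - g x) \<in> borel_measurable unit_lborel" using fm by measurable
  have i: "integrable unit_lborel (\<lambda>x. (f x - g x)\<^sup>2)"
  proof (rule Bochner_Integration.integrable_bound)
    show "integrable unit_lborel (\<lambda>x. 2 * (f x)\<^sup>2 + 2 * (g x)\<^sup>2)" using fm by auto
    show "(\<lambda>x. (f x - g x)\<^sup>2) \<in> borel_measurable unit_lborel" using m by measurable
    show "AE x in unit_lborel. norm ((f x - g x)\<^sup>2) \<le> norm (2 * (f x)\<^sup>2 + 2 * (g x)\<^sup>2)"
      using sq by (intro AE_I2) simp
  qed
  have "(\<lambda>N. LINT x|unit_lborel. ((f x - g x) - S (\<lambda>k j. \<theta> k j - \<eta> k j) N x)\<^sup>2) \<longlonglongrightarrow> 0"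
  proof (rule tendsto_sandwich[of "\<lambda>_. 0" _ _ "\<lambda>N. 2 * (LINT x|unit_lborel. (f x - S \<theta> N x)\<^sup>2) + 2 * (LINT x|unit_lborel. (g x - S \<eta> N x)\<^sup>2)"])
    note ef = series_error_integrable[OF f] and eg = series_error_integrable[OF g]
    show "\<forall>\<^sub>F N in sequentially. (LINT x|unit_lborel. ((f x - g x) - S (\<lambda>k j. \<theta> k j - \<eta> k j) N x)\<^sup>2) \<le>
       2 * (LINT x|unit_lborel. (f x - S \<theta> N x)\<^sup>2) + 2 * (LINT x|unit_lborel. (g x - S \<eta> N x)\<^sup>2)"
    proof (intro always_eventually allI)
      fix N
      have i2: "integrable unit_lborel (\<lambda>x. 2 * (f x - S \<theta> N x)\<^sup>2 + 2 * (g x - S \<eta> N x)\<^sup>2)"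
        by (intro Bochner_Integration.integrable_add integrable_mult_right ef eg)
      have le: "((f x - g x) - S (\<lambda>k j. \<theta> k j - \<eta> k j) N x)\<^sup>2 \<le> 2 * (f x - S \<theta> N x)\<^sup>2 + 2 * (g x - S \<eta> N x)\<^sup>2" for x
        using sq[of "f x - S \<theta> N x" "g x - S \<eta> N x"] by (simp add: Sd algebra_simps)
      have eqd: "(f x - g x) - S (\<lambda>k j. \<theta> k j - \<eta> k j) N x = (f x - S \<theta> N x) - (g x - S \<eta> N x)" for x
        by (simp add: Sd)
      have i1: "integrable unit_lborel (\<lambda>x. ((f x - g x) - S (\<lambda>k j. \<theta> k j - \<eta> k j) N x)\<^sup>2)"
      proof (rule Bochner_Integration.integrable_bound[OF i2])
        show "(\<lambda>x. ((f x - g x) - S (\<lambda>k j. \<theta> k j - \<eta> k j) N x)\<^sup>2) \<in> borel_measurable unit_lborel"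
          unfolding eqd by (intro borel_measurable_power borel_measurable_diff ef(1) eg(1))
        show "AE x in unit_lborel. norm (((f x - g x) - S (\<lambda>k j. \<theta> k j - \<eta> k j) N x)\<^sup>2) \<le>
          norm (2 * (f x - S \<theta> N x)\<^sup>2 + 2 * (g x - S \<eta> N x)\<^sup>2)"
          using le by (intro AE_I2) simp
      qed
      have "(LINT x|unit_lborel. ((f x - g x) - S (\<lambda>k j. \<theta> k j - \<eta> k j) N x)\<^sup>2) \<le>
        (LINT x|unit_lborel. 2 * (f x - S \<theta> N x)\<^sup>2 + 2 * (g x - S \<eta> N x)\<^sup>2)"
        by (rule integral_mono[OF i1 i2 le])
      also have "\<dots> = 2 * (LINT x|unit_lborel. (f x - S \<theta> N x)\<^sup>2) + 2 * (LINT x|unit_lborel. (g x - S \<eta> N x)\<^sup>2)"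
        by (simp only: Bochner_Integration.integral_add[OF integrable_mult_right[OF ef(2)] integrable_mult_right[OF eg(2)]]
            integral_mult_right_zero)
      finally show "(LINT x|unit_lborel. ((f x - g x) - S (\<lambda>k j. \<theta> k j - \<eta> k j) N x)\<^sup>2) \<le>
       2 * (LINT x|unit_lborel. (f x - S \<theta> N x)\<^sup>2) + 2 * (LINT x|unit_lborel. (g x - S \<eta> N x)\<^sup>2)" .
    qed
    have "(\<lambda>N. LINT x|unit_lborel. (f x - S \<theta> N x)\<^sup>2) \<longlonglongrightarrow> 0" "(\<lambda>N. LINT x|unit_lborel. (g x - S \<eta> N x)\<^sup>2) \<longlonglongrightarrow> 0"
      using f g unfolding has_wavelet_series_def wavelet_partial_def by auto
    then have "(\<lambda>N. 2 * (LINT x|unit_lborel. (f x - S \<theta> N x)\<^sup>2) + 2 * (LINT x|unit_lborel. (g x - S \<eta> N x)\<^sup>2)) \<longlonglongrightarrow> 2 * 0 + 2 * 0"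
      by (intro tendsto_add tendsto_mult_left)
    then show "(\<lambda>N. 2 * (LINT x|unit_lborel. (f x - S \<theta> N x)\<^sup>2) + 2 * (LINT x|unit_lborel. (g x - S \<eta> N x)\<^sup>2)) \<longlonglongrightarrow> 0" by simp
  qed (auto intro!: always_eventually Bochner_Integration.integral_nonneg)
  then show ?thesis using m i unfolding has_wavelet_series_def wavelet_partial_def by simp
qed

section \<open>Significant coefficients and the equivalence\<close>

text \<open>A sequence of alternatives as in the theorem, with the order of the norm made explicit by \<open>c\<^sub>0\<close> and \<open>C\<^sub>0\<close>.\<close>

locale wavelet_alternatives = bounded_wavelets \<phi> C for \<phi> C +
  fixes r s :: real and f :: "nat \<Rightarrow> real \<Rightarrow> real" and \<theta> :: "nat \<Rightarrow> nat \<Rightarrow> nat \<Rightarrow> real" and c\<^sub>0 C\<^sub>0 :: real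
  assumes r: "0 < r" "r < 1/2" and s: "s = 2 * r / (1 - 2 * r)"
    and series: "\<And>n. 1 \<le> n \<Longrightarrow> has_wavelet_series \<phi> (f n) (\<theta> n)"
    and dens: "\<And>n. 1 \<le> n \<Longrightarrow> is_density (\<lambda>x. 1 + f n x)"
    and c0: "0 < c\<^sub>0"
    and norm_lower: "\<And>n. 1 \<le> n \<Longrightarrow> ereal (c\<^sub>0 * real n powr (- r)) < Linf_norm (f n)"
    and norm_upper: "\<And>n. 1 \<le> n \<Longrightarrow> Linf_norm (f n) < ereal (C\<^sub>0 * real n powr (- r))"
    and G: "assumption_G r \<phi> \<theta>"
begin

lemma C0: "0 < C\<^sub>0"
proof -
  have "ereal (c\<^sub>0 * real 1 powr (- r)) < ereal (C\<^sub>0 * real 1 powr (- r))"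
    using norm_lower[of 1] norm_upper[of 1] by (rule less_trans) auto
  then show ?thesis using c0 by simp
qed

lemma f_bound: "1 \<le> n \<Longrightarrow> AE x in unit_lborel. \<bar>f n x\<bar> \<le> C\<^sub>0 * real n powr (- r)"
  by (rule Linf_norm_AE[OF norm_upper])

lemma coefficient_upper:
  assumes "1 \<le> n" "1 \<le> k" "j \<in> {1..2 ^ k}"
  shows "\<bar>\<theta> n k j\<bar> \<le> (C\<^sub>0 * C * real n powr (- r)) / sqrt 2 ^ k"
  using coefficient_le[OF series[OF assms(1)] assms(2,3) f_bound[OF assms(1)]] C0 by (simp add: mult_ac)

lemma sqrt_times_powr: "sqrt (real n) * real n powr (- r) = real n powr (1/2 - r)"
  by (cases "n = 0") (simp_all add: powr_half_sqrt[symmetric] flip: powr_add)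

text \<open>The choice of \<open>s\<close>: on the critical level, where \<open>2\<^sup>k = n\<^bsup>1/2-r\<^esup>\<close>, the Besov weight \<open>2\<^bsup>sk\<^esup>\<close> equals \<open>n\<^sup>r\<close>.\<close>

lemma s_exponent: "(1/2 - r) * s = r"
  using r by (simp add: s field_simps)

lemma s_pos: "0 < s"
  using r by (simp add: s)

lemma low_frequency_small:
  assumes "0 < \<epsilon>"
  shows "\<exists>c n\<^sub>0. \<forall>n\<ge>n\<^sub>0. 1 \<le> n \<longrightarrow> (\<forall>l. int l < k_index r n - int c \<longrightarrow>
    (\<forall>x\<in>{0..1}. \<bar>partial_cdf \<phi> (\<theta> n) l x - x\<bar> \<le> \<epsilon> / sqrt (real n)))"
proof -
  obtain c :: int and n0 where G: "\<And>n l. n0 < n \<Longrightarrow> int l < k_index r n - c \<Longrightarrow>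
        sqrt (real n) * kolmogorov_T (partial_cdf \<phi> (\<theta> n) l) < \<epsilon>"
    using G assms unfolding assumption_G_def by blast
  have "\<bar>partial_cdf \<phi> (\<theta> n) l x - x\<bar> \<le> \<epsilon> / sqrt (real n)"
    if n: "Suc n0 \<le> n" and l: "int l < k_index r n - int (nat c)" and x: "x \<in> {0..1}" for n l x
  proof -
    have sq: "0 < sqrt (real n)" using n by simp
    have "continuous_on {0..1} (\<lambda>x. \<bar>partial_cdf \<phi> (\<theta> n) l x - x\<bar>)"
      by (intro continuous_intros continuous_partial_cdf)
    then have "compact ((\<lambda>x. \<bar>partial_cdf \<phi> (\<theta> n) l x - x\<bar>) ` {0..1})"
      by (rule compact_continuous_image) simp
    then have "bdd_above ((\<lambda>x. \<bar>partial_cdf \<phi> (\<theta> n) l x - x\<bar>) ` {0..1})"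
      by (intro bounded_imp_bdd_above compact_imp_bounded)
    then have le: "\<bar>partial_cdf \<phi> (\<theta> n) l x - x\<bar> \<le> kolmogorov_T (partial_cdf \<phi> (\<theta> n) l)"
      unfolding kolmogorov_T_def using x by (rule cSUP_upper[rotated])
    have "int l < k_index r n - c" using l by linarith
    then have "sqrt (real n) * kolmogorov_T (partial_cdf \<phi> (\<theta> n) l) < \<epsilon>" using n by (intro G) auto
    then have "kolmogorov_T (partial_cdf \<phi> (\<theta> n) l) < \<epsilon> / sqrt (real n)"
      using sq by (simp add: pos_less_divide_eq mult.commute)
    then show ?thesis using le by linarith
  qed
  then show ?thesis by blast
qed

text \<open>A level at which assumption G still applies and which is nevertheless of the critical order; it separates low from intermediate
frequencies in the three arguments below.\<close>

lemma low_level: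
  assumes "0 < \<epsilon>"
  shows "\<exists>q>0. \<exists>n\<^sub>0>0. \<forall>n\<ge>n\<^sub>0. \<exists>l. real n powr (1/2 - r) \<le> q * 2 ^ l \<and> 2 ^ l \<le> real n powr (1/2 - r) \<and>
    (\<forall>x\<in>{0..1}. \<bar>partial_cdf \<phi> (\<theta> n) l x - x\<bar> \<le> \<epsilon> / sqrt (real n))"
proof -
  obtain c n1 where 1: "\<And>n l x. n1 \<le> n \<Longrightarrow> 1 \<le> n \<Longrightarrow> int l < k_index r n - int c \<Longrightarrow> x \<in> {0..1} \<Longrightarrow>
      \<bar>partial_cdf \<phi> (\<theta> n) l x - x\<bar> \<le> \<epsilon> / sqrt (real n)"
    using low_frequency_small[OF assms] by blast
  obtain n2 where n2: "0 < n2" "\<And>n. n2 \<le> n \<Longrightarrow> \<exists>l. int l < k_index r n - int c \<and> real n powr (1/2 - r) \<le> 2 ^ (c + 2) * 2 ^ l"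
    using level_below_critical[OF r(2), of c] by blast
  have "\<exists>l. real n powr (1/2 - r) \<le> 2 ^ (c + 2) * 2 ^ l \<and> 2 ^ l \<le> real n powr (1/2 - r) \<and>
    (\<forall>x\<in>{0..1}. \<bar>partial_cdf \<phi> (\<theta> n) l x - x\<bar> \<le> \<epsilon> / sqrt (real n))" if n: "max n1 n2 \<le> n" for n
  proof -
    have np: "1 \<le> n" using n n2(1) by auto
    obtain l where l: "int l < k_index r n - int c" "real n powr (1/2 - r) \<le> 2 ^ (c + 2) * 2 ^ l"
      using n2(2)[of n] n by auto
    have "real l \<le> (1/2 - r) * log 2 (real n)" using l(1) unfolding k_index_def by linarith
    then have "2 powr real l \<le> 2 powr ((1/2 - r) * log 2 (real n))" by simp
    also have "\<dots> = real n powr (1/2 - r)"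
      using np by (subst mult.commute, subst powr_powr[symmetric]) simp
    finally have "2 ^ l \<le> real n powr (1/2 - r)" by (simp add: powr_realpow)
    then show ?thesis using l 1[OF _ np l(1)] n by auto
  qed
  then show ?thesis using n2(1) by (intro exI[of _ "2 ^ (c + 2)"] conjI exI[of _ "max n1 n2"]) auto
qed

text \<open>A coefficient of the largest possible order on a level up to the critical one.\<close>

definition significant :: "real \<Rightarrow> real \<Rightarrow> nat \<Rightarrow> bool" where
  "significant c Q n \<longleftrightarrow> (\<exists>k\<ge>1. \<exists>j\<in>{1..2 ^ k}. 2 ^ k \<le> Q * real n powr (1/2 - r) \<and>
     c * real n powr (- r) / sqrt 2 ^ k \<le> \<bar>\<theta> n k j\<bar>)"

text \<open>Otherwise all contributions to the drift are below \<open>c/8\<close>: the low levels by assumption G, the next \<open>H\<close> levels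
because their coefficients are insignificant, the rest by the choice of \<open>H\<close>.\<close>

lemma significant_if_drift_large:
  assumes c: "0 < c" and large: "\<And>n. N \<le> n \<Longrightarrow> \<exists>x\<in>{0..1}. c \<le> sqrt (real n) * \<bar>drift_cdf (f n) x - x\<bar>"
  shows "\<exists>c'>0. \<exists>Q>0. \<exists>n\<^sub>0. \<forall>n\<ge>n\<^sub>0. significant c' Q n"
proof -
  have "0 < c / 8" using c by simp
  from low_level[OF this] obtain q n0 where q: "0 < q" and n0: "0 < n0"
    and lev: "\<And>n. n0 \<le> n \<Longrightarrow> \<exists>l. real n powr (1/2 - r) \<le> q * 2 ^ l \<and> 2 ^ l \<le> real n powr (1/2 - r) \<and>
    (\<forall>x\<in>{0..1}. \<bar>partial_cdf \<phi> (\<theta> n) l x - x\<bar> \<le> c / 8 / sqrt (real n))" by blast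
  have Cp: "0 < C" using C1 by simp
  \<comment> \<open>Chosen so that the \<open>H\<close> intermediate levels contribute at most \<open>c / 8\<close>; note that \<open>\<surd>n n\<^bsup>-r\<^esup> 2\<^bsup>-l\<^esup> \<le> q\<close>.\<close>
  define c' where "c' = c / (8 * C * q)"
  have c': "0 < c'" using c Cp q by (simp add: c'_def)
  obtain H :: nat where H: "C\<^sub>0 * C * C * q * (1/2) ^ H < c / 8"
  proof -
    have "(\<lambda>H. C\<^sub>0 * C * C * q * (1/2) ^ H) \<longlonglongrightarrow> C\<^sub>0 * C * C * q * 0"
      by (intro tendsto_mult tendsto_const LIMSEQ_realpow_zero) auto
    then have "\<forall>\<^sub>F H in sequentially. C\<^sub>0 * C * C * q * (1/2) ^ H < c / 8"
      using c by (intro order_tendstoD(2)) auto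
    then show ?thesis using that by (auto simp: eventually_sequentially)
  qed
  have "significant c' (2 ^ H) n" if n: "max n0 N \<le> n" for n
  proof (rule ccontr)
    assume ns: "\<not> significant c' (2 ^ H) n"
    have np: "1 \<le> n" using n n0 by auto
    have sq: "0 < sqrt (real n)" using np by simp
    let ?\<nu> = "real n powr (1/2 - r)" and ?\<rho> = "real n powr (- r)"
    obtain l where l: "?\<nu> \<le> q * 2 ^ l" "2 ^ l \<le> ?\<nu>"
      "\<And>x. x \<in> {0..1} \<Longrightarrow> \<bar>partial_cdf \<phi> (\<theta> n) l x - x\<bar> \<le> c / 8 / sqrt (real n)"
      using lev[of n] n by auto
    obtain x where x: "x \<in> {0..1}" "c \<le> sqrt (real n) * \<bar>drift_cdf (f n) x - x\<bar>"
      using large[of n] n by auto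
    have mid: "\<bar>\<theta> n k j\<bar> \<le> c' * ?\<rho> / sqrt 2 ^ k" if "l < k" "k \<le> l + H" "j \<in> {1..2 ^ k}" for k j
    proof (rule ccontr)
      assume "\<not> \<bar>\<theta> n k j\<bar> \<le> c' * ?\<rho> / sqrt 2 ^ k"
      moreover have "2 ^ k \<le> 2 ^ H * ?\<nu>"
      proof -
        have "(2::real) ^ k \<le> 2 ^ (l + H)" using that by (intro power_increasing) auto
        also have "\<dots> = 2 ^ H * 2 ^ l" by (simp add: power_add)
        also have "\<dots> \<le> 2 ^ H * ?\<nu>" using l(2) by (intro mult_left_mono) auto
        finally show ?thesis .
      qed
      moreover have "1 \<le> k" using that by simp
      ultimately have "significant c' (2 ^ H) n"
        using that(3) unfolding significant_def by (meson less_imp_le not_le)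
      then show False using ns by simp
    qed
    have "\<bar>drift_cdf (f n) x - x\<bar> \<le> c / 8 / sqrt (real n) + (c' * ?\<rho>) * C * (1/2) ^ l + (C\<^sub>0 * C * ?\<rho>) * C * (1/2) ^ (l + H)"
      using mid coefficient_upper[OF np] c' C0 Cp
      by (intro drift_le_coefficients[OF series[OF np] x(1) l(3)[OF x(1)]]) auto
    then have "sqrt (real n) * \<bar>drift_cdf (f n) x - x\<bar> \<le>
      sqrt (real n) * (c / 8 / sqrt (real n) + (c' * ?\<rho>) * C * (1/2) ^ l + (C\<^sub>0 * C * ?\<rho>) * C * (1/2) ^ (l + H))"
      using sq by (intro mult_left_mono) auto
    also have "\<dots> = c / 8 + c' * C * ((sqrt (real n) * ?\<rho>) * (1/2) ^ l) + C\<^sub>0 * C * C * (1/2) ^ H * ((sqrt (real n) * ?\<rho>) * (1/2) ^ l)"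
      using sq by (simp add: distrib_left power_add mult_ac)
    also have "\<dots> \<le> c / 8 + c' * C * q + C\<^sub>0 * C * C * (1/2) ^ H * q"
    proof -
      have "?\<nu> * (1/2) ^ l \<le> q" using l(1) by (simp add: power_divide divide_le_eq)
      then show ?thesis unfolding sqrt_times_powr using c' C0 Cp by (intro add_mono mult_left_mono) auto
    qed
    also have "c' * C * q = c / 8" using Cp q by (simp add: c'_def)
    finally show False using x(2) H c by (simp add: mult_ac)
  qed
  then have "\<exists>n\<^sub>0. \<forall>n\<ge>n\<^sub>0. significant c' (2 ^ H) n" by blast
  moreover have "0 < (2::real) ^ H" by simp
  ultimately show ?thesis using c' by blast
qed

text \<open>A uniformly small drift would bound the coefficient through \<open>coefficient_le_drift\<close>, whose factor \<open>2\<^bsup>k/2\<^esup>\<close> is affordable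
exactly because \<open>2\<^sup>k = O(n\<^bsup>1/2-r\<^esup>)\<close>.\<close>

lemma drift_large_if_significant:
  assumes c: "0 < c" "0 < Q" and sig: "\<And>n. n\<^sub>0 \<le> n \<Longrightarrow> significant c Q n"
  shows "\<exists>c'>0. \<exists>N. \<forall>n\<ge>N. \<exists>x\<in>{0..1}. c' \<le> sqrt (real n) * \<bar>drift_cdf (f n) x - x\<bar>"
proof -
  have Cp: "0 < C" using C1 by simp
  define c' where "c' = c / (2 * C * Q)"
  have c': "0 < c'" using c Cp by (simp add: c'_def)
  have "\<exists>x\<in>{0..1}. c' \<le> sqrt (real n) * \<bar>drift_cdf (f n) x - x\<bar>" if n: "max n\<^sub>0 1 \<le> n" for n
  proof (rule ccontr)
    assume no: "\<not> ?thesis"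
    have np: "1 \<le> n" using n by simp
    have sq: "0 < sqrt (real n)" using np by simp
    have t: "\<bar>drift_cdf (f n) x - x\<bar> \<le> c' / sqrt (real n)" if "x \<in> {0..1}" for x
    proof -
      have "sqrt (real n) * \<bar>drift_cdf (f n) x - x\<bar> < c'" using no that by (meson not_le)
      then show ?thesis using sq by (simp add: pos_le_divide_eq mult.commute)
    qed
    obtain k j where k: "1 \<le> k" "j \<in> {1..2 ^ k}" "2 ^ k \<le> Q * real n powr (1/2 - r)"
       "c * real n powr (- r) / sqrt 2 ^ k \<le> \<bar>\<theta> n k j\<bar>"
      using sig[of n] n unfolding significant_def by auto
    have "c * real n powr (- r) / sqrt 2 ^ k \<le> c' / sqrt (real n) * C * sqrt 2 ^ k"
      using k(4) coefficient_le_drift[OF series[OF np] k(1,2) t] by linarith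
    then have "(sqrt (real n) * sqrt 2 ^ k) * (c * real n powr (- r) / sqrt 2 ^ k) \<le>
       (sqrt (real n) * sqrt 2 ^ k) * (c' / sqrt (real n) * C * sqrt 2 ^ k)"
      using sq by (intro mult_left_mono) auto
    also have "\<dots> = c' * C * (sqrt 2 ^ k * sqrt 2 ^ k)" using sq by (simp add: mult_ac)
    also have "\<dots> = c' * C * 2 ^ k" by (simp only: sqrt2_power_mult)
    also have "\<dots> \<le> c' * C * (Q * real n powr (1/2 - r))" using k(3) c' Cp by (intro mult_left_mono) auto
    also have "\<dots> = c / 2 * real n powr (1/2 - r)" using c Cp by (simp add: c'_def)
    also have "(sqrt (real n) * sqrt 2 ^ k) * (c * real n powr (- r) / sqrt 2 ^ k) = c * (sqrt (real n) * real n powr (- r))"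
      by (simp add: mult_ac)
    finally have "c * real n powr (1/2 - r) \<le> c / 2 * real n powr (1/2 - r)" unfolding sqrt_times_powr .
    then show False using c np by simp
  qed
  then show ?thesis using c' by blast
qed

lemma significant_mono: "significant c Q n \<Longrightarrow> c' \<le> c \<Longrightarrow> Q \<le> Q' \<Longrightarrow> significant c' Q' n"
  unfolding significant_def
proof (elim exE conjE bexE)
  fix k j assume *: "c' \<le> c" "Q \<le> Q'" "1 \<le> k" "j \<in> {1..2 ^ k}" "2 ^ k \<le> Q * real n powr (1/2 - r)"
    "c * real n powr (- r) / sqrt 2 ^ k \<le> \<bar>\<theta> n k j\<bar>"
  have "Q * real n powr (1/2 - r) \<le> Q' * real n powr (1/2 - r)" using * by (intro mult_right_mono) auto
  moreover have "c' * real n powr (- r) / sqrt 2 ^ k \<le> c * real n powr (- r) / sqrt 2 ^ k"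
    using * by (intro divide_right_mono mult_right_mono) auto
  ultimately show "\<exists>k\<ge>1. \<exists>j\<in>{1..2 ^ k}. 2 ^ k \<le> Q' * real n powr (1/2 - r) \<and>
     c' * real n powr (- r) / sqrt 2 ^ k \<le> \<bar>\<theta> n k j\<bar>"
    using * by (intro exI[of _ k] conjI bexI[of _ j]) auto
qed

text \<open>For a single \<open>n\<close> any nonzero coefficient is significant with suitable constants, and one exists because the norm is
positive.\<close>

lemma significant_some:
  assumes n: "1 \<le> n" shows "\<exists>c>0. \<exists>Q>0. significant c Q n"
proof -
  have "\<exists>k\<ge>1. \<exists>j\<in>{1..2 ^ k}. \<theta> n k j \<noteq> 0"
  proof (rule ccontr)
    assume "\<not> ?thesis"
    then have "S (\<theta> n) N x = 0" for N x by (auto simp: wavelet_partial_def intro!: sum.neutral)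
    then have "AE x in unit_lborel. \<bar>f n x\<bar> \<le> 0" by (intro AE_le_of_partial_sums[OF series[OF n]]) simp
    then have "Linf_norm (f n) \<le> ereal 0"
      using series[OF n] by (intro Linf_norm_le) (auto simp: has_wavelet_series_def)
    then have "ereal (c\<^sub>0 * real n powr (- r)) < ereal 0" using norm_lower[OF n] by (rule less_le_trans[rotated])
    then show False using c0 by (simp add: mult_less_0_iff)
  qed
  then obtain k j where k: "1 \<le> k" "j \<in> {1..2 ^ k}" "\<theta> n k j \<noteq> 0" by auto
  let ?c = "\<bar>\<theta> n k j\<bar> * sqrt 2 ^ k / real n powr (- r)" and ?Q = "2 ^ k / real n powr (1/2 - r)"
  have "significant ?c ?Q n"
    unfolding significant_def using k n by (intro exI[of _ k] conjI bexI[of _ j]) auto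
  moreover have "0 < ?c" "0 < ?Q" using k n by auto
  ultimately show ?thesis by blast
qed

text \<open>The function \<open>f\<^sub>1\<close> has to be provided for all \<open>n\<close>, not just for large \<open>n\<close>; finitely many indices only worsen
the constants.\<close>

lemma significant_everywhere:
  assumes c: "0 < c" "0 < Q" and sig: "\<And>n. n\<^sub>0 \<le> n \<Longrightarrow> significant c Q n"
  shows "\<exists>c'>0. \<exists>Q'>0. \<forall>n\<ge>1. significant c' Q' n"
proof -
  have "\<exists>c'>0. \<exists>Q'>0. \<forall>n\<ge>1. n\<^sub>0 \<le> n \<or> n \<le> m \<longrightarrow> significant c' Q' n" for m
  proof (induction m)
    case 0
    then show ?case using assms by (intro exI[of _ c] conjI exI[of _ Q]) auto
  next
    case (Suc m)
    then obtain c1 Q1 where 1: "0 < c1" "0 < Q1" "\<And>n. 1 \<le> n \<Longrightarrow> n\<^sub>0 \<le> n \<or> n \<le> m \<Longrightarrow> significant c1 Q1 n" by blast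
    obtain c2 Q2 where 2: "0 < c2" "0 < Q2" "significant c2 Q2 (Suc m)" using significant_some[of "Suc m"] by auto
    have "significant (min c1 c2) (max Q1 Q2) n" if "1 \<le> n" "n\<^sub>0 \<le> n \<or> n \<le> Suc m" for n
    proof (cases "n = Suc m")
      case True
      then show ?thesis using significant_mono[OF 2(3)] by auto
    next
      case False
      then show ?thesis using significant_mono[OF 1(3)[of n]] that by auto
    qed
    then show ?case using 1 2 by (intro exI[of _ "min c1 c2"] conjI exI[of _ "max Q1 Q2"]) auto
  qed
  from this[of n\<^sub>0] show ?thesis by (meson nat_le_linear)
qed

text \<open>Take for \<open>f\<^sub>1\<close> the term of the series with the significant coefficient. Its difference to \<open>f\<close> just lacks this coefficient, so
all products in the orientation conditions are squares or zero.\<close>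

lemma besov_part_if_significant:
  assumes c: "0 < c" "0 < Q" and sig: "\<And>n. 1 \<le> n \<Longrightarrow> significant c Q n"
  shows "\<exists>P\<^sub>0>0. \<exists>f\<^sub>1 :: nat \<Rightarrow> real \<Rightarrow> real.
       (\<forall>n\<ge>1. f\<^sub>1 n \<in> besov_body \<phi> s P\<^sub>0) \<and>
       asymp_order (\<lambda>n. Linf_norm (f\<^sub>1 n)) (\<lambda>n. real n powr (- r)) \<and>
       (\<forall>n\<ge>1. same_orientation \<phi> (f n) (f\<^sub>1 n) \<and>
              same_orientation \<phi> (f n) (\<lambda>x. f n x - f\<^sub>1 n x) \<and>
              same_orientation \<phi> (f\<^sub>1 n) (\<lambda>x. f n x - f\<^sub>1 n x))"
proof -
  have Cp: "0 < C" using C1 by simp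
  have "\<forall>n\<in>{1..}. \<exists>k j. 1 \<le> k \<and> j \<in> {1..2 ^ k} \<and> 2 ^ k \<le> Q * real n powr (1/2 - r) \<and>
     c * real n powr (- r) / sqrt 2 ^ k \<le> \<bar>\<theta> n k j\<bar>"
  proof (intro ballI)
    fix n :: nat assume "n \<in> {1..}"
    then have "significant c Q n" by (intro sig) simp
    then show "\<exists>k j. 1 \<le> k \<and> j \<in> {1..2 ^ k} \<and> 2 ^ k \<le> Q * real n powr (1/2 - r) \<and>
     c * real n powr (- r) / sqrt 2 ^ k \<le> \<bar>\<theta> n k j\<bar>"
      unfolding significant_def by blast
  qed
  then obtain K J where "\<forall>n\<in>{1..}. 1 \<le> K n \<and> J n \<in> {1..2 ^ K n} \<and> 2 ^ K n \<le> Q * real n powr (1/2 - r) \<and>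
     c * real n powr (- r) / sqrt 2 ^ K n \<le> \<bar>\<theta> n (K n) (J n)\<bar>" by metis
  then have K: "1 \<le> K n" "J n \<in> {1..2 ^ K n}" "2 ^ K n \<le> Q * real n powr (1/2 - r)"
     "c * real n powr (- r) / sqrt 2 ^ K n \<le> \<bar>\<theta> n (K n) (J n)\<bar>" if "1 \<le> n" for n using that by auto
  define a where "a n = \<theta> n (K n) (J n)" for n
  define f1 where "f1 n x = a n * per_wavelet \<phi> (K n) (J n) x" for n x
  define \<eta> where "\<eta> n k j = (if k = K n \<and> j = J n then a n else 0)" for n k j
  have s1: "has_wavelet_series \<phi> (f1 n) (\<eta> n)" if "1 \<le> n" for n
    using single_wavelet_series[OF K(1,2)[OF that], of "a n"] unfolding f1_def[abs_def] \<eta>_def[abs_def] .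
  have s2: "has_wavelet_series \<phi> (\<lambda>x. f n x - f1 n x) (\<lambda>k j. \<theta> n k j - \<eta> n k j)" if "1 \<le> n" for n
    by (rule series_diff[OF series[OF that] s1[OF that]])
  \<comment> \<open>The Besov weight of the critical level against the general bound for coefficients.\<close>
  define P0 where "P0 = Q powr s * (C\<^sub>0 * C)"
  have P0: "0 < P0" using c C0 Cp by (simp add: P0_def)
  have besov: "f1 n \<in> besov_body \<phi> s P0" if n: "1 \<le> n" for n
  proof -
    have "2 powr ((s + 1/2) * real k) * \<bar>\<eta> n k j\<bar> \<le> P0" for k j
    proof (cases "k = K n \<and> j = J n")
      case True
      have "2 powr ((s + 1/2) * real k) = 2 powr (real k * s) * 2 powr (real k / 2)"
        by (simp add: algebra_simps flip: powr_add)
      also have "\<dots> = (2 ^ k) powr s * sqrt 2 ^ k"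
        by (simp only: powr_powr[symmetric] two_powr_nat two_powr_half)
      finally have "2 powr ((s + 1/2) * real k) * \<bar>\<eta> n k j\<bar> = (2 ^ k) powr s * (sqrt 2 ^ k * \<bar>a n\<bar>)"
        using True by (simp add: \<eta>_def)
      also have "\<dots> \<le> (Q * real n powr (1/2 - r)) powr s * (C\<^sub>0 * C * real n powr (- r))"
      proof (rule mult_mono)
        show "(2 ^ k) powr s \<le> (Q * real n powr (1/2 - r)) powr s"
          using K(3)[OF n] True s_pos by (intro powr_mono2) auto
        have "\<bar>a n\<bar> \<le> (C\<^sub>0 * C * real n powr (- r)) / sqrt 2 ^ k"
          using coefficient_upper[OF n K(1,2)[OF n]] True by (simp add: a_def)
        then show "sqrt 2 ^ k * \<bar>a n\<bar> \<le> C\<^sub>0 * C * real n powr (- r)" by (simp add: field_simps)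
      qed auto
      also have "(Q * real n powr (1/2 - r)) powr s = Q powr s * real n powr r"
        using c by (simp add: powr_mult powr_powr s_exponent)
      also have "Q powr s * real n powr r * (C\<^sub>0 * C * real n powr (- r)) = P0 * (real n powr r * real n powr (- r))"
        by (simp add: P0_def mult_ac)
      also have "real n powr r * real n powr (- r) = 1" using n by (simp flip: powr_add)
      finally show ?thesis by simp
    next
      case False
      then have "\<eta> n k j = 0" by (auto simp: \<eta>_def)
      then show ?thesis using P0 by simp
    qed
    then show ?thesis unfolding besov_body_def using s1[OF n] by blast
  qed
  have "asymp_order (\<lambda>n. Linf_norm (f1 n)) (\<lambda>n. real n powr (- r))"
  proof (subst asymp_order_iff)
    show "\<And>n. 1 \<le> n \<Longrightarrow> 0 < real n powr (- r)" by simp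
    have "ereal (c / (2 * C) * real n powr (- r)) < Linf_norm (f1 n) \<and> Linf_norm (f1 n) < ereal ((C\<^sub>0 * C * C + 1) * real n powr (- r))"
      if n: "1 \<le> n" for n
    proof
      have \<rho>: "0 < real n powr (- r)" using n by simp
      have m: "f1 n \<in> borel_measurable unit_lborel" using s1[OF n] by (simp add: has_wavelet_series_def)
      have eta: "\<eta> n (K n) (J n) = a n" by (simp add: \<eta>_def)
      have "\<not> Linf_norm (f1 n) \<le> ereal (c / (2 * C) * real n powr (- r))"
      proof
        assume le: "Linf_norm (f1 n) \<le> ereal (c / (2 * C) * real n powr (- r))"
        have "AE x in unit_lborel. ereal \<bar>f1 n x\<bar> \<le> Linf_norm (f1 n)"
          unfolding Linf_norm_def by (rule esssup_AE)
        then have "AE x in unit_lborel. ereal \<bar>f1 n x\<bar> \<le> ereal (c / (2 * C) * real n powr (- r))"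
          by (rule eventually_mono) (rule order.trans[OF _ le])
        then have "AE x in unit_lborel. \<bar>f1 n x\<bar> \<le> c / (2 * C) * real n powr (- r)" by simp
        then have "\<bar>\<eta> n (K n) (J n)\<bar> \<le> c / (2 * C) * real n powr (- r) * C / sqrt 2 ^ K n"
          using c Cp by (intro coefficient_le[OF s1[OF n] K(1,2)[OF n]]) auto
        then have "c * real n powr (- r) / sqrt 2 ^ K n \<le> c / (2 * C) * real n powr (- r) * C / sqrt 2 ^ K n"
          using K(4)[OF n] eta by (simp add: a_def)
        also have "\<dots> = (c * real n powr (- r) / sqrt 2 ^ K n) / 2" using Cp by simp
        finally have "c * real n powr (- r) / sqrt 2 ^ K n \<le> c * real n powr (- r) / sqrt 2 ^ K n / 2" .
        moreover have "0 < c * real n powr (- r) / sqrt 2 ^ K n" using c \<rho> by simp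
        moreover have "0 < z \<Longrightarrow> \<not> z \<le> z / 2" for z :: real by simp
        ultimately show False by blast
      qed
      then show "ereal (c / (2 * C) * real n powr (- r)) < Linf_norm (f1 n)" by simp
      have "AE x in unit_lborel. \<bar>f1 n x\<bar> \<le> C\<^sub>0 * C * C * real n powr (- r)"
      proof (rule AE_I2)
        fix x assume "x \<in> space unit_lborel"
        then have x: "x \<in> {0..1}" by simp
        have "\<bar>a n\<bar> * \<bar>per_wavelet \<phi> (K n) (J n) x\<bar> \<le> ((C\<^sub>0 * C * real n powr (- r)) / sqrt 2 ^ K n) * (C * sqrt 2 ^ K n)"
          using coefficient_upper[OF n K(1,2)[OF n]] C0 Cp
          by (intro mult_mono pw_bounded(2)[OF K(2)[OF n] x]) (auto simp: a_def)
        also have "\<dots> = C\<^sub>0 * C * C * real n powr (- r)" by (simp add: mult_ac)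
        finally show "\<bar>f1 n x\<bar> \<le> C\<^sub>0 * C * C * real n powr (- r)" by (simp add: f1_def abs_mult)
      qed
      then have "Linf_norm (f1 n) \<le> ereal (C\<^sub>0 * C * C * real n powr (- r))" by (rule Linf_norm_le[OF m])
      also have "\<dots> < ereal ((C\<^sub>0 * C * C + 1) * real n powr (- r))" using \<rho> by (simp add: distrib_right)
      finally show "Linf_norm (f1 n) < ereal ((C\<^sub>0 * C * C + 1) * real n powr (- r))" .
    qed
    then show "\<exists>c C. 0 < c \<and> (\<forall>n\<ge>1. ereal (c * real n powr (- r)) < Linf_norm (f1 n) \<and> Linf_norm (f1 n) < ereal (C * real n powr (- r)))"
      using c Cp by (intro exI[of _ "c / (2 * C)"] exI[of _ "C\<^sub>0 * C * C + 1"]) auto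
  qed
  moreover have "same_orientation \<phi> (f n) (f1 n) \<and> same_orientation \<phi> (f n) (\<lambda>x. f n x - f1 n x) \<and>
              same_orientation \<phi> (f1 n) (\<lambda>x. f n x - f1 n x)" if n: "1 \<le> n" for n
  proof (intro conjI)
    have nn: "0 \<le> \<theta> n j i * \<eta> n j i" "0 \<le> \<theta> n j i * (\<theta> n j i - \<eta> n j i)" "0 \<le> \<eta> n j i * (\<theta> n j i - \<eta> n j i)" for j i
      by (auto simp: \<eta>_def a_def)
    show "same_orientation \<phi> (f n) (f1 n)"
      unfolding same_orientation_def using series[OF n] s1[OF n] nn by blast
    show "same_orientation \<phi> (f n) (\<lambda>x. f n x - f1 n x)"
      unfolding same_orientation_def using series[OF n] s2[OF n] nn by blast
    show "same_orientation \<phi> (f1 n) (\<lambda>x. f n x - f1 n x)"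
      unfolding same_orientation_def using s1[OF n] s2[OF n] nn by blast
  qed
  ultimately show ?thesis using P0 besov by (intro exI[of _ P0] conjI exI[of _ f1]) auto
qed

text \<open>If no coefficient of \<open>f\<close> is significant, the low, intermediate and high levels of \<open>f\<^sub>1\<close> are each bounded by a quarter of the lower
bound \<open>c\<^sub>1 n\<^bsup>-r\<^esup>\<close> for the norm of \<open>f\<^sub>1\<close>.\<close>

lemma significant_if_besov_part:
  assumes P0: "0 < P\<^sub>0" and besov: "\<And>n. 1 \<le> n \<Longrightarrow> f\<^sub>1 n \<in> besov_body \<phi> s P\<^sub>0"
    and c1: "0 < c\<^sub>1" and norm: "\<And>n. 1 \<le> n \<Longrightarrow> ereal (c\<^sub>1 * real n powr (- r)) < Linf_norm (f\<^sub>1 n)"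
    and orient: "\<And>n. 1 \<le> n \<Longrightarrow> same_orientation \<phi> (f\<^sub>1 n) (\<lambda>x. f n x - f\<^sub>1 n x)"
  shows "\<exists>c>0. \<exists>Q>0. \<exists>n\<^sub>0. \<forall>n\<ge>n\<^sub>0. significant c Q n"
proof -
  have Cp: "0 < C" using C1 by simp
  \<comment> \<open>The low levels add up to \<open>2 \<epsilon> C\<^sup>2 n\<^bsup>-1/2\<^esup> 2\<^sup>l \<le> 2 \<epsilon> C\<^sup>2 n\<^bsup>-r\<^esup>\<close>, which becomes a quarter of \<open>c\<^sub>1 n\<^bsup>-r\<^esup>\<close>.\<close>
  define \<epsilon> where "\<epsilon> = c\<^sub>1 / (8 * C * C)"
  have \<epsilon>: "0 < \<epsilon>" using c1 Cp by (simp add: \<epsilon>_def)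
  from low_level[OF this] obtain q n0 where q: "0 < q" and n0: "0 < n0"
    and lev: "\<And>n. n0 \<le> n \<Longrightarrow> \<exists>l. real n powr (1/2 - r) \<le> q * 2 ^ l \<and> 2 ^ l \<le> real n powr (1/2 - r) \<and>
    (\<forall>x\<in>{0..1}. \<bar>partial_cdf \<phi> (\<theta> n) l x - x\<bar> \<le> \<epsilon> / sqrt (real n))" by blast
  \<comment> \<open>The factor by which the Besov condition lets the contribution of a level decay from one level to the next.\<close>
  define \<rho> where "\<rho> = 2 powr (- s)"
  have \<rho>: "0 < \<rho>" "\<rho> < 1" using s_pos by (auto simp: \<rho>_def powr_less_one)
  obtain H :: nat where H: "P\<^sub>0 * C * q powr s / (1 - \<rho>) * \<rho> ^ H < c\<^sub>1 / 4"
  proof -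
    have "(\<lambda>H. P\<^sub>0 * C * q powr s / (1 - \<rho>) * \<rho> ^ H) \<longlonglongrightarrow> P\<^sub>0 * C * q powr s / (1 - \<rho>) * 0"
      using \<rho> by (intro tendsto_mult tendsto_const LIMSEQ_realpow_zero) auto
    then have "\<forall>\<^sub>F H in sequentially. P\<^sub>0 * C * q powr s / (1 - \<rho>) * \<rho> ^ H < c\<^sub>1 / 4"
      using c1 by (intro order_tendstoD(2)) auto
    then show ?thesis using that by (auto simp: eventually_sequentially)
  qed
  define c where "c = c\<^sub>1 / (4 * C * (real H + 1))"
  have c: "0 < c" using c1 Cp by (simp add: c_def)
  have "significant c (2 ^ H) n" if n: "n0 \<le> n" for n
  proof (rule ccontr)
    assume ns: "\<not> significant c (2 ^ H) n"
    have np: "1 \<le> n" using n n0 by auto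
    have sq: "0 < sqrt (real n)" using np by simp
    let ?\<nu> = "real n powr (1/2 - r)" and ?r = "real n powr (- r)"
    have \<nu>: "0 < ?\<nu>" "0 < ?r" using np by auto
    obtain l where l: "?\<nu> \<le> q * 2 ^ l" "2 ^ l \<le> ?\<nu>"
      "\<And>x. x \<in> {0..1} \<Longrightarrow> \<bar>partial_cdf \<phi> (\<theta> n) l x - x\<bar> \<le> \<epsilon> / sqrt (real n)"
      using lev[OF n] by auto
    obtain \<eta> where \<eta>: "has_wavelet_series \<phi> (f\<^sub>1 n) \<eta>"
        "\<And>k j. 1 \<le> k \<Longrightarrow> j \<in> {1..2 ^ k} \<Longrightarrow> 2 powr ((s + 1/2) * real k) * \<bar>\<eta> k j\<bar> \<le> P\<^sub>0"
      using besov[OF np] unfolding besov_body_def by blast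
    obtain \<eta>' \<zeta> where \<zeta>: "has_wavelet_series \<phi> (f\<^sub>1 n) \<eta>'" "has_wavelet_series \<phi> (\<lambda>x. f n x - f\<^sub>1 n x) \<zeta>"
        "\<And>k j. 1 \<le> k \<Longrightarrow> j \<in> {1..2 ^ k} \<Longrightarrow> 0 \<le> \<eta>' k j * \<zeta> k j"
      using orient[OF np] unfolding same_orientation_def by blast
    \<comment> \<open>A product \<open>\<eta> (\<theta> - \<eta>) \<ge> 0\<close> puts \<open>\<eta>\<close> between \<open>0\<close> and \<open>\<theta>\<close>.\<close>
    have dom: "\<bar>\<eta> k j\<bar> \<le> \<bar>\<theta> n k j\<bar>" if k: "1 \<le> k" "j \<in> {1..2 ^ k}" for k j
    proof -
      have "\<eta>' k j = \<eta> k j"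
        using coefficient_eq[OF \<eta>(1) k] coefficient_eq[OF \<zeta>(1) k] by simp
      moreover have "\<zeta> k j = \<theta> n k j - \<eta> k j"
        using coefficient_eq[OF \<zeta>(2) k] coefficient_eq[OF series_diff[OF series[OF np] \<eta>(1)] k] by simp
      ultimately have "0 \<le> \<eta> k j * (\<theta> n k j - \<eta> k j)" using \<zeta>(3)[OF k] by simp
      then show ?thesis by (auto simp: zero_le_mult_iff)
    qed
    have low: "\<bar>\<eta> k j\<bar> \<le> (\<epsilon> / sqrt (real n) * C) * sqrt 2 ^ k" if "1 \<le> k" "k \<le> l" "j \<in> {1..2 ^ k}" for k j
      using coefficient_le_partial_cdf[of k l j "\<theta> n", OF _ that(3) l(3)] dom[OF that(1,3)] that by simp
    have mid: "\<bar>\<eta> k j\<bar> \<le> (c * ?r) / sqrt 2 ^ k" if "l < k" "k \<le> l + H" "j \<in> {1..2 ^ k}" for k j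
    proof (rule ccontr)
      assume "\<not> \<bar>\<eta> k j\<bar> \<le> (c * ?r) / sqrt 2 ^ k"
      then have "c * ?r / sqrt 2 ^ k \<le> \<bar>\<theta> n k j\<bar>" using dom[of k j] that by simp
      moreover have "2 ^ k \<le> 2 ^ H * ?\<nu>"
      proof -
        have "(2::real) ^ k \<le> 2 ^ (l + H)" using that by (intro power_increasing) auto
        also have "\<dots> = 2 ^ H * 2 ^ l" by (simp add: power_add)
        also have "\<dots> \<le> 2 ^ H * ?\<nu>" using l(2) by (intro mult_left_mono) auto
        finally show ?thesis .
      qed
      moreover have "1 \<le> k" using that by simp
      ultimately have "significant c (2 ^ H) n" using that(3) unfolding significant_def by blast
      then show False using ns by simp
    qed
    have \<rho>pow: "\<rho> ^ k = 2 powr (- s * real k)" for k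
      unfolding \<rho>_def by (simp add: powr_realpow[symmetric] powr_powr)
    have high: "\<bar>\<eta> k j\<bar> \<le> P\<^sub>0 * \<rho> ^ k / sqrt 2 ^ k" if k: "1 \<le> k" "j \<in> {1..2 ^ k}" for k j
    proof -
      have "2 powr ((s + 1/2) * real k) = 2 powr (s * real k) * sqrt 2 ^ k"
        by (simp add: distrib_right powr_add flip: two_powr_half)
      then have "2 powr (s * real k) * (sqrt 2 ^ k * \<bar>\<eta> k j\<bar>) \<le> P\<^sub>0" using \<eta>(2)[OF k] by (simp add: mult.assoc)
      then have "\<rho> ^ k * (2 powr (s * real k) * (sqrt 2 ^ k * \<bar>\<eta> k j\<bar>)) \<le> \<rho> ^ k * P\<^sub>0"
        using \<rho> by (intro mult_left_mono) auto
      moreover have "\<rho> ^ k * 2 powr (s * real k) = 1" unfolding \<rho>pow by (simp flip: powr_add)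
      ultimately have "sqrt 2 ^ k * \<bar>\<eta> k j\<bar> \<le> \<rho> ^ k * P\<^sub>0" by (simp flip: mult.assoc)
      then show ?thesis by (simp add: field_simps)
    qed
    have \<rho>l: "\<rho> ^ l \<le> q powr s * ?r"
    proof -
      have "?\<nu> / q \<le> 2 ^ l" using l(1) q by (simp add: divide_le_eq mult.commute)
      then have "(2 ^ l) powr (- s) \<le> (?\<nu> / q) powr (- s)" using s_pos \<nu> q by (intro powr_mono2') auto
      also have "(2 ^ l) powr (- s) = \<rho> ^ l" unfolding \<rho>pow by (simp add: powr_realpow[symmetric] powr_powr mult.commute)
      also have "(?\<nu> / q) powr (- s) = ?\<nu> powr (- s) / q powr (- s)"
        by (rule powr_divide)
      also have "?\<nu> powr (- s) = ?r"
      proof -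
        have "(1/2 - r) * (- s) = - r" using s_exponent by simp
        then show ?thesis by (simp only: powr_powr)
      qed
      also have "?r / q powr (- s) = q powr s * ?r" by (simp add: powr_minus_divide)
      finally show ?thesis .
    qed
    have "\<bar>S \<eta> N x\<bar> \<le> 3 / 4 * c\<^sub>1 * ?r" if x: "x \<in> {0..1}" for N x
    proof -
      have "\<bar>S \<eta> N x\<bar> \<le> (\<epsilon> / sqrt (real n) * C) * C * 2 ^ Suc l + (c * ?r) * C * real H + P\<^sub>0 * C * \<rho> ^ (l + H) / (1 - \<rho>)"
        using low mid high \<epsilon> c P0 Cp sq by (intro partial_sum_le[OF x \<rho>]) auto
      also have "(\<epsilon> / sqrt (real n) * C) * C * 2 ^ Suc l \<le> c\<^sub>1 / 4 * ?r"
      proof -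
        have "(\<epsilon> / sqrt (real n) * C) * C * 2 ^ Suc l = (2 * \<epsilon> * C * C / sqrt (real n)) * 2 ^ l" by simp
        also have "\<dots> \<le> (2 * \<epsilon> * C * C / sqrt (real n)) * ?\<nu>" using l(2) \<epsilon> Cp sq by (intro mult_left_mono) auto
        also have "\<dots> = (2 * \<epsilon> * C * C) * ?r" unfolding sqrt_times_powr[symmetric] using sq by simp
        also have "2 * \<epsilon> * C * C = c\<^sub>1 / 4" using Cp by (simp add: \<epsilon>_def)
        finally show ?thesis .
      qed
      also have "(c * ?r) * C * real H \<le> c\<^sub>1 / 4 * ?r"
      proof -
        have H1: "real H + 1 \<noteq> 0" by linarith
        have "(c * ?r) * C * real H \<le> (c * ?r) * C * (real H + 1)" using c Cp \<nu> by (intro mult_left_mono) auto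
        also have "\<dots> = (c * C * (real H + 1)) * ?r" by (simp add: mult_ac)
        also have "c * C * (real H + 1) = c\<^sub>1 / 4" 
        proof -
          have "c * (4 * C * (real H + 1)) = c\<^sub>1" using Cp H1 by (simp add: c_def del: distrib_left_numeral)
          then show ?thesis by (simp add: mult_ac)
        qed
        finally show ?thesis .
      qed
      also have "P\<^sub>0 * C * \<rho> ^ (l + H) / (1 - \<rho>) \<le> c\<^sub>1 / 4 * ?r"
      proof -
        have "P\<^sub>0 * C * \<rho> ^ (l + H) / (1 - \<rho>) = (P\<^sub>0 * C / (1 - \<rho>) * \<rho> ^ H) * \<rho> ^ l"
          by (simp add: power_add mult_ac)
        also have "\<dots> \<le> (P\<^sub>0 * C / (1 - \<rho>) * \<rho> ^ H) * (q powr s * ?r)"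
          using \<rho>l P0 Cp \<rho> by (intro mult_left_mono) auto
        also have "\<dots> = (P\<^sub>0 * C * q powr s / (1 - \<rho>) * \<rho> ^ H) * ?r" by (simp add: mult_ac)
        also have "\<dots> \<le> c\<^sub>1 / 4 * ?r" using H \<nu> by (intro mult_right_mono) auto
        finally show ?thesis .
      qed
      finally show ?thesis by simp
    qed
    then have "AE x in unit_lborel. \<bar>f\<^sub>1 n x\<bar> \<le> 3 / 4 * c\<^sub>1 * ?r" by (rule AE_le_of_partial_sums[OF \<eta>(1)])
    then have "Linf_norm (f\<^sub>1 n) \<le> ereal (3 / 4 * c\<^sub>1 * ?r)"
      using \<eta>(1) by (intro Linf_norm_le) (auto simp: has_wavelet_series_def)
    then have "ereal (c\<^sub>1 * ?r) < ereal (3 / 4 * c\<^sub>1 * ?r)" using norm[OF np] by (rule less_le_trans[rotated])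
    then show False using c1 \<nu> by simp
  qed
  then have "\<exists>n\<^sub>0. \<forall>n\<ge>n\<^sub>0. significant c (2 ^ H) n" by blast
  moreover have "0 < (2::real) ^ H" by simp
  ultimately show ?thesis using c by blast
qed

text \<open>It remains to check the hypotheses of \<open>consistent_if_drift_oscillates\<close>: the Lipschitz bound holds as soon as
\<open>C\<^sub>0 n\<^bsup>-r\<^esup> \<le> 1\<close>, and differences of averages vanish by \<open>drift_oscillation_le\<close> with the difference of two tents
as weight.\<close>

lemma consistent_if_drift_large:
  assumes c: "0 < c" and large: "\<And>n. N \<le> n \<Longrightarrow> \<exists>x\<in>{0..1}. c \<le> sqrt (real n) * \<bar>drift_cdf (f n) x - x\<bar>"
  shows "\<exists>\<alpha>. 0 < \<alpha> \<and> \<alpha> < 1 \<and> alpha_consistent \<alpha> f"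
proof -
  have Cp: "0 < C" using C1 by simp
  obtain n1 where n1: "0 < n1" "\<And>n. n1 \<le> n \<Longrightarrow> C\<^sub>0 \<le> real n powr r" using powr_eventually_large[OF r(1), of C\<^sub>0] by blast
  show ?thesis
  proof (rule consistent_if_drift_oscillates[where N = "max N n1"])
    show "\<And>n. 1 \<le> n \<Longrightarrow> is_density (\<lambda>x. 1 + f n x)" by (rule dens)
    show "0 < c" by fact
    show "\<exists>x\<in>{0..1}. c \<le> sqrt (real n) * \<bar>drift_cdf (f n) x - x\<bar>" if "max N n1 \<le> n" for n
      using that by (intro large) simp
    show "\<bar>drift_cdf (f n) x - drift_cdf (f n) y\<bar> \<le> 2 * \<bar>x - y\<bar>"
      if n: "max N n1 \<le> n" and xy: "x \<in> {0..1}" "y \<in> {0..1}" for n x y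
    proof -
      have np: "1 \<le> n" using n n1(1) by auto
      have "C\<^sub>0 * real n powr (- r) \<le> real n powr r * real n powr (- r)"
        using n1(2)[of n] n by (intro mult_right_mono) auto
      also have "\<dots> = 1" using np by (simp flip: powr_add)
      finally have le1: "C\<^sub>0 * real n powr (- r) \<le> 1" .
      have "AE x in unit_lborel. \<bar>f n x\<bar> \<le> 1"
        using f_bound[OF np] by eventually_elim (use le1 in linarith)
      then show ?thesis by (rule drift_cdf_lipschitz[OF density_integrable(1)[OF dens[OF np]] _ xy])
    qed
    fix \<delta> e :: real assume \<delta>: "0 < \<delta>" and e: "0 < e"
    define L where "L = 2 / \<delta>\<^sup>2"
    define W where "W = 2 / \<delta>"
    have LW: "0 < L" "0 < W" using \<delta> by (auto simp: L_def W_def)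
    have "0 < e / (2 * W)" using e LW by simp
    from low_level[OF this] obtain q n2 where q: "0 < q" and n2: "0 < n2"
      and lev: "\<And>n. n2 \<le> n \<Longrightarrow> \<exists>l. real n powr (1/2 - r) \<le> q * 2 ^ l \<and> 2 ^ l \<le> real n powr (1/2 - r) \<and>
      (\<forall>x\<in>{0..1}. \<bar>partial_cdf \<phi> (\<theta> n) l x - x\<bar> \<le> e / (2 * W) / sqrt (real n))" by blast
    \<comment> \<open>Above this size of \<open>n\<^bsup>1/2-r\<^esup>\<close> the high levels contribute at most \<open>e / 2\<close>: with \<open>n\<^bsup>1/2-r\<^esup> \<le> q 2\<^sup>l\<close> their share is at most
\<open>C\<^sub>0 C\<^sup>2 L q\<^sup>2 n\<^bsup>r-1/2\<^esup>\<close>.\<close>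
    define M where "M = 2 * (C\<^sub>0 * C * C * L) * q\<^sup>2 / e"
    have "0 < 1/2 - r" using r by simp
    from powr_eventually_large[OF this, of M] obtain n3 where n3: "\<And>n. n3 \<le> n \<Longrightarrow> M \<le> real n powr (1/2 - r)" by blast
    have "\<bar>LINT x|unit_lborel. sqrt (real n) * (drift_cdf (f n) x - x) * (tent \<delta> b x - tent \<delta> \<delta> x)\<bar> \<le> e"
      if n: "max n2 n3 \<le> n" and b: "\<delta> \<le> b" "b \<le> 1 - \<delta>" for n b
    proof -
      have np: "1 \<le> n" using n n2 by auto
      have sq: "0 < sqrt (real n)" using np by simp
      let ?\<nu> = "real n powr (1/2 - r)" and ?r = "real n powr (- r)"
      have \<nu>: "0 < ?\<nu>" "0 < ?r" using np by auto
      obtain l where l: "?\<nu> \<le> q * 2 ^ l"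
        "\<And>x. x \<in> {0..1} \<Longrightarrow> \<bar>partial_cdf \<phi> (\<theta> n) l x - x\<bar> \<le> e / (2 * W) / sqrt (real n)"
        using lev[of n] n by auto
      define w where "w x = tent \<delta> b x - tent \<delta> \<delta> x" for x
      have \<delta>b: "\<delta> \<le> 1 - \<delta>" using b by simp
      have it: "integrable unit_lborel (tent \<delta> b')" for b'
        by (intro integrable_unit_continuous tent_continuous)
      have "\<bar>LINT x|unit_lborel. (drift_cdf (f n) x - x) * w x\<bar> \<le>
         (e / (2 * W) / sqrt (real n)) * W + (C\<^sub>0 * C * ?r) * C * L * (1/4) ^ l"
      proof (rule drift_oscillation_le[OF series[OF np] drift_cdf_continuous[OF dens[OF np]] l(2)])
        show "\<bar>w x - w y\<bar> \<le> L * \<bar>x - y\<bar>" for x y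
        proof -
          have "\<bar>w x - w y\<bar> \<le> \<bar>tent \<delta> b x - tent \<delta> b y\<bar> + \<bar>tent \<delta> \<delta> x - tent \<delta> \<delta> y\<bar>" unfolding w_def by linarith
          also have "\<dots> \<le> 1 / \<delta>\<^sup>2 * \<bar>x - y\<bar> + 1 / \<delta>\<^sup>2 * \<bar>x - y\<bar>" by (intro add_mono tent_lipschitz \<delta>)
          also have "\<dots> = L * \<bar>x - y\<bar>" by (simp add: L_def)
          finally show ?thesis .
        qed
        show "w x = 0" if "x \<notin> {0..1}" for x
        proof -
          have "\<delta> \<le> \<bar>x - b\<bar>" "\<delta> \<le> \<bar>x - \<delta>\<bar>" using that b \<delta>b by auto
          then show ?thesis by (simp add: w_def tent_outside)
        qed
        show "(LINT x|unit_lborel. w x) = 0"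
          unfolding w_def using integral_tent[OF \<delta> b] integral_tent[OF \<delta> order_refl \<delta>b]
          by (simp only: Bochner_Integration.integral_diff[OF it it] diff_self)
        show "continuous_on {0..1} w" unfolding w_def[abs_def] by (intro continuous_intros tent_continuous)
        show "\<bar>w x\<bar> \<le> W" for x
          using tent_bounded[OF \<delta>, of b x] tent_bounded[OF \<delta>, of \<delta> x] unfolding w_def W_def by simp
      qed (use coefficient_upper[OF np] C0 Cp in auto)
      then have "sqrt (real n) * \<bar>LINT x|unit_lborel. (drift_cdf (f n) x - x) * w x\<bar> \<le>
         sqrt (real n) * ((e / (2 * W) / sqrt (real n)) * W + (C\<^sub>0 * C * ?r) * C * L * (1/4) ^ l)"
        using sq by (intro mult_left_mono) auto
      also have "\<dots> = e / 2 + (C\<^sub>0 * C * C * L) * ((sqrt (real n) * ?r) * (1/4) ^ l)"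
        using sq LW by (simp add: distrib_left mult_ac)
      also have "\<dots> \<le> e / 2 + e / 2"
      proof -
        have "?\<nu> * ?\<nu> \<le> (q * 2 ^ l) * (q * 2 ^ l)" using l(1) \<nu> q by (intro mult_mono) auto
        also have "\<dots> = q\<^sup>2 * 4 ^ l" by (simp add: power2_eq_square mult_ac flip: power_mult_distrib)
        finally have "?\<nu> * (?\<nu> * (1/4) ^ l) \<le> q\<^sup>2" by (simp add: power_divide divide_le_eq)
        moreover have "M * (?\<nu> * (1/4) ^ l) \<le> ?\<nu> * (?\<nu> * (1/4) ^ l)"
          using n3[of n] n \<nu> by (intro mult_right_mono) auto
        ultimately have "M * (?\<nu> * (1/4) ^ l) \<le> q\<^sup>2" by linarith
        then have "2 * (C\<^sub>0 * C * C * L) * (?\<nu> * (1/4) ^ l) * q\<^sup>2 \<le> e * q\<^sup>2"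
          using e unfolding M_def by (simp add: field_simps)
        then have "2 * (C\<^sub>0 * C * C * L) * (?\<nu> * (1/4) ^ l) \<le> e" using q by simp
        then show ?thesis unfolding sqrt_times_powr by simp
      qed
      finally have "sqrt (real n) * \<bar>LINT x|unit_lborel. (drift_cdf (f n) x - x) * w x\<bar> \<le> e" by simp
      moreover have "(LINT x|unit_lborel. sqrt (real n) * (drift_cdf (f n) x - x) * (tent \<delta> b x - tent \<delta> \<delta> x)) =
         sqrt (real n) * (LINT x|unit_lborel. (drift_cdf (f n) x - x) * w x)"
        unfolding w_def mult.assoc by simp
      ultimately show ?thesis by (simp add: abs_mult)
    qed
    then show "\<exists>n\<^sub>0. \<forall>n\<ge>n\<^sub>0. \<forall>b. \<delta> \<le> b \<longrightarrow> b \<le> 1 - \<delta> \<longrightarrow>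
      \<bar>LINT x|unit_lborel. sqrt (real n) * (drift_cdf (f n) x - x) * (tent \<delta> b x - tent \<delta> \<delta> x)\<bar> \<le> e" by blast
  qed
qed

lemma drift_large_if_consistent:
  assumes "0 < \<alpha>" "\<alpha> < 1" "alpha_consistent \<alpha> f"
  shows "\<exists>c>0. \<exists>N. \<forall>n\<ge>N. \<exists>x\<in>{0..1}. c \<le> sqrt (real n) * \<bar>drift_cdf (f n) x - x\<bar>"
proof (rule ccontr)
  assume no: "\<not> ?thesis"
  have "\<exists>n\<ge>N. \<forall>x\<in>{0..1}. sqrt (real n) * \<bar>drift_cdf (f n) x - x\<bar> \<le> c" if "0 < c" for c N
    using no that by (meson less_imp_le not_le)
  from not_consistent_if_drift_vanishes[OF dens this assms(1,2)] assms(3) show False by blast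
qed

theorem consistent_iff_besov_part:
  "(\<exists>\<alpha>. 0 < \<alpha> \<and> \<alpha> < 1 \<and> alpha_consistent \<alpha> f) \<longleftrightarrow>
    (\<exists>P\<^sub>0>0. \<exists>f\<^sub>1 :: nat \<Rightarrow> real \<Rightarrow> real.
       (\<forall>n\<ge>1. f\<^sub>1 n \<in> besov_body \<phi> s P\<^sub>0) \<and>
       asymp_order (\<lambda>n. Linf_norm (f\<^sub>1 n)) (\<lambda>n. real n powr (- r)) \<and>
       (\<forall>n\<ge>1. same_orientation \<phi> (f n) (f\<^sub>1 n) \<and>
              same_orientation \<phi> (f n) (\<lambda>x. f n x - f\<^sub>1 n x) \<and>
              same_orientation \<phi> (f\<^sub>1 n) (\<lambda>x. f n x - f\<^sub>1 n x)))" (is "?L \<longleftrightarrow> ?R")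
proof
  assume ?L
  then obtain c N where "0 < c" "\<And>n. N \<le> n \<Longrightarrow> \<exists>x\<in>{0..1}. c \<le> sqrt (real n) * \<bar>drift_cdf (f n) x - x\<bar>"
    using drift_large_if_consistent by blast
  from significant_if_drift_large[OF this] obtain c' Q n0 where "0 < c'" "0 < Q" "\<And>n. n0 \<le> n \<Longrightarrow> significant c' Q n"
    by blast
  from significant_everywhere[OF this] obtain c'' Q' where "0 < c''" "0 < Q'" "\<And>n. 1 \<le> n \<Longrightarrow> significant c'' Q' n"
    by blast
  then show ?R by (rule besov_part_if_significant)
next
  assume ?R
  then obtain P0 f1 where R: "0 < P0" "\<And>n. 1 \<le> n \<Longrightarrow> f1 n \<in> besov_body \<phi> s P0"
    "asymp_order (\<lambda>n. Linf_norm (f1 n)) (\<lambda>n. real n powr (- r))"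
    "\<And>n. 1 \<le> n \<Longrightarrow> same_orientation \<phi> (f1 n) (\<lambda>x. f n x - f1 n x)"
    by blast
  obtain c1 where c1: "0 < c1" "\<And>n. 1 \<le> n \<Longrightarrow> ereal (c1 * real n powr (- r)) < Linf_norm (f1 n)"
    using R(3) by (subst (asm) asymp_order_iff) auto
  from significant_if_besov_part[OF R(1,2) c1 R(4)] obtain c Q n0 where "0 < c" "0 < Q" "\<And>n. n0 \<le> n \<Longrightarrow> significant c Q n"
    by blast
  from drift_large_if_significant[OF this] obtain c' N where
    "0 < c'" "\<And>n. N \<le> n \<Longrightarrow> \<exists>x\<in>{0..1}. c' \<le> sqrt (real n) * \<bar>drift_cdf (f n) x - x\<bar>" by blast
  then show ?L by (rule consistent_if_drift_large)
qed

end

theorem theorem4p4: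
  fixes r s a\<^sub>1 a\<^sub>2 :: real
    and \<phi> :: "real \<Rightarrow> real"
    and f :: "nat \<Rightarrow> real \<Rightarrow> real"
    and \<theta> :: "nat \<Rightarrow> nat \<Rightarrow> nat \<Rightarrow> real"
  assumes "0 < r" and "r < 1/2" and "s = 2 * r / (1 - 2 * r)"
    and "mother_wavelet \<phi>"
    and "smoothness_more_than (nat \<lfloor>s\<rfloor> + 2) \<phi>"
    and "a\<^sub>1 < a\<^sub>2" and "closure {x. \<phi> x \<noteq> 0} = {a\<^sub>1..a\<^sub>2}"
    and "(LBINT x:{a\<^sub>1..a\<^sub>2}. x * \<phi> (x + (a\<^sub>1 + a\<^sub>2) / 2)) = 0"
    and "\<And>n. n \<ge> 1 \<Longrightarrow> has_wavelet_series \<phi> (f n) (\<theta> n)"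
    and "\<And>n. n \<ge> 1 \<Longrightarrow> is_density (\<lambda>x. 1 + f n x)"
    and "asymp_order (\<lambda>n. Linf_norm (f n)) (\<lambda>n. real n powr (- r))"
    and "assumption_G r \<phi> \<theta>"
  shows "(\<exists>\<alpha>. 0 < \<alpha> \<and> \<alpha> < 1 \<and> alpha_consistent \<alpha> f) \<longleftrightarrow>
    (\<exists>P\<^sub>0>0. \<exists>f\<^sub>1 :: nat \<Rightarrow> real \<Rightarrow> real.
       (\<forall>n\<ge>1. f\<^sub>1 n \<in> besov_body \<phi> s P\<^sub>0) \<and>
       asymp_order (\<lambda>n. Linf_norm (f\<^sub>1 n)) (\<lambda>n. real n powr (- r)) \<and>
       (\<forall>n\<ge>1. same_orientation \<phi> (f n) (f\<^sub>1 n) \<and>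
              same_orientation \<phi> (f n) (\<lambda>x. f n x - f\<^sub>1 n x) \<and>
              same_orientation \<phi> (f\<^sub>1 n) (\<lambda>x. f n x - f\<^sub>1 n x)))"
proof -
  \<comment> \<open>The second derivative only serves to make the first one continuous.\<close>
  have diff: "((deriv ^^ i) \<phi>) differentiable (at x)" if "i < 2" for i x
    using assms(5) that unfolding smoothness_more_than_def by auto
  have d0: "(\<phi> has_real_derivative deriv \<phi> x) (at x)" for x
    using diff[of 0 x] by (simp add: DERIV_deriv_iff_real_differentiable)
  have d1: "continuous_on UNIV (deriv \<phi>)"
  proof (intro continuous_at_imp_continuous_on ballI)
    fix x
    show "isCont (deriv \<phi>) x"
      using diff[of 1 x] differentiable_imp_continuous_within by auto
  qed
  have out: "\<phi> x = 0" if "x \<notin> {a\<^sub>1..a\<^sub>2}" for x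
    using that closure_subset[of "{x. \<phi> x \<noteq> 0}"] unfolding assms(7) by auto
  interpret compact_wavelet \<phi> a\<^sub>1 a\<^sub>2
  proof
    show "(LINT x|lborel. dyadic_wavelet \<phi> k j x * dyadic_wavelet \<phi> k' j' x) =
        (if k = k' \<and> j = j' then 1 else 0)" for k j k' j'
      using assms(4) unfolding mother_wavelet_def by blast
  qed (use d0 d1 out assms(6) in auto)
  obtain C where "bounded_wavelets \<phi> C"
  proof (rule per_wavelet_bounds)
    fix C assume b: "1 \<le> C"
      "\<And>k x. x \<in> {0..1} \<Longrightarrow> (\<Sum>j\<in>{1..2 ^ k}. \<bar>per_wavelet \<phi> k j x\<bar>) \<le> C * sqrt 2 ^ k"
      "\<And>k x. x \<in> {0..1} \<Longrightarrow> (\<Sum>j\<in>{1..2 ^ k}. \<bar>per_wavelet_prim \<phi> k j x\<bar>) \<le> C / sqrt 2 ^ k"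
      "\<And>k j. j \<in> {1..2 ^ k} \<Longrightarrow> (LINT x|unit_lborel. \<bar>per_wavelet \<phi> k j x\<bar>) \<le> C / sqrt 2 ^ k"
      "\<And>k j g t. j \<in> {1..2 ^ k} \<Longrightarrow> continuous_on {0..1} g \<Longrightarrow> (LINT x|unit_lborel. g x) = 0 \<Longrightarrow>
        (\<And>x. x \<in> {0..1} \<Longrightarrow> \<bar>LBINT u:{0..x}. g u\<bar> \<le> t) \<Longrightarrow>
        \<bar>LINT x|unit_lborel. g x * per_wavelet \<phi> k j x\<bar> \<le> t * C * sqrt 2 ^ k"
      "\<And>k j w L. j \<in> {1..2 ^ k} \<Longrightarrow> (\<And>x y. \<bar>w x - w y\<bar> \<le> L * \<bar>x - y\<bar>) \<Longrightarrow>
        (\<And>x. x \<notin> {0..1} \<Longrightarrow> w x = 0) \<Longrightarrow> (LINT x|unit_lborel. w x) = 0 \<Longrightarrow>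
        \<bar>LINT x|unit_lborel. per_wavelet_prim \<phi> k j x * w x\<bar> \<le> L * C / (sqrt 2 ^ k * 2 ^ k * 2 ^ k)"
    have "bounded_wavelets \<phi> C"
      by (rule bounded_wavelets.intro; fact b per_wavelet_continuous per_wavelet_orthonormal per_wavelet_mean)
    then show thesis by (rule that)
  qed
  then interpret bounded_wavelets \<phi> C .
  obtain c0 C0 where "0 < c0" and
    "\<And>n. 1 \<le> n \<Longrightarrow> ereal (c0 * real n powr (- r)) < Linf_norm (f n) \<and> Linf_norm (f n) < ereal (C0 * real n powr (- r))"
    using assms(11) by (subst (asm) asymp_order_iff) auto
  then interpret wavelet_alternatives \<phi> C r s f \<theta> c0 C0
    by unfold_locales (use assms in auto)
  show ?thesis by (rule consistent_iff_besov_part)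
qed

end
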